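(* Let $\mathbf{T}=\{(z,w)\in\mathbf{C}^2 : |z|<|w|<1\}$ be the Hartogs triangle. On $\mathbf{T}$ the strong maximal extension $\overline\partial_s$ of the Cauchy-Riemann operator equals the weak maximal extension $\overline\partial$; that is, for all $0\le p\le 2$ and $1\le q\le 2$, $\overline\partial_s=\overline\partial$ as unbounded operators from $L^2_{p,q-1}(\mathbf{T})$ to $L^2_{p,q}(\mathbf{T})$.
   Context: For a bounded domain $\Omega\subset\mathbf{C}^n$, $L^2_{p,q}(\Omega)$ is the Hilbert space of $(p,q)$-forms on $\Omega$ with square-integrable coefficients, and $C^\infty_{p,q}(\overline\Omega)$ is the space of $(p,q)$-forms smooth up to the boundary (restrictions of smooth forms on $\mathbf{C}^n$). Equality of unbounded operators means equality of domains and of values. Weak maximal extension $\overline\partial: L^2_{p,q-1}(\Omega)\dashrightarrow L^2_{p,q}(\Omega)$: $f\in\mathrm{Dom}(\overline\partial)$ if and only if $f\in L^2_{p,q-1}(\Omega)$ and $\overline\partial f$, taken in the sense of distributions on $\Omega$, lies in $L^2_{p,q}(\Omega)$. Strong maximal extension $\overline\partial_s: L^2_{p,q-1}(\Omega)\dashrightarrow L^2_{p,q}(\Omega)$: the closure in the graph norm of $\overline\partial$ restricted to $C^\infty_{p,q-1}(\overline\Omega)$; i.e. $f\in\mathrm{Dom}(\overline\partial_s)$ if and only if there is a sequence $f_\nu\in C^\infty_{p,q-1}(\overline\Omega)$ with $f_\nu\to f$ and $\overline\partial f_\nu\to\overline\partial f$ in $L^2$, and then $\overline\partial_s f=\overline\partial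 f$. *)

theory Defs
  imports "HOL-Analysis.Analysis"
begin

text \<open>
  A differential form on C^n is given by its coefficient functions with respect to the basis
  dz^I \<and> dzbar^J, where the strictly increasing multi-indices I, J are identified with subsets
  of the (linearly ordered, finite) index type; f I J is the coefficient of dz^I \<and> dzbar^J.
  Only the values on the domain under consideration matter.
\<close>

type_synonym 'n cform = "'n set \<Rightarrow> 'n set \<Rightarrow> complex ^ 'n \<Rightarrow> complex"

definition is_form :: "nat \<Rightarrow> nat \<Rightarrow> 'n::finite cform \<Rightarrow> bool" where
  "is_form p q f \<longleftrightarrow> (\<forall>I J x. f I J x \<noteq> 0 \<longrightarrow> card I = p \<and> card J = q)"


subsection \<open>Smooth functions and the Wirtinger derivatives\<close>

text \<open>Differentiability is over the reals, also for complex-valued functions of complex variables.\<close>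

primrec C_k :: "nat \<Rightarrow> ('a::real_normed_vector \<Rightarrow> 'b::real_normed_vector) \<Rightarrow> bool" where
  "C_k 0 f \<longleftrightarrow> continuous_on UNIV f"
| "C_k (Suc k) f \<longleftrightarrow>
     (\<forall>x. f differentiable (at x)) \<and> (\<forall>v. C_k k (\<lambda>x. frechet_derivative f (at x) v))"

definition smooth :: "('a::euclidean_space \<Rightarrow> 'b::real_normed_vector) \<Rightarrow> bool" where
  "smooth f \<longleftrightarrow> (\<forall>k. C_k k f)"

definition dzbar :: "'n::finite \<Rightarrow> (complex ^ 'n \<Rightarrow> complex) \<Rightarrow> complex ^ 'n \<Rightarrow> complex" where
  "dzbar k h x =
     (frechet_derivative h (at x) (axis k 1) + \<i> * frechet_derivative h (at x) (axis k \<i>)) / 2"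

definition test_fun :: "(complex ^ 'n::finite) set \<Rightarrow> (complex ^ 'n \<Rightarrow> complex) \<Rightarrow> bool" where
  "test_fun \<Omega> \<phi> \<longleftrightarrow>
     smooth \<phi> \<and> compact (closure {x. \<phi> x \<noteq> 0}) \<and> closure {x. \<phi> x \<noteq> 0} \<subseteq> \<Omega>"

text \<open>
  The restrictions to the domain of these forms are the forms smooth up to the boundary.
\<close>

definition smooth_forms :: "nat \<Rightarrow> nat \<Rightarrow> 'n::finite cform set" where
  "smooth_forms p q = {F. is_form p q F \<and> (\<forall>I J. smooth (F I J))}"


subsection \<open>The Cauchy-Riemann operator on forms\<close>

text \<open>
  dzbar_k \<and> dz^I \<and> dzbar^(K - {k}) = dbar_sign I k K * dz^I \<and> dzbar^K for k in K: the first
  factor moves dzbar_k past dz^I, the second one sorts it into its place in dzbar^K.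
\<close>

definition dbar_sign :: "'n::{finite,linorder} set \<Rightarrow> 'n \<Rightarrow> 'n set \<Rightarrow> complex" where
  "dbar_sign I k K = (-1) ^ card I * (-1) ^ card {j \<in> K. j < k}"

definition dbar_smooth :: "'n::{finite,linorder} cform \<Rightarrow> 'n cform" where
  "dbar_smooth F = (\<lambda>I K x. \<Sum>k\<in>K. dbar_sign I k K * dzbar k (F I (K - {k})) x)"

text \<open>
  g is the distributional dbar of f on \<Omega>; the distribution d/dzbar_k of a function h maps
  a test function \<phi> to minus the integral of h times d\<phi>/dzbar_k.
\<close>

definition dbar_distr ::
    "(complex ^ 'n::{finite,linorder}) set \<Rightarrow> 'n cform \<Rightarrow> 'n cform \<Rightarrow> bool" where
  "dbar_distr \<Omega> f g \<longleftrightarrow> (\<forall>I K \<phi>. test_fun \<Omega> \<phi> \<longrightarrow>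
     (LINT x|lebesgue_on \<Omega>. g I K x * \<phi> x) =
     (\<Sum>k\<in>K. dbar_sign I k K *
        - (LINT x|lebesgue_on \<Omega>. f I (K - {k}) x * dzbar k \<phi> x)))"


subsection \<open>Square-integrable forms and the two maximal extensions\<close>

definition L2_norm_sq :: "(complex ^ 'n::finite) set \<Rightarrow> 'n cform \<Rightarrow> ennreal" where
  "L2_norm_sq \<Omega> f =
     (\<Sum>I\<in>UNIV. \<Sum>J\<in>UNIV. \<integral>\<^sup>+x. ennreal ((cmod (f I J x))\<^sup>2) \<partial>lebesgue_on \<Omega>)"

definition L2_forms :: "nat \<Rightarrow> nat \<Rightarrow> (complex ^ 'n::finite) set \<Rightarrow> 'n cform set" where
  "L2_forms p q \<Omega> = {f. is_form p q f \<and>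
     (\<forall>I J. f I J \<in> borel_measurable (lebesgue_on \<Omega>)) \<and> L2_norm_sq \<Omega> f < \<infinity>}"

text \<open>
  Unbounded operators from L^2_(p,q-1) to L^2_(p,q) (for q >= 1) are given by their graphs, as sets
  of pairs of representatives. The two graphs below contain, with a pair (f, g), all pairs of
  L^2 forms equal to f and g almost everywhere on \<Omega>. So equality of the sets means that the
  domains and the values of the operators agree, as subsets and elements of the L^2 spaces.
\<close>

definition dbar_weak ::
    "nat \<Rightarrow> nat \<Rightarrow> (complex ^ 'n::{finite,linorder}) set \<Rightarrow> ('n cform \<times> 'n cform) set" where
  "dbar_weak p q \<Omega> =
     {(f, g). f \<in> L2_forms p (q - 1) \<Omega> \<and> g \<in> L2_forms p q \<Omega> \<and> dbar_distr \<Omega> f g}"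

text \<open>
  The closure in L^2 x L^2 of the graph of dbar on forms smooth up to the boundary. That the limit g
  is the distributional dbar of f is not part of the definition.
\<close>

definition dbar_strong ::
    "nat \<Rightarrow> nat \<Rightarrow> (complex ^ 'n::{finite,linorder}) set \<Rightarrow> ('n cform \<times> 'n cform) set" where
  "dbar_strong p q \<Omega> =
     {(f, g). f \<in> L2_forms p (q - 1) \<Omega> \<and> g \<in> L2_forms p q \<Omega> \<and>
        (\<exists>F :: nat \<Rightarrow> 'n cform. (\<forall>\<nu>. F \<nu> \<in> smooth_forms p (q - 1)) \<and>
           (\<lambda>\<nu>. L2_norm_sq \<Omega> (F \<nu> - f)) \<longlonglongrightarrow> 0 \<and>
           (\<lambda>\<nu>. L2_norm_sq \<Omega> (dbar_smooth (F \<nu>) - g)) \<longlonglongrightarrow> 0)}"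

text \<open>
  The elements of the index type 2 are 0 < 1 (and 2 = 0), so z = x $ 0 and w = x $ 1.
\<close>

definition hartogs_triangle :: "(complex ^ 2) set" where
  "hartogs_triangle = {x. cmod (x $ 0) < cmod (x $ 1) \<and> cmod (x $ 1) < 1}"

end

theory Submission
  imports Defs
begin

text \<open>
  Write \<open>(z, w)\<close> for the coordinates. Away from the origin the triangle can be shrunk into itself by
  the dilations \<open>(z, w) \<mapsto> (r z, s w)\<close> with \<open>r < s < 1\<close>, so that a form that vanishes near the origin is
  approximated in the graph norm by a dilation followed by a mollification
  (\<open>approx_vanishing_function\<close>, \<open>approx_vanishing_field\<close>). The triangle is not Lipschitz at the origin,
  and there the boundary cannot be moved inward. So everything depends on replacing a form in the
  domain of the weak operator by one that vanishes for small \<open>cmod w\<close>, with a small error in the graph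
  norm. A cutoff at the scale \<open>\<epsilon>\<close> has derivatives of size \<open>1 / \<epsilon>\<close>, and the plain product with it
  leaves an error that need not tend to zero. The two degrees overcome this in different ways.

  For \<open>q = 2\<close> there is freedom to correct. The error \<open>k\<close> caused by the cutoff in \<open>w\<close> lives where
  \<open>cmod w\<close> is comparable to \<open>\<epsilon>\<close>, in slices that are discs in the \<open>z\<close>-plane of radius comparable to
  \<open>\<epsilon>\<close>. Solving the equation \<open>dbar\<^sub>z u = k\<close> in each slice with the Cauchy kernel wins a factor \<open>\<epsilon>\<close>, and
  \<open>u\<close> is subtracted from the component that is differentiated in \<open>cnj z\<close> (\<open>localize_field\<close>). To work
  with smooth kernels, the Cauchy kernel is regularized; its antiholomorphic derivative is then an
  approximation of the identity instead of the Dirac measure.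

  For \<open>q = 1\<close> nothing can be corrected: each coefficient is a single function \<open>f\<close>, square integrable
  together with both its antiholomorphic derivatives. In the coordinates \<open>(u, w) \<mapsto> (u w, w)\<close> the
  triangle becomes the product of the disc with the punctured disc, and \<open>h(u, w) = w f(u w, w)\<close> is
  square integrable with square integrable derivative in \<open>cnj w\<close> for fixed \<open>u\<close>
  (\<open>pullback_equation\<close>). A Hardy inequality in the \<open>w\<close>-disc shows that \<open>h / (cmod w * ln (1 / cmod w))\<close>
  is square integrable near \<open>w = 0\<close> as well (\<open>hardy_L2\<close>). The derivative of a cutoff built from
  \<open>ln (ln (1 / cmod w)) / M\<close> is bounded by \<open>C / M\<close> times exactly this weight, hence the error tends to
  zero for \<open>M \<rightarrow> \<infinity>\<close> (\<open>localize_function\<close>). As such a function depends on \<open>w\<close> only, it is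
  also a cutoff in the old coordinates.

  The converse inclusion is integration by parts and passage to the limit. In all this a form is
  handled through its coefficients: each coefficient of \<open>dbar f = g\<close> is an equation between the
  divergence, with respect to the antiholomorphic derivatives, of a field and a function (\<open>weak_div\<close>).
\<close>

section \<open>Calculus of smooth functions\<close>

lemma C_k_SucI:
  assumes "\<And>x. (f has_derivative f' x) (at x)" and "\<And>v. C_k k (\<lambda>x. f' x v)"
  shows "C_k (Suc k) f"
proof -
  have "frechet_derivative f (at x) = f' x" for x
    using frechet_derivative_at[OF assms(1)] by simp
  then show ?thesis
    using assms by (auto simp: differentiable_def)
qed

lemma C_k_SucD:
  assumes "C_k (Suc k) f"
  shows "(f has_derivative frechet_derivative f (at x)) (at x)"
    and "C_k k (\<lambda>x. frechet_derivative f (at x) v)"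
  using assms by (auto simp: frechet_derivative_works)

lemma C_k_Suc_imp: "C_k (Suc k) f \<Longrightarrow> C_k k f"
proof (induction k arbitrary: f)
  case 0
  then show ?case
    by (auto intro!: differentiable_imp_continuous_on simp: differentiable_on_def
        intro: differentiable_at_withinI)
next
  case (Suc k)
  show ?case
  proof (rule C_k_SucI)
    show "(f has_derivative frechet_derivative f (at x)) (at x)" for x
      using C_k_SucD(1)[OF Suc.prems] .
    show "C_k k (\<lambda>x. frechet_derivative f (at x) v)" for v
      using Suc.IH C_k_SucD(2)[OF Suc.prems] .
  qed
qed

lemma C_k_const: "C_k k (\<lambda>x. c)"
proof (induction k arbitrary: c)
  case (Suc k)
  show ?case
    by (rule C_k_SucI[where f' = "\<lambda>x v. 0"]) (use Suc in auto)
qed auto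

lemma C_k_bounded_linear: "bounded_linear f \<Longrightarrow> C_k k f"
proof (cases k)
  case 0
  then show "bounded_linear f \<Longrightarrow> C_k k f"
    by (simp add: linear_continuous_on)
next
  case (Suc m)
  then show "bounded_linear f \<Longrightarrow> C_k k f"
    using C_k_SucI[where f' = "\<lambda>x. f"] C_k_const bounded_linear_imp_has_derivative by metis
qed

lemma C_k_add: "C_k k f \<Longrightarrow> C_k k g \<Longrightarrow> C_k k (\<lambda>x. f x + g x)"
proof (induction k arbitrary: f g)
  case (Suc k)
  show ?case
  proof (rule C_k_SucI)
    show "((\<lambda>x. f x + g x) has_derivative
        (\<lambda>v. frechet_derivative f (at x) v + frechet_derivative g (at x) v)) (at x)" for x
      by (intro has_derivative_add C_k_SucD(1)[OF Suc.prems(1)] C_k_SucD(1)[OF Suc.prems(2)])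
    show "C_k k (\<lambda>x. frechet_derivative f (at x) v + frechet_derivative g (at x) v)" for v
      by (intro Suc.IH C_k_SucD(2)[OF Suc.prems(1)] C_k_SucD(2)[OF Suc.prems(2)])
  qed
qed (auto intro: continuous_on_add)

lemma C_k_sum: "(\<And>i. i \<in> A \<Longrightarrow> C_k k (f i)) \<Longrightarrow> C_k k (\<lambda>x. \<Sum>i\<in>A. f i x)"
  by (induction A rule: infinite_finite_induct) (auto intro: C_k_const C_k_add)

lemma (in bounded_bilinear) C_k_prod:
  "C_k k f \<Longrightarrow> C_k k g \<Longrightarrow> C_k k (\<lambda>x. prod (f x) (g x))"
proof (induction k arbitrary: f g)
  case 0
  then show ?case by (auto intro: continuous_on)
next
  case (Suc k)
  show ?case
  proof (rule C_k_SucI)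
    show "((\<lambda>x. prod (f x) (g x)) has_derivative
        (\<lambda>v. prod (f x) (frechet_derivative g (at x) v) + prod (frechet_derivative f (at x) v) (g x)))
        (at x)" for x
      by (intro FDERIV C_k_SucD(1)[OF Suc.prems(1)] C_k_SucD(1)[OF Suc.prems(2)])
    show "C_k k (\<lambda>x. prod (f x) (frechet_derivative g (at x) v) +
        prod (frechet_derivative f (at x) v) (g x))" for v
      by (intro C_k_add Suc.IH C_k_SucD(2)[OF Suc.prems(1)] C_k_SucD(2)[OF Suc.prems(2)]
          C_k_Suc_imp[OF Suc.prems(1)] C_k_Suc_imp[OF Suc.prems(2)])
  qed
qed

lemma C_k_linear_o:
  assumes "bounded_linear L"
  shows "C_k k f \<Longrightarrow> C_k k (\<lambda>x. L (f x))"
proof (induction k arbitrary: f)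
  case 0
  then show ?case by (auto intro: linear_continuous_on_compose assms bounded_linear.continuous_on)
next
  case (Suc k)
  show ?case
  proof (rule C_k_SucI)
    show "((\<lambda>x. L (f x)) has_derivative (\<lambda>v. L (frechet_derivative f (at x) v))) (at x)" for x
      by (intro bounded_linear.has_derivative[OF assms] C_k_SucD(1)[OF Suc.prems])
    show "C_k k (\<lambda>x. L (frechet_derivative f (at x) v))" for v
      by (intro Suc.IH C_k_SucD(2)[OF Suc.prems])
  qed
qed

lemma C_k_compose:
  fixes f :: "'b::euclidean_space \<Rightarrow> 'c::real_normed_vector"
    and m :: "'a::real_normed_vector \<Rightarrow> 'b"
  shows "C_k k f \<Longrightarrow> C_k k m \<Longrightarrow> C_k k (\<lambda>x. f (m x))"
proof (induction k arbitrary: f)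
  case 0
  then show ?case by (auto intro: continuous_on_compose2)
next
  case (Suc k)
  let ?D = "\<lambda>x. frechet_derivative f (at (m x))"
  let ?M = "\<lambda>x. frechet_derivative m (at x)"
  have *: "?D x (?M x v) = (\<Sum>b\<in>Basis. (?M x v \<bullet> b) *\<^sub>R ?D x b)" for x v
  proof -
    have lin: "linear (?D x)"
      using C_k_SucD(1)[OF Suc.prems(1)] by (rule has_derivative_linear)
    have "?D x (?M x v) = ?D x (\<Sum>b\<in>Basis. (?M x v \<bullet> b) *\<^sub>R b)"
      by (simp add: euclidean_representation)
    also have "\<dots> = (\<Sum>b\<in>Basis. (?M x v \<bullet> b) *\<^sub>R ?D x b)"
      by (simp add: linear_sum[OF lin] linear_cmul[OF lin])
    finally show ?thesis .
  qed
  show ?case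
  proof (rule C_k_SucI)
    show "((\<lambda>x. f (m x)) has_derivative (\<lambda>v. ?D x (?M x v))) (at x)" for x
      using diff_chain_at[OF C_k_SucD(1)[OF Suc.prems(2), of x] C_k_SucD(1)[OF Suc.prems(1)]]
      by (simp add: o_def)
    show "C_k k (\<lambda>x. ?D x (?M x v))" for v
      unfolding *
    proof (intro C_k_sum bounded_bilinear.C_k_prod[OF bounded_bilinear_scaleR])
      fix b :: 'b assume "b \<in> Basis"
      show "C_k k (\<lambda>x. ?M x v \<bullet> b)"
        by (intro C_k_linear_o[OF bounded_linear_inner_left] C_k_SucD(2)[OF Suc.prems(2)])
      show "C_k k (\<lambda>x. ?D x b)"
        by (rule Suc.IH[OF C_k_SucD(2)[OF Suc.prems(1)] C_k_Suc_imp[OF Suc.prems(2)]])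
    qed
  qed
qed

lemma C_k_inverse:
  fixes f :: "'a::real_normed_vector \<Rightarrow> real"
  assumes nz: "\<And>x. f x \<noteq> 0"
  shows "C_k k f \<Longrightarrow> C_k k (\<lambda>x. inverse (f x))"
proof (induction k)
  case 0
  then show ?case using nz by (simp add: continuous_on_inverse)
next
  case (Suc k)
  have inv: "C_k k (\<lambda>x. inverse (f x))"
    by (rule Suc.IH[OF C_k_Suc_imp[OF Suc.prems]])
  show ?case
  proof (rule C_k_SucI)
    show "((\<lambda>x. inverse (f x)) has_derivative
        (\<lambda>v. - (inverse (f x) * frechet_derivative f (at x) v * inverse (f x)))) (at x)" for x
      by (rule Deriv.has_derivative_inverse[OF nz C_k_SucD(1)[OF Suc.prems]])
    show "C_k k (\<lambda>x. - (inverse (f x) * frechet_derivative f (at x) v * inverse (f x)))" for v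
      by (intro C_k_linear_o[OF bounded_linear_minus[OF bounded_linear_ident]]
          bounded_bilinear.C_k_prod[OF bounded_bilinear_mult] inv C_k_SucD(2)[OF Suc.prems])
  qed
qed

lemma C_k_ln:
  fixes f :: "'a::real_normed_vector \<Rightarrow> real"
  assumes pos: "\<And>x. f x > 0"
  shows "C_k k f \<Longrightarrow> C_k k (\<lambda>x. ln (f x))"
proof (cases k)
  case 0
  assume "C_k k f" then show ?thesis
    using 0 pos by (simp add: continuous_on_ln less_imp_neq[symmetric])
next
  case (Suc j)
  assume f: "C_k k f"
  have nz: "f x \<noteq> 0" for x using pos[of x] by simp
  show ?thesis unfolding Suc
  proof (rule C_k_SucI)
    show "((\<lambda>x. ln (f x)) has_derivative
        (\<lambda>v. frechet_derivative f (at x) v * inverse (f x))) (at x)" for x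
      by (auto intro!: derivative_eq_intros C_k_SucD(1)[OF f[unfolded Suc]] simp: pos divide_inverse)
    show "C_k j (\<lambda>x. frechet_derivative f (at x) v * inverse (f x))" for v
      by (intro bounded_bilinear.C_k_prod[OF bounded_bilinear_mult] C_k_inverse nz
          C_k_SucD(2)[OF f[unfolded Suc]] C_k_Suc_imp[OF f[unfolded Suc]])
  qed
qed

named_theorems smooth_intros

lemma smooth_const [smooth_intros]: "smooth (\<lambda>x. c)"
  by (simp add: smooth_def C_k_const)

lemma smooth_add [smooth_intros]: "smooth f \<Longrightarrow> smooth g \<Longrightarrow> smooth (\<lambda>x. f x + g x)"
  by (simp add: smooth_def C_k_add)

lemma smooth_linear: "bounded_linear L \<Longrightarrow> smooth f \<Longrightarrow> smooth (\<lambda>x. L (f x))"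
  by (simp add: smooth_def C_k_linear_o)

lemma smooth_ident [smooth_intros]: "smooth (\<lambda>x. x)"
  by (simp add: smooth_def C_k_bounded_linear)

lemma smooth_minus [smooth_intros]: "smooth f \<Longrightarrow> smooth (\<lambda>x. - f x)"
  by (rule smooth_linear[OF bounded_linear_minus[OF bounded_linear_ident]])

lemma smooth_diff [smooth_intros]:
  fixes f g :: "'a::euclidean_space \<Rightarrow> 'b::real_normed_vector"
  shows "smooth f \<Longrightarrow> smooth g \<Longrightarrow> smooth (\<lambda>x. f x - g x)"
  using smooth_add[of f "\<lambda>x. - g x"] smooth_minus[of g] by simp

lemma smooth_mult [smooth_intros]:
  fixes f g :: "'a::euclidean_space \<Rightarrow> 'b::real_normed_algebra"
  shows "smooth f \<Longrightarrow> smooth g \<Longrightarrow> smooth (\<lambda>x. f x * g x)"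
  by (simp add: smooth_def bounded_bilinear.C_k_prod[OF bounded_bilinear_mult])

lemma smooth_scaleR [smooth_intros]:
  shows "smooth f \<Longrightarrow> smooth g \<Longrightarrow> smooth (\<lambda>x. f x *\<^sub>R g x)"
  by (simp add: smooth_def bounded_bilinear.C_k_prod[OF bounded_bilinear_scaleR])

lemma smooth_inner [smooth_intros]:
  shows "smooth f \<Longrightarrow> smooth g \<Longrightarrow> smooth (\<lambda>x. f x \<bullet> g x)"
  by (simp add: smooth_def bounded_bilinear.C_k_prod[OF bounded_bilinear_inner])

lemma smooth_of_real [smooth_intros]:
  "smooth f \<Longrightarrow> smooth (\<lambda>x. of_real (f x) :: 'b::real_normed_algebra_1)"
  by (rule smooth_linear) (rule bounded_linear_of_real)

lemma smooth_cnj [smooth_intros]: "smooth f \<Longrightarrow> smooth (\<lambda>x. cnj (f x))"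
  by (rule smooth_linear) (rule bounded_linear_cnj)

lemma smooth_vec_nth [smooth_intros]:
  "smooth f \<Longrightarrow> smooth (\<lambda>x. (f x :: complex ^ 'n::finite) $ i)"
  by (rule smooth_linear) (rule bounded_linear_vec_nth)

lemma smooth_inverse [smooth_intros]:
  "(\<And>x. f x \<noteq> 0) \<Longrightarrow> smooth f \<Longrightarrow> smooth (\<lambda>x. inverse (f x :: real))"
  by (simp add: smooth_def C_k_inverse)

lemma smooth_divide [smooth_intros]:
  "(\<And>x. g x \<noteq> 0) \<Longrightarrow> smooth f \<Longrightarrow> smooth g \<Longrightarrow> smooth (\<lambda>x. f x / g x :: real)"
  by (simp add: divide_inverse smooth_intros)

lemma smooth_ln [smooth_intros]:
  "(\<And>x. f x > 0) \<Longrightarrow> smooth f \<Longrightarrow> smooth (\<lambda>x. ln (f x :: real))"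
  by (simp add: smooth_def C_k_ln)

lemma smooth_compose:
  fixes f :: "'b::euclidean_space \<Rightarrow> 'c::real_normed_vector" and m :: "'a::euclidean_space \<Rightarrow> 'b"
  shows "smooth f \<Longrightarrow> smooth m \<Longrightarrow> smooth (\<lambda>x. f (m x))"
  by (simp add: smooth_def C_k_compose)

lemma smooth_has_derivative:
  "smooth f \<Longrightarrow> (f has_derivative frechet_derivative f (at x)) (at x)"
  unfolding smooth_def using C_k_SucD(1) by blast

lemma smooth_derivative [smooth_intros]:
  "smooth f \<Longrightarrow> smooth (\<lambda>x. frechet_derivative f (at x) v)"
  unfolding smooth_def using C_k_SucD(2) by blast

lemma smooth_continuous: "smooth f \<Longrightarrow> continuous_on A f"
  using continuous_on_subset unfolding smooth_def by (metis C_k.simps(1) subset_UNIV)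

lemma smooth_measurable [measurable_dest]:
  "smooth (f :: 'a::euclidean_space \<Rightarrow> 'b::real_normed_vector) \<Longrightarrow> f \<in> borel_measurable borel"
  by (rule borel_measurable_continuous_onI[OF smooth_continuous])

text \<open>
  The functions \<open>t ^ (- j) * exp (- 1 / t)\<close> on the positive axis, extended by zero: the span of this
  family is closed under differentiation, so that all its members are smooth.
\<close>

definition flat_exp :: "nat \<Rightarrow> real \<Rightarrow> real" where
  "flat_exp j t = (if t > 0 then exp (- inverse t) * inverse t ^ j else 0)"

lemma flat_exp_le: "\<bar>flat_exp j t\<bar> \<le> fact (Suc j) * \<bar>t\<bar>"
proof (cases "t > 0")
  case True
  define y where "y = inverse t"
  have y: "y > 0" using True by (simp add: y_def)
  have "y ^ Suc j / fact (Suc j) \<le> exp y"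
  proof -
    have "(\<lambda>n. y ^ n / fact n) sums exp y"
      using exp_converges[of y] by (simp add: divide_inverse mult.commute)
    then have "summable (\<lambda>n. y ^ n / fact n)" "(\<Sum>n. y ^ n / fact n) = exp y"
      by (auto simp: sums_iff)
    then show ?thesis
      using sum_le_suminf[of "\<lambda>n. y ^ n / fact n" "{Suc j}"] y by simp
  qed
  then have "y ^ Suc j \<le> fact (Suc j) * exp y"
    by (simp add: divide_simps mult.commute)
  then have "exp (- y) * y ^ Suc j \<le> fact (Suc j)"
    by (simp add: exp_minus divide_simps mult.commute)
  then have "exp (- y) * y ^ Suc j * t \<le> fact (Suc j) * t"
    using True by (intro mult_right_mono) auto
  moreover have "exp (- y) * y ^ Suc j * t = exp (- y) * y ^ j * (y * t)"
    by (simp only: power_Suc ac_simps)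
  moreover have "y * t = 1" using True by (simp add: y_def)
  ultimately have "exp (- y) * y ^ j \<le> fact (Suc j) * t"
    by (metis mult.right_neutral)
  then show ?thesis using True y by (simp add: flat_exp_def y_def[symmetric] abs_mult del: fact_Suc)
qed (simp add: flat_exp_def mult_le_0_iff del: fact_Suc)

lemma flat_exp_has_derivative:
  "(flat_exp j has_real_derivative (flat_exp (j + 2) t - real j * flat_exp (Suc j) t)) (at t)"
proof (cases "t = 0")
  case False
  show ?thesis
  proof (cases "t > 0")
    case True
    have "((\<lambda>t. exp (- inverse t) * inverse t ^ j) has_real_derivative
        (flat_exp (j + 2) t - real j * flat_exp (Suc j) t)) (at t)"
      using True
      by (auto intro!: derivative_eq_intros simp: flat_exp_def power2_eq_square)
        (cases j, auto simp: field_simps)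
    then show ?thesis
      by (rule has_field_derivative_transform_within_open[where S = "{0<..}"])
        (use True in \<open>auto simp: flat_exp_def\<close>)
  next
    case neg: False
    have "((\<lambda>t. 0) has_real_derivative 0) (at t)" by simp
    then have "(flat_exp j has_real_derivative 0) (at t)"
      by (rule has_field_derivative_transform_within_open[where S = "{..<0}"])
        (use False neg in \<open>auto simp: flat_exp_def\<close>)
    then show ?thesis using neg by (simp add: flat_exp_def)
  qed
next
  case True
  have "((\<lambda>h. flat_exp j h / h) \<longlongrightarrow> 0) (at 0)"
  proof (rule Lim_null_comparison)
    have "\<bar>flat_exp j h / h\<bar> \<le> fact (Suc (Suc j)) * \<bar>h\<bar>" for h
    proof -
      have "flat_exp j h / h = flat_exp (Suc j) h"
        by (simp add: flat_exp_def divide_inverse)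
      then show ?thesis using flat_exp_le[of "Suc j" h] by simp
    qed
    then show "\<forall>\<^sub>F h in at 0. norm (flat_exp j h / h) \<le> fact (Suc (Suc j)) * \<bar>h\<bar>"
      by simp
    show "((\<lambda>h. fact (Suc (Suc j)) * \<bar>h\<bar>) \<longlongrightarrow> 0) (at (0::real))"
      by (auto intro!: tendsto_eq_intros)
  qed
  then show ?thesis using True by (simp add: DERIV_def flat_exp_def)
qed

lemma smooth_flat_exp: "smooth (flat_exp j)"
proof -
  have "C_k k (flat_exp j)" for k
  proof (induction k arbitrary: j)
    case 0
    show ?case
      using DERIV_isCont[OF flat_exp_has_derivative] by (auto intro: continuous_at_imp_continuous_on)
  next
    case (Suc k)
    show ?case
    proof (rule C_k_SucI)
      show "(flat_exp j has_derivative
          (\<lambda>v. v *\<^sub>R (flat_exp (j + 2) t + (- real j) *\<^sub>R flat_exp (Suc j) t))) (at t)" for t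
        using flat_exp_has_derivative[of j t]
        by (simp add: has_field_derivative_def mult.commute[of _ "_ - _"])
      show "C_k k (\<lambda>t. v *\<^sub>R (flat_exp (j + 2) t + (- real j) *\<^sub>R flat_exp (Suc j) t))" for v
        by (intro C_k_linear_o[OF bounded_linear_scaleR_right] C_k_add Suc.IH)
    qed
  qed
  then show ?thesis by (simp add: smooth_def)
qed

definition smooth_step :: "real \<Rightarrow> real" where
  "smooth_step t = flat_exp 0 t / (flat_exp 0 t + flat_exp 0 (1 - t))"

lemma smooth_step_denom: "flat_exp 0 t + flat_exp 0 (1 - t) > 0"
  by (auto simp: flat_exp_def add_pos_pos)

lemma smooth_step_eq_0 [simp]: "t \<le> 0 \<Longrightarrow> smooth_step t = 0"
  by (simp add: smooth_step_def flat_exp_def)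

lemma smooth_step_eq_1 [simp]: "t \<ge> 1 \<Longrightarrow> smooth_step t = 1"
  by (simp add: smooth_step_def flat_exp_def)

lemma smooth_step_bounds: "0 \<le> smooth_step t" "smooth_step t \<le> 1"
  using smooth_step_denom[of t] by (auto simp: smooth_step_def flat_exp_def divide_simps)

lemma smooth_smooth_step: "smooth smooth_step"
proof -
  have "smooth (\<lambda>t. flat_exp 0 (1 - t))"
    by (rule smooth_compose[OF smooth_flat_exp]) (intro smooth_intros)
  then have "smooth (\<lambda>t. flat_exp 0 t / (flat_exp 0 t + flat_exp 0 (1 - t)))"
    using smooth_step_denom
    by (intro smooth_intros smooth_flat_exp) (auto simp: less_imp_neq[symmetric])
  then show ?thesis by (simp add: smooth_step_def[abs_def])
qed

lemma smooth_step_deriv_bound: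
  obtains C where "C > 0"
    "\<And>t v. \<bar>frechet_derivative smooth_step (at t) v\<bar> \<le> C * \<bar>v\<bar>"
proof -
  let ?d = "\<lambda>t. frechet_derivative smooth_step (at t)"
  have "compact ((\<lambda>t. ?d t 1) ` {0..1})"
    by (rule compact_continuous_image[OF smooth_continuous[OF smooth_derivative[OF smooth_smooth_step]]
          compact_Icc])
  then have "bounded ((\<lambda>t. ?d t 1) ` {0..1})" by (rule compact_imp_bounded)
  then obtain B where "\<forall>y\<in>(\<lambda>t. ?d t 1) ` {0..1}. norm y \<le> B" unfolding bounded_iff ..
  then have B: "\<And>t. t \<in> {0..1} \<Longrightarrow> \<bar>?d t 1\<bar> \<le> B" by (auto simp del: atLeastAtMost_iff)
  have out: "?d t 1 = 0" if "t \<notin> {0..1}" for t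
  proof -
    have const: "?d t = (\<lambda>v. 0)" if S: "open S" "t \<in> S" "\<And>s. s \<in> S \<Longrightarrow> c = smooth_step s"
      for S c
    proof -
      have "(smooth_step has_derivative (\<lambda>v. 0)) (at t)"
        by (rule has_derivative_transform_within_open[OF has_derivative_const S])
      then show ?thesis by (rule frechet_derivative_at[symmetric])
    qed
    from that consider "t < 0" | "t > 1" by fastforce
    then show ?thesis
    proof cases
      case 1
      then have "?d t = (\<lambda>v. 0)" by (intro const[of "{..<0}" 0]) auto
      then show ?thesis by simp
    next
      case 2
      then have "?d t = (\<lambda>v. 0)" by (intro const[of "{1<..}" 1]) auto
      then show ?thesis by simp
    qed
  qed
  have "\<bar>?d t v\<bar> \<le> (\<bar>B\<bar> + 1) * \<bar>v\<bar>" for t v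
  proof -
    have "?d t v = v * ?d t 1"
      using linear_cmul[OF has_derivative_linear[OF smooth_has_derivative[OF smooth_smooth_step]], of t v 1]
      by simp
    moreover have "\<bar>?d t 1\<bar> \<le> \<bar>B\<bar> + 1"
      using B[of t] out[of t] by (cases "t \<in> {0..1}") auto
    ultimately show ?thesis by (simp add: abs_mult mult.commute[of _ "\<bar>v\<bar>"] mult_left_mono)
  qed
  then show ?thesis using that[of "\<bar>B\<bar> + 1"] by auto
qed

section \<open>Square integrals\<close>

lemma nn_integral_Cauchy_Schwarz:
  fixes u v :: "'a \<Rightarrow> ennreal"
  assumes [measurable]: "u \<in> borel_measurable M" "v \<in> borel_measurable M"
  shows "(\<integral>\<^sup>+x. u x * v x \<partial>M)\<^sup>2 \<le> (\<integral>\<^sup>+x. (u x)\<^sup>2 \<partial>M) * (\<integral>\<^sup>+x. (v x)\<^sup>2 \<partial>M)"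
proof -
  define a b where "a = (\<integral>\<^sup>+x. (u x)\<^sup>2 \<partial>M)" and "b = (\<integral>\<^sup>+x. (v x)\<^sup>2 \<partial>M)"
  show ?thesis
  proof (cases "a = 0 \<or> b = 0")
    case True
    have "(AE x in M. u x = 0) \<or> (AE x in M. v x = 0)"
    proof (cases "a = 0")
      case True
      then have "AE x in M. (u x)\<^sup>2 = 0"
        unfolding a_def by (subst (asm) nn_integral_0_iff_AE) auto
      then show ?thesis by auto
    next
      case False
      then have "b = 0" using True by simp
      then have "AE x in M. (v x)\<^sup>2 = 0"
        unfolding b_def by (subst (asm) nn_integral_0_iff_AE) auto
      then show ?thesis by auto
    qed
    then have "AE x in M. u x * v x = 0" by auto
    then have "(\<integral>\<^sup>+x. u x * v x \<partial>M) = 0"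
      by (subst nn_integral_0_iff_AE) auto
    then show ?thesis by simp
  next
    case nz: False
    show ?thesis
    proof (cases "a = top \<or> b = top")
      case True
      then have "a * b = top" using nz by (auto simp: ennreal_top_mult ennreal_mult_top)
      then show ?thesis by (simp add: a_def b_def)
    next
      case False
      then obtain r s where r: "a = ennreal r" "r > 0" and s: "b = ennreal s" "s > 0"
        using nz by (cases a; cases b) (auto simp: less_le)
      define A B where "A = sqrt r" and "B = sqrt s"
      have A: "A > 0" "a = ennreal (A\<^sup>2)" and B: "B > 0" "b = ennreal (B\<^sup>2)"
        using r s by (auto simp: A_def B_def)
      have pt: "2 * (p * q) \<le> ennreal (B / A) * p\<^sup>2 + ennreal (A / B) * q\<^sup>2" for p q :: ennreal
      proof (cases "p = top \<or> q = top")
        case True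
        then show ?thesis using A B by (auto simp: ennreal_mult_top power2_eq_square)
      next
        case False
        then obtain x y where xy: "p = ennreal x" "x \<ge> 0" "q = ennreal y" "y \<ge> 0"
          by (cases p; cases q) auto
        have "0 \<le> (B * x - A * y)\<^sup>2 / (A * B)" using A B by simp
        also have "\<dots> = B / A * x\<^sup>2 + A / B * y\<^sup>2 - 2 * (x * y)"
          using A B by (simp add: power2_eq_square field_simps)
        finally have *: "2 * (x * y) \<le> B / A * x\<^sup>2 + A / B * y\<^sup>2" by simp
        have "2 * (p * q) = ennreal (2 * (x * y))"
          using xy by (simp add: ennreal_mult)
        also have "\<dots> \<le> ennreal (B / A * x\<^sup>2 + A / B * y\<^sup>2)"
          using * by (rule ennreal_leI)
        also have "\<dots> = ennreal (B / A) * p\<^sup>2 + ennreal (A / B) * q\<^sup>2"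
          unfolding xy(1,3) ennreal_power[OF xy(2)] ennreal_power[OF xy(4)]
          using A B by (simp add: ennreal_mult[symmetric] ennreal_plus[symmetric] del: ennreal_plus)
        finally show ?thesis .
      qed
      have "2 * (\<integral>\<^sup>+x. u x * v x \<partial>M) = (\<integral>\<^sup>+x. 2 * (u x * v x) \<partial>M)"
        by (simp add: nn_integral_cmult)
      also have "\<dots> \<le> (\<integral>\<^sup>+x. ennreal (B / A) * (u x)\<^sup>2 + ennreal (A / B) * (v x)\<^sup>2 \<partial>M)"
        by (intro nn_integral_mono pt)
      also have "\<dots> = ennreal (B / A) * a + ennreal (A / B) * b"
        by (simp add: nn_integral_add nn_integral_cmult a_def b_def)
      also have "\<dots> = ennreal (B / A * A\<^sup>2 + A / B * B\<^sup>2)"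
        unfolding A(2) B(2) using A(1) B(1)
        by (simp add: ennreal_mult[symmetric] ennreal_plus[symmetric] del: ennreal_plus)
      also have "B / A * A\<^sup>2 + A / B * B\<^sup>2 = 2 * (A * B)"
        using A B by (simp add: power2_eq_square)
      also have "ennreal (2 * (A * B)) = 2 * ennreal (A * B)"
        using A B by (simp add: ennreal_mult)
      finally have "2 * (\<integral>\<^sup>+x. u x * v x \<partial>M) \<le> 2 * ennreal (A * B)" .
      then have "(\<integral>\<^sup>+x. u x * v x \<partial>M) \<le> ennreal (A * B)"
        by (subst (asm) ennreal_mult_le_mult_iff) auto
      then have "(\<integral>\<^sup>+x. u x * v x \<partial>M)\<^sup>2 \<le> (ennreal (A * B))\<^sup>2"
        by (rule power_mono) simp
      also have "\<dots> = a * b"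
        unfolding A(2) B(2) using A(1) B(1) by (simp add: ennreal_power ennreal_mult[symmetric] power_mult_distrib)
      finally show ?thesis by (simp add: a_def b_def)
    qed
  qed
qed

definition l2 :: "'a::euclidean_space set \<Rightarrow> ('a \<Rightarrow> complex) \<Rightarrow> ennreal" where
  "l2 A f = (\<integral>\<^sup>+x. (ennreal (cmod (f x)))\<^sup>2 * indicator A x \<partial>lborel)"

lemma ennreal_cmod_square: "(ennreal (cmod z))\<^sup>2 = ennreal ((cmod z)\<^sup>2)"
  by (simp add: ennreal_power)

lemma l2_mono:
  "A \<subseteq> B \<Longrightarrow> (\<And>x. x \<in> A \<Longrightarrow> cmod (f x) \<le> cmod (g x)) \<Longrightarrow> l2 A f \<le> l2 B g"
  unfolding l2_def
  by (intro nn_integral_mono) (auto simp: indicator_def intro!: power_mono ennreal_leI)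

lemma l2_cong: "A = B \<Longrightarrow> (\<And>x. x \<in> B \<Longrightarrow> f x = g x) \<Longrightarrow> l2 A f = l2 B g"
  by (intro antisym l2_mono) auto

lemma l2_cong_AE:
  "(AE x in lborel. x \<in> A \<longrightarrow> f x = g x) \<Longrightarrow> l2 A f = l2 A g"
  unfolding l2_def by (intro nn_integral_cong_AE) (auto simp: indicator_def)

lemma l2_zero [simp]: "l2 A (\<lambda>x. 0) = 0"
  by (simp add: l2_def power2_eq_square)

lemma l2_support: "(\<And>x. x \<in> B \<Longrightarrow> x \<notin> A \<Longrightarrow> f x = 0) \<Longrightarrow> A \<subseteq> B \<Longrightarrow> l2 B f = l2 A f"
  unfolding l2_def
  by (intro nn_integral_cong) (auto simp: indicator_def power2_eq_square)

lemma l2_cmult: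
  assumes [measurable]: "f \<in> borel_measurable borel" "A \<in> sets borel"
  shows "l2 A (\<lambda>x. c * f x) = ennreal ((cmod c)\<^sup>2) * l2 A f"
proof -
  have "l2 A (\<lambda>x. c * f x) =
      (\<integral>\<^sup>+x. ennreal ((cmod c)\<^sup>2) * ((ennreal (cmod (f x)))\<^sup>2 * indicator A x) \<partial>lborel)"
    unfolding l2_def ennreal_cmod_square
    by (simp add: norm_mult power_mult_distrib ennreal_mult mult.assoc)
  also have "\<dots> = ennreal ((cmod c)\<^sup>2) * l2 A f"
    unfolding l2_def by (rule nn_integral_cmult) measurable
  finally show ?thesis .
qed

lemma l2_cmult_le:
  assumes [measurable]: "f \<in> borel_measurable borel" "A \<in> sets borel" and "C \<ge> 0"
    and "\<And>x. x \<in> A \<Longrightarrow> cmod (g x) \<le> C * cmod (f x)"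
  shows "l2 A g \<le> ennreal (C\<^sup>2) * l2 A f"
proof -
  have "l2 A g \<le> l2 A (\<lambda>x. of_real C * f x)"
    using assms by (intro l2_mono) (auto simp: norm_mult)
  then show ?thesis using assms by (simp add: l2_cmult)
qed

lemma l2_add:
  assumes [measurable]: "f \<in> borel_measurable borel" "g \<in> borel_measurable borel" "A \<in> sets borel"
  shows "l2 A (\<lambda>x. f x + g x) \<le> 2 * l2 A f + 2 * l2 A g"
proof -
  have pt: "(ennreal (cmod (a + b)))\<^sup>2 \<le> 2 * (ennreal (cmod a))\<^sup>2 + 2 * (ennreal (cmod b))\<^sup>2" for a b
  proof -
    have "(cmod (a + b))\<^sup>2 \<le> (cmod a + cmod b)\<^sup>2"
      by (intro power_mono norm_triangle_ineq) auto
    also have "\<dots> \<le> 2 * (cmod a)\<^sup>2 + 2 * (cmod b)\<^sup>2"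
      using sum_squares_bound[of "cmod a" "cmod b"] by (simp add: power2_sum)
    finally have "ennreal ((cmod (a + b))\<^sup>2) \<le> ennreal (2 * (cmod a)\<^sup>2 + 2 * (cmod b)\<^sup>2)"
      by (rule ennreal_leI)
    then show ?thesis unfolding ennreal_cmod_square by (simp add: ennreal_mult)
  qed
  have "l2 A (\<lambda>x. f x + g x) \<le> (\<integral>\<^sup>+x. 2 * ((ennreal (cmod (f x)))\<^sup>2 * indicator A x) +
      2 * ((ennreal (cmod (g x)))\<^sup>2 * indicator A x) \<partial>lborel)"
    unfolding l2_def using pt by (intro nn_integral_mono) (auto simp: indicator_def)
  also have "\<dots> = 2 * l2 A f + 2 * l2 A g"
    unfolding l2_def by (subst nn_integral_add) (auto simp: nn_integral_cmult)
  finally show ?thesis .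
qed

lemma l2_diff_triangle:
  assumes [measurable]: "f \<in> borel_measurable borel" "g \<in> borel_measurable borel"
    "h \<in> borel_measurable borel" "A \<in> sets borel"
  shows "l2 A (\<lambda>x. f x - h x) \<le> 2 * l2 A (\<lambda>x. f x - g x) + 2 * l2 A (\<lambda>x. g x - h x)"
  using l2_add[of "\<lambda>x. f x - g x" "\<lambda>x. g x - h x" A] by simp

lemma l2_minus: "l2 A (\<lambda>x. f x - g x) = l2 A (\<lambda>x. g x - f x)"
  by (simp add: l2_def norm_minus_commute)

lemma l2_const: "A \<in> sets borel \<Longrightarrow> l2 A (\<lambda>x. c) = ennreal ((cmod c)\<^sup>2) * emeasure lborel A"
  unfolding l2_def ennreal_cmod_square by (simp add: nn_integral_cmult_indicator)

lemma l2_bounded_finite: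
  assumes "bounded A" "A \<in> sets borel" "\<And>x. x \<in> A \<Longrightarrow> cmod (f x) \<le> B"
  shows "l2 A f < top"
proof -
  have "l2 A f \<le> l2 A (\<lambda>x. of_real \<bar>B\<bar>)"
    using assms by (intro l2_mono) (fastforce intro: order_trans)+
  also have "\<dots> < top"
    using emeasure_bounded_finite[OF assms(1)] assms(2)
    by (simp add: l2_const ennreal_mult_less_top)
  finally show ?thesis .
qed

text \<open>Cauchy--Schwarz for the pairing of two square integrable functions.\<close>

lemma l2_pairing:
  assumes [measurable]: "f \<in> borel_measurable borel" "g \<in> borel_measurable borel" "A \<in> sets borel"
    and fin: "l2 A f < top" "l2 A g < top" and supp: "\<And>x. x \<notin> A \<Longrightarrow> f x * g x = 0"
  shows "integrable lborel (\<lambda>x. f x * g x)"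
    and "(ennreal (cmod (LINT x|lborel. f x * g x)))\<^sup>2 \<le> l2 A f * l2 A g"
proof -
  have "(\<integral>\<^sup>+x. ennreal (cmod (f x * g x)) \<partial>lborel) =
      (\<integral>\<^sup>+x. (ennreal (cmod (f x)) * indicator A x) * (ennreal (cmod (g x)) * indicator A x) \<partial>lborel)"
    using supp by (intro nn_integral_cong) (auto simp: indicator_def norm_mult ennreal_mult)
  then have "(\<integral>\<^sup>+x. ennreal (cmod (f x * g x)) \<partial>lborel)\<^sup>2 \<le>
      (\<integral>\<^sup>+x. (ennreal (cmod (f x)) * indicator A x)\<^sup>2 \<partial>lborel) *
      (\<integral>\<^sup>+x. (ennreal (cmod (g x)) * indicator A x)\<^sup>2 \<partial>lborel)"
    by (simp only:) (rule nn_integral_Cauchy_Schwarz; measurable)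
  also have "\<dots> = l2 A f * l2 A g"
    unfolding l2_def
    by (intro arg_cong2[where f = "(*)"] nn_integral_cong) (auto simp: indicator_def power2_eq_square)
  finally have *: "(\<integral>\<^sup>+x. ennreal (cmod (f x * g x)) \<partial>lborel)\<^sup>2 \<le> l2 A f * l2 A g" .
  have "l2 A f * l2 A g < top" using fin by (simp add: ennreal_mult_less_top)
  with * have "(\<integral>\<^sup>+x. ennreal (cmod (f x * g x)) \<partial>lborel)\<^sup>2 < top"
    by (rule le_less_trans)
  then have "(\<integral>\<^sup>+x. ennreal (cmod (f x * g x)) \<partial>lborel) < top"
    by (simp add: power_less_top_ennreal)
  then show int: "integrable lborel (\<lambda>x. f x * g x)"
    by (intro integrableI_bounded) auto
  have "(ennreal (cmod (LINT x|lborel. f x * g x)))\<^sup>2 \<le> (\<integral>\<^sup>+x. ennreal (cmod (f x * g x)) \<partial>lborel)\<^sup>2"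
    by (intro power_mono integral_norm_bound_ennreal int) auto
  with * show "(ennreal (cmod (LINT x|lborel. f x * g x)))\<^sup>2 \<le> l2 A f * l2 A g" by simp
qed

section \<open>Averages of square integrable functions\<close>

text \<open>
  Cauchy--Schwarz in the averaging variable. Convolutions, partial convolutions and mollifications
  combined with a dilation are all averages of this kind.
\<close>

lemma nn_integral_average_square_le:
  fixes F :: "'a \<Rightarrow> 'b \<Rightarrow> ennreal"
  assumes M: "sigma_finite_measure M" and N: "finite_measure N"
    and [measurable]: "(\<lambda>(x, y). F x y) \<in> borel_measurable (M \<Otimes>\<^sub>M N)"
  shows "(\<integral>\<^sup>+x. (\<integral>\<^sup>+y. F x y \<partial>N)\<^sup>2 \<partial>M) \<le>
    emeasure N (space N) * (\<integral>\<^sup>+y. (\<integral>\<^sup>+x. (F x y)\<^sup>2 \<partial>M) \<partial>N)"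
proof -
  interpret M: sigma_finite_measure M by fact
  interpret N: finite_measure N by fact
  interpret pair_sigma_finite M N ..
  have "(\<integral>\<^sup>+x. (\<integral>\<^sup>+y. F x y \<partial>N)\<^sup>2 \<partial>M) \<le> (\<integral>\<^sup>+x. emeasure N (space N) * (\<integral>\<^sup>+y. (F x y)\<^sup>2 \<partial>N) \<partial>M)"
  proof (rule nn_integral_mono)
    fix x assume [measurable]: "x \<in> space M"
    show "(\<integral>\<^sup>+y. F x y \<partial>N)\<^sup>2 \<le> emeasure N (space N) * (\<integral>\<^sup>+y. (F x y)\<^sup>2 \<partial>N)"
      using nn_integral_Cauchy_Schwarz[of "\<lambda>_. 1" N "F x"] by simp
  qed
  also have "\<dots> = emeasure N (space N) * (\<integral>\<^sup>+x. (\<integral>\<^sup>+y. (F x y)\<^sup>2 \<partial>N) \<partial>M)"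
    by (rule nn_integral_cmult) measurable
  also have "(\<integral>\<^sup>+x. (\<integral>\<^sup>+y. (F x y)\<^sup>2 \<partial>N) \<partial>M) = (\<integral>\<^sup>+y. (\<integral>\<^sup>+x. (F x y)\<^sup>2 \<partial>M) \<partial>N)"
    by (rule Fubini'[symmetric]) measurable
  finally show ?thesis .
qed

lemma two_mult_ennreal: "2 * ennreal x = ennreal (2 * x)"
  by (cases "x \<ge> 0") (simp_all add: ennreal_mult ennreal_neg)

lemma tendsto_ennreal_0I:
  fixes u :: "'a \<Rightarrow> ennreal"
  assumes "\<And>e::real. e > 0 \<Longrightarrow> eventually (\<lambda>n. u n \<le> ennreal e) F"
  shows "(u \<longlongrightarrow> 0) F"
proof (rule order_tendstoI)
  fix a :: ennreal assume "0 < a"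
  from dense[OF this] obtain b where b: "0 < b" "b < a" by blast
  have "b < top" by (rule less_le_trans[OF b(2) top_greatest])
  then obtain e where e: "b = ennreal e" "e \<ge> 0" by (cases b) auto
  with b have "e > 0" by (auto simp: less_le)
  from assms[OF this] show "eventually (\<lambda>n. u n < a) F"
    using b e by (auto elim!: eventually_mono)
qed simp

lemma measurable_on_approx_AE:
  fixes f :: "'a::euclidean_space \<Rightarrow> complex"
  assumes "f \<in> borel_measurable borel"
  obtains g where "\<And>n. continuous_on UNIV (g n)" "AE x in lborel. (\<lambda>n. g n x) \<longlonglongrightarrow> f x"
proof -
  have "f \<in> borel_measurable lborel" using assms by simp
  then have "f \<in> borel_measurable lebesgue" by (rule measurable_completion)
  then have "f measurable_on UNIV"
    by (rule lebesgue_measurable_imp_measurable_on) simp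
  then obtain N g where *: "negligible N \<and> (\<forall>n. continuous_on UNIV (g n)) \<and>
      (\<forall>x. x \<notin> N \<longrightarrow> (\<lambda>n. g n x) \<longlonglongrightarrow> (if x \<in> UNIV then f x else 0))"
    unfolding measurable_on_def by blast
  then have N: "negligible N" and g: "\<And>n. continuous_on UNIV (g n)"
    and lim: "\<And>x. x \<notin> N \<Longrightarrow> (\<lambda>n. g n x) \<longlonglongrightarrow> f x"
    by simp_all
  have "AE x in lebesgue. x \<notin> N"
    using N AE_not_in negligible_iff_null_sets by blast
  then have "AE x in lborel. x \<notin> N" by (simp add: AE_completion_iff)
  then have "AE x in lborel. (\<lambda>n. g n x) \<longlonglongrightarrow> f x"
    by (rule AE_mp) (use lim in auto)
  with g show ?thesis by (rule that)
qed

lemma l2_dominated_tendsto_0: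
  assumes [measurable]: "\<And>n. f n \<in> borel_measurable borel" "w \<in> borel_measurable borel" "A \<in> sets borel"
    and le: "\<And>n x. x \<in> A \<Longrightarrow> cmod (f n x) \<le> cmod (w x)" and fin: "l2 A w < top"
    and lim: "AE x in lborel. x \<in> A \<longrightarrow> (\<lambda>n. f n x) \<longlonglongrightarrow> 0"
  shows "(\<lambda>n. l2 A (f n)) \<longlonglongrightarrow> 0"
proof -
  have "(\<lambda>n. \<integral>\<^sup>+x. (ennreal (cmod (f n x)))\<^sup>2 * indicator A x \<partial>lborel) \<longlonglongrightarrow> (\<integral>\<^sup>+x. 0 \<partial>(lborel :: 'a measure))"
  proof (rule nn_integral_dominated_convergence[where w = "\<lambda>x. (ennreal (cmod (w x)))\<^sup>2 * indicator A x"])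
    show "AE x in lborel. (ennreal (cmod (f n x)))\<^sup>2 * indicator A x \<le> (ennreal (cmod (w x)))\<^sup>2 * indicator A x" for n
      using le by (intro AE_I2) (auto simp: indicator_def intro!: power_mono ennreal_leI)
    show "(\<integral>\<^sup>+x. (ennreal (cmod (w x)))\<^sup>2 * indicator A x \<partial>lborel) < \<infinity>"
      using fin by (simp add: l2_def)
    show "AE x in lborel. (\<lambda>n. (ennreal (cmod (f n x)))\<^sup>2 * indicator A x) \<longlonglongrightarrow> 0"
      using lim
    proof (rule AE_mp, intro AE_I2 impI)
      fix x assume x: "x \<in> A \<longrightarrow> (\<lambda>n. f n x) \<longlonglongrightarrow> 0"
      show "(\<lambda>n. (ennreal (cmod (f n x)))\<^sup>2 * indicator A x) \<longlonglongrightarrow> 0"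
      proof (cases "x \<in> A")
        case True
        then have "(\<lambda>n. (cmod (f n x))\<^sup>2) \<longlonglongrightarrow> 0"
          using x by (auto intro!: tendsto_eq_intros)
        then show ?thesis
          using True tendsto_ennrealI[of "\<lambda>n. (cmod (f n x))\<^sup>2" 0] by (simp add: ennreal_cmod_square)
      qed simp
    qed
  qed measurable
  then show ?thesis by (simp add: l2_def)
qed

text \<open>
  Truncation reduces to a bounded function with bounded support; such a function is the limit
  almost everywhere of continuous functions, which can be truncated as well.
\<close>

lemma l2_dense_continuous:
  fixes f :: "'a::euclidean_space \<Rightarrow> complex"
  assumes [measurable]: "f \<in> borel_measurable borel" and fin: "l2 UNIV f < top" and e: "(e::real) > 0"
  obtains \<phi> where "continuous_on UNIV \<phi>" "l2 UNIV (\<lambda>x. f x - \<phi> x) \<le> ennreal e" "l2 UNIV \<phi> < top"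
proof -
  define fn where "fn n x = (if cmod (f x) \<le> real n \<and> norm x \<le> real n then f x else 0)" for n x
  have [measurable]: "fn n \<in> borel_measurable borel" for n
    unfolding fn_def[abs_def] by measurable
  have "(\<lambda>n. l2 UNIV (\<lambda>x. f x - fn n x)) \<longlonglongrightarrow> 0"
  proof (rule l2_dominated_tendsto_0[where w = f])
    show "AE x in lborel. x \<in> UNIV \<longrightarrow> (\<lambda>n. f x - fn n x) \<longlonglongrightarrow> 0"
    proof (intro AE_I2 impI)
      fix x
      obtain m :: nat where m: "max (cmod (f x)) (norm x) \<le> real m"
        using real_arch_simple by blast
      have "eventually (\<lambda>n. f x - fn n x = 0) sequentially"
        using eventually_ge_at_top[of m]
      proof eventually_elim
        case (elim n)
        then show ?case using m by (auto simp: fn_def)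
      qed
      then show "(\<lambda>n. f x - fn n x) \<longlonglongrightarrow> 0" by (rule tendsto_eventually)
    qed
  qed (use fin in \<open>auto simp: fn_def\<close>)
  from order_tendstoD(2)[OF this, of "ennreal (e / 4)"] e
  obtain n where n: "l2 UNIV (\<lambda>x. f x - fn n x) < ennreal (e / 4)"
    by (auto simp: eventually_sequentially)
  obtain g where g: "\<And>k. continuous_on UNIV (g k)" "AE x in lborel. (\<lambda>k. g k x) \<longlonglongrightarrow> fn n x"
    using measurable_on_approx_AE[of "fn n"] by auto
  define clip where "clip z = z / of_real (max 1 (cmod z / (real n + 1)))" for z :: complex
  define cut where "cut x = max 0 (min 1 (real n + 1 - norm x))" for x :: 'a
  have mx: "max 1 (cmod z / (real n + 1)) > 0" for z by (simp add: less_max_iff_disj)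
  then have mx0: "max 1 (cmod z / (real n + 1)) \<noteq> 0" for z by (metis less_irrefl)
  have cont_clip: "continuous_on A clip" for A
    unfolding clip_def by (intro continuous_intros ballI) (simp_all only: of_real_eq_0_iff mx0, auto)
  have clip_le: "cmod (clip z) \<le> real n + 1" for z
  proof -
    have "(real n + 1) * (cmod z / (real n + 1)) \<le> (real n + 1) * max 1 (cmod z / (real n + 1))"
      by (intro mult_left_mono) auto
    then have "cmod z \<le> (real n + 1) * max 1 (cmod z / (real n + 1))"
      by simp
    then show ?thesis
      using mx[of z] by (simp add: clip_def norm_divide pos_divide_le_eq del: max_less_iff_conj)
  qed
  have clip_id: "clip z = z" if "cmod z \<le> real n" for z
  proof -
    have "cmod z / (real n + 1) \<le> 1" using that by (simp add: field_simps)
    then show ?thesis by (simp add: clip_def max_def)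
  qed
  define h where "h k x = of_real (cut x) * clip (g k x)" for k x
  have cont: "continuous_on UNIV (h k)" for k
    unfolding h_def cut_def
    by (intro continuous_intros continuous_on_compose2[OF cont_clip[of UNIV] g(1)]) auto
  then have [measurable]: "h k \<in> borel_measurable borel" for k
    by (rule borel_measurable_continuous_onI)
  have cut: "0 \<le> cut x" "cut x \<le> 1" for x by (auto simp: cut_def)
  have supp: "h k x = 0" "fn n x = 0" if "x \<notin> cball 0 (real n + 1)" for k x
    using that by (auto simp: h_def cut_def fn_def)
  have h_le: "cmod (h k x) \<le> real n + 1" for k x
    using mult_mono[OF cut(2)[of x] clip_le[of "g k x"]] cut(1)[of x] by (simp add: h_def norm_mult)
  have "(\<lambda>k. l2 (cball 0 (real n + 1)) (\<lambda>x. fn n x - h k x)) \<longlonglongrightarrow> 0"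
  proof (rule l2_dominated_tendsto_0[where w = "\<lambda>x. of_real (2 * real n + 1)"])
    show "AE x in lborel. x \<in> cball 0 (real n + 1) \<longrightarrow> (\<lambda>k. fn n x - h k x) \<longlonglongrightarrow> 0"
      using g(2)
    proof (rule AE_mp, intro AE_I2 impI)
      fix x :: 'a assume lim: "(\<lambda>k. g k x) \<longlonglongrightarrow> fn n x"
      have "isCont clip (fn n x)"
        using cont_clip[of UNIV] by (simp add: continuous_on_eq_continuous_at)
      then have "(\<lambda>k. clip (g k x)) \<longlonglongrightarrow> clip (fn n x)"
        using lim by (rule isCont_tendsto_compose)
      then have "(\<lambda>k. fn n x - h k x) \<longlonglongrightarrow> fn n x - of_real (cut x) * clip (fn n x)"
        unfolding h_def by (intro tendsto_intros)
      moreover have "of_real (cut x) * clip (fn n x) = fn n x"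
        by (auto simp: fn_def clip_id cut_def)
      ultimately show "(\<lambda>k. fn n x - h k x) \<longlonglongrightarrow> 0" by simp
    qed
    show "cmod (fn n x - h k x) \<le> cmod (of_real (2 * real n + 1))" for k x
    proof -
      have "cmod (fn n x - h k x) \<le> cmod (fn n x) + cmod (h k x)" by (rule norm_triangle_ineq4)
      moreover have "cmod (fn n x) \<le> real n" by (simp add: fn_def)
      ultimately show ?thesis using h_le[of k x] by (simp only: norm_of_real)
    qed
    show "l2 (cball 0 (real n + 1)) (\<lambda>x. of_real (2 * real n + 1)) < top"
      by (rule l2_bounded_finite[OF bounded_cball]) auto
  qed auto
  from order_tendstoD(2)[OF this, of "ennreal (e / 4)"] e
  obtain k where k: "l2 (cball 0 (real n + 1)) (\<lambda>x. fn n x - h k x) < ennreal (e / 4)"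
    by (auto simp: eventually_sequentially)
  have "l2 UNIV (\<lambda>x. f x - h k x) \<le> 2 * l2 UNIV (\<lambda>x. f x - fn n x) + 2 * l2 UNIV (\<lambda>x. fn n x - h k x)"
    by (rule l2_diff_triangle) auto
  also have "l2 UNIV (\<lambda>x. fn n x - h k x) = l2 (cball 0 (real n + 1)) (\<lambda>x. fn n x - h k x)"
    by (rule l2_support) (auto simp del: mem_cball simp: supp)
  also have "2 * l2 UNIV (\<lambda>x. f x - fn n x) + 2 * \<dots> \<le> 2 * ennreal (e / 4) + 2 * ennreal (e / 4)"
    using n k by (intro add_mono mult_left_mono) auto
  also have "\<dots> = ennreal (2 * (e / 4) + 2 * (e / 4))"
    using e by (subst ennreal_plus) (simp_all only: two_mult_ennreal)
  also have "\<dots> = ennreal e" by simp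
  finally have "l2 UNIV (\<lambda>x. f x - h k x) \<le> ennreal e" .
  moreover have "l2 UNIV (h k) < top"
  proof -
    have "l2 UNIV (h k) = l2 (cball 0 (real n + 1)) (h k)"
      by (rule l2_support) (auto simp del: mem_cball simp: supp)
    also have "\<dots> < top" by (rule l2_bounded_finite[OF bounded_cball _ h_le]) auto
    finally show ?thesis .
  qed
  ultimately show ?thesis using that[OF cont] by blast
qed

text \<open>
  For a continuous function this is uniform continuity on bounded sets; the hypothesis on the image
  measures keeps the error of a continuous approximation of \<open>f\<close> under control.
\<close>

lemma l2_compose_tendsto:
  fixes f :: "'a::euclidean_space \<Rightarrow> complex"
  assumes f [measurable]: "f \<in> borel_measurable borel" and fin: "l2 UNIV f < top"
    and \<sigma> [measurable]: "\<And>n. \<sigma> n \<in> borel \<rightarrow>\<^sub>M borel"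
    and C: "\<And>n h. h \<in> borel_measurable borel \<Longrightarrow>
      (\<integral>\<^sup>+x. h (\<sigma> n x) \<partial>lborel) \<le> ennreal C * (\<integral>\<^sup>+x. h x \<partial>lborel)"
    and unif: "uniform_limit B \<sigma> (\<lambda>x. x) sequentially"
    and B: "bounded B" "B \<in> sets borel"
  shows "(\<lambda>n. l2 B (\<lambda>x. f (\<sigma> n x) - f x)) \<longlonglongrightarrow> 0"
proof (rule tendsto_ennreal_0I)
  fix e :: real assume e: "e > 0"
  define C' where "C' = max C 0"
  define d where "d = e / (8 * (C' + 1))"
  have d: "d > 0" using e by (simp add: d_def C'_def)
  obtain \<phi> where \<phi>: "continuous_on UNIV \<phi>" and close: "l2 UNIV (\<lambda>x. f x - \<phi> x) \<le> ennreal d"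
    using l2_dense_continuous[OF f fin d] by metis
  note [measurable] = borel_measurable_continuous_onI[OF \<phi>] B(2)
  have m: "emeasure lborel B < top" using B emeasure_bounded_finite by auto
  define b where "b = measure lborel B"
  have b: "emeasure lborel B = ennreal b" "b \<ge> 0"
    using m by (auto simp: b_def emeasure_eq_ennreal_measure)
  define s where "s = sqrt (e / (8 * (b + 1)))"
  have s: "s > 0" "s\<^sup>2 * b \<le> e / 8"
  proof -
    show "s > 0" using e b by (simp add: s_def)
    have "s\<^sup>2 * b = e / 8 * (b / (b + 1))" using e b by (simp add: s_def field_simps)
    also have "\<dots> \<le> e / 8 * 1" using e b by (intro mult_left_mono) auto
    finally show "s\<^sup>2 * b \<le> e / 8" by simp
  qed
  define K where "K = (\<Union>x\<in>closure B. \<Union>y\<in>cball 0 1. {x + y})"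
  have K: "compact K"
    unfolding K_def using B(1) by (intro compact_sums') (auto simp: compact_closure)
  have "uniformly_continuous_on K \<phi>"
    using compact_uniformly_continuous[OF continuous_on_subset[OF \<phi>] K] by auto
  then obtain r where r: "r > 0" and
    r': "\<And>x y. x \<in> K \<Longrightarrow> y \<in> K \<Longrightarrow> dist y x < r \<Longrightarrow> dist (\<phi> y) (\<phi> x) < s"
    using s(1) unfolding uniformly_continuous_on_def by metis
  have "eventually (\<lambda>n. \<forall>x\<in>B. dist (\<sigma> n x) x < min r 1) sequentially"
    by (rule uniform_limitD[OF unif]) (use r(1) in simp)
  then show "eventually (\<lambda>n. l2 B (\<lambda>x. f (\<sigma> n x) - f x) \<le> ennreal e) sequentially"
  proof eventually_elim
    case (elim n)
    have close_phi: "cmod (\<phi> (\<sigma> n x) - \<phi> x) \<le> s" if x: "x \<in> B" for x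
    proof -
      have K: "x + y \<in> K" if "norm y \<le> 1" for y
        using x that closure_subset[of B] unfolding K_def by fastforce
      have "norm (\<sigma> n x - x) \<le> 1"
        using elim x by (simp add: dist_norm less_imp_le)
      from K[OF this] K[of 0] have "x \<in> K" "\<sigma> n x \<in> K" by simp_all
      then show ?thesis using r'[of x "\<sigma> n x"] elim x by (simp add: dist_norm less_imp_le)
    qed
    have 1: "l2 B (\<lambda>x. f (\<sigma> n x) - \<phi> (\<sigma> n x)) \<le> ennreal (C' * d)"
    proof -
      have "l2 B (\<lambda>x. f (\<sigma> n x) - \<phi> (\<sigma> n x)) \<le> l2 UNIV (\<lambda>x. f (\<sigma> n x) - \<phi> (\<sigma> n x))"
        by (rule l2_mono) auto
      also have "\<dots> \<le> ennreal C * l2 UNIV (\<lambda>x. f x - \<phi> x)"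
        using C[of "\<lambda>x. (ennreal (cmod (f x - \<phi> x)))\<^sup>2" n] unfolding l2_def by simp
      also have "\<dots> \<le> ennreal C' * ennreal d"
        using close by (intro mult_mono) (auto simp: C'_def intro: ennreal_leI)
      finally show ?thesis using d by (simp add: ennreal_mult C'_def)
    qed
    have 2: "l2 B (\<lambda>x. \<phi> (\<sigma> n x) - \<phi> x) \<le> ennreal (e / 8)"
    proof -
      have "l2 B (\<lambda>x. \<phi> (\<sigma> n x) - \<phi> x) \<le> l2 B (\<lambda>x. of_real s)"
        using close_phi s by (intro l2_mono) auto
      also have "\<dots> = ennreal (s\<^sup>2 * b)"
        using B b s by (simp add: l2_const ennreal_mult)
      also have "\<dots> \<le> ennreal (e / 8)" using s(2) by (rule ennreal_leI)
      finally show ?thesis .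
    qed
    have 3: "l2 B (\<lambda>x. \<phi> x - f x) \<le> ennreal d"
      using l2_mono[of B UNIV "\<lambda>x. \<phi> x - f x" "\<lambda>x. f x - \<phi> x"] close
      by (auto simp: norm_minus_commute intro: order_trans)
    have "l2 B (\<lambda>x. f (\<sigma> n x) - f x) \<le>
        2 * l2 B (\<lambda>x. f (\<sigma> n x) - \<phi> (\<sigma> n x)) + 2 * l2 B (\<lambda>x. \<phi> (\<sigma> n x) - f x)"
      by (rule l2_diff_triangle) auto
    also have "\<dots> \<le> 2 * l2 B (\<lambda>x. f (\<sigma> n x) - \<phi> (\<sigma> n x)) +
        2 * (2 * l2 B (\<lambda>x. \<phi> (\<sigma> n x) - \<phi> x) + 2 * l2 B (\<lambda>x. \<phi> x - f x))"
      by (intro add_mono mult_left_mono l2_diff_triangle) auto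
    also have "\<dots> \<le> 2 * ennreal (C' * d) + 2 * (2 * ennreal (e / 8) + 2 * ennreal d)"
      by (intro add_mono mult_left_mono 1 2 3) auto
    also have "\<dots> = ennreal (2 * (C' * d) + 2 * (2 * (e / 8) + 2 * d))"
      unfolding two_mult_ennreal
      using e d by (simp add: two_mult_ennreal ennreal_plus[symmetric] C'_def del: ennreal_plus)
    also have "\<dots> \<le> ennreal e"
    proof (rule ennreal_leI)
      have "(C' + 1) * d = e / 8" by (simp add: d_def C'_def field_simps max_def)
      moreover have "d \<le> (C' + 1) * d" using d by (simp add: C'_def)
      ultimately show "2 * (C' * d) + 2 * (2 * (e / 8) + 2 * d) \<le> e"
        by (simp add: algebra_simps)
    qed
    finally show ?case .
  qed
qed

text \<open>
  If the integrand is not integrable, the average has the default value 0, but then the integral on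
  the right is infinite.
\<close>

lemma average_diff_le:
  fixes u :: "'b \<Rightarrow> complex"
  assumes N: "finite_measure N" "emeasure N (space N) = 1" and [measurable]: "u \<in> borel_measurable N"
  shows "ennreal (cmod ((LINT y|N. u y) - c)) \<le> (\<integral>\<^sup>+y. ennreal (cmod (u y - c)) \<partial>N)"
proof -
  interpret finite_measure N by fact
  show ?thesis
  proof (cases "integrable N u")
    case True
    have 1: "measure N (space N) = 1" using N(2) unfolding measure_def by simp
    have eq: "(LINT y|N. u y - c) = (LINT y|N. u y) - c"
      using True 1 by (simp add: Bochner_Integration.integral_diff)
    have "ennreal (cmod (LINT y|N. u y - c)) \<le> (\<integral>\<^sup>+y. ennreal (cmod (u y - c)) \<partial>N)"
      by (rule integral_norm_bound_ennreal) (use True in simp)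
    then show ?thesis unfolding eq .
  next
    case False
    then have "\<not> integrable N (\<lambda>y. u y - c)"
      using Bochner_Integration.integrable_add[of N "\<lambda>y. u y - c" "\<lambda>_. c"] by auto
    then have "(\<integral>\<^sup>+y. ennreal (cmod (u y - c)) \<partial>N) = top"
      by (auto simp: integrable_iff_bounded less_top[symmetric])
    then show ?thesis by simp
  qed
qed

text \<open>
  The square of an average is at most the average of the squares, so that the claim follows from
  the convergence for each fixed \<open>y\<close> by dominated convergence in \<open>y\<close>.
\<close>

lemma l2_average_tendsto:
  fixes f :: "'a::euclidean_space \<Rightarrow> complex" and \<tau> :: "nat \<Rightarrow> 'a \<Rightarrow> 'b \<Rightarrow> 'a"
  assumes f [measurable]: "f \<in> borel_measurable borel" and fin: "l2 UNIV f < top"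
    and N: "finite_measure N" "emeasure N (space N) = 1"
    and \<tau> [measurable]: "\<And>n. (\<lambda>(x, y). \<tau> n x y) \<in> borel \<Otimes>\<^sub>M N \<rightarrow>\<^sub>M borel"
    and C: "\<And>n y h. h \<in> borel_measurable borel \<Longrightarrow> y \<in> space N \<Longrightarrow>
      (\<integral>\<^sup>+x. h (\<tau> n x y) \<partial>lborel) \<le> ennreal C * (\<integral>\<^sup>+x. h x \<partial>lborel)"
    and unif: "\<And>y. y \<in> space N \<Longrightarrow> uniform_limit B (\<lambda>n x. \<tau> n x y) (\<lambda>x. x) sequentially"
    and B: "bounded B" "B \<in> sets borel"
  shows "(\<lambda>n. l2 B (\<lambda>x. (LINT y|N. f (\<tau> n x y)) - f x)) \<longlonglongrightarrow> 0"
proof -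
  interpret N: finite_measure N by fact
  interpret L: sigma_finite_measure "lborel :: 'a measure" by (rule sigma_finite_lborel)
  note [measurable] = B(2)
  have [measurable]: "(\<lambda>(x, y). f (\<tau> n x y)) \<in> borel_measurable (borel \<Otimes>\<^sub>M N)" for n
    using measurable_compose[OF \<tau>[of n] f] by (simp add: case_prod_unfold)
  have sec [measurable]: "(\<lambda>x. \<tau> n x y) \<in> borel \<rightarrow>\<^sub>M borel" if "y \<in> space N" for n y
    using measurable_Pair1'[of y N borel] measurable_compose[OF measurable_Pair2'[of y N borel, OF that] \<tau>[of n]]
    by simp
  have sec2 [measurable]: "(\<lambda>y. f (\<tau> n x y)) \<in> borel_measurable N" for n x
    using measurable_compose[OF measurable_Pair1'[of x borel N] measurable_compose[OF \<tau>[of n] f]]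
    by simp
  define G where "G n y = l2 B (\<lambda>x. f (\<tau> n x y) - f x)" for n y
  have G [measurable]: "G n \<in> borel_measurable N" for n
    unfolding G_def l2_def by measurable
  have le: "l2 B (\<lambda>x. (LINT y|N. f (\<tau> n x y)) - f x) \<le> (\<integral>\<^sup>+y. G n y \<partial>N)" for n
  proof -
    have "l2 B (\<lambda>x. (LINT y|N. f (\<tau> n x y)) - f x) \<le>
        (\<integral>\<^sup>+x. (\<integral>\<^sup>+y. ennreal (cmod (f (\<tau> n x y) - f x)) * indicator B x \<partial>N)\<^sup>2 \<partial>lborel)"
      unfolding l2_def
    proof (rule nn_integral_mono)
      fix x :: 'a
      show "(ennreal (cmod ((LINT y|N. f (\<tau> n x y)) - f x)))\<^sup>2 * indicator B x \<le>
          (\<integral>\<^sup>+y. ennreal (cmod (f (\<tau> n x y) - f x)) * indicator B x \<partial>N)\<^sup>2"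
        using average_diff_le[OF N sec2, of n x "f x"]
        by (auto simp: indicator_def intro!: power_mono)
    qed
    also have "\<dots> \<le> emeasure N (space N) *
        (\<integral>\<^sup>+y. (\<integral>\<^sup>+x. (ennreal (cmod (f (\<tau> n x y) - f x)) * indicator B x)\<^sup>2 \<partial>lborel) \<partial>N)"
      by (rule nn_integral_average_square_le) (unfold_locales, measurable)
    also have "\<dots> = (\<integral>\<^sup>+y. G n y \<partial>N)"
      unfolding G_def l2_def N(2) mult_1_left
      by (intro nn_integral_cong) (auto simp: indicator_def power2_eq_square)
    finally show ?thesis .
  qed
  have Gle: "G n y \<le> 2 * (ennreal C * l2 UNIV f) + 2 * l2 UNIV f" if y: "y \<in> space N" for n y
  proof -
    note [measurable] = sec[OF y]
    have "G n y = l2 B (\<lambda>x. f (\<tau> n x y) + - f x)" by (simp add: G_def)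
    also have "\<dots> \<le> 2 * l2 B (\<lambda>x. f (\<tau> n x y)) + 2 * l2 B (\<lambda>x. - f x)"
      by (rule l2_add) auto
    also have "\<dots> \<le> 2 * l2 UNIV (\<lambda>x. f (\<tau> n x y)) + 2 * l2 UNIV f"
      by (intro add_mono mult_left_mono l2_mono) auto
    also have "l2 UNIV (\<lambda>x. f (\<tau> n x y)) \<le> ennreal C * l2 UNIV f"
      using C[of "\<lambda>x. (ennreal (cmod (f x)))\<^sup>2" y n] y unfolding l2_def by simp
    finally show ?thesis by (simp add: mult_left_mono add_right_mono)
  qed
  have "(\<lambda>n. \<integral>\<^sup>+y. G n y \<partial>N) \<longlonglongrightarrow> (\<integral>\<^sup>+y. 0 \<partial>N)"
  proof (rule nn_integral_dominated_convergence[where w = "\<lambda>y. 2 * (ennreal C * l2 UNIV f) + 2 * l2 UNIV f"])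
    show "(\<integral>\<^sup>+y. 2 * (ennreal C * l2 UNIV f) + 2 * l2 UNIV f \<partial>N) < \<infinity>"
      using fin by (simp add: N(2) ennreal_mult_less_top)
    show "AE y in N. (\<lambda>n. G n y) \<longlonglongrightarrow> 0"
      unfolding G_def using f fin sec C unif B by (intro AE_I2 l2_compose_tendsto) auto
  qed (use Gle in auto)
  then have lim: "(\<lambda>n. \<integral>\<^sup>+y. G n y \<partial>N) \<longlonglongrightarrow> 0" by simp
  show ?thesis
    by (rule tendsto_sandwich[OF _ _ tendsto_const lim]) (simp_all add: le)
qed

section \<open>Smooth functions of bounded support\<close>

definition csmooth :: "('a::euclidean_space \<Rightarrow> complex) \<Rightarrow> bool" where
  "csmooth \<phi> \<longleftrightarrow> smooth \<phi> \<and> bounded {x. \<phi> x \<noteq> 0}"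

lemma csmooth_imp_smooth: "csmooth \<phi> \<Longrightarrow> smooth \<phi>"
  by (simp add: csmooth_def)

lemma csmoothI: "smooth \<phi> \<Longrightarrow> bounded A \<Longrightarrow> (\<And>x. \<phi> x \<noteq> 0 \<Longrightarrow> x \<in> A) \<Longrightarrow> csmooth \<phi>"
  unfolding csmooth_def by (auto intro: bounded_subset)

lemma csmooth_radius:
  assumes "csmooth \<phi>"
  obtains R where "R > 0" "\<And>x. norm x \<ge> R \<Longrightarrow> \<phi> x = 0"
proof -
  obtain R where "R > 0" "{x. \<phi> x \<noteq> 0} \<subseteq> ball 0 R"
    using assms bounded_subset_ballD[of "{x. \<phi> x \<noteq> 0}" 0] unfolding csmooth_def by auto
  then show ?thesis by (intro that[of R]) (auto simp: subset_iff)
qed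

lemma frechet_derivative_eqI:
  "(f has_derivative f') (at x) \<Longrightarrow> frechet_derivative f (at x) = f'"
  by (rule frechet_derivative_at[symmetric])

lemma frechet_derivative_zero_on_open:
  assumes "open S" "x \<in> S" "\<And>y. y \<in> S \<Longrightarrow> f y = c"
  shows "frechet_derivative f (at x) v = 0"
proof -
  have "(f has_derivative (\<lambda>v. 0)) (at x)"
    by (rule has_derivative_transform_within_open[OF has_derivative_const assms(1,2)])
      (simp add: assms(3))
  then show ?thesis by (simp add: frechet_derivative_eqI)
qed

lemma csmooth_derivative:
  assumes "csmooth \<phi>" shows "csmooth (\<lambda>x. frechet_derivative \<phi> (at x) v)"
proof (rule csmoothI)
  show "smooth (\<lambda>x. frechet_derivative \<phi> (at x) v)"
    using assms by (simp add: csmooth_def smooth_derivative)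
  show "bounded (closure {x. \<phi> x \<noteq> 0})"
    using assms by (simp add: csmooth_def bounded_closure)
  show "x \<in> closure {x. \<phi> x \<noteq> 0}" if "frechet_derivative \<phi> (at x) v \<noteq> 0" for x
  proof (rule ccontr)
    assume x: "x \<notin> closure {x. \<phi> x \<noteq> 0}"
    have "frechet_derivative \<phi> (at x) v = 0"
      by (rule frechet_derivative_zero_on_open[of "- closure {x. \<phi> x \<noteq> 0}"])
        (use x closure_subset[of "{x. \<phi> x \<noteq> 0}"] in auto)
    with that show False by simp
  qed
qed

lemma csmooth_bounded:
  assumes "csmooth \<phi>"
  obtains B where "B > 0" "\<And>x. cmod (\<phi> x) \<le> B"
proof -
  obtain R where R: "\<And>x. norm x \<ge> R \<Longrightarrow> \<phi> x = 0" using csmooth_radius[OF assms] by metis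
  have "compact (\<phi> ` cball 0 R)"
    by (intro compact_continuous_image smooth_continuous csmooth_imp_smooth assms compact_cball)
  then obtain B where B: "\<forall>y \<in> \<phi> ` cball 0 R. cmod y \<le> B"
    using compact_imp_bounded[of "\<phi> ` cball 0 R"] unfolding bounded_iff by blast
  have "cmod (\<phi> x) \<le> \<bar>B\<bar> + 1" for x
  proof (cases "norm x \<le> R")
    case True
    then have "cmod (\<phi> x) \<le> B" using B by simp
    then show ?thesis by simp
  qed (simp add: R)
  then show ?thesis by (intro that[of "\<bar>B\<bar> + 1"]) auto
qed

lemma csmooth_measurable: "csmooth \<phi> \<Longrightarrow> \<phi> \<in> borel_measurable borel"
  by (simp add: csmooth_def smooth_measurable)

lemma csmooth_l2: assumes "csmooth \<phi>" shows "l2 A \<phi> < top"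
proof -
  obtain B where B: "\<And>x. cmod (\<phi> x) \<le> B" using csmooth_bounded[OF assms] by metis
  obtain R where R: "\<And>x. norm x \<ge> R \<Longrightarrow> \<phi> x = 0" using csmooth_radius[OF assms] by metis
  have "l2 A \<phi> \<le> l2 UNIV \<phi>" by (rule l2_mono) auto
  also have "\<dots> = l2 (cball 0 R) \<phi>"
    by (rule l2_support) (use R in auto)
  also have "\<dots> < top"
    by (rule l2_bounded_finite[OF bounded_cball _ B]) auto
  finally show ?thesis .
qed

lemma csmooth_integrable:
  assumes "csmooth \<phi>" shows "integrable lborel \<phi>"
proof -
  obtain B where B: "\<And>x. cmod (\<phi> x) \<le> B" using csmooth_bounded[OF assms] by metis
  obtain R where R: "\<And>x. norm x \<ge> R \<Longrightarrow> \<phi> x = 0" using csmooth_radius[OF assms] by metis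
  show ?thesis
    by (rule integrableI_bounded_set[of "cball 0 R" _ _ B])
      (use B R csmooth_measurable[OF assms] emeasure_lborel_cball_finite in \<open>auto simp: top.not_eq_extremum\<close>)
qed

lemma csmooth_integrable_mult:
  assumes "csmooth \<phi>" "integrable M u" "s \<in> M \<rightarrow>\<^sub>M borel"
  shows "integrable M (\<lambda>y. u y * \<phi> (s y))"
proof -
  obtain B where B: "\<And>x. cmod (\<phi> x) \<le> B" using csmooth_bounded[OF assms(1)] by metis
  show ?thesis
  proof (rule Bochner_Integration.integrable_bound[of M "\<lambda>y. of_real B * u y"])
    show "(\<lambda>y. u y * \<phi> (s y)) \<in> borel_measurable M"
      using borel_measurable_integrable[OF assms(2)] csmooth_measurable[OF assms(1)] assms(3) by measurable
    show "AE y in M. cmod (u y * \<phi> (s y)) \<le> cmod (of_real B * u y)"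
      using mult_left_mono[OF order_trans[OF B abs_ge_self], of "cmod (u _)" "s _"]
      by (intro AE_I2) (simp add: norm_mult mult.commute)
  qed (use assms(2) in simp)
qed

lemma csmooth_uniformly_continuous:
  assumes "csmooth \<phi>" shows "uniformly_continuous_on UNIV \<phi>"
  unfolding uniformly_continuous_on_def
proof (intro allI impI)
  fix e :: real assume e: "e > 0"
  obtain R where R: "\<And>x. norm x \<ge> R \<Longrightarrow> \<phi> x = 0" using csmooth_radius[OF assms] by metis
  have "uniformly_continuous_on (cball 0 (R + 1)) \<phi>"
    by (intro compact_uniformly_continuous smooth_continuous csmooth_imp_smooth assms compact_cball)
  then obtain d where d: "d > 0" and
    d': "\<And>x y. x \<in> cball 0 (R + 1) \<Longrightarrow> y \<in> cball 0 (R + 1) \<Longrightarrow> dist y x < d \<Longrightarrow> dist (\<phi> y) (\<phi> x) < e"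
    using e unfolding uniformly_continuous_on_def by metis
  show "\<exists>d>0. \<forall>x\<in>UNIV. \<forall>y\<in>UNIV. dist y x < d \<longrightarrow> dist (\<phi> y) (\<phi> x) < e"
  proof (intro exI[of _ "min d 1"] conjI ballI impI)
    fix x y :: 'a assume xy: "dist y x < min d 1"
    have n: "norm x \<le> norm y + 1" "norm y \<le> norm x + 1"
      using xy norm_triangle_ineq2[of x y] norm_triangle_ineq2[of y x] by (auto simp: dist_norm norm_minus_commute)
    show "dist (\<phi> y) (\<phi> x) < e"
    proof (cases "norm x \<le> R + 1 \<and> norm y \<le> R + 1")
      case True
      then show ?thesis using d'[of x y] xy by simp
    next
      case False
      then have "norm x \<ge> R" "norm y \<ge> R" using n by auto
      then show ?thesis using R e by simp
    qed
  qed (use d in simp)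
qed

text \<open>
  The remainder is small uniformly in \<open>x\<close>; this allows differentiation under an integral against a
  function of which nothing is known but its integrability.
\<close>

lemma csmooth_taylor:
  fixes \<phi> :: "'a::euclidean_space \<Rightarrow> complex"
  assumes "csmooth \<phi>" and e: "e > 0"
  obtains d where "d > 0"
    "\<And>x h. norm h < d \<Longrightarrow> cmod (\<phi> (x + h) - \<phi> x - frechet_derivative \<phi> (at x) h) \<le> e * norm h"
proof -
  let ?D = "\<lambda>x. frechet_derivative \<phi> (at x)"
  let ?n = "real DIM('a)"
  have der: "(\<phi> has_derivative ?D x) (at x)" for x
    using assms(1) by (simp add: csmooth_def smooth_has_derivative)
  have lin: "linear (?D x)" for x using der by (rule has_derivative_linear)
  have "\<exists>d>0. \<forall>x y. dist y x < d \<longrightarrow> dist (?D y b) (?D x b) < e / ?n" for b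
    using csmooth_uniformly_continuous[OF csmooth_derivative[OF assms(1)], of b] e
    unfolding uniformly_continuous_on_def by simp
  then obtain d where d: "\<And>b. d b > 0"
    "\<And>b x y. dist y x < d b \<Longrightarrow> dist (?D y b) (?D x b) < e / ?n" by metis
  define m where "m = Min (d ` (Basis :: 'a set))"
  have m: "m > 0" "\<And>b. b \<in> Basis \<Longrightarrow> m \<le> d b"
    using d(1) by (auto simp: m_def)
  have on: "onorm (?D y - ?D x) \<le> e" if "dist y x < m" for x y
  proof (rule onorm_le)
    fix v :: 'a
    have rep: "?D z v = (\<Sum>b\<in>Basis. (v \<bullet> b) *\<^sub>R ?D z b)" for z
      by (subst (1) euclidean_representation[of v, symmetric])
        (simp add: linear_sum[OF lin] linear_cmul[OF lin])
    have "norm ((?D y - ?D x) v) = norm (\<Sum>b\<in>Basis. (v \<bullet> b) *\<^sub>R (?D y b - ?D x b))"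
      by (simp add: rep scaleR_diff_right sum_subtractf)
    also have "\<dots> \<le> (\<Sum>b\<in>(Basis :: 'a set). norm v * (e / ?n))"
    proof (rule sum_norm_le)
      fix b :: 'a assume b: "b \<in> Basis"
      have "norm (?D y b - ?D x b) \<le> e / ?n"
        using d(2)[of y x b] m(2)[OF b] that by (simp add: dist_norm)
      then have "\<bar>v \<bullet> b\<bar> * norm (?D y b - ?D x b) \<le> norm v * (e / ?n)"
        by (intro mult_mono Basis_le_norm[OF b, of v]) auto
      then show "norm ((v \<bullet> b) *\<^sub>R (?D y b - ?D x b)) \<le> norm v * (e / ?n)" by simp
    qed
    also have "\<dots> = e * norm v" by simp
    finally show "norm ((?D y - ?D x) v) \<le> e * norm v" .
  qed
  show ?thesis
  proof (rule that[OF m(1)])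
    fix x h :: 'a assume h: "norm h < m"
    have "norm (\<phi> (x + h) - \<phi> x - ?D x (x + h - x)) \<le> norm (x + h - x) * e"
    proof (rule differentiable_bound_linearization[where S = "ball x m" and f' = ?D])
      show "x + t *\<^sub>R (x + h - x) \<in> ball x m" if "t \<in> {0..1}" for t
        using that h mult_left_le_one_le[of "norm h" t] by (auto simp: dist_norm intro: le_less_trans)
      show "(\<phi> has_derivative ?D y) (at y within ball x m)" for y
        using der by (rule has_derivative_at_withinI)
      show "onorm (?D y - ?D x) \<le> e" if "y \<in> ball x m" for y
        using on[of y x] that by (simp add: dist_commute)
    qed (use m in simp)
    then show "cmod (\<phi> (x + h) - \<phi> x - ?D x h) \<le> e * norm h" by (simp add: mult.commute)
  qed
qed

text \<open>
  Differentiation under the integral sign; convolutions and correlations are the cases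
  \<open>s y = - y\<close> and \<open>s y = y\<close>.
\<close>

lemma integral_translate_has_derivative:
  fixes \<phi> :: "'a::euclidean_space \<Rightarrow> complex"
  assumes u: "integrable M u" and s: "s \<in> M \<rightarrow>\<^sub>M borel" and \<phi>: "csmooth \<phi>"
  shows "((\<lambda>x. LINT y|M. u y * \<phi> (x + s y)) has_derivative
    (\<lambda>v. LINT y|M. u y * frechet_derivative \<phi> (at (x + s y)) v)) (at x)"
proof -
  let ?D = "\<lambda>x. frechet_derivative \<phi> (at x)"
  have der: "(\<phi> has_derivative ?D x) (at x)" for x
    using \<phi> by (simp add: csmooth_def smooth_has_derivative)
  have lin: "linear (?D x)" for x using der by (rule has_derivative_linear)
  have s': "(\<lambda>y. x + s y) \<in> M \<rightarrow>\<^sub>M borel" for x using s by measurable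
  have i1: "integrable M (\<lambda>y. u y * \<phi> (x + s y))" for x
    by (rule csmooth_integrable_mult[OF \<phi> u s'])
  have i2: "integrable M (\<lambda>y. u y * ?D (x + s y) v)" for x v
    by (rule csmooth_integrable_mult[OF csmooth_derivative[OF \<phi>] u s'])
  define U where "U = (LINT y|M. cmod (u y))"
  have U: "U \<ge> 0" by (simp add: U_def)
  show ?thesis
    unfolding has_derivative_at2
  proof
    have "linear (\<lambda>v. LINT y|M. u y * ?D (x + s y) v)"
    proof (rule linearI)
      show "(LINT y|M. u y * ?D (x + s y) (v + w)) =
          (LINT y|M. u y * ?D (x + s y) v) + (LINT y|M. u y * ?D (x + s y) w)" for v w
        using i2 by (simp add: linear_add[OF lin] distrib_left)
      show "(LINT y|M. u y * ?D (x + s y) (c *\<^sub>R v)) = c *\<^sub>R (LINT y|M. u y * ?D (x + s y) v)" for c v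
        by (simp add: linear_cmul[OF lin])
    qed
    then show "bounded_linear (\<lambda>v. LINT y|M. u y * ?D (x + s y) v)"
      by (simp add: linear_conv_bounded_linear)
    show "(\<lambda>y. (1 / norm (y - x)) *\<^sub>R ((LINT z|M. u z * \<phi> (y + s z)) - ((LINT z|M. u z * \<phi> (x + s z)) +
        (LINT z|M. u z * ?D (x + s z) (y - x))))) \<midarrow>x\<rightarrow> 0"
    proof (rule LIM_I)
      fix e :: real assume e: "e > 0"
      define e' where "e' = e / (2 * (U + 1))"
      have e': "e' > 0" "e' * U < e"
      proof -
        show "e' > 0" using e U by (simp add: e'_def)
        have "e' * U \<le> e / 2 * 1" using e U by (simp add: e'_def field_simps)
        then show "e' * U < e" using e by simp
      qed
      obtain d where d: "d > 0"
        "\<And>x h. norm h < d \<Longrightarrow> cmod (\<phi> (x + h) - \<phi> x - ?D x h) \<le> e' * norm h"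
        using csmooth_taylor[OF \<phi> e'(1)] by metis
      show "\<exists>d>0. \<forall>y. y \<noteq> x \<and> norm (y - x) < d \<longrightarrow> norm ((1 / norm (y - x)) *\<^sub>R
          ((LINT z|M. u z * \<phi> (y + s z)) - ((LINT z|M. u z * \<phi> (x + s z)) +
          (LINT z|M. u z * ?D (x + s z) (y - x)))) - 0) < e"
      proof (intro exI[of _ d] conjI allI impI d(1), elim conjE)
        fix y assume y: "y \<noteq> x" "norm (y - x) < d"
        let ?R = "\<lambda>z. \<phi> (y + s z) - \<phi> (x + s z) - ?D (x + s z) (y - x)"
        have R: "cmod (?R z) \<le> e' * norm (y - x)" for z
          using d(2)[OF y(2), of "x + s z"] by (simp add: algebra_simps)
        have eq: "(LINT z|M. u z * \<phi> (y + s z)) - ((LINT z|M. u z * \<phi> (x + s z)) +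
            (LINT z|M. u z * ?D (x + s z) (y - x))) = (LINT z|M. u z * ?R z)"
          using i1 i2 by (simp add: right_diff_distrib)
        have int: "integrable M (\<lambda>z. u z * ?R z)"
          using i1 i2 by (simp add: right_diff_distrib)
        have "cmod (LINT z|M. u z * ?R z) \<le> (LINT z|M. cmod (u z * ?R z))"
          by (rule integral_norm_bound)
        also have "\<dots> \<le> (LINT z|M. (e' * norm (y - x)) * cmod (u z))"
        proof (rule integral_mono)
          show "cmod (u z * ?R z) \<le> e' * norm (y - x) * cmod (u z)" for z
            using mult_right_mono[OF R[of z], of "cmod (u z)"] by (simp add: norm_mult mult.commute)
        qed (use u int in auto)
        also have "\<dots> = (e' * U) * norm (y - x)" by (simp add: U_def)
        also have "\<dots> < e * norm (y - x)" using e' y by (intro mult_strict_right_mono) auto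
        finally show "norm ((1 / norm (y - x)) *\<^sub>R
          ((LINT z|M. u z * \<phi> (y + s z)) - ((LINT z|M. u z * \<phi> (x + s z)) +
          (LINT z|M. u z * ?D (x + s z) (y - x)))) - 0) < e"
          unfolding eq using y by (simp add: field_simps)
      qed
    qed
  qed
qed

lemma smooth_integral_translate:
  fixes \<phi> :: "'a::euclidean_space \<Rightarrow> complex"
  assumes u: "integrable M u" and s: "s \<in> M \<rightarrow>\<^sub>M borel" and "csmooth \<phi>"
  shows "smooth (\<lambda>x. LINT y|M. u y * \<phi> (x + s y))"
proof -
  have "C_k k (\<lambda>x. LINT y|M. u y * \<phi> (x + s y))" if "csmooth \<phi>" for k \<phi>
    using that
  proof (induction k arbitrary: \<phi>)
    case 0
    have "isCont (\<lambda>x. LINT y|M. u y * \<phi> (x + s y)) x" for x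
      using integral_translate_has_derivative[OF u s 0] by (rule has_derivative_continuous)
    then show ?case by (simp add: continuous_at_imp_continuous_on)
  next
    case (Suc k)
    show ?case
      by (rule C_k_SucI[OF integral_translate_has_derivative[OF u s Suc.prems]])
        (rule Suc.IH[OF csmooth_derivative[OF Suc.prems]])
  qed
  with assms show ?thesis by (simp add: smooth_def)
qed

section \<open>The antiholomorphic derivative and integration by parts\<close>

text \<open>
  With \<open>e\<close> and \<open>e'\<close> the real and the imaginary unit vector of a complex coordinate, this is the
  antiholomorphic derivative in that coordinate.
\<close>

definition dbar_dir :: "'a \<Rightarrow> 'a \<Rightarrow> ('a::euclidean_space \<Rightarrow> complex) \<Rightarrow> 'a \<Rightarrow> complex" where
  "dbar_dir e e' h x =
     (frechet_derivative h (at x) e + \<i> * frechet_derivative h (at x) e') / 2"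

lemma dzbar_eq_dbar_dir: "dzbar k = dbar_dir (axis k 1) (axis k \<i>)"
  by (auto simp: fun_eq_iff dzbar_def dbar_dir_def)

lemma dbar_dir_eqI:
  "(f has_derivative f') (at x) \<Longrightarrow> dbar_dir e e' f x = (f' e + \<i> * f' e') / 2"
  by (simp add: dbar_dir_def frechet_derivative_eqI)

lemma smooth_dbar_dir [smooth_intros]: "smooth f \<Longrightarrow> smooth (dbar_dir e e' f)"
  unfolding dbar_dir_def[abs_def] divide_inverse by (intro smooth_intros)

lemma csmooth_dbar_dir: assumes "csmooth f" shows "csmooth (dbar_dir e e' f)"
proof (rule csmoothI)
  show "smooth (dbar_dir e e' f)"
    using assms by (simp add: csmooth_def smooth_dbar_dir)
  let ?S = "\<lambda>v. {x. frechet_derivative f (at x) v \<noteq> 0}"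
  show "bounded (?S e \<union> ?S e')"
    using csmooth_derivative[OF assms] by (simp add: csmooth_def)
qed (auto simp: dbar_dir_def)

lemma dbar_dir_mult:
  assumes "smooth f" "smooth g"
  shows "dbar_dir e e' (\<lambda>x. f x * g x) x = dbar_dir e e' f x * g x + f x * dbar_dir e e' g x"
  unfolding dbar_dir_eqI[OF has_derivative_mult[OF smooth_has_derivative[OF assms(1)] smooth_has_derivative[OF assms(2)]]]
  by (simp add: dbar_dir_def field_simps)

lemma csmooth_mult: "smooth f \<Longrightarrow> csmooth \<phi> \<Longrightarrow> csmooth (\<lambda>x. f x * \<phi> x)"
  by (rule csmoothI[of _ "{x. \<phi> x \<noteq> 0}"]) (auto simp: csmooth_def intro: smooth_intros)

lemma integral_derivative_eq_0:
  fixes \<phi> :: "'a::euclidean_space \<Rightarrow> complex"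
  assumes \<phi>: "csmooth \<phi>"
  shows "(LINT x|lborel. frechet_derivative \<phi> (at x) v) = 0"
proof -
  obtain R where R: "R > 0" "\<And>x. norm x \<ge> R \<Longrightarrow> \<phi> x = 0" using csmooth_radius[OF \<phi>] by metis
  obtain R' where R': "\<And>x. norm x \<ge> R' \<Longrightarrow> frechet_derivative \<phi> (at x) v = 0"
    using csmooth_radius[OF csmooth_derivative[OF \<phi>]] by metis
  define B where "B = cball (0 :: 'a) (max (R + 1) R')"
  define u :: "'a \<Rightarrow> complex" where "u = indicator B"
  have "emeasure lborel B < top" 
    by (simp add: B_def emeasure_lborel_cball_finite[unfolded infinity_ennreal_def])
  then have u: "integrable lborel u"
    unfolding u_def by (intro integrable_real_indicator[THEN integrable_of_real, unfolded of_real_indicator])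
      (auto simp: B_def)
  let ?h = "\<lambda>x. LINT y|lborel. u y * \<phi> (x + y)"
  have der: "(?h has_derivative (\<lambda>v. LINT y|lborel. u y * frechet_derivative \<phi> (at (0 + y)) v)) (at 0)"
    by (rule integral_translate_has_derivative[OF u _ \<phi>]) simp
  have "?h x = (LINT y|lborel. \<phi> y)" if "x \<in> ball 0 1" for x
  proof -
    have "u y * \<phi> (x + y) = \<phi> (x + y)" for y
    proof (cases "y \<in> B")
      case False
      then have "norm (x + y) \<ge> R"
        using that norm_triangle_ineq4[of "x + y" x] by (auto simp: B_def)
      then show ?thesis using R by simp
    qed (simp add: u_def)
    then have "?h x = (LINT y|lborel. \<phi> (x + y))" by presburger
    also have "\<dots> = (LINT y|distr lborel borel ((+) x). \<phi> y)"
      using csmooth_measurable[OF \<phi>] by (simp add: integral_distr)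
    finally show ?thesis by (simp add: lborel_distr_plus)
  qed
  then have "frechet_derivative ?h (at 0) v = 0"
    by (intro frechet_derivative_zero_on_open[of "ball 0 1"]) auto
  then have "(LINT y|lborel. u y * frechet_derivative \<phi> (at (0 + y)) v) = 0"
    using frechet_derivative_eqI[OF der] by simp
  moreover have "u y * frechet_derivative \<phi> (at (0 + y)) v = frechet_derivative \<phi> (at y) v" for y
    using R'[of y] by (cases "y \<in> B") (auto simp: u_def B_def)
  ultimately show ?thesis by (simp only:)
qed

lemma integral_by_parts:
  assumes f: "smooth f" and \<phi>: "csmooth \<phi>"
  shows "(LINT x|lborel. f x * frechet_derivative \<phi> (at x) v) =
    - (LINT x|lborel. frechet_derivative f (at x) v * \<phi> x)"
proof -
  have eq: "frechet_derivative (\<lambda>x. f x * \<phi> x) (at x) v =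
      f x * frechet_derivative \<phi> (at x) v + frechet_derivative f (at x) v * \<phi> x" for x
    using frechet_derivative_eqI[OF has_derivative_mult[OF smooth_has_derivative[OF f]
      smooth_has_derivative[OF csmooth_imp_smooth[OF \<phi>]]]] by simp
  have i: "integrable lborel (\<lambda>x. f x * frechet_derivative \<phi> (at x) v)"
    "integrable lborel (\<lambda>x. frechet_derivative f (at x) v * \<phi> x)"
    by (intro csmooth_integrable csmooth_mult f \<phi> csmooth_derivative smooth_derivative)+
  have "(LINT x|lborel. frechet_derivative (\<lambda>x. f x * \<phi> x) (at x) v) = 0"
    by (intro integral_derivative_eq_0 csmooth_mult f \<phi>)
  then show ?thesis unfolding eq using i by (simp add: eq_neg_iff_add_eq_0)
qed

lemma integral_by_parts_dbar:
  assumes f: "smooth f" and \<phi>: "csmooth \<phi>"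
  shows "(LINT x|lborel. f x * dbar_dir e e' \<phi> x) = - (LINT x|lborel. dbar_dir e e' f x * \<phi> x)"
proof -
  have i: "integrable lborel (\<lambda>x. f x * frechet_derivative \<phi> (at x) v)"
    "integrable lborel (\<lambda>x. frechet_derivative f (at x) v * \<phi> x)" for v
    by (intro csmooth_integrable csmooth_mult f \<phi> csmooth_derivative smooth_derivative)+
  have l: "f x * dbar_dir e e' \<phi> x = (1 / 2) * (f x * frechet_derivative \<phi> (at x) e) +
      (\<i> / 2) * (f x * frechet_derivative \<phi> (at x) e')" for x
    by (simp add: dbar_dir_def field_simps)
  have r: "dbar_dir e e' f x * \<phi> x = (1 / 2) * (frechet_derivative f (at x) e * \<phi> x) +
      (\<i> / 2) * (frechet_derivative f (at x) e' * \<phi> x)" for x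
    by (simp add: dbar_dir_def field_simps)
  have L: "(LINT x|lborel. f x * dbar_dir e e' \<phi> x) =
      (1 / 2) * (LINT x|lborel. f x * frechet_derivative \<phi> (at x) e) +
      (\<i> / 2) * (LINT x|lborel. f x * frechet_derivative \<phi> (at x) e')"
    unfolding l by (subst Bochner_Integration.integral_add) (use i in \<open>simp_all only: integral_mult_right_zero integrable_mult_right\<close>)
  have R: "(LINT x|lborel. dbar_dir e e' f x * \<phi> x) =
      (1 / 2) * (LINT x|lborel. frechet_derivative f (at x) e * \<phi> x) +
      (\<i> / 2) * (LINT x|lborel. frechet_derivative f (at x) e' * \<phi> x)"
    unfolding r by (subst Bochner_Integration.integral_add) (use i in \<open>simp_all only: integral_mult_right_zero integrable_mult_right\<close>)
  show ?thesis unfolding L R integral_by_parts[OF f \<phi>] by simp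
qed

text \<open>
  Both sides are obtained from the integrals of \<open>D\<^sub>a \<phi> (y) \<psi> (x + y) = - \<phi> (y) D\<^sub>a \<psi> (x + y)\<close> by
  differentiation in \<open>x\<close>; no second derivatives have to be interchanged.
\<close>

lemma integral_derivatives_swap:
  fixes \<phi> \<psi> :: "'a::euclidean_space \<Rightarrow> complex"
  assumes \<phi>: "csmooth \<phi>" and \<psi>: "csmooth \<psi>"
  shows "(LINT x|lborel. frechet_derivative \<phi> (at x) a * frechet_derivative \<psi> (at x) b) =
    (LINT x|lborel. frechet_derivative \<phi> (at x) b * frechet_derivative \<psi> (at x) a)"
proof -
  have trans: "frechet_derivative (\<lambda>y. \<psi> (x + y)) (at y) = frechet_derivative \<psi> (at (x + y))"
    and sm: "smooth (\<lambda>y. \<psi> (x + y))" for x y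
  proof -
    have "((\<lambda>y. x + y) has_derivative (\<lambda>v. v)) (at y)" by (auto intro!: derivative_eq_intros)
    from diff_chain_at[OF this smooth_has_derivative[OF csmooth_imp_smooth[OF \<psi>]]]
    show "frechet_derivative (\<lambda>y. \<psi> (x + y)) (at y) = frechet_derivative \<psi> (at (x + y))"
      by (intro frechet_derivative_eqI) (simp add: o_def)
    show "smooth (\<lambda>y. \<psi> (x + y))"
      by (rule smooth_compose[OF csmooth_imp_smooth[OF \<psi>]]) (intro smooth_intros)
  qed
  have "(LINT y|lborel. frechet_derivative \<phi> (at y) a * \<psi> (x + y)) =
      - (LINT y|lborel. \<phi> y * frechet_derivative \<psi> (at (x + y)) a)" for x
    using integral_by_parts[OF sm \<phi>, of x a] by (simp add: trans mult.commute)
  then have fun_eq: "(\<lambda>x. LINT y|lborel. frechet_derivative \<phi> (at y) a * \<psi> (x + y)) =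
      (\<lambda>x. - (LINT y|lborel. \<phi> y * frechet_derivative \<psi> (at (x + y)) a))" by blast
  have 1: "frechet_derivative (\<lambda>x. LINT y|lborel. frechet_derivative \<phi> (at y) a * \<psi> (x + y)) (at 0) b =
      (LINT y|lborel. frechet_derivative \<phi> (at y) a * frechet_derivative \<psi> (at y) b)"
    using frechet_derivative_eqI[OF integral_translate_has_derivative[of lborel "\<lambda>y. frechet_derivative \<phi> (at y) a" "\<lambda>y. y" \<psi> 0]]
      csmooth_integrable[OF csmooth_derivative[OF \<phi>]] \<psi> by simp
  have 2: "frechet_derivative (\<lambda>x. - (LINT y|lborel. \<phi> y * frechet_derivative \<psi> (at (x + y)) a)) (at 0) b =
      - (LINT y|lborel. \<phi> y * frechet_derivative (\<lambda>y. frechet_derivative \<psi> (at y) a) (at y) b)"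
    using frechet_derivative_eqI[OF has_derivative_minus[OF integral_translate_has_derivative[of lborel \<phi> "\<lambda>y. y" "\<lambda>y. frechet_derivative \<psi> (at y) a" 0]]]
      csmooth_integrable[OF \<phi>] csmooth_derivative[OF \<psi>] by simp
  have "(LINT x|lborel. frechet_derivative \<phi> (at x) b * frechet_derivative \<psi> (at x) a) =
      - (LINT y|lborel. \<phi> y * frechet_derivative (\<lambda>y. frechet_derivative \<psi> (at y) a) (at y) b)"
    using integral_by_parts[OF csmooth_imp_smooth[OF \<phi>] csmooth_derivative[OF \<psi>], of a b] by simp
  then show ?thesis using 1 2 fun_eq by simp
qed

section \<open>Mollifiers\<close>

definition bump :: "'a::euclidean_space \<Rightarrow> real" where
  "bump x = flat_exp 0 (1 - x \<bullet> x)"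

definition mollifier :: "'a::euclidean_space \<Rightarrow> real" where
  "mollifier x = bump x / (LINT y|lborel. bump (y :: 'a))"

lemma smooth_bump: "smooth bump"
  unfolding bump_def[abs_def]
  by (rule smooth_compose[OF smooth_flat_exp]) (intro smooth_intros)

lemma bump_bounds: "bump x \<ge> 0" "bump x \<le> 1"
  by (auto simp: bump_def flat_exp_def)

lemma bump_support: "norm x \<ge> 1 \<Longrightarrow> bump x = 0"
  using power_mono[of 1 "norm x" 2] by (simp add: bump_def flat_exp_def power2_norm_eq_inner)

lemma csmooth_bump: "csmooth (\<lambda>x. of_real (bump x))"
  by (rule csmoothI[of _ "ball 0 1"]) (use bump_support in \<open>force intro: smooth_intros smooth_bump\<close>)+

lemma integrable_bump: "integrable lborel bump"
  using csmooth_integrable[OF csmooth_bump] by (simp add: complex_of_real_integrable_eq)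

lemma integral_bump_pos: "(LINT y|lborel. bump (y :: 'a::euclidean_space)) > 0"
proof -
  define c where "c = exp (- (4 / 3 :: real))"
  have le: "bump y \<ge> c * indicator (ball 0 (1/2)) y" for y :: 'a
  proof (cases "y \<in> ball 0 (1/2)")
    case True
    then have "y \<bullet> y \<le> 1 / 4"
      using power_mono[of "norm y" "1/2" 2] by (simp add: power2_norm_eq_inner power_divide)
    then have "inverse (1 - y \<bullet> y) \<le> inverse (3 / 4)" "1 - y \<bullet> y > 0"
      using le_imp_inverse_le[of "3 / 4" "1 - y \<bullet> y"] by auto
    then show ?thesis using True by (simp add: bump_def flat_exp_def c_def)
  qed (simp add: bump_bounds)
  have "0 < c * measure lborel (ball (0 :: 'a) (1/2))"
    using content_ball_pos[of "1/2" "0 :: 'a"] by (simp add: c_def)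
  also have "\<dots> = (LINT y|lborel. c * indicator (ball (0 :: 'a) (1/2)) y)"
    by simp
  also have "\<dots> \<le> (LINT y|lborel. bump (y :: 'a))"
    by (rule integral_mono)
      (use le integrable_bump emeasure_lborel_ball_finite[of "0 :: 'a" "1/2"] in \<open>auto intro!: integrable_real_indicator\<close>)
  finally show ?thesis .
qed

lemma mollifier_nonneg: "mollifier x \<ge> 0"
  using integral_bump_pos by (simp add: mollifier_def bump_bounds less_imp_le)

lemma csmooth_mollifier: "csmooth (\<lambda>x. of_real (mollifier ((1 / \<delta>) *\<^sub>R x)))"
  if "\<delta> > 0"
proof (rule csmoothI[of _ "ball 0 \<delta>"])
  have "smooth (\<lambda>x. bump ((1 / \<delta>) *\<^sub>R x))"
    by (rule smooth_compose[OF smooth_bump]) (intro smooth_intros)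
  then show "smooth (\<lambda>x. complex_of_real (mollifier ((1 / \<delta>) *\<^sub>R x)))"
    unfolding mollifier_def divide_inverse[of "bump _"] by (intro smooth_of_real smooth_mult smooth_const)
  show "x \<in> ball 0 \<delta>" if "of_real (mollifier ((1 / \<delta>) *\<^sub>R x)) \<noteq> (0 :: complex)" for x :: 'a
    using that bump_support[of "(1 / \<delta>) *\<^sub>R x"] \<open>\<delta> > 0\<close> by (force simp: mollifier_def field_simps)
qed simp

definition mollifier_measure :: "'a::euclidean_space measure" where
  "mollifier_measure = density lborel (\<lambda>x. ennreal (mollifier x))"

lemma mollifier_measurable [measurable]: "mollifier \<in> borel_measurable borel"
  using smooth_measurable[OF smooth_bump] unfolding mollifier_def[abs_def] by measurable

lemma space_mollifier_measure [simp]: "space mollifier_measure = UNIV"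
  and sets_mollifier_measure [measurable_cong]: "sets mollifier_measure = sets borel"
  by (simp_all add: mollifier_measure_def)

lemma emeasure_mollifier_measure:
  "emeasure (mollifier_measure :: 'a::euclidean_space measure) UNIV = 1"
proof -
  let ?c = "LINT y|lborel. bump (y :: 'a)"
  have "emeasure (mollifier_measure :: 'a measure) UNIV = (\<integral>\<^sup>+x. ennreal (mollifier (x :: 'a)) \<partial>lborel)"
    unfolding mollifier_measure_def by (subst emeasure_density) auto
  also have "\<dots> = ennreal (LINT x|lborel. mollifier (x :: 'a))"
    by (rule nn_integral_eq_integral)
      (use integrable_bump mollifier_nonneg in \<open>auto simp: mollifier_def[abs_def]\<close>)
  also have "(LINT x|lborel. mollifier (x :: 'a)) = 1"
    unfolding mollifier_def using integral_bump_pos[where 'a = 'a] by simp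
  finally show ?thesis by simp
qed

lemma finite_mollifier_measure: "finite_measure mollifier_measure"
  by (rule finite_measureI) (simp add: emeasure_mollifier_measure)

text \<open>
  Mollification as an average of translates, to which the convergence of averages applies, and the
  kernel that represents it as a convolution, from which its smoothness follows.
\<close>

definition mollify :: "real \<Rightarrow> ('a::euclidean_space \<Rightarrow> complex) \<Rightarrow> 'a \<Rightarrow> complex" where
  "mollify \<delta> f x = (LINT y|mollifier_measure. f (x - \<delta> *\<^sub>R y))"

definition mollifier_at :: "real \<Rightarrow> 'a::euclidean_space \<Rightarrow> complex" where
  "mollifier_at \<delta> x = of_real (mollifier ((1 / \<delta>) *\<^sub>R x) / \<delta> ^ DIM('a))"

lemma csmooth_mollifier_at: "\<delta> > 0 \<Longrightarrow> csmooth (mollifier_at \<delta>)"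
  using csmooth_mult[OF smooth_const csmooth_mollifier, of \<delta> "of_real (1 / \<delta> ^ DIM('a))"]
  by (simp add: mollifier_at_def[abs_def])

lemma mollifier_at_support: "\<delta> > 0 \<Longrightarrow> norm x \<ge> \<delta> \<Longrightarrow> mollifier_at \<delta> x = 0"
  using bump_support[of "(1 / \<delta>) *\<^sub>R x"] by (simp add: mollifier_at_def mollifier_def)

lemma mollify_eq_convolution:
  fixes f :: "'a::euclidean_space \<Rightarrow> complex"
  assumes [measurable]: "f \<in> borel_measurable borel" and \<delta>: "\<delta> > 0"
  shows "mollify \<delta> f x = (LINT y|lborel. f y * mollifier_at \<delta> (x - y))"
proof -
  note [measurable] = csmooth_measurable[OF csmooth_mollifier_at[OF \<delta>]]
  have "(LINT y|lborel. f y * mollifier_at \<delta> (x - y)) =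
      (LINT y|density (distr lborel borel (\<lambda>y. x + (- \<delta>) *\<^sub>R y)) (\<lambda>_. ennreal (\<bar>- \<delta>\<bar> ^ DIM('a))).
        f y * mollifier_at \<delta> (x - y))"
    using lborel_affine[of "- \<delta>" x] \<delta> by (intro arg_cong2[where f = "integral\<^sup>L"]) auto
  also have "\<dots> = (LINT y|distr lborel borel (\<lambda>y. x + (- \<delta>) *\<^sub>R y).
      (\<delta> ^ DIM('a)) *\<^sub>R (f y * mollifier_at \<delta> (x - y)))"
    using \<delta> csmooth_measurable[OF csmooth_mollifier_at[OF \<delta>]] by (subst integral_density) auto
  also have "\<dots> = (LINT y|lborel. (\<delta> ^ DIM('a)) *\<^sub>R (f (x + (- \<delta>) *\<^sub>R y) * mollifier_at \<delta> (x - (x + (- \<delta>) *\<^sub>R y))))"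
    using csmooth_measurable[OF csmooth_mollifier_at[OF \<delta>]] by (subst integral_distr) auto
  also have "\<dots> = (LINT y|lborel. mollifier y *\<^sub>R f (x - \<delta> *\<^sub>R y))"
    using \<delta> by (intro Bochner_Integration.integral_cong) (auto simp: mollifier_at_def scaleR_conv_of_real)
  also have "\<dots> = mollify \<delta> f x"
    unfolding mollify_def mollifier_measure_def using mollifier_nonneg
    by (subst integral_density) auto
  finally show ?thesis by simp
qed

lemma smooth_mollify:
  fixes f :: "'a::euclidean_space \<Rightarrow> complex"
  assumes f: "integrable lborel f" and \<delta>: "\<delta> > 0"
  shows "smooth (mollify \<delta> f)"
    and "dbar_dir e e' (mollify \<delta> f) x = (LINT y|lborel. f y * dbar_dir e e' (mollifier_at \<delta>) (x - y))"
proof -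
  have m: "f \<in> borel_measurable borel" using borel_measurable_integrable[OF f] by simp
  have eq: "mollify \<delta> f = (\<lambda>x. LINT y|lborel. f y * mollifier_at \<delta> (x + - y))"
    using mollify_eq_convolution[OF m \<delta>] by auto
  show "smooth (mollify \<delta> f)"
    unfolding eq by (rule smooth_integral_translate[OF f _ csmooth_mollifier_at[OF \<delta>]]) simp
  have i: "integrable lborel (\<lambda>y. f y * frechet_derivative (mollifier_at \<delta>) (at (x + - y)) v)" for v
    by (rule csmooth_integrable_mult[OF csmooth_derivative[OF csmooth_mollifier_at[OF \<delta>]] f]) simp
  have der: "(mollify \<delta> f has_derivative
      (\<lambda>v. LINT y|lborel. f y * frechet_derivative (mollifier_at \<delta>) (at (x + - y)) v)) (at x)"
    unfolding eq by (rule integral_translate_has_derivative[OF f _ csmooth_mollifier_at[OF \<delta>]]) simp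
  have r: "f y * dbar_dir e e' (mollifier_at \<delta>) (x - y) =
      (1 / 2) * (f y * frechet_derivative (mollifier_at \<delta>) (at (x + - y)) e) +
      (\<i> / 2) * (f y * frechet_derivative (mollifier_at \<delta>) (at (x + - y)) e')" for y
    by (simp add: dbar_dir_def field_simps)
  show "dbar_dir e e' (mollify \<delta> f) x = (LINT y|lborel. f y * dbar_dir e e' (mollifier_at \<delta>) (x - y))"
    unfolding r
    by (subst Bochner_Integration.integral_add)
      (use i in \<open>simp_all only: integral_mult_right_zero integrable_mult_right dbar_dir_eqI[OF der], simp_all add: field_simps\<close>)
qed

section \<open>Divergence equations in the sense of distributions\<close>

text \<open>
  Each component of the equation \<open>dbar f = g\<close> says that \<open>g\<close> is a sum of antiholomorphic derivatives
  of signed components of \<open>f\<close>, that is, the divergence of a field of square integrable functions.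
\<close>

definition weak_div :: "(complex ^ 2) set \<Rightarrow> (2 \<Rightarrow> complex ^ 2 \<Rightarrow> complex) \<Rightarrow> (complex ^ 2 \<Rightarrow> complex) \<Rightarrow> bool" where
  "weak_div \<Omega> f g \<longleftrightarrow> (\<forall>\<phi>. test_fun \<Omega> \<phi> \<longrightarrow>
     (LINT x|lborel. g x * \<phi> x) = (\<Sum>k\<in>UNIV. - (LINT x|lborel. f k x * dzbar k \<phi> x)))"

definition L2on :: "'a::euclidean_space set \<Rightarrow> ('a \<Rightarrow> complex) \<Rightarrow> bool" where
  "L2on \<Omega> f \<longleftrightarrow> f \<in> borel_measurable borel \<and> l2 UNIV f < top \<and> (\<forall>x. x \<notin> \<Omega> \<longrightarrow> f x = 0)"

lemma UNIV_2': "UNIV = {0, 1 :: 2}"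
  using card_subset_eq[of UNIV "{0, 1 :: 2}"] by simp

lemma sum_2': "(\<Sum>k\<in>UNIV. u k) = u (0 :: 2) + u 1"
  by (simp add: UNIV_2')

lemma L2on_measurable: "L2on \<Omega> f \<Longrightarrow> f \<in> borel_measurable borel"
  by (simp add: L2on_def)

lemma L2on_zero [simp]: "L2on \<Omega> (\<lambda>x. 0)"
  by (simp add: L2on_def)

lemma L2on_add: assumes "L2on \<Omega> f" "L2on \<Omega> g" shows "L2on \<Omega> (\<lambda>x. f x + g x)"
proof -
  have "l2 UNIV (\<lambda>x. f x + g x) \<le> 2 * l2 UNIV f + 2 * l2 UNIV g"
    using assms by (intro l2_add) (auto simp: L2on_def)
  also have "\<dots> < top" using assms by (simp add: L2on_def ennreal_mult_less_top)
  finally show ?thesis using assms by (auto simp: L2on_def)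
qed

lemma L2on_mult_bounded:
  assumes f: "L2on \<Omega> f" and [measurable]: "m \<in> borel_measurable borel"
    and B: "\<And>x. x \<in> \<Omega> \<Longrightarrow> cmod (m x) \<le> B"
  shows "L2on \<Omega> (\<lambda>x. m x * f x)"
proof -
  have [measurable]: "f \<in> borel_measurable borel" using f by (simp add: L2on_def)
  have "l2 UNIV (\<lambda>x. m x * f x) \<le> ennreal (\<bar>B\<bar>\<^sup>2) * l2 UNIV f"
  proof (rule l2_cmult_le)
    fix x
    show "cmod (m x * f x) \<le> \<bar>B\<bar> * cmod (f x)"
    proof (cases "x \<in> \<Omega>")
      case True
      then have "cmod (m x) \<le> \<bar>B\<bar>" using B[of x] by simp
      then show ?thesis by (simp add: norm_mult mult_right_mono)
    next
      case False
      then show ?thesis using f by (simp add: L2on_def)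
    qed
  qed auto
  also have "\<dots> < top" using f by (simp add: L2on_def ennreal_mult_less_top)
  finally show ?thesis using f by (auto simp: L2on_def)
qed

lemma L2on_cmult: "L2on \<Omega> f \<Longrightarrow> L2on \<Omega> (\<lambda>x. c * f x)"
  by (rule L2on_mult_bounded[of _ _ "\<lambda>_. c" "cmod c"]) auto

lemma L2on_minus: "L2on \<Omega> f \<Longrightarrow> L2on \<Omega> (\<lambda>x. - f x)"
  using L2on_cmult[of \<Omega> f "- 1"] by simp

lemma L2on_diff: "L2on \<Omega> f \<Longrightarrow> L2on \<Omega> g \<Longrightarrow> L2on \<Omega> (\<lambda>x. f x - g x)"
  using L2on_add[of \<Omega> f "\<lambda>x. - g x"] L2on_minus[of \<Omega> g] by simp

lemma L2on_integrable_csmooth: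
  "L2on \<Omega> f \<Longrightarrow> csmooth \<phi> \<Longrightarrow> integrable lborel (\<lambda>x. f x * \<phi> x)"
  by (rule l2_pairing(1)[of f \<phi> UNIV]) (auto simp: L2on_def csmooth_measurable csmooth_l2)

lemma L2on_integrable:
  fixes f :: "'a::euclidean_space \<Rightarrow> complex"
  assumes f: "L2on \<Omega> f" and B: "bounded \<Omega>"
  shows "integrable lborel f"
proof -
  obtain R where "\<Omega> \<subseteq> ball 0 R" using bounded_subset_ballD[OF B, of 0] by blast
  then have R: "\<Omega> \<subseteq> cball 0 R" using ball_subset_cball by blast
  have "integrable lborel (\<lambda>x. f x * indicator (cball 0 R) x)"
  proof (rule l2_pairing(1)[of f _ "cball 0 R"])
    show "l2 (cball 0 R) f < top"
      using f l2_mono[of "cball 0 R" UNIV f f] by (auto simp: L2on_def intro: le_less_trans)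
    show "l2 (cball (0 :: 'a) R) (indicator (cball 0 R)) < top"
      by (rule l2_bounded_finite[OF bounded_cball, where B = 1]) (auto simp: indicator_def)
  qed (use f in \<open>auto simp: L2on_def intro!: borel_measurable_indicator\<close>)
  moreover have "f x * indicator (cball 0 R) x = f x" for x
    using f R by (auto simp: L2on_def indicator_def)
  ultimately show ?thesis by simp
qed

lemma test_fun_csmooth: "test_fun \<Omega> \<phi> \<Longrightarrow> csmooth \<phi>"
  unfolding test_fun_def csmooth_def
  by (meson bounded_subset closure_subset compact_imp_bounded)

lemma test_funI:
  assumes "smooth \<phi>" "compact K" "K \<subseteq> \<Omega>" "\<And>x. \<phi> x \<noteq> 0 \<Longrightarrow> x \<in> K"
  shows "test_fun \<Omega> \<phi>"
proof -
  have "closure {x. \<phi> x \<noteq> 0} \<subseteq> K"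
    using assms by (intro closure_minimal) (auto intro: compact_imp_closed)
  then show ?thesis
    using assms compact_closure[of "{x. \<phi> x \<noteq> 0}"] bounded_subset[OF compact_imp_bounded[OF assms(2)], of "{x. \<phi> x \<noteq> 0}"]
    by (auto simp: test_fun_def)
qed

lemma test_fun_zero: "test_fun \<Omega> \<phi> \<Longrightarrow> x \<notin> \<Omega> \<Longrightarrow> \<phi> x = 0"
  using closure_subset[of "{x. \<phi> x \<noteq> 0}"] by (auto simp: test_fun_def)

lemma test_fun_mult: 
  assumes \<eta>: "smooth \<eta>" and \<phi>: "test_fun \<Omega> \<phi>"
  shows "test_fun \<Omega> (\<lambda>x. \<eta> x * \<phi> x)"
proof (rule test_funI[of _ "closure {x. \<phi> x \<noteq> 0}"])
  show "smooth (\<lambda>x. \<eta> x * \<phi> x)"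
    using \<eta> \<phi> by (intro smooth_intros) (auto simp: test_fun_def)
  show "x \<in> closure {x. \<phi> x \<noteq> 0}" if "\<eta> x * \<phi> x \<noteq> 0" for x
    using that closure_subset[of "{x. \<phi> x \<noteq> 0}"] by auto
qed (use \<phi> in \<open>auto simp: test_fun_def\<close>)

lemma test_fun_derivative_zero:
  assumes \<phi>: "test_fun \<Omega> \<phi>" and x: "x \<notin> \<Omega>"
  shows "frechet_derivative \<phi> (at x) v = 0"
proof (rule frechet_derivative_zero_on_open[of "- closure {x. \<phi> x \<noteq> 0}"])
  show "x \<in> - closure {x. \<phi> x \<noteq> 0}" using assms by (auto simp: test_fun_def)
  show "\<phi> y = 0" if "y \<in> - closure {x. \<phi> x \<noteq> 0}" for y
    using that closure_subset[of "{x. \<phi> x \<noteq> 0}"] by auto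
qed auto

lemma dzbar_mult:
  "smooth f \<Longrightarrow> smooth g \<Longrightarrow> dzbar k (\<lambda>x. f x * g x) x = dzbar k f x * g x + f x * dzbar k g x"
  unfolding dzbar_eq_dbar_dir by (rule dbar_dir_mult)

lemma smooth_dzbar [smooth_intros]: "smooth f \<Longrightarrow> smooth (dzbar k f)"
  unfolding dzbar_eq_dbar_dir by (rule smooth_dbar_dir)

lemma csmooth_dzbar: "csmooth f \<Longrightarrow> csmooth (dzbar k f)"
  unfolding dzbar_eq_dbar_dir by (rule csmooth_dbar_dir)

lemma dzbar_zero [simp]: "dzbar k (\<lambda>x. 0) x = 0"
  by (simp add: dzbar_def frechet_derivative_const)

lemma weak_div_mult:
  assumes \<eta>: "smooth \<eta>" and f: "\<And>k. L2on \<Omega> (f k)" and g: "L2on \<Omega> g" and w: "weak_div \<Omega> f g"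
  shows "weak_div \<Omega> (\<lambda>k x. \<eta> x * f k x) (\<lambda>x. \<eta> x * g x + (\<Sum>k\<in>UNIV. dzbar k \<eta> x * f k x))"
  unfolding weak_div_def
proof (intro allI impI)
  fix \<phi> assume \<phi>: "test_fun \<Omega> \<phi>"
  note cs = test_fun_csmooth[OF \<phi>]
  note sm = csmooth_imp_smooth[OF cs]
  have i: "integrable lborel (\<lambda>x. f k x * (dzbar k \<eta> x * \<phi> x))"
    "integrable lborel (\<lambda>x. f k x * (\<eta> x * dzbar k \<phi> x))"
    "integrable lborel (\<lambda>x. g x * (\<eta> x * \<phi> x))" for k
    by (intro L2on_integrable_csmooth[OF f] L2on_integrable_csmooth[OF g] csmooth_mult smooth_dzbar \<eta> cs csmooth_dzbar)+
  have "(LINT x|lborel. g x * (\<eta> x * \<phi> x)) = (\<Sum>k\<in>UNIV. - (LINT x|lborel. f k x * dzbar k (\<lambda>x. \<eta> x * \<phi> x) x))"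
    using w test_fun_mult[OF \<eta> \<phi>] unfolding weak_div_def by blast
  also have "\<dots> = (\<Sum>k\<in>UNIV. - (LINT x|lborel. f k x * (dzbar k \<eta> x * \<phi> x)) - (LINT x|lborel. f k x * (\<eta> x * dzbar k \<phi> x)))"
  proof (rule sum.cong[OF refl])
    fix k :: 2
    have "(LINT x|lborel. f k x * dzbar k (\<lambda>x. \<eta> x * \<phi> x) x) =
        (LINT x|lborel. f k x * (dzbar k \<eta> x * \<phi> x) + f k x * (\<eta> x * dzbar k \<phi> x))"
      unfolding dzbar_mult[OF \<eta> sm] by (simp only: distrib_left)
    also have "\<dots> = (LINT x|lborel. f k x * (dzbar k \<eta> x * \<phi> x)) + (LINT x|lborel. f k x * (\<eta> x * dzbar k \<phi> x))"
      by (rule Bochner_Integration.integral_add[OF i(1,2)])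
    finally show "- (LINT x|lborel. f k x * dzbar k (\<lambda>x. \<eta> x * \<phi> x) x) =
      - (LINT x|lborel. f k x * (dzbar k \<eta> x * \<phi> x)) - (LINT x|lborel. f k x * (\<eta> x * dzbar k \<phi> x))" by simp
  qed
  finally have eq: "(LINT x|lborel. g x * (\<eta> x * \<phi> x)) + (\<Sum>k\<in>UNIV. LINT x|lborel. f k x * (dzbar k \<eta> x * \<phi> x)) =
      (\<Sum>k\<in>UNIV. - (LINT x|lborel. f k x * (\<eta> x * dzbar k \<phi> x)))"
    by (simp add: sum_2')
  have "(LINT x|lborel. (\<eta> x * g x + (\<Sum>k\<in>UNIV. dzbar k \<eta> x * f k x)) * \<phi> x) =
      (LINT x|lborel. g x * (\<eta> x * \<phi> x) + (\<Sum>k\<in>UNIV. f k x * (dzbar k \<eta> x * \<phi> x)))"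
    by (intro Bochner_Integration.integral_cong) (auto simp: algebra_simps sum_2')
  also have "\<dots> = (LINT x|lborel. g x * (\<eta> x * \<phi> x)) + (\<Sum>k\<in>UNIV. LINT x|lborel. f k x * (dzbar k \<eta> x * \<phi> x))"
    using i by (subst Bochner_Integration.integral_add) auto
  also note eq
  finally show "(LINT x|lborel. (\<eta> x * g x + (\<Sum>k\<in>UNIV. dzbar k \<eta> x * f k x)) * \<phi> x) =
      (\<Sum>k\<in>UNIV. - (LINT x|lborel. \<eta> x * f k x * dzbar k \<phi> x))"
    by (simp add: mult.assoc mult.left_commute)
qed

lemma weak_div_diff:
  assumes L: "\<And>k. L2on \<Omega> (f k)" "L2on \<Omega> g" "\<And>k. L2on \<Omega> (f' k)" "L2on \<Omega> g'"
    and w: "weak_div \<Omega> f g" "weak_div \<Omega> f' g'"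
  shows "weak_div \<Omega> (\<lambda>k x. f k x - f' k x) (\<lambda>x. g x - g' x)"
  unfolding weak_div_def
proof (intro allI impI)
  fix \<phi> assume \<phi>: "test_fun \<Omega> \<phi>"
  note cs = test_fun_csmooth[OF \<phi>]
  note i = L2on_integrable_csmooth[OF L(1) csmooth_dzbar[OF cs]] L2on_integrable_csmooth[OF L(3) csmooth_dzbar[OF cs]]
    L2on_integrable_csmooth[OF L(2) cs] L2on_integrable_csmooth[OF L(4) cs]
  show "(LINT x|lborel. (g x - g' x) * \<phi> x) = (\<Sum>k\<in>UNIV. - (LINT x|lborel. (f k x - f' k x) * dzbar k \<phi> x))"
    using w[unfolded weak_div_def, rule_format, OF \<phi>] i by (simp add: left_diff_distrib sum_2')
qed

text \<open>The distributional equation is stable under convergence in square mean on the domain.\<close>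

lemma weak_div_limit:
  assumes [measurable]: "\<Omega> \<in> sets borel"
    and f: "\<And>k. L2on \<Omega> (f k)" and g: "L2on \<Omega> g"
    and F: "\<And>n k. smooth (F n k)"
    and lim: "\<And>k. (\<lambda>n. l2 \<Omega> (\<lambda>x. F n k x - f k x)) \<longlonglongrightarrow> 0"
    and lim': "(\<lambda>n. l2 \<Omega> (\<lambda>x. (\<Sum>k\<in>UNIV. dzbar k (F n k) x) - g x)) \<longlonglongrightarrow> 0"
  shows "weak_div \<Omega> f g"
  unfolding weak_div_def
proof (intro allI impI)
  fix \<phi> assume \<phi>: "test_fun \<Omega> \<phi>"
  note cs = test_fun_csmooth[OF \<phi>]
  have pair: "(\<lambda>n. LINT x|lborel. (G n x - h x) * \<psi> x) \<longlonglongrightarrow> 0"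
    if "(\<lambda>n. l2 \<Omega> (\<lambda>x. G n x - h x)) \<longlonglongrightarrow> 0" "\<And>n. G n \<in> borel_measurable borel" "h \<in> borel_measurable borel"
      "csmooth \<psi>" "\<And>x. x \<notin> \<Omega> \<Longrightarrow> \<psi> x = 0" for G h \<psi>
  proof -
    let ?I = "\<lambda>n. LINT x|lborel. (G n x - h x) * \<psi> x"
    have "(\<lambda>n. l2 \<Omega> (\<lambda>x. G n x - h x) * l2 \<Omega> \<psi>) \<longlonglongrightarrow> 0 * l2 \<Omega> \<psi>"
      using csmooth_l2[OF that(4), of \<Omega>] by (intro tendsto_mult_ennreal that tendsto_const) auto
    then have lim0: "(\<lambda>n. l2 \<Omega> (\<lambda>x. G n x - h x) * l2 \<Omega> \<psi>) \<longlonglongrightarrow> 0" by simp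
    have "eventually (\<lambda>n. l2 \<Omega> (\<lambda>x. G n x - h x) < 1) sequentially"
      using order_tendstoD(2)[OF that(1), of 1] by simp
    then have "eventually (\<lambda>n. (ennreal (cmod (?I n)))\<^sup>2 \<le> l2 \<Omega> (\<lambda>x. G n x - h x) * l2 \<Omega> \<psi>) sequentially"
    proof eventually_elim
      case (elim n)
      show ?case
        by (rule l2_pairing(2)) (use that elim csmooth_l2[OF that(4)] csmooth_measurable[OF that(4)] in
            \<open>auto intro: less_trans\<close>)
    qed
    then have "(\<lambda>n. (ennreal (cmod (?I n)))\<^sup>2) \<longlonglongrightarrow> 0"
      by (intro tendsto_sandwich[OF _ _ tendsto_const lim0]) auto
    then have "(\<lambda>n. ennreal ((cmod (?I n))\<^sup>2)) \<longlonglongrightarrow> ennreal 0" by (simp add: ennreal_cmod_square)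
    then have "(\<lambda>n. (cmod (?I n))\<^sup>2) \<longlonglongrightarrow> 0"
      by (subst (asm) tendsto_ennreal_iff) auto
    then have "(\<lambda>n. sqrt ((cmod (?I n))\<^sup>2)) \<longlonglongrightarrow> sqrt 0" by (rule tendsto_real_sqrt)
    then show ?thesis by (simp add: tendsto_norm_zero_iff)
  qed
  have m: "F n k \<in> borel_measurable borel" "dzbar k (F n k) \<in> borel_measurable borel" for n k
    using F by (auto intro: smooth_measurable smooth_dzbar)
  have z: "dzbar k \<phi> x = 0" if "x \<notin> \<Omega>" for k x
    using test_fun_derivative_zero[OF \<phi> that] by (simp add: dzbar_def)
  have 1: "(\<lambda>n. LINT x|lborel. (F n k x - f k x) * dzbar k \<phi> x) \<longlonglongrightarrow> 0" for k
    by (rule pair[OF lim]) (use m f cs z in \<open>auto simp: L2on_def intro: csmooth_dzbar\<close>)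
  have 2: "(\<lambda>n. LINT x|lborel. ((\<Sum>k\<in>UNIV. dzbar k (F n k) x) - g x) * \<phi> x) \<longlonglongrightarrow> 0"
    by (rule pair[OF lim']) (use m g cs test_fun_zero[OF \<phi>] in \<open>auto simp: L2on_def\<close>)
  have i: "integrable lborel (\<lambda>x. F n k x * dzbar k \<phi> x)" "integrable lborel (\<lambda>x. dzbar k (F n k) x * \<phi> x)" for n k
    by (intro csmooth_integrable csmooth_mult F cs csmooth_dzbar smooth_dzbar)+
  have i': "integrable lborel (\<lambda>x. f k x * dzbar k \<phi> x)" "integrable lborel (\<lambda>x. g x * \<phi> x)" for k
    by (intro L2on_integrable_csmooth[OF f] L2on_integrable_csmooth[OF g] cs csmooth_dzbar)+
  have eq: "(LINT x|lborel. ((\<Sum>k\<in>UNIV. dzbar k (F n k) x) - g x) * \<phi> x) +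
      (\<Sum>k\<in>UNIV. LINT x|lborel. (F n k x - f k x) * dzbar k \<phi> x) =
      - (LINT x|lborel. g x * \<phi> x) - (\<Sum>k\<in>UNIV. LINT x|lborel. f k x * dzbar k \<phi> x)" for n
    using i i' integral_by_parts_dbar[OF F cs, folded dzbar_eq_dbar_dir]
    by (simp add: left_diff_distrib sum_2' distrib_right dzbar_eq_dbar_dir)
  have "(\<lambda>n. (LINT x|lborel. ((\<Sum>k\<in>UNIV. dzbar k (F n k) x) - g x) * \<phi> x) +
      (\<Sum>k\<in>UNIV. LINT x|lborel. (F n k x - f k x) * dzbar k \<phi> x)) \<longlonglongrightarrow> 0 + (\<Sum>k\<in>(UNIV :: 2 set). 0)"
    by (intro tendsto_intros 1 2)
  then have "- (LINT x|lborel. g x * \<phi> x) - (\<Sum>k\<in>UNIV. LINT x|lborel. f k x * dzbar k \<phi> x) = 0"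
    unfolding eq by (simp add: LIMSEQ_const_iff)
  then show "(LINT x|lborel. g x * \<phi> x) = (\<Sum>k\<in>UNIV. - (LINT x|lborel. f k x * dzbar k \<phi> x))"
    by (simp add: sum_negf) (metis add.inverse_inverse eq_iff_diff_eq_0)
qed

lemma dzbar_reflect:
  assumes "smooth \<rho>" shows "dzbar k (\<lambda>y. \<rho> (x - y)) y = - dzbar k \<rho> (x - y)"
proof -
  have "((\<lambda>y. x - y) has_derivative (\<lambda>v. - v)) (at y)" by (auto intro!: derivative_eq_intros)
  from diff_chain_at[OF this smooth_has_derivative[OF assms]]
  have d: "((\<lambda>y. \<rho> (x - y)) has_derivative (\<lambda>v. frechet_derivative \<rho> (at (x - y)) (- v))) (at y)"
    by (simp add: o_def)
  have l: "linear (frechet_derivative \<rho> (at (x - y)))"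
    using smooth_has_derivative[OF assms] by (rule has_derivative_linear)
  show ?thesis
    unfolding dzbar_eq_dbar_dir dbar_dir_eqI[OF d] by (simp add: dbar_dir_def linear_neg[OF l] field_simps)
qed

text \<open>Testing the equation against a reflected mollifier.\<close>

lemma weak_div_mollify:
  assumes f: "\<And>k. L2on \<Omega> (f k)" and g: "L2on \<Omega> g" and B: "bounded \<Omega>" and w: "weak_div \<Omega> f g"
    and \<delta>: "\<delta> > 0" and x: "cball x \<delta> \<subseteq> \<Omega>"
  shows "(\<Sum>k\<in>UNIV. dzbar k (mollify \<delta> (f k)) x) = mollify \<delta> g x"
proof -
  note sm = csmooth_imp_smooth[OF csmooth_mollifier_at[OF \<delta>]]
  have "smooth (\<lambda>y. mollifier_at \<delta> (x - y))"
    by (rule smooth_compose[OF sm]) (intro smooth_intros)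
  then have "test_fun \<Omega> (\<lambda>y. mollifier_at \<delta> (x - y))"
    by (rule test_funI[OF _ compact_cball x]) (use mollifier_at_support[OF \<delta>] in \<open>force simp: dist_norm\<close>)
  then have "(LINT y|lborel. g y * mollifier_at \<delta> (x - y)) =
      (\<Sum>k\<in>UNIV. LINT y|lborel. f k y * dzbar k (mollifier_at \<delta>) (x - y))"
    using w unfolding weak_div_def by (simp add: dzbar_reflect[OF sm])
  then show ?thesis
    unfolding mollify_eq_convolution[OF L2on_measurable[OF g] \<delta>] dzbar_eq_dbar_dir
    by (simp add: smooth_mollify(2)[OF L2on_integrable[OF f B] \<delta>])
qed

lemma mollify_cong_ball:
  assumes "f \<in> borel_measurable borel" "\<delta> > 0" "\<And>y. dist x y < \<delta> \<Longrightarrow> f y = 0"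
  shows "mollify \<delta> f x = 0"
proof -
  have eq: "f y * mollifier_at \<delta> (x - y) = 0" for y
    using assms(3)[of y] mollifier_at_support[OF assms(2), of "x - y"] by (force simp: dist_norm)
  show ?thesis unfolding mollify_eq_convolution[OF assms(1,2)] eq by simp
qed

section \<open>Approximation of pairs that vanish near the singular point\<close>

abbreviation T :: "(complex ^ 2) set" where "T \<equiv> hartogs_triangle"

definition diag_scale :: "real \<Rightarrow> real \<Rightarrow> complex ^ 2 \<Rightarrow> complex ^ 2" where
  "diag_scale r s x = (\<chi> k. (if k = 0 then r else s) *\<^sub>R x $ k)"

lemma diag_scale_nth [simp]: "diag_scale r s x $ 0 = r *\<^sub>R x $ 0" "diag_scale r s x $ 1 = s *\<^sub>R x $ 1"
  by (simp_all add: diag_scale_def)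

lemma bounded_linear_diag_scale: "bounded_linear (diag_scale r s)"
  unfolding linear_conv_bounded_linear[symmetric]
  by (rule linearI) (auto simp: diag_scale_def vec_eq_iff scaleR_add_right)

lemma norm_le_components: "norm (x :: complex ^ 2) \<le> cmod (x $ 0) + cmod (x $ 1)"
  using L2_set_le_sum[of UNIV "\<lambda>i. norm (x $ i)"]
  by (simp add: norm_vec_def sum_2')

lemma bounded_T: "bounded T"
  unfolding bounded_iff hartogs_triangle_def
proof (intro exI[of _ 2] ballI)
  fix x :: "complex ^ 2" assume "x \<in> {x. cmod (x $ 0) < cmod (x $ 1) \<and> cmod (x $ 1) < 1}"
  then show "norm x \<le> 2" using norm_le_components[of x] by auto
qed

lemma open_T: "open T"
  unfolding hartogs_triangle_def
  by (intro open_Collect_conj open_Collect_less continuous_intros)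

lemma T_borel [measurable]: "T \<in> sets borel"
  by (rule borel_open[OF open_T])

lemma nn_integral_affine_diag_scale:
  assumes [measurable]: "h \<in> borel_measurable borel" and r: "r \<ge> 1/2" and s: "s \<ge> 1/2"
  shows "(\<integral>\<^sup>+x. h (diag_scale r s x + t) \<partial>lborel) \<le> ennreal 16 * (\<integral>\<^sup>+x. h x \<partial>lborel)"
proof -
  define c where "c j = (if j $ 0 \<noteq> 0 then r else s)" for j :: "complex ^ 2"
  have c: "c j \<ge> 1/2" for j using r s by (simp add: c_def)
  have T: "t + (\<Sum>j\<in>Basis. (c j * (x \<bullet> j)) *\<^sub>R j) = diag_scale r s x + t" for x
  proof -
    have "(\<Sum>j\<in>Basis. (c j * (x \<bullet> j)) *\<^sub>R j) = diag_scale r s x"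
    proof (rule euclidean_eqI)
      fix b :: "complex ^ 2" assume b: "b \<in> Basis"
      then obtain i u where iu: "b = axis i u" "u \<in> Basis" by (auto simp: Basis_vec_def)
      have "c b = (if i = 0 then r else s)"
        using nonzero_Basis[OF iu(2)] by (auto simp: iu c_def axis_def)
      then have "diag_scale r s x \<bullet> b = c b * (x \<bullet> b)"
        by (simp add: iu inner_axis diag_scale_def)
      then show "(\<Sum>j\<in>Basis. (c j * (x \<bullet> j)) *\<^sub>R j) \<bullet> b = diag_scale r s x \<bullet> b"
        using b by (simp add: inner_sum_left inner_Basis if_distrib cong: if_cong)
    qed
    then show ?thesis by simp
  qed
  have nz: "c j \<noteq> 0" for j using c[of j] by auto
  define P where "P = (\<Prod>j\<in>Basis. \<bar>c j\<bar>)"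
  have "(\<Prod>j\<in>(Basis :: (complex ^ 2) set). 1 / 2) \<le> P"
    unfolding P_def by (intro prod_mono conjI order_trans[OF c abs_ge_self]) simp
  then have P: "1 \<le> 16 * P" by (simp add: power_divide)
  have [measurable]: "(\<lambda>x. diag_scale r s x + t) \<in> borel_measurable borel"
    using borel_measurable_continuous_onI[OF linear_continuous_on[OF bounded_linear_diag_scale[of r s], of UNIV]]
    by measurable
  have "(\<integral>\<^sup>+x. h x \<partial>lborel) =
      (\<integral>\<^sup>+x. h x \<partial>density (distr lborel borel (\<lambda>x. diag_scale r s x + t)) (\<lambda>_. ennreal P))"
    using lborel_affine_euclidean[of c t] nz unfolding T P_def by simp
  also have "\<dots> = ennreal P * (\<integral>\<^sup>+x. h (diag_scale r s x + t) \<partial>lborel)"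
    by (simp add: nn_integral_density nn_integral_distr nn_integral_cmult)
  finally have eq: "(\<integral>\<^sup>+x. h x \<partial>lborel) = ennreal P * (\<integral>\<^sup>+x. h (diag_scale r s x + t) \<partial>lborel)" .
  have "1 * (\<integral>\<^sup>+x. h (diag_scale r s x + t) \<partial>lborel) \<le>
      ennreal (16 * P) * (\<integral>\<^sup>+x. h (diag_scale r s x + t) \<partial>lborel)"
    using P by (intro mult_right_mono) auto
  also have "\<dots> = ennreal 16 * (\<integral>\<^sup>+x. h x \<partial>lborel)"
    unfolding eq using P by (simp add: ennreal_mult mult.assoc)
  finally show ?thesis by simp
qed

lemma mollify_scaled_tendsto:
  assumes f: "f \<in> borel_measurable borel" "l2 UNIV f < top"
    and B: "bounded B" "B \<in> sets borel"
    and r: "\<And>n. r n \<ge> 1/2" "r \<longlonglongrightarrow> 1" and s: "\<And>n. s n \<ge> 1/2" "s \<longlonglongrightarrow> 1" and d: "d \<longlonglongrightarrow> 0"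
  shows "(\<lambda>n. l2 B (\<lambda>x. mollify (d n) f (diag_scale (r n) (s n) x) - f x)) \<longlonglongrightarrow> 0"
  unfolding mollify_def
proof (rule l2_average_tendsto[where C = 16 and N = mollifier_measure, OF f finite_mollifier_measure])
  show "emeasure (mollifier_measure :: (complex ^ 2) measure) (space mollifier_measure) = 1"
    by (simp add: emeasure_mollifier_measure)
  have [measurable]: "diag_scale r s \<in> borel_measurable borel" for r s
    by (rule borel_measurable_continuous_onI[OF linear_continuous_on[OF bounded_linear_diag_scale]])
  show "(\<lambda>(x, y). diag_scale (r n) (s n) x - d n *\<^sub>R y) \<in> borel \<Otimes>\<^sub>M mollifier_measure \<rightarrow>\<^sub>M borel" for n
    by measurable
  show "(\<integral>\<^sup>+x. h (diag_scale (r n) (s n) x - d n *\<^sub>R y) \<partial>lborel) \<le> ennreal 16 * (\<integral>\<^sup>+x. h x \<partial>lborel)"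
    if "h \<in> borel_measurable borel" for h n y
    using nn_integral_affine_diag_scale[OF that r(1) s(1), of n n "- d n *\<^sub>R y"] by simp
  show "uniform_limit B (\<lambda>n x. diag_scale (r n) (s n) x - d n *\<^sub>R y) (\<lambda>x. x) sequentially" for y
  proof (rule uniform_limitI)
    fix e :: real assume e: "e > 0"
    obtain R where R: "R > 0" "\<And>x. x \<in> B \<Longrightarrow> norm x \<le> R"
      using B(1) by (auto simp: bounded_pos)
    have "(\<lambda>n. \<bar>1 - r n\<bar> * R + \<bar>1 - s n\<bar> * R + \<bar>d n\<bar> * norm y) \<longlonglongrightarrow> \<bar>1 - 1\<bar> * R + \<bar>1 - 1\<bar> * R + \<bar>0\<bar> * norm y"
      by (intro tendsto_intros r s d)
    then have "eventually (\<lambda>n. \<bar>1 - r n\<bar> * R + \<bar>1 - s n\<bar> * R + \<bar>d n\<bar> * norm y < e) sequentially"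
      using e by (intro order_tendstoD) auto
    then show "eventually (\<lambda>n. \<forall>x\<in>B. dist (diag_scale (r n) (s n) x - d n *\<^sub>R y) x < e) sequentially"
    proof eventually_elim
      case (elim n)
      show ?case
      proof
        fix x assume x: "x \<in> B"
        have "dist (diag_scale (r n) (s n) x - d n *\<^sub>R y) x = norm ((diag_scale (r n) (s n) x - x) - d n *\<^sub>R y)"
          by (simp add: dist_norm algebra_simps)
        also have "\<dots> \<le> norm (diag_scale (r n) (s n) x - x) + norm (d n *\<^sub>R y)"
          by (rule norm_triangle_ineq4)
        also have "norm (diag_scale (r n) (s n) x - x) \<le>
            cmod ((diag_scale (r n) (s n) x - x) $ 0) + cmod ((diag_scale (r n) (s n) x - x) $ 1)"
          by (rule norm_le_components)
        also have "(diag_scale (r n) (s n) x - x) $ 0 = (r n - 1) *\<^sub>R x $ 0"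
          by (simp add: scaleR_diff_left)
        also have "(diag_scale (r n) (s n) x - x) $ 1 = (s n - 1) *\<^sub>R x $ 1"
          by (simp add: scaleR_diff_left)
        also have "cmod ((r n - 1) *\<^sub>R x $ 0) \<le> \<bar>1 - r n\<bar> * R"
          using order_trans[OF Finite_Cartesian_Product.norm_nth_le R(2)[OF x], of 0]
          by (simp add: abs_minus_commute mult_left_mono)
        also have "cmod ((s n - 1) *\<^sub>R x $ 1) \<le> \<bar>1 - s n\<bar> * R"
          using order_trans[OF Finite_Cartesian_Product.norm_nth_le R(2)[OF x], of 1]
          by (simp add: abs_minus_commute mult_left_mono)
        finally show "dist (diag_scale (r n) (s n) x - d n *\<^sub>R y) x < e" using elim by simp
      qed
    qed
  qed
qed (use B in auto)

lemma dzbar_diag_scale: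
  assumes "smooth F"
  shows "dzbar k (\<lambda>x. F (diag_scale r s x)) x = (if k = 0 then of_real r else of_real s) * dzbar k F (diag_scale r s x)"
proof -
  let ?c = "if k = 0 then r else s"
  have "(diag_scale r s has_derivative diag_scale r s) (at x)"
    by (rule bounded_linear_imp_has_derivative[OF bounded_linear_diag_scale])
  from diff_chain_at[OF this smooth_has_derivative[OF assms]]
  have d: "((\<lambda>x. F (diag_scale r s x)) has_derivative
      (\<lambda>v. frechet_derivative F (at (diag_scale r s x)) (diag_scale r s v))) (at x)"
    by (simp add: o_def)
  have l: "linear (frechet_derivative F (at (diag_scale r s x)))"
    using smooth_has_derivative[OF assms] by (rule has_derivative_linear)
  have a: "diag_scale r s (axis k c) = ?c *\<^sub>R axis k c" for c
    by (auto simp: diag_scale_def axis_def vec_eq_iff)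
  show ?thesis
    unfolding dzbar_eq_dbar_dir dbar_dir_eqI[OF d]
    by (simp only: a linear_cmul[OF l]) (simp add: dbar_dir_def scaleR_conv_of_real field_simps)
qed

text \<open>
  For \<open>r < s < 1\<close> the dilation maps the triangle into its interior, except near the origin, where
  the functions vanish. So a mollification after the dilation is smooth everywhere and keeps the
  equation on the triangle.
\<close>

definition inner_scale :: "real \<Rightarrow> nat \<Rightarrow> (complex ^ 2 \<Rightarrow> complex) \<Rightarrow> complex ^ 2 \<Rightarrow> complex" where
  "inner_scale \<epsilon> n f x = mollify (\<epsilon> / (8 * (real n + 4))) f
     (diag_scale (1 - 2 / (real n + 4)) (1 - 1 / (real n + 4)) x)"

lemma inner_scale_tendsto:
  assumes "L2on T f" shows "(\<lambda>n. l2 T (\<lambda>x. inner_scale \<epsilon> n f x - f x)) \<longlonglongrightarrow> 0"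
  unfolding inner_scale_def
proof (rule mollify_scaled_tendsto)
  have lim: "(\<lambda>n. c / (real n + 4)) \<longlonglongrightarrow> 0" for c
    using LIMSEQ_ignore_initial_segment[OF lim_const_over_n[of c], of 4] by simp
  show "(\<lambda>n. 1 - 2 / (real n + 4)) \<longlonglongrightarrow> 1" "(\<lambda>n. 1 - 1 / (real n + 4)) \<longlonglongrightarrow> 1"
    using tendsto_diff[OF tendsto_const[of 1] lim] by simp_all
  show "(\<lambda>n. \<epsilon> / (8 * (real n + 4))) \<longlonglongrightarrow> 0"
    using lim[of "\<epsilon> / 8"] by simp
qed (use assms bounded_T in \<open>auto simp: L2on_def field_simps\<close>)

lemma smooth_inner_scale:
  assumes "L2on T f" "\<epsilon> > 0" shows "smooth (inner_scale \<epsilon> n f)"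
  unfolding inner_scale_def[abs_def]
  by (rule smooth_compose[OF smooth_mollify(1)])
    (use assms L2on_integrable[OF assms(1) bounded_T] smooth_linear[OF bounded_linear_diag_scale smooth_ident] in auto)

lemma dzbar_inner_scale:
  assumes f: "\<And>k. L2on T (f k)" and g: "L2on T g" and w: "weak_div T f g"
    and \<epsilon>: "0 < \<epsilon>"
    and vf: "\<And>k x. cmod (x $ 1) < \<epsilon> \<Longrightarrow> f k x = 0" and vg: "\<And>x. cmod (x $ 1) < \<epsilon> \<Longrightarrow> g x = 0"
    and x: "x \<in> T"
  shows "dzbar 0 (inner_scale \<epsilon> n (f 0)) x * of_real (1 - 1 / (real n + 4)) +
      dzbar 1 (inner_scale \<epsilon> n (f 1)) x * of_real (1 - 2 / (real n + 4)) =
    of_real ((1 - 2 / (real n + 4)) * (1 - 1 / (real n + 4))) * inner_scale \<epsilon> n g x"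
proof -
  define t where "t = 1 / (real n + 4)"
  define y where "y = diag_scale (1 - 2 * t) (1 - t) x"
  have t: "0 < t" "t \<le> 1/4" by (auto simp: t_def field_simps)
  define \<delta> where "\<delta> = t * \<epsilon> / 8"
  have \<delta>: "\<delta> > 0" using t \<epsilon> by (simp add: \<delta>_def)
  have sc: "inner_scale \<epsilon> n h = (\<lambda>x. mollify \<delta> h (diag_scale (1 - 2 * t) (1 - t) x))" for h
    by (auto simp: inner_scale_def t_def \<delta>_def field_simps)
  have m: "smooth (mollify \<delta> (f k))" for k
    using smooth_mollify(1)[OF L2on_integrable[OF f bounded_T] \<delta>] .
  have y01: "cmod (y $ 0) = (1 - 2 * t) * cmod (x $ 0)" "cmod (y $ 1) = (1 - t) * cmod (x $ 1)"
    using t by (simp_all add: y_def)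
  have key: "(\<Sum>k\<in>UNIV. dzbar k (mollify \<delta> (f k)) y) = mollify \<delta> g y"
  proof (cases "cmod (x $ 1) < \<epsilon> / 2")
    case True
    have near: "cmod (v $ 1) < \<epsilon>" if "dist y v < \<epsilon> / 2" for v
    proof -
      have "cmod (v $ 1) \<le> cmod (y $ 1) + cmod ((v - y) $ 1)"
        using norm_triangle_ineq[of "y $ 1" "(v - y) $ 1"] by simp
      also have "cmod ((v - y) $ 1) \<le> norm (v - y)" by (rule Finite_Cartesian_Product.norm_nth_le)
      also have "cmod (y $ 1) \<le> 1 * cmod (x $ 1)"
        unfolding y01 using t by (intro mult_right_mono) auto
      finally show ?thesis using True that by (simp add: dist_norm norm_minus_commute)
    qed
    have "\<delta> \<le> \<epsilon> / 4" using t \<epsilon> by (simp add: \<delta>_def field_simps)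
    have z: "mollify \<delta> h v = 0" if "dist y v < \<epsilon> / 4" "h \<in> borel_measurable borel"
      "\<And>x. cmod (x $ 1) < \<epsilon> \<Longrightarrow> h x = 0" for h v
    proof (rule mollify_cong_ball[OF that(2) \<delta>])
      fix u assume "dist v u < \<delta>"
      then have "dist y u < \<epsilon> / 2"
        using that(1) \<open>\<delta> \<le> \<epsilon> / 4\<close> dist_triangle[of y u v] by simp
      then show "h u = 0" using near that(3) by blast
    qed
    have "frechet_derivative (mollify \<delta> (f k)) (at y) v = 0" for k v
      by (rule frechet_derivative_zero_on_open[of "ball y (\<epsilon> / 4)"])
        (use \<epsilon> z L2on_measurable[OF f] vf in auto)
    moreover have "mollify \<delta> g y = 0"
      by (rule z) (use \<epsilon> L2on_measurable[OF g] vg in auto)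
    ultimately show ?thesis by (simp add: dzbar_def)
  next
    case False
    have "cball y \<delta> \<subseteq> T"
    proof
      fix v assume "v \<in> cball y \<delta>"
      then have d: "norm (v - y) \<le> \<delta>" by (simp add: dist_norm norm_minus_commute)
      have d0: "cmod (v $ 0) \<le> cmod (y $ 0) + \<delta>"
        using norm_triangle_ineq[of "y $ 0" "(v - y) $ 0"] Finite_Cartesian_Product.norm_nth_le[of "v - y" 0] d by simp
      have d1: "cmod (v $ 1) \<le> cmod (y $ 1) + \<delta>" "cmod (y $ 1) \<le> cmod (v $ 1) + \<delta>"
        using norm_triangle_ineq[of "y $ 1" "(v - y) $ 1"] norm_triangle_ineq[of "v $ 1" "(y - v) $ 1"]
          Finite_Cartesian_Product.norm_nth_le[of "v - y" 1] Finite_Cartesian_Product.norm_nth_le[of "y - v" 1] d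
        by (auto simp: norm_minus_commute)
      have x01: "cmod (x $ 0) < cmod (x $ 1)" "cmod (x $ 1) < 1" using x by (auto simp: hartogs_triangle_def)
      have "(1 - 2 * t) * cmod (x $ 0) \<le> (1 - 2 * t) * cmod (x $ 1)"
        using t x01 by (intro mult_left_mono) auto
      moreover have "t * \<epsilon> \<le> 2 * (t * cmod (x $ 1))"
        using False t mult_left_mono[of \<epsilon> "2 * cmod (x $ 1)" t] by simp
      moreover have "t * cmod (x $ 1) \<le> t * 1" using x01 t by (intro mult_left_mono) auto
      moreover have "(1 - t) * cmod (x $ 1) < 1 - t"
        using x01 t mult_strict_left_mono[of "cmod (x $ 1)" 1 "1 - t"] by simp
      moreover have "(1 - t) * cmod (x $ 1) = (1 - 2 * t) * cmod (x $ 1) + t * cmod (x $ 1)"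
        by (simp add: algebra_simps)
      moreover have "t * \<epsilon> > 0" using t \<epsilon> by simp
      ultimately have "cmod (y $ 0) + \<delta> < cmod (y $ 1) - \<delta>" "cmod (y $ 1) + \<delta> < 1"
        unfolding y01 \<delta>_def using t by linarith+
      then show "v \<in> T" using d0 d1 by (simp add: hartogs_triangle_def)
    qed
    then show ?thesis by (intro weak_div_mollify[OF f g bounded_T w \<delta>])
  qed
  have t': "1 - 1 / (real n + 4) = 1 - t" "1 - 2 / (real n + 4) = 1 - 2 * t" by (simp_all add: t_def)
  have "mollify \<delta> g y = dzbar 0 (mollify \<delta> (f 0)) y + dzbar 1 (mollify \<delta> (f 1)) y"
    using key by (simp add: sum_2')
  then show ?thesis
    unfolding sc dzbar_diag_scale[OF m] y_def[symmetric] t' by (simp add: algebra_simps)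
qed

lemma l2_scaled_tendsto:
  fixes u :: "nat \<Rightarrow> 'a::euclidean_space \<Rightarrow> complex"
  assumes [measurable]: "\<And>n. u n \<in> borel_measurable borel" "g \<in> borel_measurable borel" "A \<in> sets borel"
    and fin: "l2 A g < top"
    and lim: "(\<lambda>n. l2 A (\<lambda>x. u n x - g x)) \<longlonglongrightarrow> 0" and c: "c \<longlonglongrightarrow> (1 :: real)"
  shows "(\<lambda>n. l2 A (\<lambda>x. of_real (c n) * u n x - g x)) \<longlonglongrightarrow> 0"
proof (rule tendsto_sandwich[OF _ _ tendsto_const])
  show "eventually (\<lambda>n. l2 A (\<lambda>x. of_real (c n) * u n x - g x) \<le>
      2 * (ennreal ((c n)\<^sup>2) * l2 A (\<lambda>x. u n x - g x)) + 2 * (ennreal ((c n - 1)\<^sup>2) * l2 A g)) sequentially"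
  proof (intro always_eventually allI)
    fix n
    have "l2 A (\<lambda>x. of_real (c n) * u n x - g x) =
        l2 A (\<lambda>x. of_real (c n) * (u n x - g x) + of_real (c n - 1) * g x)"
      by (rule l2_cong) (simp_all add: algebra_simps)
    also have "\<dots> \<le> 2 * l2 A (\<lambda>x. of_real (c n) * (u n x - g x)) + 2 * l2 A (\<lambda>x. of_real (c n - 1) * g x)"
      by (rule l2_add) auto
    finally show "l2 A (\<lambda>x. of_real (c n) * u n x - g x) \<le>
        2 * (ennreal ((c n)\<^sup>2) * l2 A (\<lambda>x. u n x - g x)) + 2 * (ennreal ((c n - 1)\<^sup>2) * l2 A g)"
      by (simp add: l2_cmult del: of_real_diff)
  qed
  have "(\<lambda>n. ennreal ((c n)\<^sup>2)) \<longlonglongrightarrow> ennreal (1\<^sup>2)" "(\<lambda>n. ennreal ((c n - 1)\<^sup>2)) \<longlonglongrightarrow> ennreal ((1 - 1)\<^sup>2)"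
    by (intro tendsto_ennrealI tendsto_intros c)+
  then have "(\<lambda>n. 2 * (ennreal ((c n)\<^sup>2) * l2 A (\<lambda>x. u n x - g x)) + 2 * (ennreal ((c n - 1)\<^sup>2) * l2 A g))
      \<longlonglongrightarrow> 2 * (ennreal (1\<^sup>2) * 0) + 2 * (ennreal ((1 - 1)\<^sup>2) * l2 A g)"
    using lim fin by (intro tendsto_add tendsto_mult_ennreal tendsto_const) auto
  then show "(\<lambda>n. 2 * (ennreal ((c n)\<^sup>2) * l2 A (\<lambda>x. u n x - g x)) + 2 * (ennreal ((c n - 1)\<^sup>2) * l2 A g)) \<longlonglongrightarrow> 0"
    by simp
qed simp

lemma L2on_l2: "L2on \<Omega> f \<Longrightarrow> l2 A f < top"
  using l2_mono[of A UNIV f f] by (auto simp: L2on_def intro: le_less_trans)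

lemma scale_factors_tendsto:
  "(\<lambda>n. 1 - 1 / (real n + 4)) \<longlonglongrightarrow> 1" "(\<lambda>n. 1 - 2 / (real n + 4)) \<longlonglongrightarrow> 1"
proof -
  have lim: "(\<lambda>n. c / (real n + 4)) \<longlonglongrightarrow> 0" for c
    using LIMSEQ_ignore_initial_segment[OF lim_const_over_n[of c], of 4] by simp
  show "(\<lambda>n. 1 - 1 / (real n + 4)) \<longlonglongrightarrow> 1" "(\<lambda>n. 1 - 2 / (real n + 4)) \<longlonglongrightarrow> 1"
    using tendsto_diff[OF tendsto_const[of 1] lim] by simp_all
qed

lemma inner_scale_zero [simp]: "inner_scale \<epsilon> n (\<lambda>x. 0) = (\<lambda>x. 0)"
  by (simp add: inner_scale_def fun_eq_iff mollify_def)

lemma dzbar_cmult: "smooth f \<Longrightarrow> dzbar k (\<lambda>x. c * f x) x = c * dzbar k f x"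
  using dzbar_mult[OF smooth_const, of f k c x] by (simp add: dzbar_def frechet_derivative_const)

text \<open>
  As the two coordinates are dilated by different factors, each derivative of the dilated function
  carries its own factor; this is harmless since both factors tend to 1.
\<close>

lemma approx_vanishing_function:
  assumes f: "L2on T f" and g: "\<And>k. L2on T (g k)"
    and w: "\<And>k. weak_div T (\<lambda>j. if j = k then f else (\<lambda>x. 0)) (g k)"
    and \<epsilon>: "0 < \<epsilon>"
    and vf: "\<And>x. cmod (x $ 1) < \<epsilon> \<Longrightarrow> f x = 0" and vg: "\<And>k x. cmod (x $ 1) < \<epsilon> \<Longrightarrow> g k x = 0"
  shows "\<exists>F. (\<forall>n. smooth (F n)) \<and> (\<lambda>n. l2 T (\<lambda>x. F n x - f x)) \<longlonglongrightarrow> 0 \<and>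
    (\<forall>k. (\<lambda>n. l2 T (\<lambda>x. dzbar k (F n) x - g k x)) \<longlonglongrightarrow> 0)"
proof (intro exI[of _ "\<lambda>n. inner_scale \<epsilon> n f"] conjI allI)
  show "smooth (inner_scale \<epsilon> n f)" for n by (rule smooth_inner_scale[OF f \<epsilon>])
  show "(\<lambda>n. l2 T (\<lambda>x. inner_scale \<epsilon> n f x - f x)) \<longlonglongrightarrow> 0" by (rule inner_scale_tendsto[OF f])
  fix k :: 2
  define c where "c n = (if k = 0 then 1 - 2 / (real n + 4) else 1 - 1 / (real n + 4))" for n
  have c: "c \<longlonglongrightarrow> 1"
    unfolding c_def using scale_factors_tendsto by (cases "k = 0") simp_all
  have "dzbar k (inner_scale \<epsilon> n f) x = of_real (c n) * inner_scale \<epsilon> n (g k) x" if x: "x \<in> T" for n x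
  proof -
    have a: "1 - 1 / (real n + 4) \<noteq> 0" "1 - 2 / (real n + 4) \<noteq> 0" by (auto simp: field_simps)
    have "k = 0 \<or> k = 1" using UNIV_2' by auto
    then show ?thesis
      using dzbar_inner_scale[of "\<lambda>j. if j = k then f else (\<lambda>x. 0)", OF _ g[of k] w[of k] \<epsilon> _ vg[of _ k] x, of n] f vf a
      unfolding of_real_mult by (auto simp: c_def simp del: of_real_diff)
  qed
  then have eq: "l2 T (\<lambda>x. dzbar k (inner_scale \<epsilon> n f) x - g k x) =
      l2 T (\<lambda>x. of_real (c n) * inner_scale \<epsilon> n (g k) x - g k x)" for n
    by (intro l2_cong) auto
  show "(\<lambda>n. l2 T (\<lambda>x. dzbar k (inner_scale \<epsilon> n f) x - g k x)) \<longlonglongrightarrow> 0"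
    unfolding eq
    by (rule l2_scaled_tendsto[OF _ _ T_borel _ inner_scale_tendsto[OF g] c])
      (use L2on_measurable[OF g] L2on_l2[OF g] smooth_measurable[OF smooth_inner_scale[OF g \<epsilon>]] in auto)
qed

text \<open>
  The different dilation factors of the two coordinates would spoil the divergence. Multiplying
  each component by the factor of the other coordinate restores a common factor.
\<close>

lemma approx_vanishing_field:
  assumes f: "\<And>k. L2on T (f k)" and g: "L2on T g" and w: "weak_div T f g"
    and \<epsilon>: "0 < \<epsilon>"
    and vf: "\<And>k x. cmod (x $ 1) < \<epsilon> \<Longrightarrow> f k x = 0" and vg: "\<And>x. cmod (x $ 1) < \<epsilon> \<Longrightarrow> g x = 0"
  shows "\<exists>F. (\<forall>n k. smooth (F n k)) \<and> (\<forall>k. (\<lambda>n. l2 T (\<lambda>x. F n k x - f k x)) \<longlonglongrightarrow> 0) \<and>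
    (\<lambda>n. l2 T (\<lambda>x. (\<Sum>k\<in>UNIV. dzbar k (F n k) x) - g x)) \<longlonglongrightarrow> 0"
proof -
  define c where "c n k = (if k = (0 :: 2) then 1 - 1 / (real n + 4) else 1 - 2 / (real n + 4))" for n k
  have c: "(\<lambda>n. c n k) \<longlonglongrightarrow> 1" for k
    unfolding c_def using scale_factors_tendsto by (cases "k = 0") simp_all
  define F where "F n k x = of_real (c n k) * inner_scale \<epsilon> n (f k) x" for n k x
  note sm = smooth_inner_scale[OF f \<epsilon>]
  note sg = smooth_inner_scale[OF g \<epsilon>]
  have "(\<Sum>k\<in>UNIV. dzbar k (F n k) x) = of_real (c n 1 * c n 0) * inner_scale \<epsilon> n g x" if x: "x \<in> T" for n x
    using dzbar_inner_scale[OF f g w \<epsilon> vf vg x, of n]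
    unfolding F_def dzbar_cmult[OF sm] sum_2' by (simp add: c_def mult.commute)
  then have eq: "l2 T (\<lambda>x. (\<Sum>k\<in>UNIV. dzbar k (F n k) x) - g x) =
      l2 T (\<lambda>x. of_real (c n 1 * c n 0) * inner_scale \<epsilon> n g x - g x)" for n
    by (intro l2_cong) auto
  have "(\<lambda>n. l2 T (\<lambda>x. of_real (c n 1 * c n 0) * inner_scale \<epsilon> n g x - g x)) \<longlonglongrightarrow> 0"
    by (rule l2_scaled_tendsto[OF _ _ T_borel _ inner_scale_tendsto[OF g]])
      (use L2on_measurable[OF g] L2on_l2[OF g] smooth_measurable[OF sg] tendsto_mult[OF c[of 1] c[of 0]] in auto)
  moreover have "(\<lambda>n. l2 T (\<lambda>x. F n k x - f k x)) \<longlonglongrightarrow> 0" for k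
    unfolding F_def
    by (rule l2_scaled_tendsto[OF _ _ T_borel _ inner_scale_tendsto[OF f] c])
      (use L2on_measurable[OF f] L2on_l2[OF f] smooth_measurable[OF sm] in auto)
  moreover have "smooth (F n k)" for n k
    unfolding F_def[abs_def] by (intro smooth_intros sm)
  ultimately show ?thesis unfolding eq[symmetric] by blast
qed

section \<open>Radial cutoff functions\<close>

lemma dbar_dir_radial:
  fixes L :: "'a::euclidean_space \<Rightarrow> complex"
  assumes L: "bounded_linear L" and P: "(P has_real_derivative D) (at (L x \<bullet> L x))"
  shows "dbar_dir e e' (\<lambda>x. of_real (P (L x \<bullet> L x))) x = of_real D * (of_real (L x \<bullet> L e) + \<i> * of_real (L x \<bullet> L e'))"
proof -
  have l: "(L has_derivative L) (at x)" by (rule bounded_linear_imp_has_derivative[OF L])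
  have "((\<lambda>x. L x \<bullet> L x) has_derivative (\<lambda>v. L x \<bullet> L v + L v \<bullet> L x)) (at x)"
    by (rule has_derivative_inner[OF l l])
  from diff_chain_at[OF this P[unfolded has_field_derivative_def]]
  have "((\<lambda>x. P (L x \<bullet> L x)) has_derivative (\<lambda>v. D * (L x \<bullet> L v + L v \<bullet> L x))) (at x)"
    by (simp add: o_def)
  from bounded_linear.has_derivative[OF bounded_linear_of_real this]
  have "((\<lambda>x. complex_of_real (P (L x \<bullet> L x))) has_derivative
      (\<lambda>v. of_real (D * (L x \<bullet> L v + L v \<bullet> L x)))) (at x)" .
  then show ?thesis
    by (subst dbar_dir_eqI, assumption) (simp add: inner_commute[of "L e"] inner_commute[of "L e'"] field_simps)
qed

lemma dzbar_radial:
  assumes "(P has_real_derivative D) (at (x $ 1 \<bullet> x $ 1))"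
  shows "dzbar 1 (\<lambda>x :: complex ^ 2. of_real (P (x $ 1 \<bullet> x $ 1))) x = of_real D * x $ 1"
    and "dzbar 0 (\<lambda>x :: complex ^ 2. of_real (P (x $ 1 \<bullet> x $ 1))) x = 0"
proof -
  have b: "bounded_linear (\<lambda>x :: complex ^ 2. x $ 1)" by (rule bounded_linear_vec_nth)
  show "dzbar 1 (\<lambda>x :: complex ^ 2. of_real (P (x $ 1 \<bullet> x $ 1))) x = of_real D * x $ 1"
    unfolding dzbar_eq_dbar_dir dbar_dir_radial[OF b assms]
    by (simp add: axis_def inner_complex_def complex_eq_iff)
  show "dzbar 0 (\<lambda>x :: complex ^ 2. of_real (P (x $ 1 \<bullet> x $ 1))) x = 0"
    unfolding dzbar_eq_dbar_dir dbar_dir_radial[OF b assms] by (simp add: axis_def)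
qed

definition smooth_step' :: "real \<Rightarrow> real" where
  "smooth_step' t = frechet_derivative smooth_step (at t) 1"

lemma smooth_step_has_derivative: "(smooth_step has_real_derivative smooth_step' t) (at t)"
proof -
  have d: "(smooth_step has_derivative frechet_derivative smooth_step (at t)) (at t)"
    by (rule smooth_has_derivative[OF smooth_smooth_step])
  have "frechet_derivative smooth_step (at t) = (\<lambda>v. smooth_step' t * v)"
  proof
    fix v show "frechet_derivative smooth_step (at t) v = smooth_step' t * v"
      using linear_cmul[OF has_derivative_linear[OF d], of v 1] by (simp add: smooth_step'_def)
  qed
  then show ?thesis using d by (simp add: has_field_derivative_def)
qed

lemma smooth_step'_eq_0: "t < 0 \<or> t > 1 \<Longrightarrow> smooth_step' t = 0"
  unfolding smooth_step'_def
  using frechet_derivative_zero_on_open[of "{..<0}" t smooth_step 0 1]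
    frechet_derivative_zero_on_open[of "{1<..}" t smooth_step 1 1] by auto

definition punct_cutoff :: "real \<Rightarrow> complex ^ 2 \<Rightarrow> complex" where
  "punct_cutoff \<epsilon> x = of_real (smooth_step ((x $ 1 \<bullet> x $ 1) / \<epsilon>\<^sup>2 - 1))"

lemma smooth_punct_cutoff: "\<epsilon> \<noteq> 0 \<Longrightarrow> smooth (punct_cutoff \<epsilon>)"
  unfolding punct_cutoff_def[abs_def]
  by (intro smooth_of_real smooth_compose[OF smooth_smooth_step] smooth_diff smooth_divide smooth_intros) auto

lemma inner_eq_cmod2: "z \<bullet> z = (cmod z)\<^sup>2"
  by (simp add: power2_norm_eq_inner)

lemma punct_cutoff_values:
  assumes "\<epsilon> > 0"
  shows "cmod (punct_cutoff \<epsilon> x) \<le> 1" "cmod (punct_cutoff \<epsilon> x - 1) \<le> 1"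
    and "cmod (x $ 1) \<le> \<epsilon> \<Longrightarrow> punct_cutoff \<epsilon> x = 0"
    and "cmod (x $ 1) \<ge> 2 * \<epsilon> \<Longrightarrow> punct_cutoff \<epsilon> x = 1"
proof -
  show "cmod (punct_cutoff \<epsilon> x) \<le> 1" 
    using smooth_step_bounds by (simp add: punct_cutoff_def)
  have "punct_cutoff \<epsilon> x - 1 = of_real (smooth_step ((x $ 1 \<bullet> x $ 1) / \<epsilon>\<^sup>2 - 1) - 1)"
    by (simp add: punct_cutoff_def)
  then show "cmod (punct_cutoff \<epsilon> x - 1) \<le> 1"
    using smooth_step_bounds[of "(x $ 1 \<bullet> x $ 1) / \<epsilon>\<^sup>2 - 1"] by (simp only: norm_of_real)
  show "punct_cutoff \<epsilon> x = 0" if "cmod (x $ 1) \<le> \<epsilon>"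
  proof -
    have "(cmod (x $ 1))\<^sup>2 \<le> \<epsilon>\<^sup>2" using that by (intro power_mono) auto
    then show ?thesis using assms by (simp add: punct_cutoff_def inner_eq_cmod2 field_simps)
  qed
  show "punct_cutoff \<epsilon> x = 1" if "cmod (x $ 1) \<ge> 2 * \<epsilon>"
  proof -
    have "(2 * \<epsilon>)\<^sup>2 \<le> (cmod (x $ 1))\<^sup>2" using that assms by (intro power_mono) auto
    moreover have "(2 * \<epsilon>)\<^sup>2 = 4 * \<epsilon>\<^sup>2" by (simp add: power_mult_distrib)
    ultimately have "2 * \<epsilon>\<^sup>2 \<le> (cmod (x $ 1))\<^sup>2" using zero_le_power2[of \<epsilon>] by linarith
    then have "(x $ 1 \<bullet> x $ 1) / \<epsilon>\<^sup>2 - 1 \<ge> 1"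
      using assms by (simp add: inner_eq_cmod2 field_simps)
    then show ?thesis by (simp add: punct_cutoff_def)
  qed
qed

lemma dzbar_punct_cutoff:
  obtains C where "C > 0"
    "\<And>\<epsilon> x. \<epsilon> > 0 \<Longrightarrow> cmod (dzbar 1 (punct_cutoff \<epsilon>) x) \<le> C / \<epsilon>"
    "\<And>\<epsilon> x. \<epsilon> > 0 \<Longrightarrow> cmod (x $ 1) < \<epsilon> \<or> cmod (x $ 1) > 2 * \<epsilon> \<Longrightarrow> dzbar 1 (punct_cutoff \<epsilon>) x = 0"
    "\<And>\<epsilon> x. \<epsilon> > 0 \<Longrightarrow> dzbar 0 (punct_cutoff \<epsilon>) x = 0"
proof -
  obtain C where C: "C > 0" "\<And>t v. \<bar>frechet_derivative smooth_step (at t) v\<bar> \<le> C * \<bar>v\<bar>"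
    using smooth_step_deriv_bound by metis
  have C': "\<bar>smooth_step' t\<bar> \<le> C" for t using C(2)[of t 1] by (simp add: smooth_step'_def)
  have der: "((\<lambda>t. smooth_step (t / \<epsilon>\<^sup>2 - 1)) has_real_derivative smooth_step' (t / \<epsilon>\<^sup>2 - 1) / \<epsilon>\<^sup>2) (at t)" 
    if "\<epsilon> > 0" for \<epsilon> t :: real
  proof -
    have "((\<lambda>t. t / \<epsilon>\<^sup>2 - 1) has_real_derivative 1 / \<epsilon>\<^sup>2) (at t)"
      by (rule DERIV_cong[OF DERIV_diff[OF DERIV_cdivide[OF DERIV_ident] DERIV_const]]) simp
    from DERIV_chain2[OF smooth_step_has_derivative this] show ?thesis by simp
  qed
  have d1: "dzbar 1 (punct_cutoff \<epsilon>) x = of_real (smooth_step' ((x $ 1 \<bullet> x $ 1) / \<epsilon>\<^sup>2 - 1) / \<epsilon>\<^sup>2) * x $ 1"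
    and d0: "dzbar 0 (punct_cutoff \<epsilon>) x = 0" if "\<epsilon> > 0" for \<epsilon> x
    unfolding punct_cutoff_def[abs_def]
    by (rule dzbar_radial[OF der[OF that]])+
  have zero: "dzbar 1 (punct_cutoff \<epsilon>) x = 0" if "\<epsilon> > 0" "cmod (x $ 1) < \<epsilon> \<or> cmod (x $ 1) > 2 * \<epsilon>" for \<epsilon> x
  proof -
    have "(x $ 1 \<bullet> x $ 1) / \<epsilon>\<^sup>2 - 1 < 0 \<or> (x $ 1 \<bullet> x $ 1) / \<epsilon>\<^sup>2 - 1 > 1"
    proof (cases "cmod (x $ 1) < \<epsilon>")
      case True
      then have "(cmod (x $ 1))\<^sup>2 < \<epsilon>\<^sup>2" by (intro power_strict_mono) auto
      then show ?thesis using that by (simp add: inner_eq_cmod2 field_simps)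
    next
      case False
      then have "(2 * \<epsilon>)\<^sup>2 < (cmod (x $ 1))\<^sup>2" using that by (intro power_strict_mono) auto
      moreover have "(2 * \<epsilon>)\<^sup>2 = 4 * \<epsilon>\<^sup>2" by (simp add: power_mult_distrib)
      ultimately have "2 * \<epsilon>\<^sup>2 < (cmod (x $ 1))\<^sup>2"
        using zero_le_power2[of \<epsilon>] by linarith
      then show ?thesis using that by (simp add: inner_eq_cmod2 field_simps)
    qed
    then show ?thesis by (simp add: d1[OF that(1)] smooth_step'_eq_0)
  qed
  show ?thesis
  proof (rule that[of "2 * C"])
    fix \<epsilon> :: real and x :: "complex ^ 2" assume e: "\<epsilon> > 0"
    show "cmod (dzbar 1 (punct_cutoff \<epsilon>) x) \<le> 2 * C / \<epsilon>"
    proof (cases "cmod (x $ 1) > 2 * \<epsilon>")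
      case True
      then show ?thesis using zero[OF e] C(1) e by simp
    next
      case False
      have "cmod (dzbar 1 (punct_cutoff \<epsilon>) x) = \<bar>smooth_step' ((x $ 1 \<bullet> x $ 1) / \<epsilon>\<^sup>2 - 1)\<bar> / \<epsilon>\<^sup>2 * cmod (x $ 1)"
        using e by (simp add: d1[OF e] norm_mult norm_divide norm_power)
      also have "\<dots> \<le> C / \<epsilon>\<^sup>2 * (2 * \<epsilon>)"
        using C' False e C(1) by (intro mult_mono divide_right_mono) auto
      also have "\<dots> = 2 * C / \<epsilon>" using e by (simp add: power2_eq_square)
      finally show ?thesis .
    qed
  qed (use C zero d0 in auto)
qed

text \<open>
  Dominated convergence, with the function itself as majorant.
\<close>

lemma cutoff_tendsto:
  assumes h: "L2on T h"
    and m: "\<And>n. m n \<in> borel_measurable borel" "\<And>n x. x \<in> T \<Longrightarrow> cmod (m n x - 1) \<le> 1"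
    and lim: "\<And>x. x \<in> T \<Longrightarrow> (\<lambda>n. m n x) \<longlonglongrightarrow> 1"
  shows "(\<lambda>n. l2 T (\<lambda>x. m n x * h x - h x)) \<longlonglongrightarrow> 0"
proof (rule l2_dominated_tendsto_0[where w = h])
  note [measurable] = L2on_measurable[OF h] m(1)
  show "(\<lambda>x. m n x * h x - h x) \<in> borel_measurable borel" for n by measurable
  show "cmod (m n x * h x - h x) \<le> cmod (h x)" if "x \<in> T" for n x
  proof -
    have "m n x * h x - h x = (m n x - 1) * h x" by (simp add: algebra_simps)
    then show ?thesis using mult_right_mono[OF m(2)[OF that, of n], of "cmod (h x)"] by (simp add: norm_mult)
  qed
  show "AE x in lborel. x \<in> T \<longrightarrow> (\<lambda>n. m n x * h x - h x) \<longlonglongrightarrow> 0"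
  proof (intro AE_I2 impI)
    fix x assume "x \<in> T"
    from tendsto_diff[OF tendsto_mult[OF lim[OF this] tendsto_const[of "h x"]] tendsto_const[of "h x"]]
    show "(\<lambda>n. m n x * h x - h x) \<longlonglongrightarrow> 0" by simp
  qed
qed (use L2on_measurable[OF h] L2on_l2[OF h] in auto)

lemma punct_cutoff_tendsto:
  assumes h: "L2on T h" and d: "\<And>n. d n > 0" "d \<longlonglongrightarrow> 0"
  shows "(\<lambda>n. l2 T (\<lambda>x. punct_cutoff (d n) x * h x - h x)) \<longlonglongrightarrow> 0"
proof (rule cutoff_tendsto[OF h])
  show "punct_cutoff (d n) \<in> borel_measurable borel" for n
    using d(1)[of n] by (intro smooth_measurable smooth_punct_cutoff) auto
  show "cmod (punct_cutoff (d n) x - 1) \<le> 1" for n x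
    using punct_cutoff_values(2)[OF d(1)] .
  fix x assume "x \<in> T"
  then have "cmod (x $ 1) / 2 > 0" by (auto simp: hartogs_triangle_def intro: le_less_trans[OF norm_ge_zero])
  from order_tendstoD(2)[OF d(2) this]
  have "eventually (\<lambda>n. punct_cutoff (d n) x = 1) sequentially"
    by eventually_elim (rule punct_cutoff_values(4)[OF d(1)], simp)
  then show "(\<lambda>n. punct_cutoff (d n) x) \<longlonglongrightarrow> 1" by (rule tendsto_eventually)
qed

section \<open>Partial convolutions\<close>

lemma nn_integral_translate:
  fixes c :: "'a::euclidean_space"
  assumes [measurable]: "h \<in> borel_measurable borel"
  shows "(\<integral>\<^sup>+x. h (x + c) \<partial>lborel) = (\<integral>\<^sup>+x. h x \<partial>lborel)"
proof -
  have "(\<integral>\<^sup>+x. h x \<partial>lborel) = (\<integral>\<^sup>+x. h x \<partial>distr lborel borel ((+) c))"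
    by (simp add: lborel_distr_plus)
  also have "\<dots> = (\<integral>\<^sup>+x. h (x + c) \<partial>lborel)"
    by (subst nn_integral_distr) (auto simp: add.commute)
  finally show ?thesis by simp
qed

lemma integral_translate:
  fixes c :: "'a::euclidean_space" and h :: "'a \<Rightarrow> complex"
  assumes [measurable]: "h \<in> borel_measurable borel"
  shows "(LINT x|lborel. h (x + c)) = (LINT x|lborel. h x)"
proof -
  have "(LINT x|lborel. h x) = (LINT x|distr lborel borel ((+) c). h x)"
    by (simp add: lborel_distr_plus)
  also have "\<dots> = (LINT x|lborel. h (x + c))"
    by (subst integral_distr) (auto simp: add.commute)
  finally show ?thesis by simp
qed

lemma norm_integral_le_nn_integral:
  fixes f :: "'a \<Rightarrow> complex"
  shows "ennreal (cmod (LINT x|M. f x)) \<le> (\<integral>\<^sup>+x. ennreal (cmod (f x)) \<partial>M)"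
  by (cases "integrable M f") (simp_all add: integral_norm_bound_ennreal not_integrable_integral_eq)

definition axis0 :: "complex \<Rightarrow> complex ^ 2" where "axis0 \<zeta> = axis 0 \<zeta>"

lemma axis0_nth [simp]: "axis0 \<zeta> $ 0 = \<zeta>" "axis0 \<zeta> $ 1 = 0"
  by (simp_all add: axis0_def axis_def)

lemma bounded_linear_axis0: "bounded_linear axis0"
  unfolding linear_conv_bounded_linear[symmetric] axis0_def
  by (rule linearI) (auto simp: axis_def vec_eq_iff)

lemma axis0_measurable [measurable]: "axis0 \<in> borel_measurable borel"
  by (rule borel_measurable_continuous_onI[OF linear_continuous_on[OF bounded_linear_axis0]])

text \<open>
  The convolution in the first coordinate only, slice by slice.
\<close>

definition pconv :: "(complex ^ 2 \<Rightarrow> complex) \<Rightarrow> (complex \<Rightarrow> complex) \<Rightarrow> complex ^ 2 \<Rightarrow> complex" where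
  "pconv k K x = (LINT \<zeta>|lborel. K \<zeta> * k (x - axis0 \<zeta>))"

lemma pconv_measurable [measurable]:
  assumes [measurable]: "k \<in> borel_measurable borel" "K \<in> borel_measurable borel"
  shows "pconv k K \<in> borel_measurable borel"
  unfolding pconv_def[abs_def] by measurable

text \<open>
  Young's inequality in the slices.
\<close>

lemma l2_pconv:
  assumes [measurable]: "k \<in> borel_measurable borel" "K \<in> borel_measurable borel"
    and fin: "(\<integral>\<^sup>+\<zeta>. ennreal (cmod (K \<zeta>)) \<partial>lborel) \<le> ennreal C"
  shows "l2 UNIV (pconv k K) \<le> (ennreal C)\<^sup>2 * l2 UNIV k"
proof -
  let ?N = "density lborel (\<lambda>\<zeta>. ennreal (cmod (K \<zeta>)))"
  have Nm: "emeasure ?N (space ?N) = (\<integral>\<^sup>+\<zeta>. ennreal (cmod (K \<zeta>)) \<partial>lborel)"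
    by (subst emeasure_density) auto
  have N: "finite_measure ?N"
    by (rule finite_measureI) (use fin Nm in \<open>auto simp: top_unique\<close>)
  have tr: "(\<integral>\<^sup>+x. (ennreal (cmod (k (x - axis0 \<zeta>))))\<^sup>2 \<partial>lborel) = l2 UNIV k" for \<zeta>
    using nn_integral_translate[of "\<lambda>x. (ennreal (cmod (k x)))\<^sup>2" "- axis0 \<zeta>"] by (simp add: l2_def)
  have "l2 UNIV (pconv k K) \<le> (\<integral>\<^sup>+x. (\<integral>\<^sup>+\<zeta>. ennreal (cmod (k (x - axis0 \<zeta>))) \<partial>?N)\<^sup>2 \<partial>lborel)"
    unfolding l2_def
  proof (rule nn_integral_mono)
    fix x
    have "ennreal (cmod (pconv k K x)) \<le> (\<integral>\<^sup>+\<zeta>. ennreal (cmod (K \<zeta> * k (x - axis0 \<zeta>))) \<partial>lborel)"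
      unfolding pconv_def by (rule norm_integral_le_nn_integral)
    also have "\<dots> = (\<integral>\<^sup>+\<zeta>. ennreal (cmod (k (x - axis0 \<zeta>))) \<partial>?N)"
      by (subst nn_integral_density) (auto simp: norm_mult ennreal_mult)
    finally show "(ennreal (cmod (pconv k K x)))\<^sup>2 * indicator UNIV x \<le>
        (\<integral>\<^sup>+\<zeta>. ennreal (cmod (k (x - axis0 \<zeta>))) \<partial>?N)\<^sup>2"
      by (simp add: power_mono)
  qed
  also have "\<dots> \<le> emeasure ?N (space ?N) *
      (\<integral>\<^sup>+\<zeta>. (\<integral>\<^sup>+x. (ennreal (cmod (k (x - axis0 \<zeta>))))\<^sup>2 \<partial>lborel) \<partial>?N)"
    by (rule nn_integral_average_square_le[OF sigma_finite_lborel N]) measurable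
  also have "\<dots> = (emeasure ?N (space ?N))\<^sup>2 * l2 UNIV k"
    unfolding tr by (simp add: power2_eq_square ac_simps)
  also have "\<dots> \<le> (ennreal C)\<^sup>2 * l2 UNIV k"
    unfolding Nm by (intro mult_right_mono power_mono fin) auto
  finally show ?thesis .
qed

lemma pconv_pairing:
  assumes k: "integrable lborel k" and K: "integrable lborel K"
    and [measurable]: "\<psi> \<in> borel_measurable borel" and B: "\<And>x. cmod (\<psi> x) \<le> B"
  shows "(LINT x|lborel. pconv k K x * \<psi> x) =
    (LINT y|lborel. k y * (LINT \<zeta>|lborel. K \<zeta> * \<psi> (y + axis0 \<zeta>)))"
proof -
  have [measurable]: "k \<in> borel_measurable borel" "K \<in> borel_measurable borel"
    using borel_measurable_integrable[OF k] borel_measurable_integrable[OF K] by simp_all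
  have fin: "(\<integral>\<^sup>+x. ennreal (cmod (k x)) \<partial>lborel) < top" "(\<integral>\<^sup>+\<zeta>. ennreal (cmod (K \<zeta>)) \<partial>lborel) < top"
    using k K by (auto simp: integrable_iff_bounded)
  have B0: "B \<ge> 0" using B[of 0] norm_ge_zero order_trans by blast
  have int: "integrable (lborel \<Otimes>\<^sub>M lborel) (\<lambda>(x, \<zeta>). K \<zeta> * k (x + s *\<^sub>R axis0 \<zeta>) * \<psi> (x + t *\<^sub>R axis0 \<zeta>))" for s t :: real
  proof (rule integrableI_bounded)
    have "(\<integral>\<^sup>+z. ennreal (cmod (case z of (x, \<zeta>) \<Rightarrow> K \<zeta> * k (x + s *\<^sub>R axis0 \<zeta>) * \<psi> (x + t *\<^sub>R axis0 \<zeta>))) \<partial>(lborel \<Otimes>\<^sub>M lborel)) \<le>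
        (\<integral>\<^sup>+z. (case z of (x, \<zeta>) \<Rightarrow> ennreal B * (ennreal (cmod (K \<zeta>)) * ennreal (cmod (k (x + s *\<^sub>R axis0 \<zeta>))))) \<partial>(lborel \<Otimes>\<^sub>M lborel))"
    proof (rule nn_integral_mono, clarsimp)
      fix x \<zeta>
      have "cmod (K \<zeta> * k (x + s *\<^sub>R axis0 \<zeta>) * \<psi> (x + t *\<^sub>R axis0 \<zeta>)) \<le> B * (cmod (K \<zeta>) * cmod (k (x + s *\<^sub>R axis0 \<zeta>)))"
        using mult_right_mono[OF B, of "cmod (K \<zeta>) * cmod (k (x + s *\<^sub>R axis0 \<zeta>))"]
        by (simp add: norm_mult ac_simps)
      then show "ennreal (cmod (K \<zeta> * k (x + s *\<^sub>R axis0 \<zeta>) * \<psi> (x + t *\<^sub>R axis0 \<zeta>))) \<le>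
          ennreal B * (ennreal (cmod (K \<zeta>)) * ennreal (cmod (k (x + s *\<^sub>R axis0 \<zeta>))))"
        using B0 by (simp add: ennreal_mult[symmetric])
    qed
    also have "\<dots> = (\<integral>\<^sup>+\<zeta>. (\<integral>\<^sup>+x. ennreal B * (ennreal (cmod (K \<zeta>)) * ennreal (cmod (k (x + s *\<^sub>R axis0 \<zeta>)))) \<partial>lborel) \<partial>lborel)"
      by (subst lborel_pair.nn_integral_snd[symmetric]) auto
    also have "\<dots> = (\<integral>\<^sup>+\<zeta>. ennreal B * (ennreal (cmod (K \<zeta>)) * (\<integral>\<^sup>+x. ennreal (cmod (k x)) \<partial>lborel)) \<partial>lborel)"
      by (intro nn_integral_cong) (simp add: nn_integral_cmult nn_integral_translate[of "\<lambda>x. ennreal (cmod (k x))"])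
    also have "\<dots> = ennreal B * ((\<integral>\<^sup>+\<zeta>. ennreal (cmod (K \<zeta>)) \<partial>lborel) * (\<integral>\<^sup>+x. ennreal (cmod (k x)) \<partial>lborel))"
      by (simp add: nn_integral_cmult nn_integral_multc)
    also have "\<dots> < \<infinity>" using fin by (simp add: ennreal_mult_less_top)
    finally show "(\<integral>\<^sup>+z. ennreal (cmod (case z of (x, \<zeta>) \<Rightarrow> K \<zeta> * k (x + s *\<^sub>R axis0 \<zeta>) * \<psi> (x + t *\<^sub>R axis0 \<zeta>))) \<partial>(lborel \<Otimes>\<^sub>M lborel)) < \<infinity>" .
  qed measurable
  have "(LINT x|lborel. pconv k K x * \<psi> x) = (LINT x|lborel. (LINT \<zeta>|lborel. K \<zeta> * k (x - axis0 \<zeta>) * \<psi> x))"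
    by (simp add: pconv_def)
  also have "\<dots> = (LINT \<zeta>|lborel. (LINT x|lborel. K \<zeta> * k (x - axis0 \<zeta>) * \<psi> x))"
    by (rule lborel_pair.Fubini_integral[symmetric]) (use int[of "- 1" 0] in simp)
  also have "\<dots> = (LINT \<zeta>|lborel. (LINT y|lborel. K \<zeta> * k y * \<psi> (y + axis0 \<zeta>)))"
  proof (rule Bochner_Integration.integral_cong[OF refl])
    fix \<zeta>
    show "(LINT x|lborel. K \<zeta> * k (x - axis0 \<zeta>) * \<psi> x) = (LINT y|lborel. K \<zeta> * k y * \<psi> (y + axis0 \<zeta>))"
      using integral_translate[of "\<lambda>x. K \<zeta> * k (x - axis0 \<zeta>) * \<psi> x" "axis0 \<zeta>"] by simp
  qed
  also have "\<dots> = (LINT y|lborel. (LINT \<zeta>|lborel. K \<zeta> * k y * \<psi> (y + axis0 \<zeta>)))"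
    by (rule lborel_pair.Fubini_integral) (use int[of 0 1] in simp)
  also have "\<dots> = (LINT y|lborel. k y * (LINT \<zeta>|lborel. K \<zeta> * \<psi> (y + axis0 \<zeta>)))"
    by (simp add: mult.commute[of "K _" "k _"] mult.assoc)
  finally show ?thesis .
qed

section \<open>A regularized Cauchy kernel\<close>

lemma nn_integral_even_le:
  assumes [measurable]: "f \<in> borel_measurable borel" and even: "\<And>t :: real. f (- t) = f t"
  shows "(\<integral>\<^sup>+t. f t \<partial>lborel) \<le> 2 * (\<integral>\<^sup>+t. f t * indicator {0..} t \<partial>lborel)"
proof -
  have "(\<integral>\<^sup>+t. f t \<partial>lborel) \<le>
      (\<integral>\<^sup>+t. f t * indicator {0..} t + f (- t) * indicator {0..} (- t) \<partial>lborel)"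
    by (intro nn_integral_mono) (auto simp: indicator_def even)
  also have "\<dots> = (\<integral>\<^sup>+t. f t * indicator {0..} t \<partial>lborel) + (\<integral>\<^sup>+t. f (- t) * indicator {0..} (- t) \<partial>lborel)"
    by (subst nn_integral_add) auto
  also have "(\<integral>\<^sup>+t. f (- t) * indicator {0..} (- t) \<partial>lborel) = (\<integral>\<^sup>+t. f t * indicator {0..} t \<partial>lborel)"
    using nn_integral_real_affine[of "\<lambda>t. f t * indicator {0..} t" "- 1" 0] by simp
  finally show ?thesis by (simp add: mult_2)
qed

lemma nn_integral_complex_prod:
  assumes [measurable]: "f \<in> borel_measurable borel" and "\<And>t :: real. f t \<ge> 0"
  shows "(\<integral>\<^sup>+\<zeta>. ennreal (f (Re \<zeta>) * f (Im \<zeta>)) \<partial>lborel) = (\<integral>\<^sup>+t. ennreal (f t) \<partial>lborel)\<^sup>2"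
proof -
  have "(\<integral>\<^sup>+\<zeta>. ennreal (f (Re \<zeta>) * f (Im \<zeta>)) \<partial>lborel) =
      (\<integral>\<^sup>+\<zeta>. (\<Prod>b\<in>(Basis :: complex set). ennreal (f (\<zeta> \<bullet> b))) \<partial>lborel)"
    using assms(2) by (intro nn_integral_cong) (simp add: Basis_complex_def complex_eq_iff ennreal_mult)
  also have "\<dots> = (\<Prod>b\<in>(Basis :: complex set). \<integral>\<^sup>+t. ennreal (f t) \<partial>lborel)"
    by (rule nn_integral_lborel_prod) auto
  also have "\<dots> = (\<integral>\<^sup>+t. ennreal (f t) \<partial>lborel)\<^sup>2"
    by (simp add: Basis_complex_def power2_eq_square complex_eq_iff)
  finally show ?thesis .
qed

text \<open>
  The value is \<open>pi\<close>, and \<open>cauchy_kernel s\<close> regularizes the kernel \<open>1 / (pi * \<zeta>)\<close> that inverts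
  the antiholomorphic derivative: in \<open>1 / \<zeta> = cnj \<zeta> / (cmod \<zeta>)\<^sup>2\<close> the denominator is replaced by
  \<open>(cmod \<zeta>)\<^sup>2 + s\<^sup>2\<close>. Its antiholomorphic derivative is \<open>poisson_kernel s\<close>, an approximation of the
  identity.
\<close>

definition poisson_mass :: real where
  "poisson_mass = (LINT \<zeta>|(lborel :: complex measure). (inverse (\<zeta> \<bullet> \<zeta> + 1))\<^sup>2)"

definition poisson_kernel :: "real \<Rightarrow> complex \<Rightarrow> real" where
  "poisson_kernel s \<zeta> = s\<^sup>2 * (inverse (\<zeta> \<bullet> \<zeta> + s\<^sup>2))\<^sup>2 / poisson_mass"

definition cauchy_kernel :: "real \<Rightarrow> complex \<Rightarrow> complex" where
  "cauchy_kernel s \<zeta> = of_real (inverse (\<zeta> \<bullet> \<zeta> + s\<^sup>2) / poisson_mass) * cnj \<zeta>"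

lemma denom_pos: "s \<noteq> 0 \<Longrightarrow> \<zeta> \<bullet> \<zeta> + s\<^sup>2 > 0" for s :: real and \<zeta> :: complex
  by (simp add: add_nonneg_pos)

lemma poisson_base_integrable: "integrable lborel (\<lambda>\<zeta> :: complex. (inverse (\<zeta> \<bullet> \<zeta> + 1))\<^sup>2)"
proof (rule integrableI_bounded)
  have pos: "1 + t\<^sup>2 > 0" for t :: real by (simp add: add_pos_nonneg)
  have half: "(\<integral>\<^sup>+t. ennreal (inverse (1 + t\<^sup>2)) * indicator {0..} t \<partial>lborel) = ennreal (pi / 2 - arctan 0)"
    by (rule nn_integral_FTC_atLeast[OF _ DERIV_arctan _ tendsto_arctan_at_top])
      (use pos in \<open>auto simp: less_imp_le\<close>)
  have "(\<integral>\<^sup>+t. ennreal (inverse (1 + t\<^sup>2)) \<partial>lborel) \<le> 2 * (\<integral>\<^sup>+t. ennreal (inverse (1 + t\<^sup>2)) * indicator {0..} t \<partial>lborel)"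
    by (rule nn_integral_even_le) auto
  also have "\<dots> < top" unfolding half by (simp add: ennreal_mult_less_top)
  finally have fin: "(\<integral>\<^sup>+t. ennreal (inverse (1 + t\<^sup>2)) \<partial>lborel) < top" .
  have "(\<integral>\<^sup>+\<zeta>. ennreal (norm ((inverse (\<zeta> \<bullet> \<zeta> + 1))\<^sup>2)) \<partial>(lborel :: complex measure)) \<le>
      (\<integral>\<^sup>+\<zeta>. ennreal (inverse (1 + (Re \<zeta>)\<^sup>2) * inverse (1 + (Im \<zeta>)\<^sup>2)) \<partial>lborel)"
  proof (intro nn_integral_mono ennreal_leI)
    fix \<zeta> :: complex
    define a b where "a = (Re \<zeta>)\<^sup>2" and "b = (Im \<zeta>)\<^sup>2"
    have ab: "a \<ge> 0" "b \<ge> 0" by (auto simp: a_def b_def)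
    have "\<zeta> \<bullet> \<zeta> = a + b" by (simp add: inner_complex_def a_def b_def power2_eq_square)
    moreover have "(1 + a) * (1 + b) \<le> (a + b + 1)\<^sup>2"
      using ab by (simp add: power2_eq_square algebra_simps)
    then have "inverse ((a + b + 1)\<^sup>2) \<le> inverse ((1 + a) * (1 + b))"
      using ab by (intro le_imp_inverse_le) (auto intro!: mult_pos_pos)
    ultimately show "norm ((inverse (\<zeta> \<bullet> \<zeta> + 1))\<^sup>2) \<le> inverse (1 + (Re \<zeta>)\<^sup>2) * inverse (1 + (Im \<zeta>)\<^sup>2)"
      unfolding a_def[symmetric] b_def[symmetric] by (simp add: power_inverse)
  qed
  also have "\<dots> = (\<integral>\<^sup>+t. ennreal (inverse (1 + t\<^sup>2)) \<partial>lborel)\<^sup>2"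
    by (rule nn_integral_complex_prod) (use pos in \<open>auto simp: less_imp_le\<close>)
  also have "\<dots> < \<infinity>" using fin by (simp add: power_less_top_ennreal)
  finally show "(\<integral>\<^sup>+\<zeta>. ennreal (norm ((inverse (\<zeta> \<bullet> \<zeta> + 1))\<^sup>2)) \<partial>(lborel :: complex measure)) < \<infinity>" .
qed measurable

lemma poisson_mass_pos: "poisson_mass > 0"
proof -
  have "poisson_mass \<noteq> 0"
  proof
    assume "poisson_mass = 0"
    then have "AE \<zeta> in lborel. (inverse ((\<zeta> :: complex) \<bullet> \<zeta> + 1))\<^sup>2 = 0"
      unfolding poisson_mass_def
      by (subst (asm) integral_nonneg_eq_0_iff_AE[OF poisson_base_integrable]) auto
    moreover have "(inverse ((\<zeta> :: complex) \<bullet> \<zeta> + 1))\<^sup>2 \<noteq> 0" for \<zeta>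
      using denom_pos[of 1 \<zeta>] by simp
    ultimately have "AE \<zeta> in (lborel :: complex measure). False" by simp
    then show False by (simp add: eventually_False ae_filter_eq_bot_iff)
  qed
  moreover have "poisson_mass \<ge> 0" unfolding poisson_mass_def by simp
  ultimately show ?thesis by simp
qed

lemma smooth_cauchy_kernel: assumes "s \<noteq> 0" shows "smooth (cauchy_kernel s)"
proof -
  have "smooth (\<lambda>\<zeta> :: complex. inverse (\<zeta> \<bullet> \<zeta> + s\<^sup>2) * inverse poisson_mass)"
    using denom_pos[OF assms] by (intro smooth_mult smooth_inverse smooth_intros) (auto simp: less_imp_neq[symmetric])
  then have "smooth (\<lambda>\<zeta>. complex_of_real (inverse (\<zeta> \<bullet> \<zeta> + s\<^sup>2) * inverse poisson_mass) * cnj \<zeta>)"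
    by (rule smooth_mult[OF smooth_of_real smooth_cnj[OF smooth_ident]])
  then show ?thesis
    unfolding cauchy_kernel_def[abs_def] divide_inverse .
qed

lemma dbar_cauchy_kernel:
  assumes "s \<noteq> 0" shows "dbar_dir 1 \<i> (cauchy_kernel s) \<zeta> = of_real (poisson_kernel s \<zeta>)"
proof -
  let ?q = "\<zeta> \<bullet> \<zeta> + s\<^sup>2"
  have q: "?q \<noteq> 0" using denom_pos[OF assms, of \<zeta>] by simp
  let ?P = "\<lambda>t. inverse (t + s\<^sup>2) / poisson_mass"
  have P: "(?P has_real_derivative (- (inverse ?q * inverse ?q) / poisson_mass)) (at (\<zeta> \<bullet> \<zeta>))"
    using q poisson_mass_pos by (auto intro!: derivative_eq_intros simp: power2_eq_square)
  have "dbar_dir 1 \<i> (\<lambda>\<zeta> :: complex. of_real (?P (\<zeta> \<bullet> \<zeta>))) \<zeta> =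
      of_real (- (inverse ?q * inverse ?q) / poisson_mass) * (of_real (\<zeta> \<bullet> 1) + \<i> * of_real (\<zeta> \<bullet> \<i>))"
    by (rule dbar_dir_radial[OF bounded_linear_ident P])
  also have "of_real (\<zeta> \<bullet> 1) + \<i> * of_real (\<zeta> \<bullet> \<i>) = \<zeta>"
    by (simp add: inner_complex_def complex_eq_iff)
  finally have 1: "dbar_dir 1 \<i> (\<lambda>\<zeta> :: complex. of_real (?P (\<zeta> \<bullet> \<zeta>))) \<zeta> =
      of_real (- (inverse ?q * inverse ?q) / poisson_mass) * \<zeta>" .
  have 2: "dbar_dir 1 \<i> cnj \<zeta> = 1"
    using dbar_dir_eqI[OF bounded_linear_imp_has_derivative[OF bounded_linear_cnj], of 1 \<i>] by simp
  have sm: "smooth (\<lambda>\<zeta> :: complex. complex_of_real (?P (\<zeta> \<bullet> \<zeta>)))"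
    unfolding divide_inverse using denom_pos[OF assms]
    by (intro smooth_of_real smooth_mult smooth_inverse smooth_intros) (auto simp: less_imp_neq[symmetric])
  have "dbar_dir 1 \<i> (cauchy_kernel s) \<zeta> =
      of_real (- (inverse ?q * inverse ?q) / poisson_mass) * \<zeta> * cnj \<zeta> + of_real (?P (\<zeta> \<bullet> \<zeta>))"
    unfolding cauchy_kernel_def[abs_def]
    unfolding dbar_dir_mult[OF sm smooth_cnj[OF smooth_ident]] 1 2 by simp
  also have "\<dots> = of_real (- (inverse ?q * inverse ?q) / poisson_mass * (\<zeta> \<bullet> \<zeta>) + ?P (\<zeta> \<bullet> \<zeta>))"
    by (simp add: inner_eq_cmod2 complex_norm_square[symmetric] mult.assoc)
  also have "- (inverse ?q * inverse ?q) / poisson_mass * (\<zeta> \<bullet> \<zeta>) + ?P (\<zeta> \<bullet> \<zeta>) = poisson_kernel s \<zeta>"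
  proof -
    have "?P (\<zeta> \<bullet> \<zeta>) = inverse ?q * inverse ?q * ?q / poisson_mass" using q by simp
    moreover have "- (i * i) / m * a + i * i * (a + s\<^sup>2) / m = s\<^sup>2 * i\<^sup>2 / m" for i m a :: real
      by (simp add: power2_eq_square algebra_simps add_divide_distrib)
    ultimately show ?thesis by (simp only: poisson_kernel_def)
  qed
  finally show ?thesis .
qed

text \<open>
  This product form reduces the integral of the kernel over a disc to the integral of
  \<open>1 / sqrt \<bar>t\<bar>\<close> over an interval.
\<close>

lemma cauchy_kernel_bound:
  assumes s: "s > 0"
  shows "cmod (cauchy_kernel s \<zeta>) \<le>
    inverse (sqrt (\<bar>Re \<zeta>\<bar> + s / 2)) * inverse (sqrt (\<bar>Im \<zeta>\<bar> + s / 2)) / poisson_mass"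
proof -
  define q a b where "q = \<zeta> \<bullet> \<zeta> + s\<^sup>2" and "a = \<bar>Re \<zeta>\<bar> + s / 2" and "b = \<bar>Im \<zeta>\<bar> + s / 2"
  have ab: "a > 0" "b > 0" and q: "q > 0" using s denom_pos[of s \<zeta>] by (auto simp: a_def b_def q_def)
  have "a * b \<le> (a\<^sup>2 + b\<^sup>2) / 2" using sum_squares_bound[of a b] by simp
  also have "\<dots> \<le> (2 * (Re \<zeta>)\<^sup>2 + 2 * (s / 2)\<^sup>2 + (2 * (Im \<zeta>)\<^sup>2 + 2 * (s / 2)\<^sup>2)) / 2"
  proof -
    have "(x + y)\<^sup>2 \<le> 2 * x\<^sup>2 + 2 * y\<^sup>2" for x y :: real
      using sum_squares_bound[of x y] by (simp add: power2_sum)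
    from this[of "\<bar>Re \<zeta>\<bar>" "s / 2"] this[of "\<bar>Im \<zeta>\<bar>" "s / 2"] show ?thesis
      unfolding a_def b_def by simp
  qed
  also have "\<dots> \<le> q"
    unfolding q_def inner_complex_def by (simp add: power2_eq_square field_simps)
  finally have le: "a * b \<le> q" .
  have "(cmod \<zeta>)\<^sup>2 \<le> q" by (simp add: q_def inner_eq_cmod2)
  then have "cmod \<zeta> \<le> sqrt q" by (simp add: real_le_rsqrt)
  then have "cmod \<zeta> * inverse q \<le> sqrt q * inverse q" using q by (intro mult_right_mono) auto
  also have "\<dots> = inverse (sqrt q)"
    using q real_sqrt_mult_self[of q] by (simp add: field_simps)
  also have "\<dots> \<le> inverse (sqrt (a * b))" using le ab by (intro le_imp_inverse_le) auto
  also have "\<dots> = inverse (sqrt a) * inverse (sqrt b)" by (simp add: real_sqrt_mult)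
  finally have "cmod \<zeta> * inverse q / poisson_mass \<le> inverse (sqrt a) * inverse (sqrt b) / poisson_mass"
    using poisson_mass_pos by (intro divide_right_mono) auto
  moreover have "cmod (cauchy_kernel s \<zeta>) = cmod \<zeta> * inverse q / poisson_mass"
    using poisson_mass_pos q unfolding cauchy_kernel_def q_def[symmetric]
    by (simp add: norm_mult norm_divide norm_inverse)
  ultimately show ?thesis by (simp add: a_def b_def)
qed

text \<open>
  The bound is linear in the radius and uniform in \<open>s\<close>; this is where solving in a small disc wins
  a small factor.
\<close>

lemma cauchy_kernel_mass:
  assumes s: "s > 0" and R: "R > 0"
  shows "(\<integral>\<^sup>+\<zeta>. ennreal (cmod (cauchy_kernel s \<zeta> * indicator (cball 0 R) \<zeta>)) \<partial>lborel) \<le> ennreal (16 * R / poisson_mass)"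
proof -
  define f where "f t = inverse (sqrt (\<bar>t\<bar> + s / 2)) * indicator {- R..R} t" for t :: real
  have [measurable]: "f \<in> borel_measurable borel" unfolding f_def[abs_def] by measurable
  have f0: "f t \<ge> 0" for t using s by (simp add: f_def)
  have "(\<integral>\<^sup>+t. ennreal (f t) \<partial>lborel) \<le> 2 * (\<integral>\<^sup>+t. ennreal (f t) * indicator {0..} t \<partial>lborel)"
    by (rule nn_integral_even_le) (auto simp: f_def indicator_def)
  also have "(\<integral>\<^sup>+t. ennreal (f t) * indicator {0..} t \<partial>lborel) =
      (\<integral>\<^sup>+t. ennreal (inverse (sqrt (\<bar>t\<bar> + s / 2))) * indicator {0..R} t \<partial>lborel)"
    using R by (intro nn_integral_cong) (auto simp: f_def indicator_def)
  also have "\<dots> = ennreal (2 * sqrt (R + s / 2) - 2 * sqrt (0 + s / 2))"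
  proof (rule nn_integral_FTC_Icc)
    fix t :: real assume t: "t \<in> {0..R}"
    then have p: "t + s / 2 > 0" using s by (intro add_nonneg_pos) auto
    have "((\<lambda>t. 2 * sqrt (t + s / 2)) has_real_derivative inverse (sqrt (t + s / 2))) (at t)"
      using p by (auto intro!: derivative_eq_intros simp: field_simps)
    then show "((\<lambda>t. 2 * sqrt (t + s / 2)) has_real_derivative inverse (sqrt (\<bar>t\<bar> + s / 2))) (at t)"
      using t by simp
  qed (use s R in auto)
  also have "\<dots> \<le> ennreal (2 * sqrt R)"
  proof (rule ennreal_leI)
    have "sqrt (R + s / 2) \<le> sqrt R + sqrt (s / 2)"
      using R s by (intro real_le_lsqrt) (auto simp: power2_sum)
    then show "2 * sqrt (R + s / 2) - 2 * sqrt (0 + s / 2) \<le> 2 * sqrt R" by simp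
  qed
  finally have F: "(\<integral>\<^sup>+t. ennreal (f t) \<partial>lborel) \<le> ennreal (4 * sqrt R)"
    by (simp add: two_mult_ennreal mult_left_mono)
  have "(\<integral>\<^sup>+\<zeta>. ennreal (cmod (cauchy_kernel s \<zeta> * indicator (cball 0 R) \<zeta>)) \<partial>lborel) \<le>
      (\<integral>\<^sup>+\<zeta>. ennreal (inverse poisson_mass) * ennreal (f (Re \<zeta>) * f (Im \<zeta>)) \<partial>lborel)"
  proof (rule nn_integral_mono)
    fix \<zeta>
    show "ennreal (cmod (cauchy_kernel s \<zeta> * indicator (cball 0 R) \<zeta>)) \<le>
        ennreal (inverse poisson_mass) * ennreal (f (Re \<zeta>) * f (Im \<zeta>))"
    proof (cases "cmod \<zeta> \<le> R")
      case True
      then have "\<bar>Re \<zeta>\<bar> \<le> R" "\<bar>Im \<zeta>\<bar> \<le> R" using abs_Re_le_cmod abs_Im_le_cmod order_trans by blast+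
      then have "cmod (cauchy_kernel s \<zeta>) \<le> inverse poisson_mass * (f (Re \<zeta>) * f (Im \<zeta>))"
      proof -
        assume "\<bar>Re \<zeta>\<bar> \<le> R" "\<bar>Im \<zeta>\<bar> \<le> R"
        then have "f (Re \<zeta>) = inverse (sqrt (\<bar>Re \<zeta>\<bar> + s / 2))" "f (Im \<zeta>) = inverse (sqrt (\<bar>Im \<zeta>\<bar> + s / 2))"
          by (simp_all add: f_def abs_le_iff)
        then show ?thesis
          using cauchy_kernel_bound[OF s, of \<zeta>]
          by (simp only: divide_inverse mult.commute[of "inverse poisson_mass"])
      qed
      then show ?thesis using True poisson_mass_pos f0 by (simp add: ennreal_mult[symmetric])
    qed simp
  qed
  also have "\<dots> = ennreal (inverse poisson_mass) * (\<integral>\<^sup>+t. ennreal (f t) \<partial>lborel)\<^sup>2"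
    by (simp add: nn_integral_cmult nn_integral_complex_prod f0)
  also have "\<dots> \<le> ennreal (inverse poisson_mass) * (ennreal (4 * sqrt R))\<^sup>2"
    by (intro mult_left_mono power_mono F) auto
  also have "\<dots> = ennreal (16 * R / poisson_mass)"
    using R poisson_mass_pos by (simp add: ennreal_power ennreal_mult[symmetric] power_mult_distrib field_simps)
  finally show ?thesis .
qed

definition poisson_measure :: "complex measure" where
  "poisson_measure = density lborel (\<lambda>\<zeta>. ennreal ((inverse (\<zeta> \<bullet> \<zeta> + 1))\<^sup>2 / poisson_mass))"

lemma sets_poisson_measure [measurable_cong]: "sets poisson_measure = sets borel"
  and space_poisson_measure [simp]: "space poisson_measure = UNIV"
  by (simp_all add: poisson_measure_def)

lemma emeasure_poisson_measure: "emeasure poisson_measure UNIV = 1"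
proof -
  have "emeasure poisson_measure UNIV = (\<integral>\<^sup>+\<zeta>. ennreal ((inverse (\<zeta> \<bullet> \<zeta> + 1))\<^sup>2 / poisson_mass) \<partial>(lborel :: complex measure))"
    unfolding poisson_measure_def by (subst emeasure_density) auto
  also have "\<dots> = ennreal (LINT \<zeta>|(lborel :: complex measure). (inverse (\<zeta> \<bullet> \<zeta> + 1))\<^sup>2 / poisson_mass)"
    using poisson_base_integrable poisson_mass_pos by (intro nn_integral_eq_integral) auto
  also have "(LINT \<zeta>|(lborel :: complex measure). (inverse (\<zeta> \<bullet> \<zeta> + 1))\<^sup>2 / poisson_mass) = 1"
    using poisson_mass_pos by (simp add: poisson_mass_def[symmetric])
  finally show ?thesis by simp
qed

lemma poisson_kernel_scale:
  assumes "s > 0" shows "s\<^sup>2 * poisson_kernel s (s *\<^sub>R \<zeta>) = (inverse (\<zeta> \<bullet> \<zeta> + 1))\<^sup>2 / poisson_mass"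
proof -
  have "(s *\<^sub>R \<zeta>) \<bullet> (s *\<^sub>R \<zeta>) + s\<^sup>2 = s\<^sup>2 * (\<zeta> \<bullet> \<zeta> + 1)" by (simp add: power2_eq_square algebra_simps)
  moreover have "s\<^sup>2 * (s\<^sup>2 * (inverse (s\<^sup>2 * q))\<^sup>2 / m) = (inverse q)\<^sup>2 / m" if "q > 0" for q m :: real
    using assms that by (simp add: power2_eq_square field_simps)
  ultimately show ?thesis
    using denom_pos[of 1 \<zeta>] by (simp add: poisson_kernel_def)
qed

lemma poisson_kernel_measurable [measurable]: "poisson_kernel s \<in> borel_measurable borel"
  unfolding poisson_kernel_def[abs_def] by measurable

lemma poisson_kernel_nonneg: "poisson_kernel s \<zeta> \<ge> 0"
  using poisson_mass_pos by (simp add: poisson_kernel_def)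

lemma pconv_poisson:
  assumes [measurable]: "k \<in> borel_measurable borel" and s: "s > 0"
  shows "pconv k (\<lambda>\<zeta>. of_real (poisson_kernel s \<zeta>)) x = (LINT \<zeta>|poisson_measure. k (x - s *\<^sub>R axis0 \<zeta>))"
proof -
  have lin: "axis0 (s *\<^sub>R \<zeta>) = s *\<^sub>R axis0 \<zeta>" for \<zeta>
    using bounded_linear_axis0 by (rule linear_simps(5))
  have "pconv k (\<lambda>\<zeta>. of_real (poisson_kernel s \<zeta>)) x =
      (LINT \<zeta>|density (distr lborel borel (\<lambda>\<zeta>. 0 + s *\<^sub>R \<zeta>)) (\<lambda>_. ennreal (\<bar>s\<bar> ^ DIM(complex))).
        of_real (poisson_kernel s \<zeta>) * k (x - axis0 \<zeta>))"
    unfolding pconv_def using lborel_affine[of s "0 :: complex"] s by (intro arg_cong2[where f = "integral\<^sup>L"]) auto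
  also have "\<dots> = (LINT \<zeta>|distr lborel borel (\<lambda>\<zeta>. 0 + s *\<^sub>R \<zeta>).
      (s\<^sup>2) *\<^sub>R (of_real (poisson_kernel s \<zeta>) * k (x - axis0 \<zeta>)))"
    using s by (subst integral_density) auto
  also have "\<dots> = (LINT \<zeta>|lborel. (s\<^sup>2) *\<^sub>R (of_real (poisson_kernel s (0 + s *\<^sub>R \<zeta>)) * k (x - axis0 (0 + s *\<^sub>R \<zeta>))))"
    by (subst integral_distr) auto
  also have "\<dots> = (LINT \<zeta>|lborel. ((inverse (\<zeta> \<bullet> \<zeta> + 1))\<^sup>2 / poisson_mass) *\<^sub>R k (x - s *\<^sub>R axis0 \<zeta>))"
    unfolding poisson_kernel_scale[OF s, symmetric]
  proof (rule Bochner_Integration.integral_cong[OF refl])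
    fix \<zeta>
    have "(s\<^sup>2) *\<^sub>R (complex_of_real a * z) = (s\<^sup>2 * a) *\<^sub>R z" for a z
      by (simp add: scaleR_conv_of_real)
    then show "(s\<^sup>2) *\<^sub>R (of_real (poisson_kernel s (0 + s *\<^sub>R \<zeta>)) * k (x - axis0 (0 + s *\<^sub>R \<zeta>))) =
        (s\<^sup>2 * poisson_kernel s (s *\<^sub>R \<zeta>)) *\<^sub>R k (x - s *\<^sub>R axis0 \<zeta>)"
      by (simp only: add_0_left lin)
  qed
  also have "\<dots> = (LINT \<zeta>|poisson_measure. k (x - s *\<^sub>R axis0 \<zeta>))"
    unfolding poisson_measure_def using poisson_mass_pos by (subst integral_density) auto
  finally show ?thesis .
qed

lemma pconv_poisson_tendsto:
  assumes k: "L2on T k" and s: "\<And>n. s n > 0" "s \<longlonglongrightarrow> 0"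
  shows "(\<lambda>n. l2 T (\<lambda>x. pconv k (\<lambda>\<zeta>. of_real (poisson_kernel (s n) \<zeta>)) x - k x)) \<longlonglongrightarrow> 0"
  unfolding pconv_poisson[OF L2on_measurable[OF k] s(1)]
proof (rule l2_average_tendsto[where C = 1 and N = poisson_measure])
  show "finite_measure poisson_measure"
    by (rule finite_measureI) (simp add: emeasure_poisson_measure)
  show "emeasure poisson_measure (space poisson_measure) = 1" by (simp add: emeasure_poisson_measure)
  show "(\<lambda>(x, y). x - s n *\<^sub>R axis0 y) \<in> borel \<Otimes>\<^sub>M poisson_measure \<rightarrow>\<^sub>M borel" for n
    by measurable
  show "(\<integral>\<^sup>+x. h (x - s n *\<^sub>R axis0 y) \<partial>lborel) \<le> ennreal 1 * (\<integral>\<^sup>+x. h x \<partial>lborel)"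
    if "h \<in> borel_measurable borel" for h n y
    using nn_integral_translate[OF that, of "- s n *\<^sub>R axis0 y"] by simp
  show "uniform_limit T (\<lambda>n x. x - s n *\<^sub>R axis0 y) (\<lambda>x. x) sequentially" for y
  proof (rule uniform_limitI)
    fix e :: real assume e: "e > 0"
    have "(\<lambda>n. s n * norm (axis0 y)) \<longlonglongrightarrow> 0 * norm (axis0 y)" by (intro tendsto_intros s)
    then have "eventually (\<lambda>n. s n * norm (axis0 y) < e) sequentially"
      using e by (intro order_tendstoD) auto
    then show "eventually (\<lambda>n. \<forall>x\<in>T. dist (x - s n *\<^sub>R axis0 y) x < e) sequentially"
      by eventually_elim (use s(1) in \<open>simp add: dist_norm abs_of_pos\<close>)
  qed
qed (use k bounded_T in \<open>auto simp: L2on_def\<close>)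

lemma poisson_kernel_integrable:
  assumes s: "0 < s" "s \<le> 1" shows "integrable lborel (\<lambda>\<zeta>. complex_of_real (poisson_kernel s \<zeta>))"
proof -
  have "integrable lborel (poisson_kernel s)"
  proof (rule Bochner_Integration.integrable_bound)
    show "integrable lborel (\<lambda>\<zeta> :: complex. s\<^sup>2 * (inverse (s\<^sup>2) * inverse (s\<^sup>2)) / poisson_mass * (inverse (\<zeta> \<bullet> \<zeta> + 1))\<^sup>2)"
      by (intro integrable_mult_right poisson_base_integrable)
    show "AE \<zeta> in lborel. norm (poisson_kernel s \<zeta>) \<le>
        norm (s\<^sup>2 * (inverse (s\<^sup>2) * inverse (s\<^sup>2)) / poisson_mass * (inverse (\<zeta> \<bullet> \<zeta> + 1))\<^sup>2)"
    proof (intro AE_I2)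
      fix \<zeta> :: complex
      have s2: "s\<^sup>2 > 0" "s\<^sup>2 \<le> 1" using s by (auto simp: power_le_one)
      have "s\<^sup>2 * (\<zeta> \<bullet> \<zeta>) \<le> 1 * (\<zeta> \<bullet> \<zeta>)" using s2 by (intro mult_right_mono) auto
      then have "s\<^sup>2 * (\<zeta> \<bullet> \<zeta> + 1) \<le> \<zeta> \<bullet> \<zeta> + s\<^sup>2" by (simp add: distrib_left)
      then have "inverse (\<zeta> \<bullet> \<zeta> + s\<^sup>2) \<le> inverse (s\<^sup>2 * (\<zeta> \<bullet> \<zeta> + 1))"
        using s2 denom_pos[of 1 \<zeta>] by (intro le_imp_inverse_le) auto
      then have "(inverse (\<zeta> \<bullet> \<zeta> + s\<^sup>2))\<^sup>2 \<le> (inverse (s\<^sup>2 * (\<zeta> \<bullet> \<zeta> + 1)))\<^sup>2"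
        using denom_pos[of s \<zeta>] s by (intro power_mono) auto
      then have "poisson_kernel s \<zeta> \<le> s\<^sup>2 * (inverse (s\<^sup>2 * (\<zeta> \<bullet> \<zeta> + 1)))\<^sup>2 / poisson_mass"
        unfolding poisson_kernel_def using poisson_mass_pos by (intro divide_right_mono mult_left_mono) auto
      also have "\<dots> = s\<^sup>2 * (inverse (s\<^sup>2) * inverse (s\<^sup>2)) / poisson_mass * (inverse (\<zeta> \<bullet> \<zeta> + 1))\<^sup>2"
        by (simp add: power2_eq_square)
      finally show "norm (poisson_kernel s \<zeta>) \<le>
        norm (s\<^sup>2 * (inverse (s\<^sup>2) * inverse (s\<^sup>2)) / poisson_mass * (inverse (\<zeta> \<bullet> \<zeta> + 1))\<^sup>2)"
        using poisson_kernel_nonneg[of s \<zeta>] poisson_mass_pos by (simp add: abs_of_nonneg)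
    qed
  qed measurable
  then show ?thesis by (rule integrable_of_real)
qed

lemma cutoff_kernel_integrable:
  assumes "s > 0" "R > 0"
  shows "integrable lborel (\<lambda>\<zeta>. cauchy_kernel s \<zeta> * indicator (cball 0 R) \<zeta>)"
proof (rule integrableI_bounded)
  show "(\<lambda>\<zeta>. cauchy_kernel s \<zeta> * indicator (cball 0 R) \<zeta>) \<in> borel_measurable lborel"
    using smooth_measurable[OF smooth_cauchy_kernel[of s]] assms
    by (intro borel_measurable_times borel_measurable_indicator) auto
  show "(\<integral>\<^sup>+\<zeta>. ennreal (cmod (cauchy_kernel s \<zeta> * indicator (cball 0 R) \<zeta>)) \<partial>lborel) < \<infinity>"
    using cauchy_kernel_mass[OF assms] by (rule le_less_trans) simp
qed

text \<open>
  On a slice in the first coordinate, the convolution with the Cauchy kernel is, up to the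
  smoothing by the Poisson kernel, a right inverse of the first antiholomorphic derivative. Two
  points of the slice of the triangle at \<open>w\<close> have distance less than \<open>2 * cmod w\<close>, so that the kernel
  may be cut off at the radius \<open>R\<close> without changing anything on the triangle.
\<close>

lemma weak_div_pconv:
  assumes k: "L2on T k" and kR: "\<And>x. k x \<noteq> 0 \<Longrightarrow> 2 * cmod (x $ 1) \<le> R" and R: "R > 0"
    and s: "0 < s" "s \<le> 1"
  shows "weak_div T (\<lambda>j x. if j = 0 then indicator T x * pconv k (\<lambda>\<zeta>. cauchy_kernel s \<zeta> * indicator (cball 0 R) \<zeta>) x else 0)
    (\<lambda>x. indicator T x * pconv k (\<lambda>\<zeta>. of_real (poisson_kernel s \<zeta>)) x)"
  unfolding weak_div_def
proof (intro allI impI)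
  fix \<phi> assume \<phi>: "test_fun T \<phi>"
  let ?K = "\<lambda>\<zeta>. cauchy_kernel s \<zeta> * indicator (cball 0 R) \<zeta>"
  let ?P = "\<lambda>\<zeta>. complex_of_real (poisson_kernel s \<zeta>)"
  note cs = test_fun_csmooth[OF \<phi>]
  note sm = csmooth_imp_smooth[OF cs]
  have z: "dzbar j \<phi> x = 0" if "x \<notin> T" for j x
    using test_fun_derivative_zero[OF \<phi> that] by (simp add: dzbar_def)
  obtain B where B: "\<And>x. cmod (\<phi> x) \<le> B" using csmooth_bounded[OF cs] by metis
  obtain B' where B': "\<And>x. cmod (dzbar 0 \<phi> x) \<le> B'" using csmooth_bounded[OF csmooth_dzbar[OF cs]] by metis
  note ki = L2on_integrable[OF k bounded_T]
  have lhs: "(LINT x|lborel. indicator T x * pconv k ?P x * \<phi> x) =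
      (LINT y|lborel. k y * (LINT \<zeta>|lborel. ?P \<zeta> * \<phi> (y + axis0 \<zeta>)))"
  proof -
    have "(LINT x|lborel. indicator T x * pconv k ?P x * \<phi> x) = (LINT x|lborel. pconv k ?P x * \<phi> x)"
      using test_fun_zero[OF \<phi>] by (intro Bochner_Integration.integral_cong) (auto simp: indicator_def)
    also have "\<dots> = (LINT y|lborel. k y * (LINT \<zeta>|lborel. ?P \<zeta> * \<phi> (y + axis0 \<zeta>)))"
      by (rule pconv_pairing[OF ki poisson_kernel_integrable[OF s] csmooth_measurable[OF cs] B])
    finally show ?thesis .
  qed
  have rhs: "(LINT x|lborel. indicator T x * pconv k ?K x * dzbar 0 \<phi> x) =
      (LINT y|lborel. k y * (LINT \<zeta>|lborel. ?K \<zeta> * dzbar 0 \<phi> (y + axis0 \<zeta>)))"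
  proof -
    have "(LINT x|lborel. indicator T x * pconv k ?K x * dzbar 0 \<phi> x) = (LINT x|lborel. pconv k ?K x * dzbar 0 \<phi> x)"
      using z by (intro Bochner_Integration.integral_cong) (auto simp: indicator_def)
    also have "\<dots> = (LINT y|lborel. k y * (LINT \<zeta>|lborel. ?K \<zeta> * dzbar 0 \<phi> (y + axis0 \<zeta>)))"
      by (rule pconv_pairing[OF ki cutoff_kernel_integrable[OF s(1) R] csmooth_measurable[OF csmooth_dzbar[OF cs]] B'])
    finally show ?thesis .
  qed
  have pt: "k y * (LINT \<zeta>|lborel. ?P \<zeta> * \<phi> (y + axis0 \<zeta>)) =
      - (k y * (LINT \<zeta>|lborel. ?K \<zeta> * dzbar 0 \<phi> (y + axis0 \<zeta>)))" for y
  proof (cases "k y = 0")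
    case False
    then have y: "y \<in> T" "2 * cmod (y $ 1) \<le> R" using k kR by (auto simp: L2on_def)
    let ?\<psi> = "\<lambda>\<zeta>. \<phi> (y + axis0 \<zeta>)"
    have "((\<lambda>\<zeta>. y + axis0 \<zeta>) has_derivative axis0) (at \<zeta>)" for \<zeta>
      using has_derivative_add[OF has_derivative_const bounded_linear_imp_has_derivative[OF bounded_linear_axis0], of y]
      by simp
    from diff_chain_at[OF this smooth_has_derivative[OF sm]]
    have d: "(?\<psi> has_derivative (\<lambda>v. frechet_derivative \<phi> (at (y + axis0 \<zeta>)) (axis0 v))) (at \<zeta>)" for \<zeta>
      by (simp add: o_def)
    have dz: "dzbar 0 \<phi> (y + axis0 \<zeta>) = dbar_dir 1 \<i> ?\<psi> \<zeta>" for \<zeta>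
    proof -
      have "axis 0 c = axis0 c" for c by (simp add: axis0_def)
      then show ?thesis by (simp only: dbar_dir_eqI[OF d] dzbar_def)
    qed
    have far: "y + axis0 \<zeta> \<notin> T" if "\<zeta> \<notin> cball 0 R" for \<zeta>
    proof
      assume "y + axis0 \<zeta> \<in> T"
      then have "cmod (y $ 0 + \<zeta>) < cmod (y $ 1)" "cmod (y $ 0) < cmod (y $ 1)"
        using y by (auto simp: hartogs_triangle_def)
      then have "cmod \<zeta> \<le> R"
        using norm_triangle_ineq4[of "y $ 0 + \<zeta>" "y $ 0"] y(2) by simp
      with that show False by simp
    qed
    have \<psi>: "csmooth ?\<psi>"
    proof (rule csmoothI[of _ "cball 0 R"])
      show "smooth ?\<psi>"
        by (rule smooth_compose[OF sm]) (intro smooth_add smooth_const smooth_linear[OF bounded_linear_axis0 smooth_ident])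
      show "\<zeta> \<in> cball 0 R" if "?\<psi> \<zeta> \<noteq> 0" for \<zeta>
        using far test_fun_zero[OF \<phi>] that by blast
    qed simp
    have "?K \<zeta> * dzbar 0 \<phi> (y + axis0 \<zeta>) = cauchy_kernel s \<zeta> * dbar_dir 1 \<i> ?\<psi> \<zeta>" for \<zeta>
      using far[of \<zeta>] z by (cases "\<zeta> \<in> cball 0 R") (auto simp: dz[symmetric])
    then have "(LINT \<zeta>|lborel. ?K \<zeta> * dzbar 0 \<phi> (y + axis0 \<zeta>)) = (LINT \<zeta>|lborel. cauchy_kernel s \<zeta> * dbar_dir 1 \<i> ?\<psi> \<zeta>)"
      by (simp only:)
    also have "\<dots> = - (LINT \<zeta>|lborel. dbar_dir 1 \<i> (cauchy_kernel s) \<zeta> * ?\<psi> \<zeta>)"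
      by (rule integral_by_parts_dbar[OF smooth_cauchy_kernel \<psi>]) (use s in simp)
    also have "\<dots> = - (LINT \<zeta>|lborel. ?P \<zeta> * \<phi> (y + axis0 \<zeta>))"
      using s by (simp add: dbar_cauchy_kernel)
    finally show ?thesis by simp
  qed simp
  show "(LINT x|lborel. indicator T x * pconv k ?P x * \<phi> x) =
      (\<Sum>j\<in>UNIV. - (LINT x|lborel. (if j = 0 then indicator T x * pconv k ?K x else 0) * dzbar j \<phi> x))"
    unfolding sum_2' using lhs rhs by (simp only: pt) simp
qed

lemma l2_indicator_T: "l2 UNIV (\<lambda>x. indicator T x * u x) = l2 T u"
proof -
  have "l2 UNIV (\<lambda>x. indicator T x * u x) = l2 T (\<lambda>x. indicator T x * u x)"
    by (rule l2_support) (auto simp: indicator_def)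
  also have "\<dots> = l2 T u" by (rule l2_cong) auto
  finally show ?thesis .
qed

lemma L2on_restrict: "u \<in> borel_measurable borel \<Longrightarrow> l2 T u < top \<Longrightarrow> L2on T (\<lambda>x. indicator T x * u x)"
  by (simp add: L2on_def l2_indicator_T)

text \<open>
  The cutoff changes the right-hand side by \<open>k = dzbar 1 \<eta> * f 1\<close>, whose norm is only bounded, as
  \<open>k\<close> is of size \<open>C / \<epsilon>\<close> times \<open>f 1\<close>. But \<open>k\<close> is supported in slices of diameter comparable to \<open>\<epsilon>\<close>,
  so that solving for \<open>k\<close> in the slices wins the factor \<open>\<epsilon>\<close> back; and the norm of \<open>f 1\<close> over the
  support of the cutoff's derivative tends to zero.
\<close>

lemma localize_field:
  assumes f: "\<And>k. L2on T (f k)" and g: "L2on T g" and w: "weak_div T f g" and e: "(e :: real) > 0"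
  obtains f' g' \<epsilon> where "0 < \<epsilon>" "\<And>k. L2on T (f' k)" "L2on T g'" "weak_div T f' g'"
    "\<And>k x. cmod (x $ 1) < \<epsilon> \<Longrightarrow> f' k x = 0" "\<And>x. cmod (x $ 1) < \<epsilon> \<Longrightarrow> g' x = 0"
    "\<And>k. l2 T (\<lambda>x. f' k x - f k x) \<le> ennreal e" "l2 T (\<lambda>x. g' x - g x) \<le> ennreal e"
proof -
  obtain C where C: "C > 0"
    "\<And>\<epsilon> x. \<epsilon> > 0 \<Longrightarrow> cmod (dzbar 1 (punct_cutoff \<epsilon>) x) \<le> C / \<epsilon>"
    "\<And>\<epsilon> x. \<epsilon> > 0 \<Longrightarrow> cmod (x $ 1) < \<epsilon> \<or> cmod (x $ 1) > 2 * \<epsilon> \<Longrightarrow> dzbar 1 (punct_cutoff \<epsilon>) x = 0"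
    "\<And>\<epsilon> x. \<epsilon> > 0 \<Longrightarrow> dzbar 0 (punct_cutoff \<epsilon>) x = 0"
    by (rule dzbar_punct_cutoff) (rule that)
  define d where "d n = 1 / real (Suc n)" for n
  have d: "d n > 0" for n by (simp add: d_def)
  have dlim: "d \<longlonglongrightarrow> 0" unfolding d_def using LIMSEQ_inverse_real_of_nat by (simp add: inverse_eq_divide)
  \<comment> \<open>The square of the kernel mass \<open>16 * (4 * \<epsilon>) / poisson_mass\<close> times the bound \<open>C / \<epsilon>\<close> of the
    cutoff's derivative; here \<open>\<epsilon>\<close> cancels.\<close>
  define M where "M = (64 * C / poisson_mass)\<^sup>2"
  have M: "M \<ge> 0" by (simp add: M_def)
  let ?in = "\<lambda>n x. indicator {x :: complex ^ 2. cmod (x $ 1) \<le> 2 * d n} x :: complex"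
  have m [measurable]: "f k \<in> borel_measurable borel" "g \<in> borel_measurable borel" for k
    using L2on_measurable[OF f] L2on_measurable[OF g] by auto
  have in_meas [measurable]: "{x :: complex ^ 2. cmod (x $ 1) \<le> r} \<in> sets borel" for r
    by (intro borel_closed closed_Collect_le continuous_intros)
  have inlim: "(\<lambda>n. l2 T (\<lambda>x. (1 - ?in n x) * f 1 x - f 1 x)) \<longlonglongrightarrow> 0"
  proof (rule cutoff_tendsto[OF f])
    show "cmod (1 - ?in n x - 1) \<le> 1" for n x by (simp add: indicator_def)
    fix x assume "x \<in> T"
    then have "cmod (x $ 1) / 2 > 0" by (auto simp: hartogs_triangle_def intro: le_less_trans[OF norm_ge_zero])
    from order_tendstoD(2)[OF dlim this]
    have "eventually (\<lambda>n. 1 - ?in n x = 1) sequentially"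
      by eventually_elim (simp add: indicator_def)
    then show "(\<lambda>n. 1 - ?in n x) \<longlonglongrightarrow> 1" by (rule tendsto_eventually)
  qed measurable
  have ev: "eventually (\<lambda>n. u n < ennreal r) sequentially" if "u \<longlonglongrightarrow> 0" "r > 0" for u r
    using order_tendstoD(2)[OF that(1), of "ennreal r"] that(2) by simp
  have "eventually (\<lambda>n. l2 T (\<lambda>x. punct_cutoff (d n) x * f 0 x - f 0 x) < ennreal (e / 4) \<and>
      l2 T (\<lambda>x. punct_cutoff (d n) x * f 1 x - f 1 x) < ennreal (e / 4) \<and>
      l2 T (\<lambda>x. punct_cutoff (d n) x * g x - g x) < ennreal (e / 4) \<and>
      l2 T (\<lambda>x. (1 - ?in n x) * f 1 x - f 1 x) < ennreal (e / (4 * (M + 1)))) sequentially"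
    using e M by (intro eventually_conj ev punct_cutoff_tendsto f g d dlim inlim) auto
  then obtain n where n: "l2 T (\<lambda>x. punct_cutoff (d n) x * f 0 x - f 0 x) < ennreal (e / 4)"
    "l2 T (\<lambda>x. punct_cutoff (d n) x * f 1 x - f 1 x) < ennreal (e / 4)"
    "l2 T (\<lambda>x. punct_cutoff (d n) x * g x - g x) < ennreal (e / 4)"
    "l2 T (\<lambda>x. (1 - ?in n x) * f 1 x - f 1 x) < ennreal (e / (4 * (M + 1)))"
    by (auto simp: eventually_sequentially)
  define \<epsilon> where "\<epsilon> = d n"
  have \<epsilon>: "\<epsilon> > 0" using d by (simp add: \<epsilon>_def)
  define \<kappa> where "\<kappa> = punct_cutoff \<epsilon>"
  have \<kappa>: "smooth \<kappa>" unfolding \<kappa>_def using \<epsilon> by (intro smooth_punct_cutoff) simp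
  have km [measurable]: "\<kappa> \<in> borel_measurable borel" "dzbar 1 \<kappa> \<in> borel_measurable borel"
    using \<kappa> by (auto intro: smooth_measurable smooth_dzbar)
  \<comment> \<open>The error that the cutoff produces on the right-hand side.\<close>
  define k where "k x = dzbar 1 \<kappa> x * f 1 x" for x
  have k: "L2on T k"
    unfolding k_def[abs_def] by (rule L2on_mult_bounded[OF f, where B = "C / \<epsilon>"]) (use C(2)[OF \<epsilon>] km in \<open>auto simp: \<kappa>_def\<close>)
  have [measurable]: "k \<in> borel_measurable borel" by (rule L2on_measurable[OF k])
  have ksupp: "k x = 0" if "cmod (x $ 1) < \<epsilon> \<or> cmod (x $ 1) > 2 * \<epsilon>" for x
    using C(3)[OF \<epsilon> that] by (simp add: k_def \<kappa>_def)
  have kl2: "l2 UNIV k \<le> ennreal ((C / \<epsilon>)\<^sup>2) * ennreal (e / (4 * (M + 1)))"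
  proof -
    have "l2 UNIV k = l2 T k" by (rule l2_support) (use k in \<open>auto simp: L2on_def\<close>)
    also have "\<dots> \<le> ennreal ((C / \<epsilon>)\<^sup>2) * l2 T (\<lambda>x. (1 - ?in n x) * f 1 x - f 1 x)"
    proof (rule l2_cmult_le)
      show "cmod (k x) \<le> C / \<epsilon> * cmod ((1 - ?in n x) * f 1 x - f 1 x)" for x
      proof (cases "cmod (x $ 1) \<le> 2 * \<epsilon>")
        case True
        then have "(1 - ?in n x) * f 1 x - f 1 x = - f 1 x" by (simp add: \<epsilon>_def)
        moreover have "cmod (k x) \<le> C / \<epsilon> * cmod (f 1 x)"
          using mult_right_mono[OF C(2)[OF \<epsilon>, of x] norm_ge_zero, of "f 1 x"]
          by (simp add: k_def \<kappa>_def norm_mult)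
        ultimately show ?thesis by (simp only: norm_minus_cancel)
      next
        case False
        then show ?thesis using ksupp[of x] C(1) \<epsilon> by simp
      qed
    qed (use C(1) \<epsilon> in auto)
    also have "\<dots> \<le> ennreal ((C / \<epsilon>)\<^sup>2) * ennreal (e / (4 * (M + 1)))"
      using n(4) by (intro mult_left_mono) auto
    finally show ?thesis .
  qed
  have "(\<lambda>i. l2 T (\<lambda>x. pconv k (\<lambda>\<zeta>. of_real (poisson_kernel (d i) \<zeta>)) x - k x)) \<longlonglongrightarrow> 0"
    by (rule pconv_poisson_tendsto[OF k d dlim])
  from ev[OF this, of "e / 4"] e
  obtain i where i: "l2 T (\<lambda>x. pconv k (\<lambda>\<zeta>. of_real (poisson_kernel (d i) \<zeta>)) x - k x) < ennreal (e / 4)"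
    by (auto simp: eventually_sequentially)
  define s where "s = d i"
  have s: "0 < s" "s \<le> 1" by (auto simp: s_def d_def field_simps)
  let ?K = "\<lambda>\<zeta>. cauchy_kernel s \<zeta> * indicator (cball 0 (4 * \<epsilon>)) \<zeta>"
  let ?P = "\<lambda>\<zeta>. complex_of_real (poisson_kernel s \<zeta>)"
  have [measurable]: "?K \<in> borel_measurable borel"
    using borel_measurable_integrable[OF cutoff_kernel_integrable[of s "4 * \<epsilon>"]] s \<epsilon> by simp
  have pK: "l2 UNIV (pconv k ?K) \<le> ennreal (e / 4)"
  proof -
    have R: "4 * \<epsilon> > 0" using \<epsilon> by simp
    have "l2 UNIV (pconv k ?K) \<le> (ennreal (16 * (4 * \<epsilon>) / poisson_mass))\<^sup>2 * l2 UNIV k"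
      by (rule l2_pconv[OF _ _ cauchy_kernel_mass[OF s(1) R]]) measurable
    also have "\<dots> \<le> (ennreal (16 * (4 * \<epsilon>) / poisson_mass))\<^sup>2 * (ennreal ((C / \<epsilon>)\<^sup>2) * ennreal (e / (4 * (M + 1))))"
      using kl2 by (rule mult_left_mono) simp
    also have "\<dots> = ennreal ((16 * (4 * \<epsilon>) / poisson_mass)\<^sup>2 * ((C / \<epsilon>)\<^sup>2 * (e / (4 * (M + 1)))))"
    proof -
      have "(ennreal a)\<^sup>2 * (ennreal b * ennreal c) = ennreal (a\<^sup>2 * (b * c))" if "a \<ge> 0" "b \<ge> 0" "c \<ge> 0" for a b c
        using that by (simp add: ennreal_power ennreal_mult)
      then show ?thesis using \<epsilon> e M poisson_mass_pos by simp
    qed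
    also have "(16 * (4 * \<epsilon>) / poisson_mass)\<^sup>2 * ((C / \<epsilon>)\<^sup>2 * (e / (4 * (M + 1)))) = M * (e / (4 * (M + 1)))"
    proof -
      have "(16 * (4 * \<epsilon>) / poisson_mass)\<^sup>2 * ((C / \<epsilon>)\<^sup>2 * Y) = (64 * C / poisson_mass)\<^sup>2 * Y" for Y
        using \<epsilon> by (simp add: power_mult_distrib power_divide)
      then show ?thesis by (simp only: M_def)
    qed
    also have "\<dots> \<le> e / 4"
    proof -
      have "M * (e / (4 * (M + 1))) = (M / (M + 1)) * (e / 4)" by simp
      also have "\<dots> \<le> 1 * (e / 4)" using M e by (intro mult_right_mono) auto
      finally show ?thesis by simp
    qed
    finally show ?thesis by (simp add: ennreal_leI)
  qed
  \<comment> \<open>Subtracting this field replaces the error \<open>k\<close> by its difference to a smoothing of it.\<close>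
  define E where "E j x = (if j = (0 :: 2) then indicator T x * pconv k ?K x else 0)" for j x
  define p where "p x = indicator T x * pconv k ?P x" for x
  have EL: "L2on T (E j)" for j
  proof (cases "j = 0")
    case True
    have "l2 T (pconv k ?K) \<le> l2 UNIV (pconv k ?K)" by (rule l2_mono) auto
    then have "l2 T (pconv k ?K) \<le> ennreal (e / 4)" using pK by (rule order_trans)
    then have "l2 T (pconv k ?K) < top" by (rule le_less_trans) simp
    then show ?thesis using True by (simp add: E_def[abs_def] L2on_restrict)
  qed (simp add: E_def[abs_def])
  have pL: "L2on T p"
    unfolding p_def[abs_def]
  proof (rule L2on_restrict)
    have "l2 T (pconv k ?P) = l2 T (\<lambda>x. (pconv k ?P x - k x) + k x)" by simp
    also have "\<dots> \<le> 2 * l2 T (\<lambda>x. pconv k ?P x - k x) + 2 * l2 T k" by (rule l2_add) measurable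
    also have "\<dots> < top"
    proof -
      have "l2 T (\<lambda>x. pconv k ?P x - k x) < top" using i unfolding s_def by (rule less_trans) simp
      then show ?thesis using L2on_l2[OF k, of T] by (simp add: ennreal_mult_less_top)
    qed
    finally show "l2 T (pconv k ?P) < top" .
  qed measurable
  have wE: "weak_div T E p"
    unfolding E_def[abs_def] p_def[abs_def]
    by (rule weak_div_pconv[OF k _ _ s]) (use ksupp \<epsilon> in \<open>force+\<close>)
  have wk: "weak_div T (\<lambda>j x. \<kappa> x * f j x) (\<lambda>x. \<kappa> x * g x + k x)"
    using weak_div_mult[OF \<kappa> f g w] by (simp add: sum_2' k_def \<kappa>_def C(4)[OF \<epsilon>])
  have kap: "L2on T (\<lambda>x. \<kappa> x * u x)" if "L2on T u" for u
    by (rule L2on_mult_bounded[OF that, where B = 1]) (use punct_cutoff_values(1)[OF \<epsilon>] km in \<open>auto simp: \<kappa>_def\<close>)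
  have kap0: "\<kappa> x = 0" if "cmod (x $ 1) < \<epsilon>" for x
    using punct_cutoff_values(3)[OF \<epsilon>, of x] that by (simp add: \<kappa>_def)
  have pc0: "pconv k K x = 0" if "cmod (x $ 1) < \<epsilon>" for K x
    using that ksupp by (simp add: pconv_def)
  have two: "l2 T (\<lambda>x. u x - v x) \<le> ennreal e"
    if le: "l2 T h1 \<le> ennreal (e / 4)" "l2 T h2 \<le> ennreal (e / 4)"
      and eq: "\<And>x. x \<in> T \<Longrightarrow> u x - v x = h1 x + h2 x"
      and [measurable]: "h1 \<in> borel_measurable borel" "h2 \<in> borel_measurable borel" for u v h1 h2
  proof -
    have "l2 T (\<lambda>x. u x - v x) = l2 T (\<lambda>x. h1 x + h2 x)" by (rule l2_cong) (use eq in auto)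
    also have "\<dots> \<le> 2 * l2 T h1 + 2 * l2 T h2" by (rule l2_add) measurable
    also have "\<dots> \<le> 2 * ennreal (e / 4) + 2 * ennreal (e / 4)" using le by (intro add_mono mult_left_mono) auto
    also have "\<dots> = ennreal (2 * (e / 4) + 2 * (e / 4))"
      unfolding two_mult_ennreal using e by (subst ennreal_plus) auto
    finally show ?thesis by simp
  qed
  show ?thesis
  proof (rule that[OF \<epsilon>, of "\<lambda>j x. \<kappa> x * f j x - E j x" "\<lambda>x. \<kappa> x * g x + k x - p x"])
    show "L2on T (\<lambda>x. \<kappa> x * f j x - E j x)" for j by (intro L2on_diff kap f EL)
    show "L2on T (\<lambda>x. \<kappa> x * g x + k x - p x)" by (intro L2on_diff L2on_add kap g k pL)
    show "weak_div T (\<lambda>j x. \<kappa> x * f j x - E j x) (\<lambda>x. \<kappa> x * g x + k x - p x)"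
      by (rule weak_div_diff[OF _ _ EL pL wk wE]) (intro L2on_add kap f g k)+
    show "\<kappa> x * f j x - E j x = 0" if "cmod (x $ 1) < \<epsilon>" for j x
      using that by (simp add: kap0 E_def pc0)
    show "\<kappa> x * g x + k x - p x = 0" if "cmod (x $ 1) < \<epsilon>" for x
      using that by (simp add: kap0 p_def pc0 ksupp)
    have le0: "l2 T (\<lambda>x. \<kappa> x * f j x - f j x) \<le> ennreal (e / 4)" for j
    proof -
      have "j = 0 \<or> j = 1" using UNIV_2' by auto
      then show ?thesis using n(1,2) by (auto simp: \<kappa>_def \<epsilon>_def less_imp_le)
    qed
    have Em: "E j \<in> borel_measurable borel" for j by (rule L2on_measurable[OF EL])
    have leE: "l2 T (\<lambda>x. - E j x) \<le> ennreal (e / 4)" for j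
    proof -
      have "l2 T (\<lambda>x. - E j x) \<le> l2 UNIV (pconv k ?K)"
        by (rule l2_mono) (auto simp: E_def indicator_def)
      then show ?thesis using pK by (rule order_trans)
    qed
    show "l2 T (\<lambda>x. \<kappa> x * f j x - E j x - f j x) \<le> ennreal e" for j
      by (rule two[OF le0[of j] leE[of j]]) (use Em in auto)
    have lek: "l2 T (\<lambda>x. k x - pconv k ?P x) \<le> ennreal (e / 4)"
      using i unfolding l2_minus[of T k] s_def by simp
    show "l2 T (\<lambda>x. \<kappa> x * g x + k x - p x - g x) \<le> ennreal e"
    proof (rule two[OF _ lek])
      show "l2 T (\<lambda>x. \<kappa> x * g x - g x) \<le> ennreal (e / 4)"
        using n(3) by (simp add: \<kappa>_def \<epsilon>_def less_imp_le)
      show "(\<lambda>x. \<kappa> x * g x - g x) \<in> borel_measurable borel" by measurable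
      show "(\<lambda>x. k x - pconv k ?P x) \<in> borel_measurable borel" by measurable
    qed (simp add: p_def)
  qed
qed

lemma approx_field:
  assumes f: "\<And>k. L2on T (f k)" and g: "L2on T g" and w: "weak_div T f g" and e: "(e :: real) > 0"
  shows "\<exists>F. (\<forall>k. smooth (F k)) \<and> (\<forall>k. l2 T (\<lambda>x. F k x - f k x) \<le> ennreal e) \<and>
    l2 T (\<lambda>x. (\<Sum>k\<in>UNIV. dzbar k (F k) x) - g x) \<le> ennreal e"
proof -
  have e4: "e / 4 > 0" using e by simp
  obtain f' g' \<epsilon> where l: "0 < \<epsilon>" "\<And>k. L2on T (f' k)" "L2on T g'" "weak_div T f' g'"
    "\<And>k x. cmod (x $ 1) < \<epsilon> \<Longrightarrow> f' k x = 0" "\<And>x. cmod (x $ 1) < \<epsilon> \<Longrightarrow> g' x = 0"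
    "\<And>k. l2 T (\<lambda>x. f' k x - f k x) \<le> ennreal (e / 4)" "l2 T (\<lambda>x. g' x - g x) \<le> ennreal (e / 4)"
    by (rule localize_field[OF f g w e4]) (rule that)
  obtain F where F: "\<And>n k. smooth (F n k)" "\<And>k. (\<lambda>n. l2 T (\<lambda>x. F n k x - f' k x)) \<longlonglongrightarrow> 0"
    "(\<lambda>n. l2 T (\<lambda>x. (\<Sum>k\<in>UNIV. dzbar k (F n k) x) - g' x)) \<longlonglongrightarrow> 0"
    using approx_vanishing_field[OF l(2-4,1,5,6)] by blast
  have ev: "eventually (\<lambda>n. u n < ennreal (e / 4)) sequentially" if "u \<longlonglongrightarrow> 0" for u
    using order_tendstoD(2)[OF that, of "ennreal (e / 4)"] e by simp
  have "eventually (\<lambda>n. l2 T (\<lambda>x. F n 0 x - f' 0 x) < ennreal (e / 4) \<and> l2 T (\<lambda>x. F n 1 x - f' 1 x) < ennreal (e / 4) \<and>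
      l2 T (\<lambda>x. (\<Sum>k\<in>UNIV. dzbar k (F n k) x) - g' x) < ennreal (e / 4)) sequentially"
    by (intro eventually_conj ev F)
  then obtain n where n: "l2 T (\<lambda>x. F n 0 x - f' 0 x) < ennreal (e / 4)" "l2 T (\<lambda>x. F n 1 x - f' 1 x) < ennreal (e / 4)"
      "l2 T (\<lambda>x. (\<Sum>k\<in>UNIV. dzbar k (F n k) x) - g' x) < ennreal (e / 4)"
    by (auto simp: eventually_sequentially)
  have n': "l2 T (\<lambda>x. F n k x - f' k x) \<le> ennreal (e / 4)" for k
  proof -
    have "k = 0 \<or> k = 1" using UNIV_2' by auto
    then show ?thesis using n by (auto simp: less_imp_le)
  qed
  have two: "l2 T (\<lambda>x. u x - h x) \<le> ennreal e"
    if le: "l2 T (\<lambda>x. u x - v x) \<le> ennreal (e / 4)" "l2 T (\<lambda>x. v x - h x) \<le> ennreal (e / 4)"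
      and m: "u \<in> borel_measurable borel" "v \<in> borel_measurable borel" "h \<in> borel_measurable borel" for u v h
  proof -
    have "l2 T (\<lambda>x. u x - h x) \<le> 2 * l2 T (\<lambda>x. u x - v x) + 2 * l2 T (\<lambda>x. v x - h x)"
      by (rule l2_diff_triangle[OF m T_borel])
    also have "\<dots> \<le> 2 * ennreal (e / 4) + 2 * ennreal (e / 4)" using le by (intro add_mono mult_left_mono) auto
    also have "\<dots> = ennreal (2 * (e / 4) + 2 * (e / 4))"
      unfolding two_mult_ennreal using e by (subst ennreal_plus) auto
    finally show ?thesis by simp
  qed
  show ?thesis
  proof (intro exI[of _ "F n"] conjI allI)
    show "smooth (F n k)" for k by (rule F)
    show "l2 T (\<lambda>x. F n k x - f k x) \<le> ennreal e" for k
      by (rule two[OF n' l(7)]) (use F(1) smooth_measurable L2on_measurable l(2) f in blast)+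
    show "l2 T (\<lambda>x. (\<Sum>k\<in>UNIV. dzbar k (F n k) x) - g x) \<le> ennreal e"
    proof (rule two[OF _ l(8)])
      show "(\<lambda>x. \<Sum>k\<in>UNIV. dzbar k (F n k) x) \<in> borel_measurable borel"
        by (intro borel_measurable_sum smooth_measurable smooth_dzbar F)
    qed (use n(3) L2on_measurable[OF l(3)] L2on_measurable[OF g] in \<open>auto simp: less_imp_le\<close>)
  qed
qed

section \<open>Change of variables\<close>

lemma nn_integral_complex_iterated:
  assumes [measurable]: "f \<in> borel_measurable (borel :: complex measure)"
  shows "(\<integral>\<^sup>+z. f z \<partial>lborel) = (\<integral>\<^sup>+y. \<integral>\<^sup>+x. f (Complex x y) \<partial>lborel \<partial>lborel)"
proof -
  have [measurable]: "(\<lambda>p. Complex (fst p) (snd p)) \<in> lborel \<Otimes>\<^sub>M lborel \<rightarrow>\<^sub>M borel"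
    unfolding Complex_eq by measurable
  have eq: "lborel = distr (lborel \<Otimes>\<^sub>M lborel) borel (\<lambda>p. Complex (fst p) (snd p))"
  proof (rule lborel_eqI)
    fix l u :: complex assume le: "\<And>b. b \<in> Basis \<Longrightarrow> l \<bullet> b \<le> u \<bullet> b"
    have "(\<lambda>p. Complex (fst p) (snd p)) -` box l u \<inter> space (lborel \<Otimes>\<^sub>M lborel) = box (Re l) (Re u) \<times> box (Im l) (Im u)"
      by (auto simp: box_def Basis_complex_def space_pair_measure)
    then show "emeasure (distr (lborel \<Otimes>\<^sub>M lborel) borel (\<lambda>p. Complex (fst p) (snd p))) (box l u) = (\<Prod>b\<in>Basis. (u - l) \<bullet> b)"
      using le[of 1] le[of \<i>]
      by (simp add: emeasure_distr lborel.emeasure_pair_measure_Times emeasure_lborel_box_eq Basis_complex_def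
          complex_eq_iff ennreal_mult)
  qed simp
  have "(\<integral>\<^sup>+z. f z \<partial>lborel) = (\<integral>\<^sup>+z. f z \<partial>distr (lborel \<Otimes>\<^sub>M lborel) borel (\<lambda>p. Complex (fst p) (snd p)))"
    by (rule arg_cong[where f = "\<lambda>M. nn_integral M f", OF eq])
  also have "\<dots> = (\<integral>\<^sup>+p. f (Complex (fst p) (snd p)) \<partial>(lborel \<Otimes>\<^sub>M lborel))"
    by (simp add: nn_integral_distr)
  also have "\<dots> = (\<integral>\<^sup>+y. \<integral>\<^sup>+x. f (Complex x y) \<partial>lborel \<partial>lborel)"
    by (subst lborel_pair.nn_integral_snd[symmetric]) simp_all
  finally show ?thesis .
qed

lemma nn_integral_complex_mult:
  assumes [measurable]: "f \<in> borel_measurable (borel :: complex measure)" and w: "w \<noteq> 0"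
  shows "(\<integral>\<^sup>+z. f z \<partial>lborel) = ennreal ((cmod w)\<^sup>2) * (\<integral>\<^sup>+u. f (u * w) \<partial>lborel)"
proof -
  define a b where "a = Re w" and "b = Im w"
  have ab: "(cmod w)\<^sup>2 = a\<^sup>2 + b\<^sup>2" by (simp add: a_def b_def cmod_power2)
  have [measurable]: "(\<lambda>x. f (Complex (p x) (q x))) \<in> borel_measurable M"
    if [measurable]: "p \<in> borel_measurable M" "q \<in> borel_measurable M" for p q :: "'x \<Rightarrow> real" and M
    unfolding Complex_eq by measurable
  have meas2 [measurable]: "(\<lambda>(x, y). f (Complex (p x y) (q x y))) \<in> borel_measurable (lborel \<Otimes>\<^sub>M lborel)"
    if "(\<lambda>(x, y). p x y) \<in> borel_measurable (lborel \<Otimes>\<^sub>M lborel)" "(\<lambda>(x, y). q x y) \<in> borel_measurable (lborel \<Otimes>\<^sub>M lborel)"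
    for p q :: "real \<Rightarrow> real \<Rightarrow> real"
    using that unfolding case_prod_unfold by measurable
  have mult: "Complex x y * w = Complex (x * a - y * b) (x * b + y * a)" for x y
    by (simp add: complex_eq_iff a_def b_def)
  have lhs: "(\<integral>\<^sup>+u. f (u * w) \<partial>lborel) = (\<integral>\<^sup>+y. \<integral>\<^sup>+x. f (Complex (x * a - y * b) (x * b + y * a)) \<partial>lborel \<partial>lborel)"
    by (subst nn_integral_complex_iterated) (simp_all add: mult)
  have swap: "(\<integral>\<^sup>+y. \<integral>\<^sup>+x. F x y \<partial>lborel \<partial>lborel) = (\<integral>\<^sup>+x. \<integral>\<^sup>+y. F x y \<partial>lborel \<partial>lborel)"
    if "(\<lambda>(x, y). F x y) \<in> borel_measurable (lborel \<Otimes>\<^sub>M lborel)" for F :: "real \<Rightarrow> real \<Rightarrow> ennreal"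
    by (rule lborel_pair.Fubini') (use that in simp)
  show ?thesis
  proof (cases "a = 0")
    case False
    define c where "c = (a\<^sup>2 + b\<^sup>2) / a"
    have c0: "c \<noteq> 0" and ac: "\<bar>a\<bar> * \<bar>c\<bar> = a\<^sup>2 + b\<^sup>2"
      using False by (auto simp: c_def abs_mult[symmetric] add_nonneg_eq_0_iff)
    have inner: "(\<integral>\<^sup>+X. f (Complex X (X * b / a + c * y)) \<partial>lborel) =
        ennreal \<bar>a\<bar> * (\<integral>\<^sup>+x. f (Complex (x * a - y * b) (x * b + y * a)) \<partial>lborel)" for y
    proof -
      have e: "(- (y * b) + a * x) * b / a + c * y = x * b + y * a" for x
        using False by (simp add: c_def power2_eq_square field_simps)
      show ?thesis
        by (subst nn_integral_real_affine[OF _ False, of _ "- (y * b)"]) (simp_all only: e, simp_all add: mult.commute)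
    qed
    have inner2: "(\<integral>\<^sup>+Y. f (Complex X Y) \<partial>lborel) = ennreal \<bar>c\<bar> * (\<integral>\<^sup>+y. f (Complex X (X * b / a + c * y)) \<partial>lborel)" for X
      by (rule nn_integral_real_affine[OF _ c0]) measurable
    have "(\<integral>\<^sup>+z. f z \<partial>lborel) = (\<integral>\<^sup>+X. \<integral>\<^sup>+Y. f (Complex X Y) \<partial>lborel \<partial>lborel)"
      unfolding nn_integral_complex_iterated[OF assms(1)] by (rule swap) measurable
    also have "\<dots> = ennreal \<bar>c\<bar> * (\<integral>\<^sup>+X. \<integral>\<^sup>+y. f (Complex X (X * b / a + c * y)) \<partial>lborel \<partial>lborel)"
      unfolding inner2 by (rule nn_integral_cmult) measurable
    also have "(\<integral>\<^sup>+X. \<integral>\<^sup>+y. f (Complex X (X * b / a + c * y)) \<partial>lborel \<partial>lborel) =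
        (\<integral>\<^sup>+y. \<integral>\<^sup>+X. f (Complex X (X * b / a + c * y)) \<partial>lborel \<partial>lborel)"
      by (rule swap[symmetric]) measurable
    also have "\<dots> = ennreal \<bar>a\<bar> * (\<integral>\<^sup>+u. f (u * w) \<partial>lborel)"
      unfolding inner lhs by (rule nn_integral_cmult) measurable
    finally show ?thesis
      unfolding ab ac[symmetric] by (simp add: ennreal_mult mult.assoc[symmetric] mult.commute)
  next
    case True
    then have b: "b \<noteq> 0" "- b \<noteq> 0" using w by (auto simp: a_def b_def complex_eq_iff)
    have "(\<integral>\<^sup>+z. f z \<partial>lborel) = (\<integral>\<^sup>+X. \<integral>\<^sup>+Y. f (Complex X Y) \<partial>lborel \<partial>lborel)"
      unfolding nn_integral_complex_iterated[OF assms(1)] by (rule swap) measurable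
    also have "\<dots> = ennreal \<bar>- b\<bar> * (\<integral>\<^sup>+y. \<integral>\<^sup>+Y. f (Complex (0 + (- b) * y) Y) \<partial>lborel \<partial>lborel)"
      by (rule nn_integral_real_affine[OF _ b(2)]) measurable
    also have "(\<integral>\<^sup>+y. \<integral>\<^sup>+Y. f (Complex (0 + (- b) * y) Y) \<partial>lborel \<partial>lborel) =
        (\<integral>\<^sup>+y. ennreal \<bar>b\<bar> * (\<integral>\<^sup>+x. f (Complex (0 + (- b) * y) (0 + b * x)) \<partial>lborel) \<partial>lborel)"
      by (intro nn_integral_cong nn_integral_real_affine[OF _ b(1)]) measurable
    also have "(\<integral>\<^sup>+y. ennreal \<bar>b\<bar> * (\<integral>\<^sup>+x. f (Complex (0 + (- b) * y) (0 + b * x)) \<partial>lborel) \<partial>lborel) =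
        ennreal \<bar>b\<bar> * (\<integral>\<^sup>+u. f (u * w) \<partial>lborel)"
      unfolding lhs using True by (subst nn_integral_cmult) (simp_all add: mult.commute)
    finally show ?thesis
      unfolding ab using True by (simp add: ennreal_mult[symmetric] mult.assoc[symmetric] power2_eq_square abs_mult_self_eq)
  qed
qed

definition vec2 :: "complex \<Rightarrow> complex \<Rightarrow> complex ^ 2" where
  "vec2 z w = (\<chi> k. if k = 0 then z else w)"

lemma vec2_nth [simp]: "vec2 z w $ 0 = z" "vec2 z w $ 1 = w"
  by (simp_all add: vec2_def)

lemma vec_eq_2: "x = y \<longleftrightarrow> x $ 0 = y $ 0 \<and> x $ 1 = y $ (1 :: 2)"
proof
  assume eq: "x $ 0 = y $ 0 \<and> x $ 1 = y $ (1 :: 2)"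
  show "x = y"
    unfolding vec_eq_iff
  proof
    fix k :: 2
    have "k = 0 \<or> k = 1" using UNIV_2' by auto
    then show "x $ k = y $ k" using eq by auto
  qed
qed simp

lemma continuous_on_vec2 [continuous_intros]:
  "continuous_on A f \<Longrightarrow> continuous_on A g \<Longrightarrow> continuous_on A (\<lambda>x. vec2 (f x) (g x))"
  unfolding vec2_def
proof (rule continuous_on_vec_lambda)
  fix k :: 2
  assume "continuous_on A f" "continuous_on A g"
  then show "continuous_on A (\<lambda>x. if k = 0 then f x else g x)" by (cases "k = 0") simp_all
qed

lemma vec2_measurable: "(\<lambda>p. vec2 (fst p) (snd p)) \<in> borel \<rightarrow>\<^sub>M borel"
  by (rule borel_measurable_continuous_onI) (intro continuous_intros)

lemma Basis_complex2: "(Basis :: (complex ^ 2) set) = {axis 0 1, axis 0 \<i>, axis 1 1, axis 1 \<i>}"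
  by (auto simp: Basis_vec_def Basis_complex_def UNIV_2')

lemma prod_Basis_complex2:
  fixes F :: "real \<Rightarrow> 'a::comm_monoid_mult"
  shows "(\<Prod>b\<in>(Basis :: (complex ^ 2) set). F (x \<bullet> b)) = F (Re (x $ 0)) * F (Im (x $ 0)) * (F (Re (x $ 1)) * F (Im (x $ 1)))"
  unfolding Basis_complex2 by (simp add: axis_eq_axis inner_axis complex_eq_iff mult.assoc)

lemma nn_integral_vec2:
  assumes [measurable]: "f \<in> borel_measurable (borel :: (complex ^ 2) measure)"
  shows "(\<integral>\<^sup>+x. f x \<partial>lborel) = (\<integral>\<^sup>+w. \<integral>\<^sup>+z. f (vec2 z w) \<partial>lborel \<partial>lborel)"
proof -
  have m [measurable]: "(\<lambda>p. vec2 (fst p) (snd p)) \<in> lborel \<Otimes>\<^sub>M lborel \<rightarrow>\<^sub>M borel"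
    using vec2_measurable by (simp add: lborel_prod)
  have eq: "lborel = distr (lborel \<Otimes>\<^sub>M lborel) borel (\<lambda>p. vec2 (fst p) (snd p))"
  proof (rule lborel_eqI)
    fix l u :: "complex ^ 2" assume le: "\<And>b. b \<in> Basis \<Longrightarrow> l \<bullet> b \<le> u \<bullet> b"
    have le': "Re (l $ 0) \<le> Re (u $ 0)" "Im (l $ 0) \<le> Im (u $ 0)" "Re (l $ 1) \<le> Re (u $ 1)" "Im (l $ 1) \<le> Im (u $ 1)"
      using le[of "axis 0 1"] le[of "axis 0 \<i>"] le[of "axis 1 1"] le[of "axis 1 \<i>"]
      by (simp_all add: Basis_complex2 inner_axis)
    have "(\<lambda>p. vec2 (fst p) (snd p)) -` box l u \<inter> space (lborel \<Otimes>\<^sub>M lborel) = box (l $ 0) (u $ 0) \<times> box (l $ 1) (u $ 1)"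
      by (auto simp: box_def Basis_complex_def Basis_complex2 space_pair_measure inner_axis)
    then show "emeasure (distr (lborel \<Otimes>\<^sub>M lborel) borel (\<lambda>p. vec2 (fst p) (snd p))) (box l u) = (\<Prod>b\<in>Basis. (u - l) \<bullet> b)"
      unfolding prod_Basis_complex2[of "\<lambda>t. t"]
      using le' by (simp add: emeasure_distr lborel.emeasure_pair_measure_Times emeasure_lborel_box_eq Basis_complex_def
          complex_eq_iff ennreal_mult)
  qed simp
  have "(\<integral>\<^sup>+x. f x \<partial>lborel) = (\<integral>\<^sup>+x. f x \<partial>distr (lborel \<Otimes>\<^sub>M lborel) borel (\<lambda>p. vec2 (fst p) (snd p)))"
    by (rule arg_cong[where f = "\<lambda>M. nn_integral M f", OF eq])
  also have "\<dots> = (\<integral>\<^sup>+p. f (vec2 (fst p) (snd p)) \<partial>(lborel \<Otimes>\<^sub>M lborel))"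
    by (simp add: nn_integral_distr)
  also have "\<dots> = (\<integral>\<^sup>+w. \<integral>\<^sup>+z. f (vec2 z w) \<partial>lborel \<partial>lborel)"
    by (subst lborel_pair.nn_integral_snd[symmetric]) simp_all
  finally show ?thesis .
qed

text \<open>
  The map \<open>(u, w) \<mapsto> (u w, w)\<close> opens the triangle up to the product of the unit disc and the
  punctured unit disc.
\<close>

definition shear :: "complex ^ 2 \<Rightarrow> complex ^ 2" where
  "shear x = vec2 (x $ 0 * x $ 1) (x $ 1)"

lemma shear_nth [simp]: "shear x $ 0 = x $ 0 * x $ 1" "shear x $ 1 = x $ 1"
  by (simp_all add: shear_def)

lemma continuous_shear: "continuous_on A shear"
  unfolding shear_def by (intro continuous_intros)

lemma shear_measurable [measurable]: "shear \<in> borel \<rightarrow>\<^sub>M borel"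
  by (rule borel_measurable_continuous_onI[OF continuous_shear])

lemma vec_nth_measurable [measurable]: "(\<lambda>x :: complex ^ 2. x $ i) \<in> borel_measurable borel"
  by (rule borel_measurable_continuous_onI) (intro continuous_intros)

lemma nn_integral_shear:
  assumes [measurable]: "F \<in> borel_measurable borel"
  shows "(\<integral>\<^sup>+x. F x \<partial>lborel) = (\<integral>\<^sup>+x. ennreal ((cmod (x $ 1))\<^sup>2) * F (shear x) \<partial>lborel)"
proof -
  have [measurable]: "(\<lambda>z. F (vec2 z w)) \<in> borel_measurable borel" for w
    by (rule measurable_compose[OF borel_measurable_continuous_onI assms]) (intro continuous_intros)
  have "(\<integral>\<^sup>+x. F x \<partial>lborel) = (\<integral>\<^sup>+w. \<integral>\<^sup>+z. F (vec2 z w) \<partial>lborel \<partial>lborel)"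
    by (rule nn_integral_vec2) fact
  also have "\<dots> = (\<integral>\<^sup>+w. \<integral>\<^sup>+u. ennreal ((cmod w)\<^sup>2) * F (vec2 (u * w) w) \<partial>lborel \<partial>lborel)"
  proof (rule nn_integral_cong_AE)
    have "AE w in lborel. (w :: complex) \<noteq> 0" by (rule AE_lborel_singleton)
    then show "AE w in lborel. (\<integral>\<^sup>+z. F (vec2 z w) \<partial>lborel) = (\<integral>\<^sup>+u. ennreal ((cmod w)\<^sup>2) * F (vec2 (u * w) w) \<partial>lborel)"
    proof (rule AE_mp, intro AE_I2 impI)
      fix w :: complex assume w: "w \<noteq> 0"
      have [measurable]: "(\<lambda>u. F (vec2 (u * w) w)) \<in> borel_measurable borel"
        by (rule measurable_compose[OF borel_measurable_continuous_onI assms]) (intro continuous_intros)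
      show "(\<integral>\<^sup>+z. F (vec2 z w) \<partial>lborel) = (\<integral>\<^sup>+u. ennreal ((cmod w)\<^sup>2) * F (vec2 (u * w) w) \<partial>lborel)"
        by (subst nn_integral_complex_mult[OF _ w]) (simp_all add: nn_integral_cmult)
    qed
  qed
  also have "\<dots> = (\<integral>\<^sup>+x. ennreal ((cmod (x $ 1))\<^sup>2) * F (shear x) \<partial>lborel)"
    by (subst nn_integral_vec2, measurable, simp add: shear_def)
  finally show ?thesis .
qed

lemma integral_shear:
  fixes F :: "complex ^ 2 \<Rightarrow> complex"
  assumes [measurable]: "F \<in> borel_measurable borel"
  shows "(LINT x|lborel. F x) = (LINT x|lborel. (cmod (x $ 1))\<^sup>2 *\<^sub>R F (shear x))"
proof -
  have eq: "lborel = distr (density lborel (\<lambda>x :: complex ^ 2. ennreal ((cmod (x $ 1))\<^sup>2))) borel shear"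
  proof (rule measure_eqI)
    fix A :: "(complex ^ 2) set" assume "A \<in> sets lborel"
    then have [measurable]: "A \<in> sets borel" by simp
    have ind: "indicator (shear -` A) x = (indicator A (shear x) :: ennreal)" for x by (simp add: indicator_def)
    have [measurable]: "shear -` A \<in> sets borel"
      using measurable_sets[OF shear_measurable, of A] by simp
    have "emeasure lborel A = (\<integral>\<^sup>+x. indicator A x \<partial>lborel)" by simp
    also have "\<dots> = (\<integral>\<^sup>+x. ennreal ((cmod (x $ 1))\<^sup>2) * indicator A (shear x) \<partial>lborel)"
      by (rule nn_integral_shear) measurable
    also have "\<dots> = emeasure (distr (density lborel (\<lambda>x. ennreal ((cmod (x $ 1))\<^sup>2))) borel shear) A"
      by (simp add: emeasure_distr emeasure_density ind)
    finally show "emeasure lborel A = emeasure (distr (density lborel (\<lambda>x. ennreal ((cmod (x $ 1))\<^sup>2))) borel shear) A" .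
  qed simp
  have "(LINT x|lborel. F x) = (LINT x|distr (density lborel (\<lambda>x :: complex ^ 2. ennreal ((cmod (x $ 1))\<^sup>2))) borel shear. F x)"
    by (rule arg_cong[where f = "\<lambda>M. integral\<^sup>L M F", OF eq])
  also have "\<dots> = (LINT x|lborel. (cmod (x $ 1))\<^sup>2 *\<^sub>R F (shear x))"
    by (subst integral_distr) (auto simp: integral_density)
  finally show ?thesis .
qed

section \<open>The equation in the new coordinates\<close>

definition bidisc :: "(complex ^ 2) set" where
  "bidisc = {x. cmod (x $ 0) < 1 \<and> cmod (x $ 1) < 1}"

lemma bounded_bidisc: "bounded bidisc"
  unfolding bounded_iff bidisc_def
proof (intro exI[of _ 2] ballI)
  fix x :: "complex ^ 2" assume "x \<in> {x. cmod (x $ 0) < 1 \<and> cmod (x $ 1) < 1}"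
  then show "norm x \<le> 2" using norm_le_components[of x] by auto
qed

lemma bidisc_borel [measurable]: "bidisc \<in> sets borel"
  unfolding bidisc_def by (intro borel_open open_Collect_conj open_Collect_less continuous_intros)

lemma shear_T_iff: "shear x \<in> T \<longleftrightarrow> x \<in> bidisc \<and> x $ 1 \<noteq> 0"
proof -
  have "cmod (x $ 0) * cmod (x $ 1) < cmod (x $ 1) \<longleftrightarrow> cmod (x $ 0) < 1 \<and> x $ 1 \<noteq> 0"
    by (cases "x $ 1 = 0") auto
  then show ?thesis by (auto simp: hartogs_triangle_def bidisc_def norm_mult)
qed

text \<open>
  The factor \<open>w\<close> is the Jacobian of \<open>z = u w\<close> for fixed \<open>w\<close>, which makes this a unitary map. Being
  holomorphic, it does not interfere with the antiholomorphic derivatives.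
\<close>

definition pullback :: "(complex ^ 2 \<Rightarrow> complex) \<Rightarrow> complex ^ 2 \<Rightarrow> complex" where
  "pullback f x = x $ 1 * f (shear x)"

lemma pullback_measurable [measurable]:
  assumes [measurable]: "f \<in> borel_measurable borel"
  shows "pullback f \<in> borel_measurable borel"
  unfolding pullback_def[abs_def] by measurable

lemma l2_pullback:
  assumes [measurable]: "f \<in> borel_measurable borel" "c \<in> borel_measurable borel"
  shows "l2 UNIV (\<lambda>x. c (shear x) * pullback f x) = l2 UNIV (\<lambda>x. c x * f x)"
proof -
  have "l2 UNIV (\<lambda>x. c x * f x) = (\<integral>\<^sup>+x. ennreal ((cmod (x $ 1))\<^sup>2) * (ennreal (cmod (c (shear x) * f (shear x))))\<^sup>2 \<partial>lborel)"
    unfolding l2_def using nn_integral_shear[of "\<lambda>x. (ennreal (cmod (c x * f x)))\<^sup>2"] by simp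
  also have "\<dots> = l2 UNIV (\<lambda>x. c (shear x) * pullback f x)"
    unfolding l2_def ennreal_cmod_square
    by (intro nn_integral_cong) (simp add: pullback_def norm_mult power_mult_distrib ennreal_mult[symmetric] mult.assoc mult.left_commute)
  finally show ?thesis by simp
qed

lemma L2on_pullback: assumes "L2on T f" shows "L2on bidisc (pullback f)"
proof -
  have "l2 UNIV (pullback f) = l2 UNIV f"
    using l2_pullback[OF L2on_measurable[OF assms], of "\<lambda>_. 1"] by simp
  moreover have "pullback f x = 0" if "x \<notin> bidisc" for x
    using that assms shear_T_iff[of x] by (auto simp: pullback_def L2on_def)
  ultimately show ?thesis using assms pullback_measurable[of f] by (simp add: L2on_def)
qed

text \<open>A globally smooth function that agrees with \<open>1 / w\<close> away from the axis \<open>w = 0\<close>.\<close>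

definition smooth_recip :: "real \<Rightarrow> complex ^ 2 \<Rightarrow> complex" where
  "smooth_recip \<tau> x = of_real (inverse (x $ 1 \<bullet> x $ 1 + (1 - smooth_step (4 * (x $ 1 \<bullet> x $ 1) / \<tau>\<^sup>2 - 1)))) * cnj (x $ 1)"

lemma smooth_smooth_recip: assumes "\<tau> > 0" shows "smooth (smooth_recip \<tau>)"
proof -
  have pos: "t + (1 - smooth_step (4 * t / \<tau>\<^sup>2 - 1)) \<noteq> 0" if "t \<ge> 0" for t
    using that smooth_step_bounds[of "4 * t / \<tau>\<^sup>2 - 1"] by (cases "t = 0") auto
  have 1: "smooth (\<lambda>x :: complex ^ 2. x $ 1 \<bullet> x $ 1)" by (intro smooth_intros)
  have 2: "smooth (\<lambda>x :: complex ^ 2. smooth_step (4 * (x $ 1 \<bullet> x $ 1) / \<tau>\<^sup>2 - 1))"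
    using assms by (intro smooth_compose[OF smooth_smooth_step] smooth_diff smooth_divide smooth_mult smooth_const 1) auto
  have "smooth (\<lambda>x :: complex ^ 2. inverse (x $ 1 \<bullet> x $ 1 + (1 - smooth_step (4 * (x $ 1 \<bullet> x $ 1) / \<tau>\<^sup>2 - 1))))"
    by (intro smooth_inverse smooth_add smooth_diff smooth_const 1 2 pos) simp
  from smooth_mult[OF smooth_of_real[OF this] smooth_cnj[OF smooth_vec_nth[OF smooth_ident]]]
  show ?thesis unfolding smooth_recip_def[abs_def] .
qed

lemma smooth_recip_eq:
  assumes "\<tau> > 0" "\<tau>\<^sup>2 / 2 < x $ 1 \<bullet> x $ 1" shows "smooth_recip \<tau> x = inverse (x $ 1)"
proof -
  have "4 * (x $ 1 \<bullet> x $ 1) / \<tau>\<^sup>2 - 1 \<ge> 1" using assms by (simp add: field_simps)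
  then have "smooth_recip \<tau> x = cnj (x $ 1) / of_real ((cmod (x $ 1))\<^sup>2)"
    by (simp add: smooth_recip_def inner_eq_cmod2 divide_inverse mult.commute)
  also have "\<dots> = inverse (x $ 1)"
  proof -
    have n2: "complex_of_real ((cmod (x $ 1))\<^sup>2) = x $ 1 * cnj (x $ 1)" by (rule complex_norm_square)
    show ?thesis unfolding n2 by (cases "x $ 1 = 0") (simp_all add: divide_inverse)
  qed
  finally show ?thesis .
qed

lemma linear_axis_mult:
  fixes L :: "complex ^ 2 \<Rightarrow> complex"
  assumes "linear L"
  shows "L (axis k (c * 1)) + \<i> * L (axis k (c * \<i>)) = cnj c * (L (axis k 1) + \<i> * L (axis k \<i>))"
proof -
  have ax: "axis k (c * 1) = Re c *\<^sub>R axis k 1 + Im c *\<^sub>R axis k \<i>" "axis k (c * \<i>) = Re c *\<^sub>R axis k \<i> - Im c *\<^sub>R (axis k 1 :: complex ^ 2)"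
    by (auto simp: vec_eq_iff axis_def complex_eq_iff)
  show ?thesis
    unfolding ax linear_add[OF assms] linear_diff[OF assms] linear_cmul[OF assms]
    by (simp add: complex_eq_iff scaleR_conv_of_real algebra_simps)
qed

lemma weak_div_single:
  "weak_div \<Omega> (\<lambda>j. if j = k then f else (\<lambda>x. 0)) g \<longleftrightarrow>
    (\<forall>\<phi>. test_fun \<Omega> \<phi> \<longrightarrow> (LINT x|lborel. g x * \<phi> x) = - (LINT x|lborel. f x * dzbar k \<phi> x))"
proof -
  have "k = 0 \<or> k = 1" using UNIV_2' by auto
  then have "(\<Sum>j\<in>UNIV. - (LINT x|lborel. (if j = k then f else (\<lambda>x. 0)) x * dzbar j \<phi> x)) =
      - (LINT x|lborel. f x * dzbar k \<phi> x)" for \<phi>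
    by (auto simp: sum_2')
  then show ?thesis unfolding weak_div_def by simp
qed

text \<open>
  In the new coordinates the derivative in \<open>w\<close> for fixed \<open>u\<close> is the combination
  \<open>dzbar 1 + (cnj z / cnj w) dzbar 0\<close> of the old derivatives, and the two terms in which \<open>1 / cnj w\<close> is
  differentiated cancel.
\<close>

lemma pullback_equation_off_axis:
  assumes f: "L2on T f" and g: "\<And>k. L2on T (g k)"
    and w: "\<And>k. weak_div T (\<lambda>j. if j = k then f else (\<lambda>x. 0)) (g k)"
    and \<phi>: "test_fun bidisc \<phi>" and \<tau>: "\<tau> > 0" and v: "\<And>x. cmod (x $ 1) < \<tau> \<Longrightarrow> \<phi> x = 0"
  shows "(LINT x|lborel. pullback f x * dzbar 1 \<phi> x) =
    - (LINT x|lborel. (pullback (g 1) x + cnj (x $ 0) * pullback (g 0) x) * \<phi> x)"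
proof -
  note cs = test_fun_csmooth[OF \<phi>]
  note sm = csmooth_imp_smooth[OF cs]
  define r where "r = smooth_recip \<tau>"
  have r: "smooth r" unfolding r_def by (rule smooth_smooth_recip[OF \<tau>])
  \<comment> \<open>The inverse of \<open>shear\<close> where \<open>\<phi>\<close> is supported, continued to a smooth map of the whole space.\<close>
  define \<Psi> where "\<Psi> x = (axis 0 (x $ 0 * r x) + axis 1 (x $ 1) :: complex ^ 2)" for x
  have \<Psi>_nth [simp]: "\<Psi> x $ 0 = x $ 0 * r x" "\<Psi> x $ 1 = x $ 1" for x
    by (simp_all add: \<Psi>_def axis_def)
  have ax: "bounded_linear (\<lambda>c :: complex. axis k c :: complex ^ 2)" for k
    unfolding linear_conv_bounded_linear[symmetric] by (rule linearI) (auto simp: axis_def vec_eq_iff)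
  have "smooth \<Psi>"
    unfolding \<Psi>_def[abs_def]
    by (intro smooth_add smooth_linear[OF ax] smooth_mult smooth_vec_nth smooth_ident r)
  define \<psi> where "\<psi> x = \<phi> (\<Psi> x)" for x
  have \<psi>: "smooth \<psi>" unfolding \<psi>_def[abs_def] by (rule smooth_compose[OF sm \<open>smooth \<Psi>\<close>])
  have near: "\<psi> x = 0" if "cmod (x $ 1) < \<tau>" for x using that v by (simp add: \<psi>_def)
  have far: "\<tau>\<^sup>2 / 2 < x $ 1 \<bullet> x $ 1" "r x = inverse (x $ 1)" "x $ 1 \<noteq> 0" if "\<not> cmod (x $ 1) < \<tau>" for x
  proof -
    have "\<tau>\<^sup>2 \<le> (cmod (x $ 1))\<^sup>2" using that \<tau> by (intro power_mono) auto
    moreover have "\<tau>\<^sup>2 > 0" using \<tau> by simp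
    ultimately show *: "\<tau>\<^sup>2 / 2 < x $ 1 \<bullet> x $ 1" unfolding inner_eq_cmod2 by linarith
    show "r x = inverse (x $ 1)" unfolding r_def by (rule smooth_recip_eq[OF \<tau> *])
    show "x $ 1 \<noteq> 0" using that \<tau> by auto
  qed
  have test: "test_fun T (\<lambda>x. m x * \<psi> x)" if "smooth m" for m
  proof (rule test_funI[of _ "shear ` (closure {x. \<phi> x \<noteq> 0})"])
    show "smooth (\<lambda>x. m x * \<psi> x)" by (intro smooth_mult that \<psi>)
    have "compact (closure {x. \<phi> x \<noteq> 0})" using \<phi> by (simp add: test_fun_def)
    then show "compact (shear ` (closure {x. \<phi> x \<noteq> 0}))"
      by (intro compact_continuous_image continuous_shear)
    have "closure {x. \<phi> x \<noteq> 0} \<subseteq> {x. \<tau> \<le> cmod (x $ 1)}"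
    proof (rule closure_minimal)
      show "{x. \<phi> x \<noteq> 0} \<subseteq> {x. \<tau> \<le> cmod (x $ 1)}" using v by (auto simp: not_less[symmetric])
      show "closed {x :: complex ^ 2. \<tau> \<le> cmod (x $ 1)}" by (intro closed_Collect_le continuous_intros)
    qed
    then have "\<And>x. x \<in> closure {x. \<phi> x \<noteq> 0} \<Longrightarrow> x \<in> bidisc \<and> x $ 1 \<noteq> 0"
      using \<phi> \<tau> by (force simp: test_fun_def)
    then show "shear ` (closure {x. \<phi> x \<noteq> 0}) \<subseteq> T" using shear_T_iff by auto
    fix x assume nz: "m x * \<psi> x \<noteq> 0"
    then have "\<not> cmod (x $ 1) < \<tau>" using near by auto
    from far(2,3)[OF this] have "shear (\<Psi> x) = x" by (simp add: vec_eq_2)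
    moreover have "\<Psi> x \<in> closure {x. \<phi> x \<noteq> 0}"
      using nz closure_subset by (force simp: \<psi>_def)
    ultimately show "x \<in> shear ` (closure {x. \<phi> x \<noteq> 0})" by (metis imageI)
  qed
  define O' where "O' = {x :: complex ^ 2. \<tau>\<^sup>2 / 2 < x $ 1 \<bullet> x $ 1}"
  have O': "open O'" unfolding O'_def by (intro open_Collect_less continuous_intros)
  have rd: "(r has_derivative (\<lambda>v. - (inverse (x $ 1) * v $ 1 * inverse (x $ 1)))) (at x)" if "x \<in> O'" for x
  proof -
    have nz: "x $ 1 \<noteq> 0" using that by (auto simp: O'_def)
    have "((\<lambda>x :: complex ^ 2. x $ 1) has_derivative (\<lambda>v. v $ 1)) (at x)"
      by (rule bounded_linear_imp_has_derivative[OF bounded_linear_vec_nth])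
    from Deriv.has_derivative_inverse[OF nz this]
    show ?thesis
      by (rule has_derivative_transform_within_open[OF _ O' that]) (simp add: r_def O'_def smooth_recip_eq[OF \<tau>])
  qed
  have \<Psi>d: "(\<Psi> has_derivative (\<lambda>v. axis 0 (x $ 0 * - (inverse (x $ 1) * v $ 1 * inverse (x $ 1)) + v $ 0 * r x) + axis 1 (v $ 1))) (at x)"
    if "x \<in> O'" for x
    unfolding \<Psi>_def[abs_def]
    by (intro has_derivative_add bounded_linear.has_derivative[OF ax] has_derivative_mult rd[OF that]
        bounded_linear_imp_has_derivative[OF bounded_linear_vec_nth])
  have dr: "dzbar 1 (\<lambda>x. cnj (r x)) x = - (cnj (inverse (x $ 1)))\<^sup>2" "dzbar 0 (\<lambda>x. cnj (r x)) x = 0" if "x \<in> O'" for x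
    unfolding dzbar_eq_dbar_dir dbar_dir_eqI[OF bounded_linear.has_derivative[OF bounded_linear_cnj rd[OF that]]]
    by (simp_all add: axis_def power2_eq_square algebra_simps)
  have d\<psi>: "dzbar 0 \<psi> x = cnj (inverse (x $ 1)) * dzbar 0 \<phi> (\<Psi> x)"
    "dzbar 1 \<psi> x = dzbar 1 \<phi> (\<Psi> x) - cnj (x $ 0) * (cnj (inverse (x $ 1)))\<^sup>2 * dzbar 0 \<phi> (\<Psi> x)"
    if x: "x \<in> O'" for x
  proof -
    have rx: "r x = inverse (x $ 1)" using x by (simp add: r_def O'_def smooth_recip_eq[OF \<tau>])
    define L where "L = frechet_derivative \<phi> (at (\<Psi> x))"
    have L: "linear L" unfolding L_def using smooth_has_derivative[OF sm] by (rule has_derivative_linear)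
    from diff_chain_at[OF \<Psi>d[OF x] smooth_has_derivative[OF sm]]
    have d: "(\<psi> has_derivative (\<lambda>v. L (axis 0 (x $ 0 * - (inverse (x $ 1) * v $ 1 * inverse (x $ 1)) + v $ 0 * r x) + axis 1 (v $ 1)))) (at x)"
      by (simp add: o_def \<psi>_def[abs_def] L_def)
    let ?c = "- (x $ 0 * (inverse (x $ 1))\<^sup>2)"
    have "dzbar 0 \<psi> x = (L (axis 0 (inverse (x $ 1) * 1)) + \<i> * L (axis 0 (inverse (x $ 1) * \<i>))) / 2"
    proof -
      have "axis 0 (x $ 0 * - (inverse (x $ 1) * (axis 0 b :: complex ^ 2) $ 1 * inverse (x $ 1)) + (axis 0 b :: complex ^ 2) $ 0 * r x) +
          axis 1 ((axis 0 b :: complex ^ 2) $ 1) =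
          (axis 0 (inverse (x $ 1) * b) :: complex ^ 2)" for b
        by (simp add: vec_eq_2 axis_def rx)
      then show ?thesis
        unfolding dzbar_eq_dbar_dir dbar_dir_eqI[OF d] by (simp only:)
    qed
    then show "dzbar 0 \<psi> x = cnj (inverse (x $ 1)) * dzbar 0 \<phi> (\<Psi> x)"
      unfolding linear_axis_mult[OF L] by (simp add: dzbar_def L_def)
    have "dzbar 1 \<psi> x = (L (axis 0 (?c * 1)) + \<i> * L (axis 0 (?c * \<i>))) / 2 + (L (axis 1 1) + \<i> * L (axis 1 \<i>)) / 2"
    proof -
      have "axis 0 (x $ 0 * - (inverse (x $ 1) * (axis 1 b :: complex ^ 2) $ 1 * inverse (x $ 1)) + (axis 1 b :: complex ^ 2) $ 0 * r x) +
          axis 1 ((axis 1 b :: complex ^ 2) $ 1) =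
          axis 0 (?c * b) + (axis 1 b :: complex ^ 2)" for b
        by (simp add: vec_eq_2 axis_def power2_eq_square)
      then show ?thesis
        unfolding dzbar_eq_dbar_dir dbar_dir_eqI[OF d]
        by (simp only: linear_add[OF L] mult_1_right) (simp add: field_simps)
    qed
    then show "dzbar 1 \<psi> x = dzbar 1 \<phi> (\<Psi> x) - cnj (x $ 0) * (cnj (inverse (x $ 1)))\<^sup>2 * dzbar 0 \<phi> (\<Psi> x)"
      unfolding linear_axis_mult[OF L] by (simp add: dzbar_def L_def field_simps)
  qed
  define m1 m0 where "m1 x = cnj (r x)" and "m0 x = cnj (x $ 0) * (cnj (r x) * cnj (r x))" for x
  have m1: "smooth m1" unfolding m1_def[abs_def] by (intro smooth_cnj r)
  have m0: "smooth m0" unfolding m0_def[abs_def] by (intro smooth_mult smooth_cnj r smooth_vec_nth smooth_ident)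
  have dzb0: "dzbar 0 (\<lambda>x :: complex ^ 2. cnj (x $ 0)) x = 1" for x
  proof -
    have "((\<lambda>x :: complex ^ 2. cnj (x $ 0)) has_derivative (\<lambda>v. cnj (v $ 0))) (at x)"
      by (intro bounded_linear.has_derivative[OF bounded_linear_cnj] bounded_linear_imp_has_derivative[OF bounded_linear_vec_nth])
    then show ?thesis unfolding dzbar_eq_dbar_dir by (subst dbar_dir_eqI, assumption) (simp add: axis_def)
  qed
  have sum: "dzbar 1 (\<lambda>x. m1 x * \<psi> x) x + dzbar 0 (\<lambda>x. m0 x * \<psi> x) x = cnj (r x) * dzbar 1 \<phi> (\<Psi> x)" for x
  proof (cases "x \<in> O'")
    case True
    have rx: "r x = inverse (x $ 1)" using True by (simp add: r_def O'_def smooth_recip_eq[OF \<tau>])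
    have sr: "smooth (\<lambda>x. cnj (r x))" "smooth (\<lambda>x. cnj (r x) * cnj (r x))" "smooth (\<lambda>x :: complex ^ 2. cnj (x $ 0))"
      by (intro smooth_mult smooth_cnj r smooth_vec_nth smooth_ident)+
    have "dzbar 0 m0 x = (cnj (r x))\<^sup>2"
      unfolding m0_def[abs_def] dzbar_mult[OF sr(3,2)] dzbar_mult[OF sr(1,1)] dzb0 dr(2)[OF True]
      by (simp add: power2_eq_square)
    moreover have "dzbar 1 m1 x = - (cnj (r x))\<^sup>2" unfolding m1_def[abs_def] dr(1)[OF True] rx ..
    ultimately show ?thesis
      unfolding dzbar_mult[OF m1 \<psi>] dzbar_mult[OF m0 \<psi>] d\<psi>[OF True]
      by (simp add: m1_def m0_def rx power2_eq_square algebra_simps)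
  next
    case False
    then have lt: "cmod (x $ 1) < \<tau>" using far(1)[of x] by (auto simp: O'_def)
    have op: "open {x :: complex ^ 2. cmod (x $ 1) < \<tau>}" by (intro open_Collect_less continuous_intros)
    have "frechet_derivative (\<lambda>x. m x * \<psi> x) (at x) v = 0" for m v
      by (rule frechet_derivative_zero_on_open[OF op]) (use lt near in auto)
    moreover have "frechet_derivative \<phi> (at (\<Psi> x)) v = 0" for v
      by (rule frechet_derivative_zero_on_open[OF op]) (use lt v in auto)
    ultimately show ?thesis by (simp add: dzbar_def)
  qed
  have i: "integrable lborel (\<lambda>x. f x * dzbar k (\<lambda>x. m x * \<psi> x) x)" "integrable lborel (\<lambda>x. g j x * (m x * \<psi> x))"
    if "smooth m" for m k j
    by (intro L2on_integrable_csmooth[OF f] L2on_integrable_csmooth[OF g] csmooth_dzbar test_fun_csmooth[OF test[OF that]])+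
  have eq: "(LINT x|lborel. f x * (cnj (r x) * dzbar 1 \<phi> (\<Psi> x))) = - (LINT x|lborel. g 1 x * (m1 x * \<psi> x) + g 0 x * (m0 x * \<psi> x))"
  proof -
    have "(LINT x|lborel. f x * (cnj (r x) * dzbar 1 \<phi> (\<Psi> x))) =
        (LINT x|lborel. f x * dzbar 1 (\<lambda>x. m1 x * \<psi> x) x + f x * dzbar 0 (\<lambda>x. m0 x * \<psi> x) x)"
      unfolding sum[symmetric] distrib_left ..
    also have "\<dots> = (LINT x|lborel. f x * dzbar 1 (\<lambda>x. m1 x * \<psi> x) x) + (LINT x|lborel. f x * dzbar 0 (\<lambda>x. m0 x * \<psi> x) x)"
      by (rule Bochner_Integration.integral_add[OF i(1)[OF m1] i(1)[OF m0]])
    also have "\<dots> = - (LINT x|lborel. g 1 x * (m1 x * \<psi> x)) - (LINT x|lborel. g 0 x * (m0 x * \<psi> x))"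
      using w[unfolded weak_div_single, rule_format, OF test[OF m1], of 1]
        w[unfolded weak_div_single, rule_format, OF test[OF m0], of 0] by simp
    also have "\<dots> = - (LINT x|lborel. g 1 x * (m1 x * \<psi> x) + g 0 x * (m0 x * \<psi> x))"
      by (subst Bochner_Integration.integral_add[OF i(2)[OF m1] i(2)[OF m0]]) simp
    finally show ?thesis .
  qed
  have [measurable]: "f \<in> borel_measurable borel" "g k \<in> borel_measurable borel" "r \<in> borel_measurable borel"
    "\<psi> \<in> borel_measurable borel" "m1 \<in> borel_measurable borel" "m0 \<in> borel_measurable borel"
    "(\<lambda>x. dzbar 1 \<phi> (\<Psi> x)) \<in> borel_measurable borel" for k
    using L2on_measurable[OF f] L2on_measurable[OF g] smooth_measurable[OF r] smooth_measurable[OF \<psi>]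
      smooth_measurable[OF m1] smooth_measurable[OF m0]
      smooth_measurable[OF smooth_compose[OF smooth_dzbar[OF sm] \<open>smooth \<Psi>\<close>]] by auto
  have sh: "r (shear x) = inverse (x $ 1)" "\<Psi> (shear x) = x" "x $ 1 \<noteq> 0" if "\<not> cmod (x $ 1) < \<tau>" for x
  proof -
    have x: "\<not> cmod (shear x $ 1) < \<tau>" using that by simp
    show "r (shear x) = inverse (x $ 1)" "x $ 1 \<noteq> 0" using far(2,3)[OF x] by simp_all
    then show "\<Psi> (shear x) = x" by (simp add: vec_eq_2)
  qed
  have n2: "complex_of_real ((cmod c)\<^sup>2) = c * cnj c" for c by (rule complex_norm_square)
  have s1: "(LINT x|lborel. f x * (cnj (r x) * dzbar 1 \<phi> (\<Psi> x))) =
      (LINT x|lborel. (cmod (x $ 1))\<^sup>2 *\<^sub>R (f (shear x) * (cnj (r (shear x)) * dzbar 1 \<phi> (\<Psi> (shear x)))))"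
    by (rule integral_shear[OF borel_measurable_times[OF L2on_measurable[OF f] smooth_measurable]])
      (intro smooth_mult smooth_cnj r smooth_compose[OF smooth_dzbar[OF sm] \<open>smooth \<Psi>\<close>])
  have s2: "(LINT x|lborel. g 1 x * (m1 x * \<psi> x) + g 0 x * (m0 x * \<psi> x)) =
      (LINT x|lborel. (cmod (x $ 1))\<^sup>2 *\<^sub>R (g 1 (shear x) * (m1 (shear x) * \<psi> (shear x)) + g 0 (shear x) * (m0 (shear x) * \<psi> (shear x))))"
    by (rule integral_shear) measurable
  have "(LINT x|lborel. pullback f x * dzbar 1 \<phi> x) = (LINT x|lborel. f x * (cnj (r x) * dzbar 1 \<phi> (\<Psi> x)))"
    unfolding s1
  proof (rule Bochner_Integration.integral_cong[OF refl])
    fix x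
    show "pullback f x * dzbar 1 \<phi> x = (cmod (x $ 1))\<^sup>2 *\<^sub>R (f (shear x) * (cnj (r (shear x)) * dzbar 1 \<phi> (\<Psi> (shear x))))"
    proof (cases "cmod (x $ 1) < \<tau>")
      case True
      have op: "open {x :: complex ^ 2. cmod (x $ 1) < \<tau>}" by (intro open_Collect_less continuous_intros)
      have "frechet_derivative \<phi> (at y) v = 0" if "cmod (y $ 1) < \<tau>" for v y
        by (rule frechet_derivative_zero_on_open[OF op]) (use that assms(6) in auto)
      then show ?thesis using True by (simp add: dzbar_def)
    next
      case False
      then show ?thesis using sh(3)[OF False]
        unfolding scaleR_conv_of_real n2 sh(1,2)[OF False] by (simp add: pullback_def)
    qed
  qed
  also note eq
  also have "(LINT x|lborel. g 1 x * (m1 x * \<psi> x) + g 0 x * (m0 x * \<psi> x)) =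
      (LINT x|lborel. (pullback (g 1) x + cnj (x $ 0) * pullback (g 0) x) * \<phi> x)"
    unfolding s2
  proof (rule Bochner_Integration.integral_cong[OF refl])
    fix x
    show "(cmod (x $ 1))\<^sup>2 *\<^sub>R (g 1 (shear x) * (m1 (shear x) * \<psi> (shear x)) + g 0 (shear x) * (m0 (shear x) * \<psi> (shear x))) =
        (pullback (g 1) x + cnj (x $ 0) * pullback (g 0) x) * \<phi> x"
    proof (cases "cmod (x $ 1) < \<tau>")
      case True
      then show ?thesis using v near by simp
    next
      case False
      then show ?thesis using sh(3)[OF False]
        unfolding scaleR_conv_of_real n2 m1_def m0_def \<psi>_def sh(1,2)[OF False]
        by (simp add: pullback_def algebra_simps)
    qed
  qed
  finally show ?thesis .
qed

lemma tendsto_0_of_square: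
  fixes I :: "nat \<Rightarrow> complex"
  assumes "(\<lambda>n. (ennreal (cmod (I n)))\<^sup>2) \<longlonglongrightarrow> 0"
  shows "I \<longlonglongrightarrow> 0"
proof -
  have "(\<lambda>n. ennreal ((cmod (I n))\<^sup>2)) \<longlonglongrightarrow> ennreal 0" using assms by (simp add: ennreal_cmod_square)
  then have "(\<lambda>n. (cmod (I n))\<^sup>2) \<longlonglongrightarrow> 0"
    by (subst (asm) tendsto_ennreal_iff) auto
  then have "(\<lambda>n. sqrt ((cmod (I n))\<^sup>2)) \<longlonglongrightarrow> sqrt 0" by (rule tendsto_real_sqrt)
  then show ?thesis by (simp add: tendsto_norm_zero_iff)
qed

text \<open>
  By the chain rule this is the derivative of \<open>w * f (u w, w)\<close> with respect to \<open>cnj w\<close> for fixed \<open>u\<close>,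
  if \<open>g\<close> collects the antiholomorphic derivatives of \<open>f\<close>.
\<close>

definition pullback_rhs :: "(2 \<Rightarrow> complex ^ 2 \<Rightarrow> complex) \<Rightarrow> complex ^ 2 \<Rightarrow> complex" where
  "pullback_rhs g x = pullback (g 1) x + cnj (x $ 0) * pullback (g 0) x"

lemma L2on_pullback_rhs: assumes "\<And>k. L2on T (g k)" shows "L2on bidisc (pullback_rhs g)"
  unfolding pullback_rhs_def[abs_def]
proof (intro L2on_add L2on_pullback assms)
  have sm: "smooth (\<lambda>x :: complex ^ 2. cnj (x $ 0))" by (intro smooth_intros)
  show "L2on bidisc (\<lambda>x. cnj (x $ 0) * pullback (g 0) x)"
    by (rule L2on_mult_bounded[OF L2on_pullback[OF assms] smooth_measurable[OF sm], where B = 1])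
      (simp add: bidisc_def)
qed

lemma emeasure_thin_bidisc:
  assumes d: "d > 0"
  shows "emeasure lborel (bidisc \<inter> {x. cmod (x $ 1) \<le> 2 * d}) \<le> ennreal (64 * d\<^sup>2)"
proof -
  let ?u = "vec2 (Complex 1 1) (Complex (2 * d) (2 * d))"
  have "bidisc \<inter> {x. cmod (x $ 1) \<le> 2 * d} \<subseteq> cbox (- ?u) ?u"
  proof
    fix x assume "x \<in> bidisc \<inter> {x. cmod (x $ 1) \<le> 2 * d}"
    then have "\<bar>Re (x $ 0)\<bar> \<le> 1" "\<bar>Im (x $ 0)\<bar> \<le> 1" "\<bar>Re (x $ 1)\<bar> \<le> 2 * d" "\<bar>Im (x $ 1)\<bar> \<le> 2 * d"
      using abs_Re_le_cmod[of "x $ 0"] abs_Im_le_cmod[of "x $ 0"] abs_Re_le_cmod[of "x $ 1"] abs_Im_le_cmod[of "x $ 1"]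
      by (auto simp: bidisc_def)
    then show "x \<in> cbox (- ?u) ?u"
      by (auto simp: mem_box Basis_complex2 inner_axis abs_le_iff)
  qed
  then have "emeasure lborel (bidisc \<inter> {x. cmod (x $ 1) \<le> 2 * d}) \<le> emeasure lborel (cbox (- ?u) ?u)"
    by (rule emeasure_mono) simp
  also have "\<dots> = ennreal (\<Prod>b\<in>Basis. (?u - - ?u) \<bullet> b)"
    by (rule emeasure_lborel_cbox) (use d in \<open>auto simp: Basis_complex2 inner_axis\<close>)
  also have "(\<Prod>b\<in>Basis. (?u - - ?u) \<bullet> b) = 64 * d\<^sup>2"
    unfolding prod_Basis_complex2[of "\<lambda>t. t"] by (simp add: power2_eq_square)
  finally show ?thesis .
qed

text \<open>
  A square integrable function does not see the axis \<open>w = 0\<close>: the derivative of the cutoff at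
  distance \<open>d\<close> has size \<open>C / d\<close>, but the tube in which it lives has measure of order \<open>d\<^sup>2\<close>.
\<close>

lemma pullback_equation:
  assumes f: "L2on T f" and g: "\<And>k. L2on T (g k)"
    and w: "\<And>k. weak_div T (\<lambda>j. if j = k then f else (\<lambda>x. 0)) (g k)"
  shows "weak_div bidisc (\<lambda>j. if j = 1 then pullback f else (\<lambda>x. 0)) (pullback_rhs g)"
  unfolding weak_div_single
proof (intro allI impI)
  fix \<phi> assume \<phi>: "test_fun bidisc \<phi>"
  note cs = test_fun_csmooth[OF \<phi>]
  note sm = csmooth_imp_smooth[OF cs]
  obtain C where C: "C > 0"
    "\<And>\<epsilon> x. \<epsilon> > 0 \<Longrightarrow> cmod (dzbar 1 (punct_cutoff \<epsilon>) x) \<le> C / \<epsilon>"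
    "\<And>\<epsilon> x. \<epsilon> > 0 \<Longrightarrow> cmod (x $ 1) < \<epsilon> \<or> cmod (x $ 1) > 2 * \<epsilon> \<Longrightarrow> dzbar 1 (punct_cutoff \<epsilon>) x = 0"
    by (rule dzbar_punct_cutoff) (rule that)
  obtain B where B: "B > 0" "\<And>x. cmod (\<phi> x) \<le> B" using csmooth_bounded[OF cs] by metis
  define d where "d n = 1 / real (Suc n)" for n
  have d: "d n > 0" for n by (simp add: d_def)
  have dlim: "d \<longlonglongrightarrow> 0" unfolding d_def using LIMSEQ_inverse_real_of_nat by (simp add: inverse_eq_divide)
  define \<kappa> where "\<kappa> n = punct_cutoff (d n)" for n
  have \<kappa>: "smooth (\<kappa> n)" for n unfolding \<kappa>_def using d[of n] by (intro smooth_punct_cutoff) simp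
  note h = L2on_pullback[OF f]
  note G = L2on_pullback_rhs[OF g]
  have h0: "pullback f x = 0" "pullback_rhs g x = 0" if "x $ 1 = 0" for x
    using that by (simp_all add: pullback_def pullback_rhs_def)
  have ev: "eventually (\<lambda>n. 2 * d n < cmod (x $ 1)) sequentially" if "x $ 1 \<noteq> 0" for x :: "complex ^ 2"
  proof -
    have "cmod (x $ 1) / 2 > 0" using that by simp
    from order_tendstoD(2)[OF dlim this] show ?thesis by eventually_elim simp
  qed
  have \<kappa>lim: "(\<lambda>n. u x * (\<kappa> n x * v x)) \<longlonglongrightarrow> u x * v x" if "x $ 1 = 0 \<Longrightarrow> u x = 0" for u v :: "complex ^ 2 \<Rightarrow> complex" and x
  proof (cases "x $ 1 = 0")
    case False
    have "eventually (\<lambda>n. u x * (\<kappa> n x * v x) = u x * v x) sequentially"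
      using ev[OF False] by eventually_elim (simp add: \<kappa>_def punct_cutoff_values(4)[OF d])
    then show ?thesis by (rule tendsto_eventually)
  qed (simp add: that)
  have dom: "(\<lambda>n. LINT x|lborel. u x * (\<kappa> n x * v x)) \<longlonglongrightarrow> (LINT x|lborel. u x * v x)"
    if u: "L2on bidisc u" "\<And>x. x $ 1 = 0 \<Longrightarrow> u x = 0" and v: "csmooth v" for u v
  proof (rule integral_dominated_convergence[where w = "\<lambda>x. cmod (u x * v x)"])
    show "(\<lambda>x. u x * v x) \<in> borel_measurable lborel"
      using L2on_measurable[OF u(1)] csmooth_measurable[OF v] by simp
    show "(\<lambda>x. u x * (\<kappa> n x * v x)) \<in> borel_measurable lborel" for n
      using L2on_measurable[OF u(1)] csmooth_measurable[OF v] smooth_measurable[OF \<kappa>[of n]] by simp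
    show "integrable lborel (\<lambda>x. cmod (u x * v x))"
      by (rule integrable_norm[OF L2on_integrable_csmooth[OF u(1) v]])
    show "AE x in lborel. (\<lambda>n. u x * (\<kappa> n x * v x)) \<longlonglongrightarrow> u x * v x"
      using \<kappa>lim u(2) by (intro AE_I2) blast
    show "AE x in lborel. cmod (u x * (\<kappa> n x * v x)) \<le> cmod (u x * v x)" for n
    proof (rule AE_I2)
      fix x
      have "cmod (\<kappa> n x) * (cmod (u x) * cmod (v x)) \<le> 1 * (cmod (u x) * cmod (v x))"
        unfolding \<kappa>_def by (intro mult_right_mono punct_cutoff_values(1)[OF d]) auto
      then show "cmod (u x * (\<kappa> n x * v x)) \<le> cmod (u x * v x)" by (simp add: norm_mult mult.left_commute)
    qed
  qed
  let ?A = "\<lambda>n. bidisc \<inter> {x. cmod (x $ 1) \<le> 2 * d n}"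
  have A [measurable]: "?A n \<in> sets borel" for n
    by (intro sets.Int bidisc_borel borel_closed closed_Collect_le continuous_intros)
  have hl: "(\<lambda>n. l2 (?A n) (pullback f)) \<longlonglongrightarrow> 0"
  proof -
    have "(\<lambda>n. l2 UNIV (\<lambda>x. indicator (?A n) x * pullback f x)) \<longlonglongrightarrow> 0"
    proof (rule l2_dominated_tendsto_0[where w = "pullback f"])
      show "(\<lambda>x. indicator (?A n) x * pullback f x) \<in> borel_measurable borel" for n
        by (intro borel_measurable_times borel_measurable_indicator A L2on_measurable[OF h])
      show "cmod (indicator (?A n) x * pullback f x) \<le> cmod (pullback f x)" for n x
        by (simp add: indicator_def)
      show "AE x in lborel. x \<in> UNIV \<longrightarrow> (\<lambda>n. indicator (?A n) x * pullback f x) \<longlonglongrightarrow> 0"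
      proof (intro AE_I2 impI)
        fix x :: "complex ^ 2"
        show "(\<lambda>n. indicator (?A n) x * pullback f x) \<longlonglongrightarrow> 0"
        proof (cases "x $ 1 = 0")
          case False
          have "eventually (\<lambda>n. indicator (?A n) x * pullback f x = 0) sequentially"
            using ev[OF False] by eventually_elim simp
          then show ?thesis by (rule tendsto_eventually)
        qed (simp add: h0)
      qed
    qed (use L2on_measurable[OF h] L2on_l2[OF h] in auto)
    moreover have "l2 UNIV (\<lambda>x. indicator (?A n) x * pullback f x) = l2 (?A n) (pullback f)" for n
    proof -
      have "l2 UNIV (\<lambda>x. indicator (?A n) x * pullback f x) = l2 (?A n) (\<lambda>x. indicator (?A n) x * pullback f x)"
        by (rule l2_support) auto
      also have "\<dots> = l2 (?A n) (pullback f)" by (rule l2_cong) auto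
      finally show ?thesis .
    qed
    ultimately show ?thesis by simp
  qed
  have bad: "(\<lambda>n. LINT x|lborel. pullback f x * (dzbar 1 (\<kappa> n) x * \<phi> x)) \<longlonglongrightarrow> 0"
  proof (rule tendsto_0_of_square, rule tendsto_sandwich[OF _ _ tendsto_const])
    show "eventually (\<lambda>n. 0 \<le> (ennreal (cmod (LINT x|lborel. pullback f x * (dzbar 1 (\<kappa> n) x * \<phi> x))))\<^sup>2) sequentially"
      by simp
    have "(\<lambda>n. l2 (?A n) (pullback f) * ennreal (64 * (B * C)\<^sup>2)) \<longlonglongrightarrow> 0 * ennreal (64 * (B * C)\<^sup>2)"
      by (intro tendsto_mult_ennreal hl tendsto_const) auto
    then show "(\<lambda>n. l2 (?A n) (pullback f) * ennreal (64 * (B * C)\<^sup>2)) \<longlonglongrightarrow> 0" by simp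
    show "eventually (\<lambda>n. (ennreal (cmod (LINT x|lborel. pullback f x * (dzbar 1 (\<kappa> n) x * \<phi> x))))\<^sup>2 \<le>
        l2 (?A n) (pullback f) * ennreal (64 * (B * C)\<^sup>2)) sequentially"
    proof (intro always_eventually allI)
      fix n
      let ?m = "\<lambda>x. dzbar 1 (\<kappa> n) x * \<phi> x"
      have csm: "csmooth ?m" by (intro csmooth_mult smooth_dzbar \<kappa> cs)
      have "(ennreal (cmod (LINT x|lborel. pullback f x * ?m x)))\<^sup>2 \<le> l2 (?A n) (pullback f) * l2 (?A n) ?m"
      proof (rule l2_pairing(2))
        show "pullback f x * ?m x = 0" if "x \<notin> ?A n" for x
        proof (cases "x \<in> bidisc")
          case True
          with that have "dzbar 1 (\<kappa> n) x = 0" unfolding \<kappa>_def by (intro C(3)[OF d]) auto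
          then show ?thesis by simp
        next
          case False
          then show ?thesis using h by (simp add: L2on_def)
        qed
      qed (use L2on_measurable[OF h] L2on_l2[OF h] csmooth_measurable[OF csm] csmooth_l2[OF csm] A in auto)
      also have "l2 (?A n) ?m \<le> ennreal (64 * (B * C)\<^sup>2)"
      proof -
        have "l2 (?A n) ?m \<le> l2 (?A n) (\<lambda>x. of_real (C / d n * B))"
        proof (rule l2_mono[OF order_refl])
          fix x
          have "cmod (dzbar 1 (\<kappa> n) x) * cmod (\<phi> x) \<le> C / d n * B"
            unfolding \<kappa>_def using C(1) d[of n] by (intro mult_mono C(2)[OF d] B(2)) auto
          then show "cmod (?m x) \<le> cmod (complex_of_real (C / d n * B))"
            using order_trans[OF _ abs_ge_self] by (simp only: norm_mult norm_of_real)
        qed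
        also have "\<dots> = ennreal ((C / d n * B)\<^sup>2) * emeasure lborel (?A n)"
          by (subst l2_const[OF A]) (simp only: norm_of_real power2_abs)
        also have "\<dots> \<le> ennreal ((C / d n * B)\<^sup>2) * ennreal (64 * (d n)\<^sup>2)"
          by (intro mult_left_mono emeasure_thin_bidisc d) simp
        also have "\<dots> = ennreal ((C / d n * B)\<^sup>2 * (64 * (d n)\<^sup>2))" by (simp add: ennreal_mult)
        also have "(C / d n * B)\<^sup>2 * (64 * (d n)\<^sup>2) = 64 * (B * C)\<^sup>2"
          using d[of n] by (simp add: power_mult_distrib power_divide)
        finally show ?thesis .
      qed
      finally show "(ennreal (cmod (LINT x|lborel. pullback f x * ?m x)))\<^sup>2 \<le> l2 (?A n) (pullback f) * ennreal (64 * (B * C)\<^sup>2)"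
        by (simp add: mult_left_mono)
    qed
  qed
  have eq: "(LINT x|lborel. pullback f x * (\<kappa> n x * dzbar 1 \<phi> x)) =
      - (LINT x|lborel. pullback_rhs g x * (\<kappa> n x * \<phi> x)) - (LINT x|lborel. pullback f x * (dzbar 1 (\<kappa> n) x * \<phi> x))" for n
  proof -
    have "(LINT x|lborel. pullback f x * dzbar 1 (\<lambda>x. \<kappa> n x * \<phi> x) x) =
        - (LINT x|lborel. pullback_rhs g x * (\<kappa> n x * \<phi> x))"
      unfolding pullback_rhs_def
      by (rule pullback_equation_off_axis[OF f g w test_fun_mult[OF \<kappa> \<phi>] d[of n]])
        (simp add: \<kappa>_def punct_cutoff_values(3)[OF d])
    moreover have "(LINT x|lborel. pullback f x * dzbar 1 (\<lambda>x. \<kappa> n x * \<phi> x) x) =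
        (LINT x|lborel. pullback f x * (dzbar 1 (\<kappa> n) x * \<phi> x)) + (LINT x|lborel. pullback f x * (\<kappa> n x * dzbar 1 \<phi> x))"
      unfolding dzbar_mult[OF \<kappa> sm] distrib_left
      by (intro Bochner_Integration.integral_add L2on_integrable_csmooth[OF h] csmooth_mult smooth_dzbar \<kappa> cs csmooth_dzbar)
    ultimately show ?thesis by (simp add: algebra_simps)
  qed
  have "(\<lambda>n. - (LINT x|lborel. pullback_rhs g x * (\<kappa> n x * \<phi> x)) - (LINT x|lborel. pullback f x * (dzbar 1 (\<kappa> n) x * \<phi> x)))
      \<longlonglongrightarrow> - (LINT x|lborel. pullback_rhs g x * \<phi> x) - 0"
    by (intro tendsto_diff tendsto_minus dom[OF G _ cs] bad h0)
  moreover have "(\<lambda>n. LINT x|lborel. pullback f x * (\<kappa> n x * dzbar 1 \<phi> x)) \<longlonglongrightarrow> (LINT x|lborel. pullback f x * dzbar 1 \<phi> x)"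
    by (intro dom[OF h _ csmooth_dzbar[OF cs]] h0)
  ultimately have "(LINT x|lborel. pullback f x * dzbar 1 \<phi> x) = - (LINT x|lborel. pullback_rhs g x * \<phi> x) - 0"
    unfolding eq by (intro LIMSEQ_unique)
  then show "(LINT x|lborel. pullback_rhs g x * \<phi> x) = - (LINT x|lborel. pullback f x * dzbar 1 \<phi> x)" by simp
qed

section \<open>A Hardy inequality with a logarithmic weight\<close>

text \<open>
  With \<open>t = (cmod w)\<^sup>2\<close> and \<open>s = 0\<close> the two weights behave like \<open>2 ln (1 / cmod w)\<close> and like the inverse
  of \<open>(cmod w)\<^sup>2 * 2 ln (1 / cmod w)\<close>; a positive \<open>s\<close> makes them smooth at the origin.
\<close>

definition log_weight :: "real \<Rightarrow> real \<Rightarrow> real" where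
  "log_weight s t = ln (1 + inverse (t + s\<^sup>2))"

definition hardy_weight :: "real \<Rightarrow> real \<Rightarrow> real" where
  "hardy_weight s t = inverse ((t + s\<^sup>2) * log_weight s t)"

lemma log_weight_pos: "s > 0 \<Longrightarrow> t \<ge> 0 \<Longrightarrow> log_weight s t > 0"
  unfolding log_weight_def by (intro ln_gt_zero) (simp add: add_nonneg_pos)

lemma hardy_weight_pos: assumes "s > 0" "t \<ge> 0" shows "hardy_weight s t > 0"
proof -
  have "t + s\<^sup>2 > 0" using assms by (simp add: add_nonneg_pos)
  then show ?thesis unfolding hardy_weight_def using log_weight_pos[OF assms] by simp
qed

lemma log_weight_deriv:
  assumes "s > 0" "t \<ge> 0"
  shows "(log_weight s has_real_derivative - 1 / ((t + s\<^sup>2) * (t + s\<^sup>2 + 1))) (at t)"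
proof -
  define q where "q = t + s\<^sup>2"
  have q: "q > 0" using assms by (simp add: q_def add_nonneg_pos)
  have d1: "((\<lambda>t. t + s\<^sup>2) has_real_derivative 1) (at t)" by (auto intro!: derivative_eq_intros)
  have d2: "((\<lambda>t. 1 + inverse (t + s\<^sup>2)) has_real_derivative - (inverse q * inverse q)) (at t)"
    using q by (auto intro!: derivative_eq_intros simp: q_def power2_eq_square)
  have "1 + inverse q > 0" using q by (simp add: add_pos_pos)
  then have "((\<lambda>t. ln (1 + inverse (t + s\<^sup>2))) has_real_derivative inverse (1 + inverse q) * - (inverse q * inverse q)) (at t)"
    unfolding q_def by (intro DERIV_chain2[OF DERIV_ln d2[unfolded q_def]])
  moreover have "inverse (1 + inverse q) * - (inverse q * inverse q) = - 1 / (q * (q + 1))"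
    using q by (simp add: field_simps)
  ultimately show ?thesis by (simp add: log_weight_def[abs_def] q_def)
qed

definition hardy_weight' :: "real \<Rightarrow> real \<Rightarrow> real" where
  "hardy_weight' s t = - ((log_weight s t - 1 / (t + s\<^sup>2 + 1)) * (hardy_weight s t)\<^sup>2)"

lemma hardy_weight_deriv:
  assumes s: "s > 0" "t \<ge> 0"
  shows "(hardy_weight s has_real_derivative hardy_weight' s t) (at t)"
proof -
  define q where "q = t + s\<^sup>2"
  have q: "q > 0" using assms by (simp add: q_def add_nonneg_pos)
  have l: "log_weight s t > 0" by (rule log_weight_pos[OF s])
  have d1: "((\<lambda>t. t + s\<^sup>2) has_real_derivative 1) (at t)" by (auto intro!: derivative_eq_intros)
  have d: "((\<lambda>t. (t + s\<^sup>2) * log_weight s t) has_real_derivative 1 * log_weight s t + - 1 / ((t + s\<^sup>2) * (t + s\<^sup>2 + 1)) * (t + s\<^sup>2)) (at t)"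
    by (rule DERIV_mult[OF d1 log_weight_deriv[OF s]])
  have "((\<lambda>t. inverse ((t + s\<^sup>2) * log_weight s t)) has_real_derivative
      - (inverse ((t + s\<^sup>2) * log_weight s t) * (1 * log_weight s t + - 1 / ((t + s\<^sup>2) * (t + s\<^sup>2 + 1)) * (t + s\<^sup>2)) * inverse ((t + s\<^sup>2) * log_weight s t))) (at t)"
    by (rule DERIV_inverse'[OF d]) (use q l in \<open>simp add: q_def[symmetric]\<close>)
  moreover have "- (inverse (q * L) * (1 * L + - 1 / (q * (q + 1)) * q) * inverse (q * L)) =
      - ((L - 1 / (q + 1)) * (inverse (q * L))\<^sup>2)" for L :: real
    using q by (simp add: power2_eq_square)
  ultimately show ?thesis
    unfolding hardy_weight_def[abs_def] hardy_weight'_def q_def by simp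
qed

text \<open>
  On the right is the divergence in the plane of the vector field \<open>hardy_weight s ((cmod w)\<^sup>2) * w\<close>, on
  the left two thirds of its square. The logarithm is what makes this possible: up to a
  nonnegative remainder the terms of leading order cancel, and the derivative of the logarithm is
  left.
\<close>

lemma hardy_divergence:
  assumes s: "s > 0" "s \<le> 1" and t: "0 \<le> t" "t \<le> 1"
  shows "2 / 3 * (t * (hardy_weight s t)\<^sup>2) \<le> 2 * hardy_weight s t + 2 * t * hardy_weight' s t"
proof -
  define q a L where "q = t + s\<^sup>2" and "a = hardy_weight s t" and "L = log_weight s t"
  have q: "q > 0" "q + 1 \<le> 3" "t \<le> q"
    using s t power_le_one[of s 2] by (auto simp: q_def add_nonneg_pos)
  have L: "L > 0" unfolding L_def by (rule log_weight_pos[OF s(1) t(1)])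
  have a: "a = inverse (q * L)" by (simp add: a_def hardy_weight_def q_def L_def)
  have a0: "a > 0" unfolding a using q L by simp
  have "a * L * q = 1" unfolding a using q L by (simp add: field_simps)
  then have "t * (a\<^sup>2 * L) * q = a * t" by (simp add: power2_eq_square algebra_simps)
  also have "\<dots> \<le> a * q" using a0 q by simp
  finally have 1: "t * (a\<^sup>2 * L) \<le> a" using q by simp
  have "1 / 3 \<le> 1 / (q + 1)" using q by (intro divide_left_mono) auto
  then have "(1 / 3) * (t * a\<^sup>2) \<le> (1 / (q + 1)) * (t * a\<^sup>2)" using t by (intro mult_right_mono) auto
  moreover have "2 * a + 2 * t * hardy_weight' s t = 2 * a - 2 * (t * (a\<^sup>2 * L)) + 2 * ((1 / (q + 1)) * (t * a\<^sup>2))"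
    unfolding hardy_weight'_def a_def[symmetric] L_def[symmetric] q_def[symmetric] by (simp add: algebra_simps)
  ultimately show ?thesis using 1 unfolding a_def[symmetric] by simp
qed

definition hardy_field :: "real \<Rightarrow> complex ^ 2 \<Rightarrow> complex" where
  "hardy_field s x = of_real (hardy_weight s (x $ 1 \<bullet> x $ 1)) * x $ 1"

lemma smooth_hardy_weight: assumes "s > 0" shows "smooth (\<lambda>x :: complex ^ 2. hardy_weight s (x $ 1 \<bullet> x $ 1))"
proof -
  have 1: "smooth (\<lambda>x :: complex ^ 2. x $ 1 \<bullet> x $ 1 + s\<^sup>2)" by (intro smooth_intros)
  have p: "x $ 1 \<bullet> x $ 1 + s\<^sup>2 > 0" for x :: "complex ^ 2" using assms by (simp add: add_nonneg_pos)
  then have p0: "x $ 1 \<bullet> x $ 1 + s\<^sup>2 \<noteq> 0" for x :: "complex ^ 2" by (metis less_irrefl)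
  have 2: "smooth (\<lambda>x :: complex ^ 2. 1 + inverse (x $ 1 \<bullet> x $ 1 + s\<^sup>2))"
    by (rule smooth_add[OF smooth_const smooth_inverse[OF p0 1]])
  have p2: "1 + inverse (x $ 1 \<bullet> x $ 1 + s\<^sup>2) > 0" for x :: "complex ^ 2" using p[of x] by (simp add: add_pos_pos)
  have 3: "smooth (\<lambda>x :: complex ^ 2. log_weight s (x $ 1 \<bullet> x $ 1))"
    unfolding log_weight_def by (rule smooth_ln[OF p2 2])
  have nz: "(x $ 1 \<bullet> x $ 1 + s\<^sup>2) * log_weight s (x $ 1 \<bullet> x $ 1) \<noteq> 0" for x :: "complex ^ 2"
    using p0[of x] log_weight_pos[OF assms, of "x $ 1 \<bullet> x $ 1"] by simp
  show ?thesis
    unfolding hardy_weight_def by (rule smooth_inverse[OF nz smooth_mult[OF 1 3]])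
qed

text \<open>
  Integration by parts against the vector field bounds the weighted norm of \<open>\<phi>\<close> by the full
  gradient in \<open>w\<close>. For a function of bounded support the cross terms cancel after integration, so
  that the full gradient has the same norm as twice the antiholomorphic derivative. The factor \<open>\<theta>\<close>
  does not depend on \<open>w\<close>; it localizes in the other coordinate without producing derivatives.
\<close>

lemma hardy_inequality:
  fixes \<theta> :: "complex ^ 2 \<Rightarrow> real"
  assumes \<phi>: "csmooth \<phi>" and supp: "\<And>x. \<phi> x \<noteq> 0 \<Longrightarrow> cmod (x $ 1) \<le> 1"
    and \<theta>: "smooth \<theta>" "\<And>x. \<theta> x \<ge> 0" "\<And>x c. frechet_derivative \<theta> (at x) (axis 1 c) = 0"
    and s: "0 < s" "s \<le> 1"
  shows "(\<integral>\<^sup>+x. ennreal (\<theta> x * (cmod (hardy_field s x * \<phi> x))\<^sup>2) \<partial>lborel) \<le>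
    ennreal 36 * (\<integral>\<^sup>+x. ennreal (\<theta> x * (cmod (dzbar 1 \<phi> x))\<^sup>2) \<partial>lborel)"
proof -
  note sm = csmooth_imp_smooth[OF \<phi>]
  define p1 p2 where "p1 x = frechet_derivative \<phi> (at x) (axis 1 1)" and "p2 x = frechet_derivative \<phi> (at x) (axis 1 \<i>)" for x
  have cp: "csmooth p1" "csmooth p2" unfolding p1_def[abs_def] p2_def[abs_def] by (intro csmooth_derivative \<phi>)+
  note sp = csmooth_imp_smooth[OF cp(1)] csmooth_imp_smooth[OF cp(2)]
  have c\<phi>: "csmooth (\<lambda>x. cnj (u x))" if "csmooth u" for u :: "complex ^ 2 \<Rightarrow> complex"
    using that by (auto simp: csmooth_def intro: smooth_cnj)
  have dcnj: "frechet_derivative (\<lambda>x. cnj (\<phi> x)) (at x) v = cnj (frechet_derivative \<phi> (at x) v)" for x v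
    by (subst frechet_derivative_eqI[OF bounded_linear.has_derivative[OF bounded_linear_cnj smooth_has_derivative[OF sm]]]) (rule refl)
  have dof: "frechet_derivative (\<lambda>x. complex_of_real (u x)) (at x) v = of_real (frechet_derivative u (at x) v)" if "smooth u" for u :: "complex ^ 2 \<Rightarrow> real" and x v
    by (subst frechet_derivative_eqI[OF bounded_linear.has_derivative[OF bounded_linear_of_real smooth_has_derivative[OF that]]]) (rule refl)
  have dmul: "frechet_derivative (\<lambda>x. u x * v x) (at x) y = u x * frechet_derivative v (at x) y + frechet_derivative u (at x) y * v x"
    if "smooth u" "smooth v" for u v :: "complex ^ 2 \<Rightarrow> complex" and x y
    by (subst frechet_derivative_eqI[OF has_derivative_mult[OF smooth_has_derivative[OF that(1)] smooth_has_derivative[OF that(2)]]]) (rule refl)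
  have s\<theta>: "smooth (\<lambda>x. complex_of_real (\<theta> x))" by (rule smooth_of_real[OF \<theta>(1)])
  \<comment> \<open>Interchanging the two real derivatives by parts; \<open>\<theta>\<close> passes through them, as it does not depend on \<open>w\<close>.\<close>
  have cross: "(LINT x|lborel. of_real (\<theta> x) * (p1 x * cnj (p2 x))) = (LINT x|lborel. of_real (\<theta> x) * (p2 x * cnj (p1 x)))"
  proof -
    have d: "frechet_derivative (\<lambda>x. of_real (\<theta> x) * cnj (\<phi> x)) (at x) (axis 1 c) = of_real (\<theta> x) * cnj (frechet_derivative \<phi> (at x) (axis 1 c))" for x c
      unfolding dmul[OF s\<theta> smooth_cnj[OF sm]] dof[OF \<theta>(1)] dcnj \<theta>(3) by simp
    have "csmooth (\<lambda>x. of_real (\<theta> x) * cnj (\<phi> x))" by (rule csmooth_mult[OF s\<theta> c\<phi>[OF \<phi>]])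
    from integral_derivatives_swap[OF \<phi> this, of "axis 1 1" "axis 1 \<i>"]
    show ?thesis unfolding d p1_def[symmetric] p2_def[symmetric] by (simp add: mult.left_commute)
  qed
  have int: "integrable lborel (\<lambda>x. of_real (\<theta> x) * (u x * cnj (v x)))" if "csmooth u" "csmooth v" for u v :: "complex ^ 2 \<Rightarrow> complex"
    by (intro csmooth_integrable csmooth_mult s\<theta> csmooth_imp_smooth[OF that(1)] c\<phi>[OF that(2)])
  have n2: "complex_of_real ((cmod c)\<^sup>2) = c * cnj c" for c by (rule complex_norm_square)
  have rint: "integrable lborel (\<lambda>x. \<theta> x * (cmod (u x))\<^sup>2)" if "csmooth u" for u
  proof -
    have "integrable lborel (\<lambda>x. complex_of_real (\<theta> x * (cmod (u x))\<^sup>2))"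
      unfolding of_real_mult n2 by (rule int[OF that that])
    then show ?thesis by (simp only: complex_of_real_integrable_eq)
  qed
  have grad: "(LINT x|lborel. \<theta> x * (cmod (p1 x))\<^sup>2) + (LINT x|lborel. \<theta> x * (cmod (p2 x))\<^sup>2) =
      4 * (LINT x|lborel. \<theta> x * (cmod (dzbar 1 \<phi> x))\<^sup>2)"
  proof -
    have pt: "4 * complex_of_real (\<theta> x * (cmod (dzbar 1 \<phi> x))\<^sup>2) =
        (complex_of_real (\<theta> x * (cmod (p1 x))\<^sup>2) + complex_of_real (\<theta> x * (cmod (p2 x))\<^sup>2)) +
        \<i> * (of_real (\<theta> x) * (p2 x * cnj (p1 x)) - of_real (\<theta> x) * (p1 x * cnj (p2 x)))" for x
    proof -
      have "2 * dzbar 1 \<phi> x = p1 x + \<i> * p2 x" by (simp add: dzbar_def p1_def p2_def)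
      then have "(2 * dzbar 1 \<phi> x) * cnj (2 * dzbar 1 \<phi> x) = (p1 x + \<i> * p2 x) * cnj (p1 x + \<i> * p2 x)" by simp
      then have "4 * (dzbar 1 \<phi> x * cnj (dzbar 1 \<phi> x)) = p1 x * cnj (p1 x) + p2 x * cnj (p2 x) + \<i> * (p2 x * cnj (p1 x) - p1 x * cnj (p2 x))"
        by (simp add: algebra_simps)
      then have "of_real (\<theta> x) * (4 * (dzbar 1 \<phi> x * cnj (dzbar 1 \<phi> x))) =
          of_real (\<theta> x) * (p1 x * cnj (p1 x) + p2 x * cnj (p2 x) + \<i> * (p2 x * cnj (p1 x) - p1 x * cnj (p2 x)))" by simp
      then show ?thesis unfolding of_real_mult n2 by (simp add: algebra_simps)
    qed
    have cint: "integrable lborel (\<lambda>x. complex_of_real (\<theta> x * (cmod (u x))\<^sup>2))" if "csmooth u" for u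
      by (rule integrable_of_real[OF rint[OF that]])
    have "complex_of_real (4 * (LINT x|lborel. \<theta> x * (cmod (dzbar 1 \<phi> x))\<^sup>2)) =
        (LINT x|lborel. 4 * complex_of_real (\<theta> x * (cmod (dzbar 1 \<phi> x))\<^sup>2))"
      unfolding integral_mult_right_zero integral_complex_of_real by simp
    also have "\<dots> = ((LINT x|lborel. complex_of_real (\<theta> x * (cmod (p1 x))\<^sup>2)) + (LINT x|lborel. complex_of_real (\<theta> x * (cmod (p2 x))\<^sup>2))) +
        \<i> * ((LINT x|lborel. of_real (\<theta> x) * (p2 x * cnj (p1 x))) - (LINT x|lborel. of_real (\<theta> x) * (p1 x * cnj (p2 x))))"
      unfolding pt
      using Bochner_Integration.integral_add[OF Bochner_Integration.integrable_add[OF cint[OF cp(1)] cint[OF cp(2)]]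
          integrable_mult_right[OF Bochner_Integration.integrable_diff[OF int[OF cp(2,1)] int[OF cp(1,2)]], of \<i>]]
        Bochner_Integration.integral_add[OF cint[OF cp(1)] cint[OF cp(2)]]
        Bochner_Integration.integral_diff[OF int[OF cp(2,1)] int[OF cp(1,2)]]
      by (simp only: integral_mult_right_zero)
    also have "\<dots> = complex_of_real ((LINT x|lborel. \<theta> x * (cmod (p1 x))\<^sup>2) + (LINT x|lborel. \<theta> x * (cmod (p2 x))\<^sup>2))"
      unfolding cross by (simp only: integral_complex_of_real of_real_add diff_self mult_zero_right add_0_right)
    finally show ?thesis by (simp only: of_real_eq_iff)
  qed
  define a where "a x = hardy_weight s (x $ 1 \<bullet> x $ 1)" for x :: "complex ^ 2"
  have sa: "smooth a" unfolding a_def[abs_def] by (rule smooth_hardy_weight[OF s(1)])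
  have da: "frechet_derivative a (at x) (axis 1 c) = 2 * hardy_weight' s (x $ 1 \<bullet> x $ 1) * (x $ 1 \<bullet> c)" for x c
  proof -
    have l: "((\<lambda>x :: complex ^ 2. x $ 1) has_derivative (\<lambda>v. v $ 1)) (at x)"
      by (rule bounded_linear_imp_has_derivative[OF bounded_linear_vec_nth])
    have i: "((\<lambda>x :: complex ^ 2. x $ 1 \<bullet> x $ 1) has_derivative (\<lambda>v. x $ 1 \<bullet> v $ 1 + v $ 1 \<bullet> x $ 1)) (at x)"
      by (rule has_derivative_inner[OF l l])
    have "(hardy_weight s has_derivative (*) (hardy_weight' s (x $ 1 \<bullet> x $ 1))) (at (x $ 1 \<bullet> x $ 1))"
      using hardy_weight_deriv[OF s(1), of "x $ 1 \<bullet> x $ 1"] by (simp add: has_field_derivative_def)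
    from diff_chain_at[OF i this]
    have "(a has_derivative (\<lambda>v. hardy_weight' s (x $ 1 \<bullet> x $ 1) * (x $ 1 \<bullet> v $ 1 + v $ 1 \<bullet> x $ 1))) (at x)"
      by (simp add: o_def a_def[abs_def])
    from frechet_derivative_eqI[OF this] show ?thesis
      by (simp add: axis_def inner_commute[of c])
  qed
  define m where "m c x = complex_of_real (\<theta> x) * (of_real (a x) * of_real (x $ 1 \<bullet> c))" for c :: complex and x
  have sx: "smooth (\<lambda>x :: complex ^ 2. x $ 1 \<bullet> c)" for c by (intro smooth_intros)
  have dx: "frechet_derivative (\<lambda>x :: complex ^ 2. x $ 1 \<bullet> c) (at x) (axis 1 c) = c \<bullet> c" for c x
  proof -
    have b: "bounded_linear (\<lambda>x :: complex ^ 2. x $ 1 \<bullet> c)"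
      by (rule bounded_linear_compose[OF bounded_linear_inner_left bounded_linear_vec_nth])
    show ?thesis using frechet_derivative_eqI[OF bounded_linear_imp_has_derivative[OF b], of x] by (simp add: axis_def)
  qed
  have smm: "smooth (m c)" for c unfolding m_def[abs_def] by (intro smooth_mult smooth_of_real \<theta>(1) sa sx)
  have dm: "frechet_derivative (m c) (at x) (axis 1 c) =
      of_real (\<theta> x * (2 * hardy_weight' s (x $ 1 \<bullet> x $ 1) * (x $ 1 \<bullet> c)\<^sup>2 + a x * (c \<bullet> c)))" for c x
    unfolding m_def[abs_def] dmul[OF s\<theta> smooth_mult[OF smooth_of_real[OF sa] smooth_of_real[OF sx]]]
      dmul[OF smooth_of_real[OF sa] smooth_of_real[OF sx]] dof[OF sa] dof[OF sx] dof[OF \<theta>(1)] da dx \<theta>(3)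
    by (simp add: power2_eq_square algebra_simps)
  have flux: "(LINT x|lborel. Re (of_real (\<theta> x * (2 * hardy_weight' s (x $ 1 \<bullet> x $ 1) * (x $ 1 \<bullet> c)\<^sup>2 + a x * (c \<bullet> c))) * (\<phi> x * cnj (\<phi> x)) +
      m c x * (\<phi> x * cnj (frechet_derivative \<phi> (at x) (axis 1 c)) + frechet_derivative \<phi> (at x) (axis 1 c) * cnj (\<phi> x)))) = 0"
    and flux_int: "integrable lborel (\<lambda>x. Re (of_real (\<theta> x * (2 * hardy_weight' s (x $ 1 \<bullet> x $ 1) * (x $ 1 \<bullet> c)\<^sup>2 + a x * (c \<bullet> c))) * (\<phi> x * cnj (\<phi> x)) +
      m c x * (\<phi> x * cnj (frechet_derivative \<phi> (at x) (axis 1 c)) + frechet_derivative \<phi> (at x) (axis 1 c) * cnj (\<phi> x))))" for c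
  proof -
    let ?F = "\<lambda>x. m c x * (\<phi> x * cnj (\<phi> x))"
    have cF: "csmooth ?F" by (intro csmooth_mult smm sm c\<phi>[OF \<phi>])
    have dF: "frechet_derivative ?F (at x) (axis 1 c) =
        of_real (\<theta> x * (2 * hardy_weight' s (x $ 1 \<bullet> x $ 1) * (x $ 1 \<bullet> c)\<^sup>2 + a x * (c \<bullet> c))) * (\<phi> x * cnj (\<phi> x)) +
        m c x * (\<phi> x * cnj (frechet_derivative \<phi> (at x) (axis 1 c)) + frechet_derivative \<phi> (at x) (axis 1 c) * cnj (\<phi> x))" for x
      unfolding dmul[OF smm smooth_mult[OF sm smooth_cnj[OF sm]]] dmul[OF sm smooth_cnj[OF sm]] dcnj dm by (rule add.commute)
    have i: "integrable lborel (\<lambda>x. frechet_derivative ?F (at x) (axis 1 c))"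
      by (rule csmooth_integrable[OF csmooth_derivative[OF cF]])
    have "(LINT x|lborel. Re (frechet_derivative ?F (at x) (axis 1 c))) = Re (LINT x|lborel. frechet_derivative ?F (at x) (axis 1 c))"
      using i by simp
    also have "\<dots> = 0" by (simp add: integral_derivative_eq_0[OF cF])
    finally show "(LINT x|lborel. Re (of_real (\<theta> x * (2 * hardy_weight' s (x $ 1 \<bullet> x $ 1) * (x $ 1 \<bullet> c)\<^sup>2 + a x * (c \<bullet> c))) * (\<phi> x * cnj (\<phi> x)) +
      m c x * (\<phi> x * cnj (frechet_derivative \<phi> (at x) (axis 1 c)) + frechet_derivative \<phi> (at x) (axis 1 c) * cnj (\<phi> x)))) = 0"
      unfolding dF .
    show "integrable lborel (\<lambda>x. Re (of_real (\<theta> x * (2 * hardy_weight' s (x $ 1 \<bullet> x $ 1) * (x $ 1 \<bullet> c)\<^sup>2 + a x * (c \<bullet> c))) * (\<phi> x * cnj (\<phi> x)) +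
      m c x * (\<phi> x * cnj (frechet_derivative \<phi> (at x) (axis 1 c)) + frechet_derivative \<phi> (at x) (axis 1 c) * cnj (\<phi> x))))"
      using integrable_Re[OF i] unfolding dF .
  qed
  define Q where "Q c p x = \<theta> x * ((2 * hardy_weight' s (x $ 1 \<bullet> x $ 1) * (x $ 1 \<bullet> c)\<^sup>2 + a x * (c \<bullet> c)) * (cmod (\<phi> x))\<^sup>2 +
      2 * (a x * (x $ 1 \<bullet> c)) * Re (p x * cnj (\<phi> x)))" for c :: complex and p :: "complex ^ 2 \<Rightarrow> complex" and x
  have Qeq: "Re (of_real (\<theta> x * (2 * hardy_weight' s (x $ 1 \<bullet> x $ 1) * (x $ 1 \<bullet> c)\<^sup>2 + a x * (c \<bullet> c))) * (\<phi> x * cnj (\<phi> x)) +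
      m c x * (\<phi> x * cnj (p x) + p x * cnj (\<phi> x))) = Q c p x" for c p x
  proof -
    have "\<phi> x * cnj (p x) + p x * cnj (\<phi> x) = of_real (2 * Re (p x * cnj (\<phi> x)))"
      by (simp add: complex_eq_iff)
    then show ?thesis unfolding n2[symmetric] m_def Q_def
      by (simp only: of_real_mult[symmetric] of_real_add[symmetric] Re_complex_of_real) (simp add: algebra_simps)
  qed
  have Q0: "(LINT x|lborel. Q 1 p1 x) = 0" "integrable lborel (Q 1 p1)" "(LINT x|lborel. Q \<i> p2 x) = 0" "integrable lborel (Q \<i> p2)"
    using flux[of 1] flux_int[of 1] flux[of \<i>] flux_int[of \<i>]
    unfolding p1_def[symmetric] p2_def[symmetric] Qeq by simp_all
  have cX: "csmooth (\<lambda>x. hardy_field s x * \<phi> x)"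
    unfolding hardy_field_def a_def[symmetric]
    by (intro csmooth_mult smooth_mult smooth_of_real sa smooth_vec_nth smooth_ident \<phi>)
  have pt: "1 / 3 * (\<theta> x * (cmod (hardy_field s x * \<phi> x))\<^sup>2) - 3 * (\<theta> x * (cmod (p1 x))\<^sup>2 + \<theta> x * (cmod (p2 x))\<^sup>2) \<le> Q 1 p1 x + Q \<i> p2 x" for x
  proof -
    define t u v where "t = x $ 1 \<bullet> x $ 1" and "u = x $ 1 \<bullet> 1" and "v = x $ 1 \<bullet> \<i>"
    define F where "F = cmod (\<phi> x)"
    have t: "t = u\<^sup>2 + v\<^sup>2" by (simp add: t_def u_def v_def inner_complex_def power2_eq_square)
    have t0: "t \<ge> 0" by (simp add: t_def)
    have A: "a x > 0" unfolding a_def by (rule hardy_weight_pos[OF s(1)]) simp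
    have X: "(cmod (hardy_field s x * \<phi> x))\<^sup>2 = t * (a x)\<^sup>2 * F\<^sup>2"
    proof -
      have hf: "hardy_field s x = of_real (a x) * x $ 1" by (simp add: hardy_field_def a_def)
      have tt: "t = (cmod (x $ 1))\<^sup>2" by (simp add: t_def inner_eq_cmod2)
      show ?thesis unfolding hf tt by (simp add: norm_mult power_mult_distrib F_def)
    qed
    have div: "2 / 3 * (t * (a x)\<^sup>2) * F\<^sup>2 \<le> (2 * a x + 2 * t * hardy_weight' s t) * F\<^sup>2"
    proof (cases "\<phi> x = 0")
      case False
      then have "t \<le> 1" using supp[of x] power_le_one[of "cmod (x $ 1)" 2] by (simp add: t_def inner_eq_cmod2)
      then show ?thesis
        using hardy_divergence[OF s t0] unfolding a_def t_def[symmetric] by (intro mult_right_mono) auto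
    qed (simp add: F_def)
    have young: "- (1 / 3 * (a x * w * F)\<^sup>2) - 3 * (cmod p)\<^sup>2 \<le> 2 * (a x * w) * Re (p * cnj (\<phi> x))" for w p
    proof -
      have "\<bar>Re (p * cnj (\<phi> x))\<bar> \<le> cmod p * F"
        using abs_Re_le_cmod[of "p * cnj (\<phi> x)"] by (simp add: norm_mult F_def)
      then have "\<bar>2 * (a x * w) * Re (p * cnj (\<phi> x))\<bar> \<le> \<bar>2 * (a x * w)\<bar> * (cmod p * F)"
        unfolding abs_mult[of "2 * (a x * w)"] by (rule mult_left_mono) simp
      moreover have "\<bar>2 * (a x * w)\<bar> * (cmod p * F) = 2 * (\<bar>a x * w * F\<bar> * cmod p)"
        by (simp add: abs_mult F_def)
      moreover have "2 * (\<bar>a x * w * F\<bar> * cmod p) \<le> 1 / 3 * \<bar>a x * w * F\<bar>\<^sup>2 + 3 * (cmod p)\<^sup>2"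
      proof -
        have "0 \<le> (\<bar>a x * w * F\<bar> - 3 * cmod p)\<^sup>2" by simp
        then show ?thesis by (simp add: power2_diff power_mult_distrib algebra_simps)
      qed
      ultimately show ?thesis by (simp only: power2_abs)
    qed
    have "1 / 3 * (t * (a x)\<^sup>2 * F\<^sup>2) - 3 * ((cmod (p1 x))\<^sup>2 + (cmod (p2 x))\<^sup>2) \<le>
        (2 * a x + 2 * t * hardy_weight' s t) * F\<^sup>2 + 2 * (a x * u) * Re (p1 x * cnj (\<phi> x)) + 2 * (a x * v) * Re (p2 x * cnj (\<phi> x))"
    proof -
      have "(a x * u * F)\<^sup>2 + (a x * v * F)\<^sup>2 = t * (a x)\<^sup>2 * F\<^sup>2" by (simp add: t power_mult_distrib algebra_simps)
      then show ?thesis using div young[of u "p1 x"] young[of v "p2 x"] by (simp add: distrib_left) 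
    qed
    from mult_left_mono[OF this \<theta>(2)[of x]]
    have le: "\<theta> x * (1 / 3 * (t * (a x)\<^sup>2 * F\<^sup>2) - 3 * ((cmod (p1 x))\<^sup>2 + (cmod (p2 x))\<^sup>2)) \<le>
        \<theta> x * ((2 * a x + 2 * t * hardy_weight' s t) * F\<^sup>2 + 2 * (a x * u) * Re (p1 x * cnj (\<phi> x)) + 2 * (a x * v) * Re (p2 x * cnj (\<phi> x)))" .
    have "Q 1 p1 x + Q \<i> p2 x = \<theta> x * ((2 * a x + 2 * t * hardy_weight' s t) * F\<^sup>2 + 2 * (a x * u) * Re (p1 x * cnj (\<phi> x)) + 2 * (a x * v) * Re (p2 x * cnj (\<phi> x)))"
      unfolding Q_def t_def[symmetric] u_def[symmetric] v_def[symmetric] F_def[symmetric]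
      by (simp add: t algebra_simps inner_complex_def del: complex_cnj_mult)
    with le show ?thesis unfolding X by (simp add: algebra_simps)
  qed
  have "(LINT x|lborel. 1 / 3 * (\<theta> x * (cmod (hardy_field s x * \<phi> x))\<^sup>2) - 3 * (\<theta> x * (cmod (p1 x))\<^sup>2 + \<theta> x * (cmod (p2 x))\<^sup>2)) \<le>
      (LINT x|lborel. Q 1 p1 x + Q \<i> p2 x)"
    by (rule integral_mono[OF _ _ pt])
      (intro Bochner_Integration.integrable_diff Bochner_Integration.integrable_add integrable_mult_right rint cX cp Q0)+
  also have "\<dots> = 0" using Q0 by simp
  finally have "1 / 3 * (LINT x|lborel. \<theta> x * (cmod (hardy_field s x * \<phi> x))\<^sup>2) -
      3 * ((LINT x|lborel. \<theta> x * (cmod (p1 x))\<^sup>2) + (LINT x|lborel. \<theta> x * (cmod (p2 x))\<^sup>2)) \<le> 0"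
    using rint[OF cX] rint[OF cp(1)] rint[OF cp(2)]
    by (simp add: Bochner_Integration.integral_diff Bochner_Integration.integral_add)
  then have fin: "(LINT x|lborel. \<theta> x * (cmod (hardy_field s x * \<phi> x))\<^sup>2) \<le> 36 * (LINT x|lborel. \<theta> x * (cmod (dzbar 1 \<phi> x))\<^sup>2)"
    unfolding grad by simp
  have nn: "(\<integral>\<^sup>+x. ennreal (\<theta> x * (cmod (u x))\<^sup>2) \<partial>lborel) = ennreal (LINT x|lborel. \<theta> x * (cmod (u x))\<^sup>2)" if "csmooth u" for u
    by (rule nn_integral_eq_integral[OF rint[OF that]]) (simp add: \<theta>(2))
  show ?thesis
    unfolding nn[OF cX] nn[OF csmooth_dzbar[OF \<phi>]] ennreal_mult'[OF zero_le_numeral, symmetric]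
    by (rule ennreal_leI[OF fin])
qed

lemma l2_mollify_le:
  fixes f :: "'a::euclidean_space \<Rightarrow> complex"
  assumes [measurable]: "f \<in> borel_measurable borel"
  shows "l2 UNIV (mollify \<delta> f) \<le> l2 UNIV f"
proof -
  let ?N = "mollifier_measure :: 'a measure"
  have "l2 UNIV (mollify \<delta> f) \<le> (\<integral>\<^sup>+x. (\<integral>\<^sup>+y. ennreal (cmod (f (x - \<delta> *\<^sub>R y))) \<partial>?N)\<^sup>2 \<partial>lborel)"
    unfolding l2_def mollify_def
    by (intro nn_integral_mono) (simp add: power_mono norm_integral_le_nn_integral)
  also have "\<dots> \<le> emeasure ?N (space ?N) * (\<integral>\<^sup>+y. (\<integral>\<^sup>+x. (ennreal (cmod (f (x - \<delta> *\<^sub>R y))))\<^sup>2 \<partial>lborel) \<partial>?N)"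
    by (rule nn_integral_average_square_le[OF sigma_finite_lborel finite_mollifier_measure]) measurable
  also have "\<dots> = (\<integral>\<^sup>+y. l2 UNIV f \<partial>?N)"
  proof -
    have "(\<integral>\<^sup>+x. (ennreal (cmod (f (x - \<delta> *\<^sub>R y))))\<^sup>2 \<partial>lborel) = l2 UNIV f" for y
      using nn_integral_translate[of "\<lambda>x. (ennreal (cmod (f x)))\<^sup>2" "- \<delta> *\<^sub>R y"] by (simp add: l2_def)
    then show ?thesis by (simp add: emeasure_mollifier_measure)
  qed
  also have "\<dots> = l2 UNIV f" by (simp add: emeasure_mollifier_measure)
  finally show ?thesis .
qed

definition base_cutoff :: "real \<Rightarrow> real \<Rightarrow> complex ^ 2 \<Rightarrow> real" where
  "base_cutoff r' r x = 1 - smooth_step ((x $ 0 \<bullet> x $ 0 - r'\<^sup>2) / (r\<^sup>2 - r'\<^sup>2))"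

lemma base_cutoff:
  assumes r: "0 \<le> r'" "r' < r"
  shows "smooth (base_cutoff r' r)" "base_cutoff r' r x \<ge> 0" "base_cutoff r' r x \<le> 1"
    "cmod (x $ 0) \<le> r' \<Longrightarrow> base_cutoff r' r x = 1" "cmod (x $ 0) \<ge> r \<Longrightarrow> base_cutoff r' r x = 0"
    "frechet_derivative (base_cutoff r' r) (at x) (axis 1 c) = 0"
proof -
  have p: "r\<^sup>2 - r'\<^sup>2 > 0" using r power_strict_mono[of r' r 2] by simp
  then have p0: "r\<^sup>2 - r'\<^sup>2 \<noteq> 0" by (metis less_irrefl)
  show "smooth (base_cutoff r' r)"
    unfolding base_cutoff_def[abs_def]
    by (intro smooth_diff smooth_const smooth_compose[OF smooth_smooth_step] smooth_divide smooth_inner smooth_vec_nth smooth_ident p0)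
  show "base_cutoff r' r x \<ge> 0" "base_cutoff r' r x \<le> 1"
    using smooth_step_bounds by (simp_all add: base_cutoff_def)
  show "base_cutoff r' r x = 1" if "cmod (x $ 0) \<le> r'"
  proof -
    have "(cmod (x $ 0))\<^sup>2 \<le> r'\<^sup>2" using that by (intro power_mono) auto
    then have "(x $ 0 \<bullet> x $ 0 - r'\<^sup>2) / (r\<^sup>2 - r'\<^sup>2) \<le> 0"
      using p by (intro divide_nonpos_pos) (simp_all add: inner_eq_cmod2)
    then show ?thesis by (simp add: base_cutoff_def)
  qed
  show "base_cutoff r' r x = 0" if "cmod (x $ 0) \<ge> r"
  proof -
    have "r\<^sup>2 \<le> (cmod (x $ 0))\<^sup>2" using that r by (intro power_mono) auto
    then have "(x $ 0 \<bullet> x $ 0 - r'\<^sup>2) / (r\<^sup>2 - r'\<^sup>2) \<ge> 1"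
      using p by (simp add: inner_eq_cmod2 pos_le_divide_eq)
    then show ?thesis by (simp add: base_cutoff_def)
  qed
  have l: "((\<lambda>x :: complex ^ 2. x $ 0) has_derivative (\<lambda>v. v $ 0)) (at x)"
    by (rule bounded_linear_imp_has_derivative[OF bounded_linear_vec_nth])
  have i: "((\<lambda>x :: complex ^ 2. x $ 0 \<bullet> x $ 0) has_derivative (\<lambda>v. x $ 0 \<bullet> v $ 0 + v $ 0 \<bullet> x $ 0)) (at x)"
    by (rule has_derivative_inner[OF l l])
  have "((\<lambda>t. 1 - smooth_step ((t - r'\<^sup>2) / (r\<^sup>2 - r'\<^sup>2))) has_real_derivative
      0 - smooth_step' ((x $ 0 \<bullet> x $ 0 - r'\<^sup>2) / (r\<^sup>2 - r'\<^sup>2)) * ((1 - 0) / (r\<^sup>2 - r'\<^sup>2))) (at (x $ 0 \<bullet> x $ 0))"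
    by (intro DERIV_diff DERIV_const DERIV_chain2[OF smooth_step_has_derivative] DERIV_cdivide DERIV_ident)
  from diff_chain_at[OF i this[unfolded has_field_derivative_def]]
  have "(base_cutoff r' r has_derivative (\<lambda>v. (0 - smooth_step' ((x $ 0 \<bullet> x $ 0 - r'\<^sup>2) / (r\<^sup>2 - r'\<^sup>2)) * ((1 - 0) / (r\<^sup>2 - r'\<^sup>2))) *
      (x $ 0 \<bullet> v $ 0 + v $ 0 \<bullet> x $ 0))) (at x)"
    by (simp only: o_def base_cutoff_def[abs_def])
  from frechet_derivative_eqI[OF this] show "frechet_derivative (base_cutoff r' r) (at x) (axis 1 c) = 0"
    by (simp add: axis_def)
qed

lemma bounded_hardy_field:
  assumes s: "s > 0" obtains C where "C \<ge> 0" "\<And>x. x \<in> bidisc \<Longrightarrow> cmod (hardy_field s x) \<le> C"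
proof -
  have sm: "smooth (hardy_field s)"
    unfolding hardy_field_def[abs_def]
    by (intro smooth_mult smooth_of_real smooth_hardy_weight[OF s] smooth_vec_nth smooth_ident)
  have "compact (hardy_field s ` closure bidisc)"
    by (intro compact_continuous_image smooth_continuous[OF sm]) (simp add: compact_closure bounded_bidisc)
  then have "bounded (hardy_field s ` closure bidisc)" by (rule compact_imp_bounded)
  then obtain C where C: "\<forall>y\<in>hardy_field s ` closure bidisc. norm y \<le> C" unfolding bounded_iff ..
  show ?thesis
  proof (rule that[of "\<bar>C\<bar>"])
    show "cmod (hardy_field s x) \<le> \<bar>C\<bar>" if "x \<in> bidisc" for x
    proof -
      have "hardy_field s x \<in> hardy_field s ` closure bidisc"
        by (rule imageI[OF subsetD[OF closure_subset that]])
      then have "cmod (hardy_field s x) \<le> C" using C by blast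
      then show ?thesis by simp
    qed
  qed simp
qed

lemma hardy_field_measurable: "s > 0 \<Longrightarrow> hardy_field s \<in> borel_measurable borel"
  unfolding hardy_field_def[abs_def]
  by (intro smooth_measurable smooth_mult smooth_of_real smooth_hardy_weight smooth_vec_nth smooth_ident)

text \<open>
  The Hardy inequality for a square integrable function with square integrable derivative in \<open>w\<close>,
  by mollification; the bound does not depend on \<open>s\<close>. The mollified function satisfies the equation
  only at some distance from the boundary \<open>cmod u = 1\<close>, whence the exhaustion by smaller discs.
\<close>

lemma hardy_L2:
  assumes H: "L2on bidisc H" and G: "L2on bidisc G"
    and w: "weak_div bidisc (\<lambda>j. if j = 1 then H else (\<lambda>x. 0)) G"
    and v: "\<And>x. cmod (x $ 1) > 1/2 \<Longrightarrow> H x = 0" "\<And>x. cmod (x $ 1) > 1/2 \<Longrightarrow> G x = 0"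
    and s: "0 < s" "s \<le> 1"
  shows "l2 bidisc (\<lambda>x. hardy_field s x * H x) \<le> 72 * l2 UNIV G"
proof -
  note Hm [measurable] = L2on_measurable[OF H]
  note Gm [measurable] = L2on_measurable[OF G]
  note Xm [measurable] = hardy_field_measurable[OF s(1)]
  obtain C where C: "C \<ge> 0" "\<And>x. x \<in> bidisc \<Longrightarrow> cmod (hardy_field s x) \<le> C"
    using bounded_hardy_field[OF s(1)] by blast
  define D where "D r = bidisc \<inter> {x. cmod (x $ 0) \<le> r}" for r
  have D [measurable]: "D r \<in> sets borel" for r
    unfolding D_def by (intro sets.Int bidisc_borel borel_closed closed_Collect_le continuous_intros)
  have part: "l2 (D r') (\<lambda>x. hardy_field s x * H x) \<le> 72 * l2 UNIV G" if r': "0 \<le> r'" "r' < 1" for r'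
  proof -
    define r where "r = (r' + 1) / 2"
    have r: "r' < r" "r < 1" "0 < 1 - r" using r' by (auto simp: r_def)
    define d where "d n = min (1 - r) (1 / 8) / (real n + 2)" for n
    have d: "d n > 0" "d n < 1 - r" "d n < 1 / 8" for n
    proof -
      have m: "min (1 - r) (1 / 8) > 0" using r by simp
      then show "d n > 0" by (simp add: d_def)
      have "min (1 - r) (1 / 8) * 1 < min (1 - r) (1 / 8) * (real n + 2)"
        by (rule mult_strict_left_mono[OF _ m]) simp
      then have "d n < min (1 - r) (1 / 8)" unfolding d_def by (subst pos_divide_less_eq) auto
      then show "d n < 1 - r" "d n < 1 / 8" by auto
    qed
    have dlim: "d \<longlonglongrightarrow> 0"
      unfolding d_def using LIMSEQ_ignore_initial_segment[OF lim_const_over_n[of "min (1 - r) (1 / 8)"], of 2] by (simp add: add.commute)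
    define \<phi> where "\<phi> n = mollify (d n) H" for n
    have sm: "smooth (\<phi> n)" for n
      unfolding \<phi>_def by (rule smooth_mollify(1)[OF L2on_integrable[OF H bounded_bidisc] d(1)])
    have zero: "mollify (d n) u x = 0" if "cmod (x $ 1) > 5/8" "u \<in> borel_measurable borel" "\<And>x. cmod (x $ 1) > 1/2 \<Longrightarrow> u x = 0" for n u x
    proof (rule mollify_cong_ball[OF that(2) d(1)])
      fix y assume "dist x y < d n"
      then have "cmod ((x - y) $ 1) < 1 / 8"
        using Finite_Cartesian_Product.norm_nth_le[of "x - y" 1] d(3)[of n] by (simp add: dist_norm)
      then have "cmod (y $ 1) > 1 / 2" using that(1) norm_triangle_ineq2[of "x $ 1" "y $ 1"] by simp
      then show "u y = 0" by (rule that(3))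
    qed
    have supp: "cmod (x $ 1) \<le> 1" if "\<phi> n x \<noteq> 0" for n x
    proof (rule ccontr)
      assume "\<not> cmod (x $ 1) \<le> 1"
      then have "\<phi> n x = 0" unfolding \<phi>_def by (intro zero Hm v(1)) auto
      with that show False by simp
    qed
    have cs: "csmooth (\<phi> n)" for n
    proof (rule csmoothI[OF sm bounded_cball[of 0 3]])
      fix x assume nz: "\<phi> n x \<noteq> 0"
      show "x \<in> cball 0 3"
      proof (rule ccontr)
        assume x: "x \<notin> cball 0 3"
        have "\<phi> n x = 0"
          unfolding \<phi>_def
        proof (rule mollify_cong_ball[OF Hm d(1)])
          fix y assume "dist x y < d n"
          then have "norm y > 2" using x d(3)[of n] norm_triangle_ineq2[of x y] by (simp add: dist_norm)
          then have "y \<notin> bidisc" using norm_le_components[of y] by (auto simp: bidisc_def)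
          then show "H y = 0" using H by (simp add: L2on_def)
        qed
        with nz show False by simp
      qed
    qed
    have eq: "dzbar 1 (\<phi> n) x = mollify (d n) G x" if "cmod (x $ 0) < r" for n x
    proof (cases "cmod (x $ 1) > 5/8")
      case True
      have op: "open {x :: complex ^ 2. 5/8 < cmod (x $ 1)}" by (intro open_Collect_less continuous_intros)
      have "frechet_derivative (\<phi> n) (at x) u = 0" for u
      proof (rule frechet_derivative_zero_on_open[OF op])
        show "x \<in> {x. 5/8 < cmod (x $ 1)}" using True by simp
        show "\<phi> n y = 0" if "y \<in> {x. 5/8 < cmod (x $ 1)}" for y
          unfolding \<phi>_def by (rule zero[OF _ Hm v(1)]) (use that in simp_all)
      qed
      moreover have "mollify (d n) G x = 0" by (rule zero[OF True Gm v(2)])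
      ultimately show ?thesis by (simp add: dzbar_def)
    next
      case False
      have sub: "cball x (d n) \<subseteq> bidisc"
      proof
        fix y assume "y \<in> cball x (d n)"
        then have n: "norm (y - x) \<le> d n" by (simp add: dist_norm norm_minus_commute)
        have "cmod (y $ k) \<le> cmod (x $ k) + d n" for k
          using norm_triangle_ineq[of "x $ k" "(y - x) $ k"] Finite_Cartesian_Product.norm_nth_le[of "y - x" k] n by simp
        from this[of 0] this[of 1] show "y \<in> bidisc"
          using that False d(2,3)[of n] by (simp add: bidisc_def)
      qed
      have L: "L2on bidisc ((\<lambda>j. if j = 1 then H else (\<lambda>x. 0)) k)" for k :: 2 using H by simp
      have z: "mollify (d n) (\<lambda>x. 0) = (\<lambda>x. 0)" by (simp add: mollify_def fun_eq_iff)
      show ?thesis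
        using weak_div_mollify[OF L G bounded_bidisc w d(1) sub] by (simp add: sum_2' z \<phi>_def)
    qed
    have bound: "l2 (D r') (\<lambda>x. hardy_field s x * \<phi> n x) \<le> 36 * l2 UNIV G" for n
    proof -
      let ?\<theta> = "base_cutoff r' r"
      note bc = base_cutoff[OF r'(1) r(1)]
      have "l2 (D r') (\<lambda>x. hardy_field s x * \<phi> n x) \<le> (\<integral>\<^sup>+x. ennreal (?\<theta> x * (cmod (hardy_field s x * \<phi> n x))\<^sup>2) \<partial>lborel)"
        unfolding l2_def ennreal_cmod_square
        by (intro nn_integral_mono) (auto simp: indicator_def D_def bc(4))
      also have "\<dots> \<le> ennreal 36 * (\<integral>\<^sup>+x. ennreal (?\<theta> x * (cmod (dzbar 1 (\<phi> n) x))\<^sup>2) \<partial>lborel)"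
        by (rule hardy_inequality[OF cs supp bc(1,2,6) s])
      also have "(\<integral>\<^sup>+x. ennreal (?\<theta> x * (cmod (dzbar 1 (\<phi> n) x))\<^sup>2) \<partial>lborel) \<le> l2 UNIV (mollify (d n) G)"
        unfolding l2_def ennreal_cmod_square
      proof (rule nn_integral_mono)
        fix x
        have "?\<theta> x * (cmod (dzbar 1 (\<phi> n) x))\<^sup>2 \<le> (cmod (mollify (d n) G x))\<^sup>2"
        proof (cases "cmod (x $ 0) < r")
          case True
          then show ?thesis using bc(2,3)[of x] by (simp add: eq mult_left_le_one_le)
        qed (simp add: bc(5))
        then show "ennreal (?\<theta> x * (cmod (dzbar 1 (\<phi> n) x))\<^sup>2) \<le> ennreal ((cmod (mollify (d n) G x))\<^sup>2) * indicator UNIV x"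
          by (simp add: ennreal_leI)
      qed
      also have "l2 UNIV (mollify (d n) G) \<le> l2 UNIV G" by (rule l2_mollify_le[OF Gm])
      finally show ?thesis by (simp add: mult_left_mono)
    qed
    have lim: "(\<lambda>n. l2 bidisc (\<lambda>x. \<phi> n x - H x)) \<longlonglongrightarrow> 0"
    proof -
      have ds: "diag_scale 1 1 x = x" for x by (simp add: diag_scale_def vec_eq_iff)
      have "(\<lambda>n. l2 bidisc (\<lambda>x. mollify (d n) H (diag_scale ((\<lambda>_. 1) n) ((\<lambda>_. 1) n) x) - H x)) \<longlonglongrightarrow> 0"
        by (rule mollify_scaled_tendsto[OF Hm _ bounded_bidisc bidisc_borel _ _ _ _ dlim]) (use L2on_l2[OF H] in auto)
      then show ?thesis by (simp add: ds \<phi>_def)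
    qed
    have le: "l2 (D r') (\<lambda>x. hardy_field s x * H x) \<le> 2 * (ennreal (C\<^sup>2) * l2 bidisc (\<lambda>x. \<phi> n x - H x)) + 72 * l2 UNIV G" for n
    proof -
      have [measurable]: "\<phi> n \<in> borel_measurable borel" by (rule smooth_measurable[OF sm])
      have "l2 (D r') (\<lambda>x. hardy_field s x * H x) =
          l2 (D r') (\<lambda>x. hardy_field s x * (H x - \<phi> n x) + hardy_field s x * \<phi> n x)"
        by (rule l2_cong) (simp_all add: algebra_simps)
      also have "\<dots> \<le> 2 * l2 (D r') (\<lambda>x. hardy_field s x * (H x - \<phi> n x)) + 2 * l2 (D r') (\<lambda>x. hardy_field s x * \<phi> n x)"
        by (rule l2_add) measurable
      also have "l2 (D r') (\<lambda>x. hardy_field s x * (H x - \<phi> n x)) \<le> ennreal (C\<^sup>2) * l2 (D r') (\<lambda>x. \<phi> n x - H x)"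
      proof (rule l2_cmult_le[OF _ D C(1)])
        show "cmod (hardy_field s x * (H x - \<phi> n x)) \<le> C * cmod (\<phi> n x - H x)" if "x \<in> D r'" for x
          using mult_right_mono[OF C(2), of x "cmod (\<phi> n x - H x)"] that
          by (simp add: norm_mult norm_minus_commute D_def)
      qed measurable
      also have "l2 (D r') (\<lambda>x. \<phi> n x - H x) \<le> l2 bidisc (\<lambda>x. \<phi> n x - H x)"
        by (rule l2_mono) (auto simp: D_def)
      also have "2 * l2 (D r') (\<lambda>x. hardy_field s x * \<phi> n x) \<le> 2 * (36 * l2 UNIV G)"
        by (intro mult_left_mono bound) simp
      finally show ?thesis by (simp add: mult.assoc[symmetric] mult_left_mono add_mono)
    qed
    have "(\<lambda>n. 2 * (ennreal (C\<^sup>2) * l2 bidisc (\<lambda>x. \<phi> n x - H x)) + 72 * l2 UNIV G) \<longlonglongrightarrow> 2 * (ennreal (C\<^sup>2) * 0) + 72 * l2 UNIV G"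
      by (intro tendsto_add tendsto_const tendsto_mult_ennreal lim) auto
    then show ?thesis by (intro LIMSEQ_le_const) (use le in auto)
  qed
  define A where "A n = D (1 - 1 / (real n + 1))" for n
  have [measurable]: "A n \<in> sets borel" for n by (simp add: A_def)
  have inc: "incseq A"
  proof (rule incseq_SucI)
    fix n
    have "1 / (real (Suc n) + 1) \<le> 1 / (real n + 1)" by (intro divide_left_mono) auto
    then show "A n \<subseteq> A (Suc n)" by (auto simp: A_def D_def)
  qed
  have cover: "(\<Union>n. A n) = bidisc"
  proof (intro equalityI subsetI)
    fix x assume x: "x \<in> bidisc"
    then have "1 - cmod (x $ 0) > 0" by (simp add: bidisc_def)
    then obtain n where "inverse (real (Suc n)) < 1 - cmod (x $ 0)" using reals_Archimedean by blast
    then show "x \<in> (\<Union>n. A n)" using x by (auto simp: A_def D_def inverse_eq_divide add.commute intro!: exI[of _ n])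
  qed (auto simp: A_def D_def)
  let ?u = "\<lambda>x. (ennreal (cmod (hardy_field s x * H x)))\<^sup>2"
  have "l2 bidisc (\<lambda>x. hardy_field s x * H x) = (\<integral>\<^sup>+x\<in>(\<Union>n. A n). ?u x \<partial>lborel)"
    by (simp add: l2_def cover)
  also have "\<dots> = (SUP n. (\<integral>\<^sup>+x\<in>A n. ?u x \<partial>lborel))"
  proof -
    have ptw: "?u x * indicator (\<Union>n. A n) x = (SUP n. ?u x * indicator (A n) x)" for x
    proof (cases "x \<in> (\<Union>n. A n)")
      case True
      then obtain m where m: "x \<in> A m" by blast
      show ?thesis
      proof (rule antisym)
        show "?u x * indicator (\<Union>n. A n) x \<le> (SUP n. ?u x * indicator (A n) x)"
          by (rule SUP_upper2[of m]) (use True m in simp_all)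
        show "(SUP n. ?u x * indicator (A n) x) \<le> ?u x * indicator (\<Union>n. A n) x"
          by (rule SUP_least) (simp add: indicator_def True)
      qed
    next
      case False
      then show ?thesis by simp
    qed
    have "(\<integral>\<^sup>+x. ?u x * indicator (\<Union>n. A n) x \<partial>lborel) = (\<integral>\<^sup>+x. (SUP n. ?u x * indicator (A n) x) \<partial>lborel)"
      by (simp only: ptw)
    also have "\<dots> = (SUP n. (\<integral>\<^sup>+x. ?u x * indicator (A n) x \<partial>lborel))"
      by (rule nn_integral_monotone_convergence_SUP)
        (use inc in \<open>auto simp: incseq_def le_fun_def indicator_def\<close>)
    finally show ?thesis .
  qed
  also have "\<dots> \<le> 72 * l2 UNIV G"
  proof (rule SUP_least)
    fix n
    show "(\<integral>\<^sup>+x\<in>A n. ?u x \<partial>lborel) \<le> 72 * l2 UNIV G"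
      using part[of "1 - 1 / (real n + 1)"] by (simp add: l2_def A_def)
  qed
  finally show ?thesis .
qed

text \<open>
  The cutoff \<open>1 - punct_cutoff (1 / 4)\<close> removes the part of the pulled back function near the outer
  boundary \<open>cmod w = 1\<close>.
\<close>

lemma hardy_pullback:
  assumes f: "L2on T f" and g: "\<And>k. L2on T (g k)"
    and w: "\<And>k. weak_div T (\<lambda>j. if j = k then f else (\<lambda>x. 0)) (g k)"
  obtains K where "K < top"
    "\<And>s. 0 < s \<Longrightarrow> s \<le> 1 \<Longrightarrow> l2 {x. cmod (x $ 1) \<le> 1 / 4} (\<lambda>x. hardy_field s x * pullback f x) \<le> K"
proof -
  define \<eta> where "\<eta> x = 1 - punct_cutoff (1 / 4) x" for x
  have sp: "smooth (punct_cutoff (1 / 4))" by (rule smooth_punct_cutoff) simp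
  have \<eta>: "smooth \<eta>" unfolding \<eta>_def[abs_def] by (intro smooth_diff smooth_const sp)
  note pv = punct_cutoff_values[of "1 / 4"]
  have \<eta>1: "\<eta> x = 1" if "cmod (x $ 1) \<le> 1 / 4" for x using pv(3)[OF _ that] by (simp add: \<eta>_def)
  have \<eta>0: "\<eta> x = 0" if "cmod (x $ 1) > 1 / 2" for x using pv(4)[of x] that by (simp add: \<eta>_def)
  have \<eta>b: "cmod (\<eta> x) \<le> 1" for x using pv(2)[of x] by (simp add: \<eta>_def norm_minus_commute)
  define h where "h = pullback f"
  define G where "G = pullback_rhs g"
  have h: "L2on bidisc h" unfolding h_def by (rule L2on_pullback[OF f])
  have G: "L2on bidisc G" unfolding G_def by (rule L2on_pullback_rhs[OF g])
  define H where "H x = \<eta> x * h x" for x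
  define G' where "G' x = \<eta> x * G x + dzbar 1 \<eta> x * h x" for x
  have H: "L2on bidisc H"
    unfolding H_def[abs_def] by (rule L2on_mult_bounded[OF h smooth_measurable[OF \<eta>] \<eta>b])
  have d\<eta>b: "\<exists>B. \<forall>x\<in>bidisc. cmod (dzbar 1 \<eta> x) \<le> B"
  proof -
    have "compact (dzbar 1 \<eta> ` closure bidisc)"
      by (intro compact_continuous_image smooth_continuous smooth_dzbar \<eta>) (simp add: compact_closure bounded_bidisc)
    then have "bounded (dzbar 1 \<eta> ` closure bidisc)" by (rule compact_imp_bounded)
    then obtain B where B: "\<forall>y\<in>dzbar 1 \<eta> ` closure bidisc. norm y \<le> B" unfolding bounded_iff ..
    have "cmod (dzbar 1 \<eta> x) \<le> B" if "x \<in> bidisc" for x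
      using B imageI[OF subsetD[OF closure_subset that], of "dzbar 1 \<eta>"] by blast
    then show ?thesis by blast
  qed
  then obtain B where B: "\<And>x. x \<in> bidisc \<Longrightarrow> cmod (dzbar 1 \<eta> x) \<le> B" by blast
  have G': "L2on bidisc G'"
    unfolding G'_def[abs_def]
    by (intro L2on_add L2on_mult_bounded[OF G smooth_measurable[OF \<eta>] \<eta>b]
        L2on_mult_bounded[OF h smooth_measurable[OF smooth_dzbar[OF \<eta>]] B])
  have wH: "weak_div bidisc (\<lambda>j. if j = 1 then H else (\<lambda>x. 0)) G'"
  proof -
    have L: "L2on bidisc ((\<lambda>j. if j = 1 then h else (\<lambda>x. 0)) k)" for k :: 2 using h by simp
    have "weak_div bidisc (\<lambda>j. if j = 1 then h else (\<lambda>x. 0)) G"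
      unfolding h_def G_def by (rule pullback_equation[OF f g w])
    from weak_div_mult[OF \<eta> L G this]
    have "weak_div bidisc (\<lambda>k x. \<eta> x * (if k = 1 then h else (\<lambda>x. 0)) x) G'"
      by (simp add: sum_2' G'_def[abs_def])
    moreover have "(\<lambda>(k :: 2) x. \<eta> x * (if k = 1 then h else (\<lambda>x. 0)) x) = (\<lambda>j. if j = 1 then H else (\<lambda>x. 0))"
      by (auto simp: fun_eq_iff H_def)
    ultimately show ?thesis by simp
  qed
  have d0: "dzbar 1 \<eta> x = 0" if "cmod (x $ 1) > 1 / 2" for x
  proof -
    have op: "open {x :: complex ^ 2. 1 / 2 < cmod (x $ 1)}" by (intro open_Collect_less continuous_intros)
    have "frechet_derivative \<eta> (at x) v = 0" for v
      by (rule frechet_derivative_zero_on_open[OF op]) (use that \<eta>0 in auto)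
    then show ?thesis by (simp add: dzbar_def)
  qed
  show ?thesis
  proof (rule that[of "72 * l2 UNIV G'"])
    show "72 * l2 UNIV G' < top" using G' by (simp add: L2on_def ennreal_mult_less_top)
    fix s :: real assume s: "0 < s" "s \<le> 1"
    have "l2 {x. cmod (x $ 1) \<le> 1 / 4} (\<lambda>x. hardy_field s x * pullback f x) \<le> l2 UNIV (\<lambda>x. hardy_field s x * H x)"
      by (rule l2_mono) (auto simp: H_def h_def \<eta>1)
    also have "\<dots> = l2 bidisc (\<lambda>x. hardy_field s x * H x)"
      by (rule l2_support) (use H in \<open>auto simp: L2on_def\<close>)
    also have "\<dots> \<le> 72 * l2 UNIV G'"
      by (rule hardy_L2[OF H G' wH _ _ s]) (simp_all add: H_def G'_def \<eta>0 d0)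
    finally show "l2 {x. cmod (x $ 1) \<le> 1 / 4} (\<lambda>x. hardy_field s x * pullback f x) \<le> 72 * l2 UNIV G'" .
  qed
qed

section \<open>Doubly logarithmic cutoffs\<close>

text \<open>
  With \<open>L\<close> the doubly logarithmic function \<open>ln (log_weight s ((cmod w)\<^sup>2))\<close>, which is large near
  \<open>w = 0\<close>, the cutoff is 1 for \<open>L \<le> M\<close> and 0 for \<open>L \<ge> 2 * M\<close>.
\<close>

definition log_cutoff :: "real \<Rightarrow> real \<Rightarrow> complex ^ 2 \<Rightarrow> complex" where
  "log_cutoff M s x = of_real (smooth_step (2 - ln (log_weight s (x $ 1 \<bullet> x $ 1)) / M))"

text \<open>
  The scale at which \<open>L \<ge> 2 * M\<close> holds for all \<open>w\<close> below it, so that the cutoff vanishes there.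
\<close>

definition log_scale :: "real \<Rightarrow> real" where
  "log_scale M = sqrt (exp (- exp (2 * M)) / 2)"

lemma log_scale_bounds: "log_scale M > 0" "log_scale M \<le> 1" "(log_scale M)\<^sup>2 = exp (- exp (2 * M)) / 2"
proof -
  have "exp (- exp (2 * M)) / 2 \<le> 1" using exp_gt_zero[of "2 * M"] by (simp add: order_trans[of _ 1])
  then show "log_scale M \<le> 1" unfolding log_scale_def by (simp add: real_sqrt_le_1_iff)
qed (simp_all add: log_scale_def)

lemma smooth_log_cutoff: assumes "s > 0" "M > 0" shows "smooth (log_cutoff M s)"
proof -
  have 1: "smooth (\<lambda>x :: complex ^ 2. x $ 1 \<bullet> x $ 1 + s\<^sup>2)" by (intro smooth_intros)
  have p: "x $ 1 \<bullet> x $ 1 + s\<^sup>2 > 0" for x :: "complex ^ 2" using assms by (simp add: add_nonneg_pos)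
  then have p0: "x $ 1 \<bullet> x $ 1 + s\<^sup>2 \<noteq> 0" for x :: "complex ^ 2" by (metis less_irrefl)
  have 2: "smooth (\<lambda>x :: complex ^ 2. 1 + inverse (x $ 1 \<bullet> x $ 1 + s\<^sup>2))"
    by (rule smooth_add[OF smooth_const smooth_inverse[OF p0 1]])
  have p2: "1 + inverse (x $ 1 \<bullet> x $ 1 + s\<^sup>2) > 0" for x :: "complex ^ 2" using p[of x] by (simp add: add_pos_pos)
  have 3: "smooth (\<lambda>x :: complex ^ 2. log_weight s (x $ 1 \<bullet> x $ 1))"
    unfolding log_weight_def by (rule smooth_ln[OF p2 2])
  have 4: "smooth (\<lambda>x :: complex ^ 2. ln (log_weight s (x $ 1 \<bullet> x $ 1)))"
    by (rule smooth_ln[OF _ 3]) (rule log_weight_pos[OF assms(1)], simp)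
  have M: "M \<noteq> 0" using assms by simp
  show ?thesis
    unfolding log_cutoff_def[abs_def]
    by (rule smooth_of_real, rule smooth_compose[OF smooth_smooth_step],
        rule smooth_diff[OF smooth_const smooth_divide[OF M 4 smooth_const]])
qed

text \<open>
  The antiholomorphic derivative of \<open>ln (log_weight s ((cmod w)\<^sup>2))\<close> is bounded by the Hardy field; as
  the cutoff uses a range of length \<open>M\<close> of this function for its transition, it wins a factor \<open>1 / M\<close>.
\<close>

lemma dzbar_log_cutoff:
  obtains C where "C > 0"
    "\<And>M s x. M > 0 \<Longrightarrow> s > 0 \<Longrightarrow> cmod (dzbar 1 (log_cutoff M s) x) \<le> C / M * cmod (hardy_field s x)"
    "\<And>M s x. M > 0 \<Longrightarrow> s > 0 \<Longrightarrow> dzbar 0 (log_cutoff M s) x = 0"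
    "\<And>M s x. M > 0 \<Longrightarrow> s > 0 \<Longrightarrow> ln (log_weight s (x $ 1 \<bullet> x $ 1)) < M \<Longrightarrow> dzbar 1 (log_cutoff M s) x = 0"
    "\<And>M s (x :: complex ^ 2). M > 0 \<Longrightarrow> s > 0 \<Longrightarrow> \<exists>p. \<forall>y. y $ 1 = x $ 1 \<longrightarrow> dzbar 1 (log_cutoff M s) y = p"
proof -
  obtain C where C: "C > 0" "\<And>t v. \<bar>frechet_derivative smooth_step (at t) v\<bar> \<le> C * \<bar>v\<bar>"
    using smooth_step_deriv_bound by metis
  have C': "\<bar>smooth_step' t\<bar> \<le> C" for t using C(2)[of t 1] by (simp add: smooth_step'_def)
  define P where "P M s t = smooth_step' (2 - ln (log_weight s t) / M) * (0 - (inverse (log_weight s t) * (- 1 / ((t + s\<^sup>2) * (t + s\<^sup>2 + 1)))) / M)" for M s t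
  have der: "((\<lambda>t. smooth_step (2 - ln (log_weight s t) / M)) has_real_derivative P M s t) (at t)" if "s > 0" "t \<ge> 0" for M s t
    unfolding P_def
    by (intro DERIV_chain2[OF smooth_step_has_derivative] DERIV_diff DERIV_const DERIV_cdivide
        DERIV_chain2[OF DERIV_ln log_weight_deriv[OF that]] log_weight_pos that)
  have d1: "dzbar 1 (log_cutoff M s) x = of_real (P M s (x $ 1 \<bullet> x $ 1)) * x $ 1"
    and d0: "dzbar 0 (log_cutoff M s) x = 0" if "s > 0" for M s x
    unfolding log_cutoff_def[abs_def] by (rule dzbar_radial[OF der[OF that]], simp)+
  show ?thesis
  proof (rule that[OF C(1)])
    fix M s :: real and x :: "complex ^ 2" assume M: "M > 0" and s: "s > 0"
    show "dzbar 0 (log_cutoff M s) x = 0" by (rule d0[OF s])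
    show "dzbar 1 (log_cutoff M s) x = 0" if "ln (log_weight s (x $ 1 \<bullet> x $ 1)) < M"
    proof -
      have "ln (log_weight s (x $ 1 \<bullet> x $ 1)) / M < 1" using that M by simp
      then show ?thesis unfolding d1[OF s] P_def by (simp add: smooth_step'_eq_0)
    qed
    show "\<exists>p. \<forall>y. y $ 1 = x $ 1 \<longrightarrow> dzbar 1 (log_cutoff M s) y = p" by (auto simp: d1[OF s])
    define t q L where "t = x $ 1 \<bullet> x $ 1" and "q = t + s\<^sup>2" and "L = log_weight s t"
    have q: "q > 0" using s by (simp add: q_def t_def add_nonneg_pos)
    have L: "L > 0" unfolding L_def t_def by (rule log_weight_pos[OF s]) simp
    have "0 - (inverse L * (- 1 / (q * (q + 1)))) / M = inverse (q * L) * inverse (q + 1) / M"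
      using q L by (simp add: field_simps)
    then have "\<bar>P M s t\<bar> = \<bar>smooth_step' (2 - ln L / M)\<bar> * (inverse (q * L) * inverse (q + 1) / M)"
      unfolding P_def L_def[symmetric] q_def[symmetric] using q L M by (simp add: abs_mult)
    also have "\<dots> \<le> C * (inverse (q * L) * 1 / M)"
    proof (intro mult_mono C' divide_right_mono mult_left_mono)
      show "inverse (q + 1) \<le> 1" using q by (simp add: inverse_le_1_iff)
    qed (use q L M C(1) in auto)
    finally have P: "\<bar>P M s t\<bar> \<le> C / M * hardy_weight s t"
      by (simp add: hardy_weight_def q_def L_def)
    have hp: "hardy_weight s t > 0" unfolding t_def by (rule hardy_weight_pos[OF s]) simp
    have "cmod (dzbar 1 (log_cutoff M s) x) = \<bar>P M s t\<bar> * cmod (x $ 1)"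
      by (simp add: d1[OF s] norm_mult t_def)
    also have "\<dots> \<le> C / M * hardy_weight s t * cmod (x $ 1)" by (rule mult_right_mono[OF P]) simp
    also have "\<dots> = C / M * cmod (hardy_field s x)"
      unfolding hardy_field_def t_def[symmetric] using hp by (simp add: norm_mult)
    finally show "cmod (dzbar 1 (log_cutoff M s) x) \<le> C / M * cmod (hardy_field s x)" .
  qed
qed

lemma log_weight_small:
  assumes M: "M \<ge> 1" and t: "t > 0" "1 / t \<le> M" and s: "s > 0"
  shows "ln (log_weight s t) < M"
proof -
  have "inverse (t + s\<^sup>2) \<le> inverse t" using t s by (intro le_imp_inverse_le) auto
  also have "\<dots> \<le> M" using t by (simp add: inverse_eq_divide)
  finally have lt: "1 + inverse (t + s\<^sup>2) < exp (exp M)"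
    using exp_ge_add_one_self[of M] exp_ge_add_one_self[of "exp M"] by linarith
  have pos: "1 + inverse (t + s\<^sup>2) > 0" using t s by (simp add: add_pos_pos)
  have "log_weight s t < ln (exp (exp M))"
    unfolding log_weight_def by (subst ln_less_cancel_iff) (use lt pos in auto)
  then have "log_weight s t < exp M" by simp
  then have "ln (log_weight s t) < ln (exp M)"
    using log_weight_pos[OF s, of t] t by (subst ln_less_cancel_iff) auto
  then show ?thesis by simp
qed

lemma log_cutoff_values:
  assumes M: "M \<ge> 1"
  shows "cmod (log_cutoff M s x - 1) \<le> 1" "cmod (log_cutoff M s x) \<le> 1"
    and "s > 0 \<Longrightarrow> 1 / (x $ 1 \<bullet> x $ 1) \<le> M \<Longrightarrow> x $ 1 \<noteq> 0 \<Longrightarrow> log_cutoff M s x = 1"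
    and "cmod (x $ 1) < log_scale M \<Longrightarrow> log_cutoff M (log_scale M) x = 0"
proof -
  show "cmod (log_cutoff M s x) \<le> 1" using smooth_step_bounds by (simp add: log_cutoff_def)
  have "log_cutoff M s x - 1 = of_real (smooth_step (2 - ln (log_weight s (x $ 1 \<bullet> x $ 1)) / M) - 1)"
    by (simp add: log_cutoff_def)
  then show "cmod (log_cutoff M s x - 1) \<le> 1"
    using smooth_step_bounds[of "2 - ln (log_weight s (x $ 1 \<bullet> x $ 1)) / M"] by (simp only: norm_of_real)
  show "log_cutoff M s x = 1" if "s > 0" "1 / (x $ 1 \<bullet> x $ 1) \<le> M" "x $ 1 \<noteq> 0"
  proof -
    have "ln (log_weight s (x $ 1 \<bullet> x $ 1)) < M"
      by (rule log_weight_small[OF M _ that(2,1)]) (use that(3) in simp)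
    then have "ln (log_weight s (x $ 1 \<bullet> x $ 1)) / M \<le> 1" using M by simp
    then show ?thesis by (simp add: log_cutoff_def)
  qed
  show "log_cutoff M (log_scale M) x = 0" if "cmod (x $ 1) < log_scale M"
  proof -
    let ?t = "x $ 1 \<bullet> x $ 1" and ?s = "log_scale M"
    have "?t \<le> ?s\<^sup>2" unfolding inner_eq_cmod2 using that by (intro power_mono) auto
    then have "?t + ?s\<^sup>2 \<le> exp (- exp (2 * M))" using log_scale_bounds(3)[of M] by simp
    moreover have p: "?t + ?s\<^sup>2 > 0" using log_scale_bounds(1)[of M] by (simp add: add_nonneg_pos)
    ultimately have "inverse (exp (- exp (2 * M))) \<le> inverse (?t + ?s\<^sup>2)" by (intro le_imp_inverse_le)
    then have "exp (exp (2 * M)) \<le> 1 + inverse (?t + ?s\<^sup>2)" by (simp add: exp_minus)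
    then have "ln (exp (exp (2 * M))) \<le> ln (1 + inverse (?t + ?s\<^sup>2))" by (intro ln_mono) auto
    then have "exp (2 * M) \<le> log_weight ?s ?t" by (simp add: log_weight_def)
    then have "ln (exp (2 * M)) \<le> ln (log_weight ?s ?t)" by (intro ln_mono) auto
    then have "2 \<le> ln (log_weight ?s ?t) / M" using M by (simp add: pos_le_divide_eq)
    then show ?thesis by (simp add: log_cutoff_def)
  qed
qed

text \<open>
  The error in the derivative is the product of \<open>f\<close> with the derivative of the cutoff. As the cutoff
  depends on \<open>w\<close> only, the product can be measured in the new coordinates, where it is at most
  \<open>C / M\<close> times the product with the Hardy field, which is bounded in norm.
\<close>

lemma localize_function:
  assumes f: "L2on T f" and g: "\<And>k. L2on T (g k)"
    and w: "\<And>k. weak_div T (\<lambda>j. if j = k then f else (\<lambda>x. 0)) (g k)" and e: "(e :: real) > 0"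
  obtains f' g' \<epsilon> where "0 < \<epsilon>" "L2on T f'" "\<And>k. L2on T (g' k)"
    "\<And>k. weak_div T (\<lambda>j. if j = k then f' else (\<lambda>x. 0)) (g' k)"
    "\<And>x. cmod (x $ 1) < \<epsilon> \<Longrightarrow> f' x = 0" "\<And>k x. cmod (x $ 1) < \<epsilon> \<Longrightarrow> g' k x = 0"
    "l2 T (\<lambda>x. f' x - f x) \<le> ennreal e" "\<And>k. l2 T (\<lambda>x. g' k x - g k x) \<le> ennreal e"
proof -
  obtain K where K: "K < top"
    "\<And>s. 0 < s \<Longrightarrow> s \<le> 1 \<Longrightarrow> l2 {x. cmod (x $ 1) \<le> 1 / 4} (\<lambda>x. hardy_field s x * pullback f x) \<le> K"
    by (rule hardy_pullback[OF f g w]) (rule that)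
  obtain C where C: "C > 0"
    "\<And>M s x. M > 0 \<Longrightarrow> s > 0 \<Longrightarrow> cmod (dzbar 1 (log_cutoff M s) x) \<le> C / M * cmod (hardy_field s x)"
    "\<And>M s x. M > 0 \<Longrightarrow> s > 0 \<Longrightarrow> dzbar 0 (log_cutoff M s) x = 0"
    "\<And>M s x. M > 0 \<Longrightarrow> s > 0 \<Longrightarrow> ln (log_weight s (x $ 1 \<bullet> x $ 1)) < M \<Longrightarrow> dzbar 1 (log_cutoff M s) x = 0"
    "\<And>M s (x :: complex ^ 2). M > 0 \<Longrightarrow> s > 0 \<Longrightarrow> \<exists>p. \<forall>y. y $ 1 = x $ 1 \<longrightarrow> dzbar 1 (log_cutoff M s) y = p"
    by (rule dzbar_log_cutoff) (rule that)
  \<comment> \<open>With \<open>M \<ge> 16\<close> the cutoff is constant for \<open>cmod w \<ge> 1 / 4\<close>, that is, outside of the region in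
    which the Hardy inequality is available.\<close>
  define M where "M n = real n + 16" for n
  have M: "M n \<ge> 16" "M n \<ge> 1" "M n > 0" for n by (simp_all add: M_def)
  define \<kappa> where "\<kappa> n = log_cutoff (M n) (log_scale (M n))" for n
  have \<kappa>: "smooth (\<kappa> n)" for n
    unfolding \<kappa>_def by (rule smooth_log_cutoff[OF log_scale_bounds(1) M(3)])
  have fm [measurable]: "f \<in> borel_measurable borel" by (rule L2on_measurable[OF f])
  have dm [measurable]: "dzbar 1 (\<kappa> n) \<in> borel_measurable borel" for n
    by (rule smooth_measurable[OF smooth_dzbar[OF \<kappa>]])
  have lim: "(\<lambda>n. l2 T (\<lambda>x. \<kappa> n x * h x - h x)) \<longlonglongrightarrow> 0" if "L2on T h" for h
  proof (rule cutoff_tendsto[OF that smooth_measurable[OF \<kappa>]])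
    show "cmod (\<kappa> n x - 1) \<le> 1" for n x unfolding \<kappa>_def by (rule log_cutoff_values(1)[OF M(2)])
    fix x assume "x \<in> T"
    then have nz: "x $ 1 \<noteq> 0" by (auto simp: hartogs_triangle_def)
    obtain N :: nat where N: "1 / (x $ 1 \<bullet> x $ 1) \<le> real N" using real_arch_simple by blast
    have "eventually (\<lambda>n. \<kappa> n x = 1) sequentially"
      using eventually_ge_at_top[of N]
    proof eventually_elim
      case (elim n)
      then have "1 / (x $ 1 \<bullet> x $ 1) \<le> M n" using N by (simp add: M_def)
      then show ?case unfolding \<kappa>_def by (rule log_cutoff_values(3)[OF M(2) log_scale_bounds(1) _ nz])
    qed
    then show "(\<lambda>n. \<kappa> n x) \<longlonglongrightarrow> 1" by (rule tendsto_eventually)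
  qed
  have err: "l2 UNIV (\<lambda>x. dzbar 1 (\<kappa> n) x * f x) \<le> ennreal ((C / M n)\<^sup>2) * K" for n
  proof -
    let ?s = "log_scale (M n)"
    have sh: "dzbar 1 (\<kappa> n) (shear x) = dzbar 1 (\<kappa> n) x" for x
    proof -
      obtain p where p: "\<And>y. y $ 1 = x $ 1 \<Longrightarrow> dzbar 1 (\<kappa> n) y = p"
        using C(5)[OF M(3) log_scale_bounds(1), of x] unfolding \<kappa>_def by blast
      show ?thesis using p[of x] p[of "shear x"] by simp
    qed
    have "l2 UNIV (\<lambda>x. dzbar 1 (\<kappa> n) x * f x) = l2 UNIV (\<lambda>x. dzbar 1 (\<kappa> n) x * pullback f x)"
      using l2_pullback[OF fm dm, of n] by (simp add: sh)
    also have "\<dots> = l2 {x. cmod (x $ 1) \<le> 1 / 4} (\<lambda>x. dzbar 1 (\<kappa> n) x * pullback f x)"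
    proof (rule l2_support)
      fix x assume x: "x \<notin> {x :: complex ^ 2. cmod (x $ 1) \<le> 1 / 4}"
      then have "(1 / 4)\<^sup>2 < (cmod (x $ 1))\<^sup>2" by (intro power_strict_mono) auto
      then have t: "x $ 1 \<bullet> x $ 1 > 1 / 16" by (simp add: inner_eq_cmod2 power2_eq_square)
      then have "1 / (x $ 1 \<bullet> x $ 1) \<le> 16" by (simp add: divide_le_eq)
      then have "ln (log_weight ?s (x $ 1 \<bullet> x $ 1)) < M n"
        using M(1)[of n] t by (intro log_weight_small[OF M(2) _ _ log_scale_bounds(1)]) auto
      then have "dzbar 1 (\<kappa> n) x = 0" unfolding \<kappa>_def by (rule C(4)[OF M(3) log_scale_bounds(1)])
      then show "dzbar 1 (\<kappa> n) x * pullback f x = 0" by simp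
    qed simp
    also have "\<dots> \<le> ennreal ((C / M n)\<^sup>2) * l2 {x. cmod (x $ 1) \<le> 1 / 4} (\<lambda>x. hardy_field ?s x * pullback f x)"
    proof (rule l2_cmult_le)
      show "(\<lambda>x. hardy_field ?s x * pullback f x) \<in> borel_measurable borel"
        using hardy_field_measurable[OF log_scale_bounds(1)] pullback_measurable[OF fm] by (rule borel_measurable_times)
      show "{x :: complex ^ 2. cmod (x $ 1) \<le> 1 / 4} \<in> sets borel"
        by (intro borel_closed closed_Collect_le continuous_intros)
      show "0 \<le> C / M n" using C(1) M(3)[of n] by simp
      show "cmod (dzbar 1 (\<kappa> n) x * pullback f x) \<le> C / M n * cmod (hardy_field ?s x * pullback f x)" for x
        using mult_right_mono[OF C(2)[OF M(3) log_scale_bounds(1), of n "M n" x], of "cmod (pullback f x)"]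
        by (simp add: \<kappa>_def norm_mult mult.assoc)
    qed
    also have "\<dots> \<le> ennreal ((C / M n)\<^sup>2) * K"
      by (intro mult_left_mono K(2) log_scale_bounds) simp
    finally show ?thesis .
  qed
  have errlim: "(\<lambda>n. ennreal ((C / M n)\<^sup>2) * K) \<longlonglongrightarrow> 0"
  proof -
    have "(\<lambda>n. C / M n) \<longlonglongrightarrow> 0"
      unfolding M_def using LIMSEQ_ignore_initial_segment[OF lim_const_over_n[of C], of 16] by simp
    then have "(\<lambda>n. ennreal ((C / M n)\<^sup>2)) \<longlonglongrightarrow> ennreal (0\<^sup>2)" by (intro tendsto_ennrealI tendsto_power)
    then have "(\<lambda>n. ennreal ((C / M n)\<^sup>2) * K) \<longlonglongrightarrow> ennreal (0\<^sup>2) * K"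
      using K(1) by (intro tendsto_mult_ennreal tendsto_const) auto
    then show ?thesis by simp
  qed
  have ev: "eventually (\<lambda>n. u n < ennreal (e / 4)) sequentially" if "u \<longlonglongrightarrow> 0" for u
    using order_tendstoD(2)[OF that, of "ennreal (e / 4)"] e by simp
  have "eventually (\<lambda>n. l2 T (\<lambda>x. \<kappa> n x * f x - f x) < ennreal (e / 4) \<and>
      l2 T (\<lambda>x. \<kappa> n x * g 0 x - g 0 x) < ennreal (e / 4) \<and> l2 T (\<lambda>x. \<kappa> n x * g 1 x - g 1 x) < ennreal (e / 4) \<and>
      ennreal ((C / M n)\<^sup>2) * K < ennreal (e / 4)) sequentially"
    by (intro eventually_conj ev lim f g errlim)
  then obtain n where "l2 T (\<lambda>x. \<kappa> n x * f x - f x) < ennreal (e / 4) \<and>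
      l2 T (\<lambda>x. \<kappa> n x * g 0 x - g 0 x) < ennreal (e / 4) \<and> l2 T (\<lambda>x. \<kappa> n x * g 1 x - g 1 x) < ennreal (e / 4) \<and>
      ennreal ((C / M n)\<^sup>2) * K < ennreal (e / 4)"
    unfolding eventually_sequentially by blast
  then have n: "l2 T (\<lambda>x. \<kappa> n x * f x - f x) < ennreal (e / 4)" "l2 T (\<lambda>x. \<kappa> n x * g 0 x - g 0 x) < ennreal (e / 4)"
      "l2 T (\<lambda>x. \<kappa> n x * g 1 x - g 1 x) < ennreal (e / 4)" "ennreal ((C / M n)\<^sup>2) * K < ennreal (e / 4)"
    by simp_all
  let ?\<kappa> = "\<kappa> n" and ?\<epsilon> = "log_scale (M n)"
  define D where "D k x = (if k = (1 :: 2) then dzbar 1 ?\<kappa> x * f x else 0)" for k x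
  have le_e: "l2 UNIV (\<lambda>x. dzbar 1 ?\<kappa> x * f x) \<le> ennreal (e / 4)"
    using err[of n] n(4) by (rule order_trans[OF _ less_imp_le])
  have DL: "L2on T (D k)" for k
  proof (cases "k = 1")
    case True
    have "l2 UNIV (\<lambda>x. dzbar 1 ?\<kappa> x * f x) < top" by (rule le_less_trans[OF le_e]) simp
    moreover have "(\<lambda>x. dzbar 1 ?\<kappa> x * f x) \<in> borel_measurable borel" by measurable
    ultimately show ?thesis using True f by (simp add: L2on_def D_def[abs_def])
  qed (simp add: D_def[abs_def])
  have z: "?\<kappa> x = 0" if "cmod (x $ 1) < ?\<epsilon>" for x
    unfolding \<kappa>_def by (rule log_cutoff_values(4)[OF M(2) that])
  have dz: "dzbar 1 ?\<kappa> x = 0" if "cmod (x $ 1) < ?\<epsilon>" for x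
  proof -
    have op: "open {x :: complex ^ 2. cmod (x $ 1) < ?\<epsilon>}" by (intro open_Collect_less continuous_intros)
    have "frechet_derivative ?\<kappa> (at x) v = 0" for v
      by (rule frechet_derivative_zero_on_open[OF op]) (use that z in auto)
    then show ?thesis by (simp add: dzbar_def)
  qed
  have kap: "L2on T (\<lambda>x. ?\<kappa> x * u x)" if "L2on T u" for u
    by (rule L2on_mult_bounded[OF that smooth_measurable[OF \<kappa>], where B = 1])
      (unfold \<kappa>_def, rule log_cutoff_values(2)[OF M(2)])
  have d0: "dzbar 0 ?\<kappa> x = 0" for x unfolding \<kappa>_def by (rule C(3)[OF M(3) log_scale_bounds(1)])
  show ?thesis
  proof (rule that[OF log_scale_bounds(1), of "\<lambda>x. ?\<kappa> x * f x" "\<lambda>k x. ?\<kappa> x * g k x + D k x" "M n"])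
    show "L2on T (\<lambda>x. ?\<kappa> x * f x)" by (rule kap[OF f])
    show "L2on T (\<lambda>x. ?\<kappa> x * g k x + D k x)" for k by (intro L2on_add kap g DL)
    show "weak_div T (\<lambda>j. if j = k then \<lambda>x. ?\<kappa> x * f x else (\<lambda>x. 0)) (\<lambda>x. ?\<kappa> x * g k x + D k x)" for k
    proof -
      have L: "L2on T ((\<lambda>j. if j = k then f else (\<lambda>x. 0)) j)" for j using f by simp
      have k: "k = 0 \<or> k = 1" using UNIV_2' by auto
      have eq1: "(\<lambda>j x. ?\<kappa> x * (if j = k then f else (\<lambda>x. 0)) x) = (\<lambda>j. if j = k then \<lambda>x. ?\<kappa> x * f x else (\<lambda>x. 0))"
        by (auto simp: fun_eq_iff)
      have eq2: "(\<Sum>j\<in>UNIV. dzbar j ?\<kappa> x * (if j = k then f else (\<lambda>x. 0)) x) = D k x" for x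
        using k by (auto simp: sum_2' D_def d0)
      show ?thesis using weak_div_mult[OF \<kappa> L g[of k] w[of k], of n] unfolding eq1 eq2 .
    qed
    show "?\<kappa> x * f x = 0" if "cmod (x $ 1) < ?\<epsilon>" for x by (simp add: z[OF that])
    show "?\<kappa> x * g k x + D k x = 0" if "cmod (x $ 1) < ?\<epsilon>" for k x by (simp add: z[OF that] dz[OF that] D_def)
    show "l2 T (\<lambda>x. ?\<kappa> x * f x - f x) \<le> ennreal e"
      by (rule order_trans[OF less_imp_le[OF n(1)] ennreal_leI]) (use e in simp)
    show "l2 T (\<lambda>x. ?\<kappa> x * g k x + D k x - g k x) \<le> ennreal e" for k
    proof -
      have [measurable]: "g k \<in> borel_measurable borel" "D k \<in> borel_measurable borel" "?\<kappa> \<in> borel_measurable borel"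
        using L2on_measurable[OF g] L2on_measurable[OF DL] smooth_measurable[OF \<kappa>] by auto
      have k: "k = 0 \<or> k = 1" using UNIV_2' by auto
      have le1: "l2 T (\<lambda>x. ?\<kappa> x * g k x - g k x) \<le> ennreal (e / 4)" using k n(2,3) by (auto intro: less_imp_le)
      have "l2 T (D k) \<le> l2 UNIV (\<lambda>x. dzbar 1 ?\<kappa> x * f x)" by (rule l2_mono) (auto simp: D_def)
      then have le2: "l2 T (D k) \<le> ennreal (e / 4)" using le_e by (rule order_trans)
      have "l2 T (\<lambda>x. ?\<kappa> x * g k x + D k x - g k x) = l2 T (\<lambda>x. (?\<kappa> x * g k x - g k x) + D k x)"
        by (rule l2_cong) simp_all
      also have "\<dots> \<le> 2 * l2 T (\<lambda>x. ?\<kappa> x * g k x - g k x) + 2 * l2 T (D k)" by (rule l2_add) measurable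
      also have "\<dots> \<le> 2 * ennreal (e / 4) + 2 * ennreal (e / 4)" by (intro add_mono mult_left_mono le1 le2) auto
      also have "\<dots> = ennreal (2 * (e / 4) + 2 * (e / 4))"
        unfolding two_mult_ennreal using e by (subst ennreal_plus) auto
      finally show ?thesis by simp
    qed
  qed
qed

lemma l2_triangle_quarter:
  assumes e: "(e :: real) > 0" and le: "l2 A (\<lambda>x. u x - v x) \<le> ennreal (e / 4)" "l2 A (\<lambda>x. v x - h x) \<le> ennreal (e / 4)"
    and m: "u \<in> borel_measurable borel" "v \<in> borel_measurable borel" "h \<in> borel_measurable borel" "A \<in> sets borel"
  shows "l2 A (\<lambda>x. u x - h x) \<le> ennreal e"
proof -
  have "l2 A (\<lambda>x. u x - h x) \<le> 2 * l2 A (\<lambda>x. u x - v x) + 2 * l2 A (\<lambda>x. v x - h x)"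
    by (rule l2_diff_triangle[OF m])
  also have "\<dots> \<le> 2 * ennreal (e / 4) + 2 * ennreal (e / 4)" using le by (intro add_mono mult_left_mono) auto
  also have "\<dots> = ennreal (2 * (e / 4) + 2 * (e / 4))"
    unfolding two_mult_ennreal using e by (subst ennreal_plus) auto
  finally show ?thesis by simp
qed

lemma approx_function:
  assumes f: "L2on T f" and g: "\<And>k. L2on T (g k)"
    and w: "\<And>k. weak_div T (\<lambda>j. if j = k then f else (\<lambda>x. 0)) (g k)" and e: "(e :: real) > 0"
  shows "\<exists>F. smooth F \<and> l2 T (\<lambda>x. F x - f x) \<le> ennreal e \<and> (\<forall>k. l2 T (\<lambda>x. dzbar k F x - g k x) \<le> ennreal e)"
proof -
  have e4: "e / 4 > 0" using e by simp
  obtain f' g' \<epsilon> where l: "0 < \<epsilon>" "L2on T f'" "\<And>k. L2on T (g' k)"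
    "\<And>k. weak_div T (\<lambda>j. if j = k then f' else (\<lambda>x. 0)) (g' k)"
    "\<And>x. cmod (x $ 1) < \<epsilon> \<Longrightarrow> f' x = 0" "\<And>k x. cmod (x $ 1) < \<epsilon> \<Longrightarrow> g' k x = 0"
    "l2 T (\<lambda>x. f' x - f x) \<le> ennreal (e / 4)" "\<And>k. l2 T (\<lambda>x. g' k x - g k x) \<le> ennreal (e / 4)"
    by (rule localize_function[OF f g w e4]) (rule that)
  obtain F where F: "\<And>n. smooth (F n)" "(\<lambda>n. l2 T (\<lambda>x. F n x - f' x)) \<longlonglongrightarrow> 0"
    "\<And>k. (\<lambda>n. l2 T (\<lambda>x. dzbar k (F n) x - g' k x)) \<longlonglongrightarrow> 0"
    using approx_vanishing_function[OF l(2,3,4,1,5,6)] by blast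
  have ev: "eventually (\<lambda>n. u n < ennreal (e / 4)) sequentially" if "u \<longlonglongrightarrow> 0" for u
    using order_tendstoD(2)[OF that, of "ennreal (e / 4)"] e by simp
  have "eventually (\<lambda>n. l2 T (\<lambda>x. F n x - f' x) < ennreal (e / 4) \<and> l2 T (\<lambda>x. dzbar 0 (F n) x - g' 0 x) < ennreal (e / 4) \<and>
      l2 T (\<lambda>x. dzbar 1 (F n) x - g' 1 x) < ennreal (e / 4)) sequentially"
    by (intro eventually_conj ev F)
  then obtain n where "l2 T (\<lambda>x. F n x - f' x) < ennreal (e / 4) \<and> l2 T (\<lambda>x. dzbar 0 (F n) x - g' 0 x) < ennreal (e / 4) \<and>
      l2 T (\<lambda>x. dzbar 1 (F n) x - g' 1 x) < ennreal (e / 4)"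
    unfolding eventually_sequentially by blast
  then have n: "l2 T (\<lambda>x. F n x - f' x) \<le> ennreal (e / 4)" "l2 T (\<lambda>x. dzbar 0 (F n) x - g' 0 x) \<le> ennreal (e / 4)"
      "l2 T (\<lambda>x. dzbar 1 (F n) x - g' 1 x) \<le> ennreal (e / 4)"
    by (auto intro: less_imp_le)
  have n': "l2 T (\<lambda>x. dzbar k (F n) x - g' k x) \<le> ennreal (e / 4)" for k
  proof -
    have "k = 0 \<or> k = 1" using UNIV_2' by auto
    then show ?thesis using n(2,3) by auto
  qed
  show ?thesis
  proof (intro exI[of _ "F n"] conjI allI)
    show "smooth (F n)" by (rule F)
    show "l2 T (\<lambda>x. F n x - f x) \<le> ennreal e"
      by (rule l2_triangle_quarter[OF e n(1) l(7) smooth_measurable[OF F(1)] L2on_measurable[OF l(2)] L2on_measurable[OF f] T_borel])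
    show "l2 T (\<lambda>x. dzbar k (F n) x - g k x) \<le> ennreal e" for k
      by (rule l2_triangle_quarter[OF e n' l(8) smooth_measurable[OF smooth_dzbar[OF F(1)]] L2on_measurable[OF l(3)] L2on_measurable[OF g] T_borel])
  qed
qed

section \<open>From coefficient functions to forms\<close>

lemma L2_norm_sq_eq:
  fixes f :: "'n::finite cform"
  assumes "\<Omega> \<in> sets borel"
  shows "L2_norm_sq \<Omega> f = (\<Sum>I\<in>UNIV. \<Sum>J\<in>UNIV. l2 \<Omega> (f I J))"
proof -
  have "\<Omega> \<inter> space lebesgue \<in> sets lebesgue" using assms by simp
  then show ?thesis
    unfolding L2_norm_sq_def l2_def ennreal_cmod_square
    by (simp only: nn_integral_restrict_space nn_integral_completion)
qed

text \<open>
  Coefficients of forms are Lebesgue measurable on the domain. A Borel representative, extended by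
  zero, lets all integrals be taken over the whole space.
\<close>

lemma borel_representative:
  assumes f: "f \<in> borel_measurable (lebesgue_on \<Omega>)" and \<Omega>: "\<Omega> \<in> sets borel" and fin: "l2 \<Omega> f < top"
  obtains h where "L2on \<Omega> h" "AE x in lborel. x \<in> \<Omega> \<longrightarrow> f x = h x"
proof -
  define g where "g x = (if x \<in> \<Omega> then f x else 0)" for x
  have "\<Omega> \<inter> space lebesgue \<in> sets lebesgue" using \<Omega> by simp
  then have "(\<lambda>x. indicator \<Omega> x *\<^sub>R f x) \<in> borel_measurable lebesgue"
    using f by (simp add: borel_measurable_restrict_space_iff)
  moreover have "(\<lambda>x. indicator \<Omega> x *\<^sub>R f x) = g" by (auto simp: g_def fun_eq_iff)
  ultimately have g [measurable]: "g \<in> borel_measurable lebesgue" by simp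
  have m: "(\<lambda>x. Re (g x)) \<in> borel_measurable lebesgue" "(\<lambda>x. Im (g x)) \<in> borel_measurable lebesgue"
    by measurable
  obtain a where a: "a \<in> borel_measurable lborel" "AE x in lborel. Re (g x) = a x"
    using completion_ex_borel_measurable_real[OF m(1)] by blast
  obtain b where b: "b \<in> borel_measurable lborel" "AE x in lborel. Im (g x) = b x"
    using completion_ex_borel_measurable_real[OF m(2)] by blast
  define h where "h x = indicator \<Omega> x * (of_real (a x) + \<i> * of_real (b x))" for x
  have [measurable]: "a \<in> borel_measurable borel" "b \<in> borel_measurable borel" "\<Omega> \<in> sets borel"
    using a b \<Omega> by simp_all
  have h: "h \<in> borel_measurable borel" unfolding h_def[abs_def] by measurable
  have ae: "AE x in lborel. x \<in> \<Omega> \<longrightarrow> f x = h x"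
    using a(2) b(2) by eventually_elim (auto simp: h_def g_def complex_eq_iff)
  have "l2 UNIV h = l2 \<Omega> h" by (rule l2_support) (auto simp: h_def)
  also have "\<dots> = l2 \<Omega> f" by (rule l2_cong_AE) (use ae in \<open>eventually_elim, auto\<close>)
  finally have "L2on \<Omega> h" using fin h by (auto simp: L2on_def h_def)
  then show ?thesis using ae by (rule that)
qed

lemma borel_form:
  fixes f :: "'n::finite cform"
  assumes f: "f \<in> L2_forms p q \<Omega>" and \<Omega>: "\<Omega> \<in> sets borel"
  obtains h :: "'n cform" where "\<And>I J. L2on \<Omega> (h I J)" "\<And>I J. AE x in lborel. x \<in> \<Omega> \<longrightarrow> f I J x = h I J x"
    "\<And>I J. \<not> (card I = p \<and> card J = q) \<Longrightarrow> h I J = (\<lambda>x. 0)"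
proof -
  define P where "P I J h \<longleftrightarrow> L2on \<Omega> h \<and> (AE x in lborel. x \<in> \<Omega> \<longrightarrow> f I J x = h x) \<and>
      (\<not> (card I = p \<and> card J = q) \<longrightarrow> h = (\<lambda>x. 0))" for I J h
  have ex: "\<exists>h. P I J h" for I J
  proof (cases "card I = p \<and> card J = q")
    case True
    have "l2 \<Omega> (f I J) \<le> (\<Sum>J\<in>UNIV. l2 \<Omega> (f I J))" by (rule member_le_sum) auto
    also have "\<dots> \<le> (\<Sum>I\<in>UNIV. \<Sum>J\<in>UNIV. l2 \<Omega> (f I J))" by (rule member_le_sum) auto
    also have "\<dots> < top" using f by (simp add: L2_forms_def L2_norm_sq_eq[OF \<Omega>])
    finally have fin: "l2 \<Omega> (f I J) < top" .
    have "f I J \<in> borel_measurable (lebesgue_on \<Omega>)" using f by (simp add: L2_forms_def)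
    then obtain h where "L2on \<Omega> h" "AE x in lborel. x \<in> \<Omega> \<longrightarrow> f I J x = h x"
      by (rule borel_representative[OF _ \<Omega> fin]) (rule that)
    with True show ?thesis unfolding P_def by blast
  next
    case False
    then have "f I J x = 0" for x using f by (auto simp: L2_forms_def is_form_def)
    then show ?thesis by (intro exI[of _ "\<lambda>x. 0"]) (simp add: P_def)
  qed
  have "P I J (SOME h. P I J h)" for I J by (rule someI_ex[OF ex])
  then show ?thesis using that[of "\<lambda>I J. SOME h. P I J h"] unfolding P_def by blast
qed

lemma L2_norm_sq_diff_eq:
  fixes f :: "'n::finite cform"
  assumes \<Omega>: "\<Omega> \<in> sets borel" and ae: "\<And>I J. AE x in lborel. x \<in> \<Omega> \<longrightarrow> f I J x = h I J x"
  shows "L2_norm_sq \<Omega> (F - f) = (\<Sum>I\<in>UNIV. \<Sum>J\<in>UNIV. l2 \<Omega> (\<lambda>x. F I J x - h I J x))"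
proof -
  have "l2 \<Omega> ((F - f) I J) = l2 \<Omega> (\<lambda>x. F I J x - h I J x)" for I J
    by (rule l2_cong_AE) (use ae[of I J] in \<open>eventually_elim, auto\<close>)
  then show ?thesis by (simp only: L2_norm_sq_eq[OF \<Omega>])
qed

lemma integral_lebesgue_on_test:
  assumes \<Omega>: "\<Omega> \<in> sets borel" and h: "L2on \<Omega> h" and ae: "AE x in lborel. x \<in> \<Omega> \<longrightarrow> f x = h x"
    and f: "f \<in> borel_measurable (lebesgue_on \<Omega>)" and m: "m \<in> borel_measurable borel"
  shows "(LINT x|lebesgue_on \<Omega>. f x * m x) = (LINT x|lborel. h x * m x)"
proof -
  have \<Omega>': "\<Omega> \<inter> space lebesgue \<in> sets lebesgue" using \<Omega> by simp
  have hm: "(\<lambda>x. h x * m x) \<in> borel_measurable borel"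
    using L2on_measurable[OF h] m by (rule borel_measurable_times)
  have "(\<lambda>x. indicator \<Omega> x *\<^sub>R f x) \<in> borel_measurable lebesgue"
    using f \<Omega>' by (simp add: borel_measurable_restrict_space_iff)
  moreover have "m \<in> borel_measurable lebesgue" using m by (intro measurable_completion) simp
  ultimately have "(\<lambda>x. (indicator \<Omega> x *\<^sub>R f x) * m x) \<in> borel_measurable lebesgue" by (rule borel_measurable_times)
  then have fm: "(\<lambda>x. indicator \<Omega> x *\<^sub>R (f x * m x)) \<in> borel_measurable lebesgue" by simp
  have "(LINT x|lebesgue_on \<Omega>. f x * m x) = (LINT x|lebesgue. indicator \<Omega> x *\<^sub>R (f x * m x))"
    by (rule integral_restrict_space[OF \<Omega>'])
  also have "\<dots> = (LINT x|lebesgue. h x * m x)"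
  proof (rule integral_cong_AE[OF fm])
    show "(\<lambda>x. h x * m x) \<in> borel_measurable lebesgue" using hm by (intro measurable_completion) simp
    have "AE x in lborel. indicator \<Omega> x *\<^sub>R (f x * m x) = h x * m x"
      using ae by eventually_elim (use h in \<open>auto simp: L2on_def indicator_def\<close>)
    then show "AE x in lebesgue. indicator \<Omega> x *\<^sub>R (f x * m x) = h x * m x" by (rule AE_completion)
  qed
  also have "\<dots> = (LINT x|lborel. h x * m x)" by (rule integral_completion) (use hm in simp)
  finally show ?thesis .
qed

text \<open>
  The coefficient with indices \<open>I\<close> and \<open>K\<close> of the Cauchy-Riemann operator is the divergence, with
  respect to the antiholomorphic derivatives, of this field.
\<close>

definition dbar_field :: 
    "'n::{finite,linorder} cform \<Rightarrow> 'n set \<Rightarrow> 'n set \<Rightarrow> 'n \<Rightarrow> complex ^ ('n::{finite,linorder}) \<Rightarrow> complex" where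
  "dbar_field f I K k x = (if k \<in> K then dbar_sign I k K * f I (K - {k}) x else 0)"

lemma dbar_sign_square: "dbar_sign I k K * dbar_sign I k K = 1"
  by (simp add: dbar_sign_def minus_one_power_iff)

lemma cmod_dbar_sign: "cmod (dbar_sign I k K) = 1"
  by (simp add: dbar_sign_def norm_mult norm_power)

lemma dbar_field_smooth:
  assumes F: "\<And>I J. smooth (F I J)"
  shows "smooth (dbar_field F I K k)" "dbar_smooth F I K x = (\<Sum>k\<in>UNIV. dzbar k (dbar_field F I K k) x)"
proof -
  have eq: "dbar_field F I K k = (if k \<in> K then (\<lambda>x. dbar_sign I k K * F I (K - {k}) x) else (\<lambda>x. 0))" for k
    by (auto simp: dbar_field_def fun_eq_iff)
  show "smooth (dbar_field F I K k)"
    unfolding eq by (cases "k \<in> K") (simp_all add: smooth_mult[OF smooth_const F] smooth_const)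
  have "dzbar k (dbar_field F I K k) x = (if k \<in> K then dbar_sign I k K * dzbar k (F I (K - {k})) x else 0)" for k
    by (simp add: eq dzbar_cmult[OF F])
  then show "dbar_smooth F I K x = (\<Sum>k\<in>UNIV. dzbar k (dbar_field F I K k) x)"
    by (simp add: dbar_smooth_def sum.If_cases)
qed

lemma L2on_dbar_field:
  assumes "\<And>I J. L2on \<Omega> (f I J)"
  shows "L2on \<Omega> (dbar_field f I K k)"
proof (cases "k \<in> K")
  case True
  then show ?thesis unfolding dbar_field_def[abs_def] by (simp add: L2on_cmult assms)
qed (simp add: dbar_field_def[abs_def])

lemma dbar_distr_iff_weak_div:
  fixes f g :: "2 cform"
  assumes \<Omega>: "\<Omega> \<in> sets borel"
    and f: "f \<in> L2_forms p q \<Omega>" "\<And>I J. L2on \<Omega> (f' I J)" "\<And>I J. AE x in lborel. x \<in> \<Omega> \<longrightarrow> f I J x = f' I J x"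
    and g: "g \<in> L2_forms p' q' \<Omega>" "\<And>I J. L2on \<Omega> (g' I J)" "\<And>I J. AE x in lborel. x \<in> \<Omega> \<longrightarrow> g I J x = g' I J x"
  shows "dbar_distr \<Omega> f g \<longleftrightarrow> (\<forall>I K. weak_div \<Omega> (dbar_field f' I K) (g' I K))"
proof -
  have fm: "f I J \<in> borel_measurable (lebesgue_on \<Omega>)" and gm: "g I J \<in> borel_measurable (lebesgue_on \<Omega>)" for I J
    using f(1) g(1) by (simp_all add: L2_forms_def)
  have eq: "(LINT x|lebesgue_on \<Omega>. g I K x * \<phi> x) = (LINT x|lborel. g' I K x * \<phi> x)"
    "(\<Sum>k\<in>K. dbar_sign I k K * - (LINT x|lebesgue_on \<Omega>. f I (K - {k}) x * dzbar k \<phi> x)) =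
      (\<Sum>k\<in>UNIV. - (LINT x|lborel. dbar_field f' I K k x * dzbar k \<phi> x))"
    if "test_fun \<Omega> \<phi>" for I K \<phi>
  proof -
    have s: "smooth \<phi>" using that by (simp add: test_fun_def)
    show "(LINT x|lebesgue_on \<Omega>. g I K x * \<phi> x) = (LINT x|lborel. g' I K x * \<phi> x)"
      by (rule integral_lebesgue_on_test[OF \<Omega> g(2,3) gm smooth_measurable[OF s]])
    have "(LINT x|lebesgue_on \<Omega>. f I J x * dzbar k \<phi> x) = (LINT x|lborel. f' I J x * dzbar k \<phi> x)" for J k
      by (rule integral_lebesgue_on_test[OF \<Omega> f(2,3) fm smooth_measurable[OF smooth_dzbar[OF s]]])
    moreover have "- (LINT x|lborel. dbar_field f' I K k x * dzbar k \<phi> x) =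
        (if k \<in> K then dbar_sign I k K * - (LINT x|lborel. f' I (K - {k}) x * dzbar k \<phi> x) else 0)" for k
      by (simp add: dbar_field_def mult.assoc)
    ultimately show "(\<Sum>k\<in>K. dbar_sign I k K * - (LINT x|lebesgue_on \<Omega>. f I (K - {k}) x * dzbar k \<phi> x)) =
        (\<Sum>k\<in>UNIV. - (LINT x|lborel. dbar_field f' I K k x * dzbar k \<phi> x))"
      by (simp add: sum.If_cases)
  qed
  show ?thesis
  proof
    assume D: "dbar_distr \<Omega> f g"
    show "\<forall>I K. weak_div \<Omega> (dbar_field f' I K) (g' I K)"
      unfolding weak_div_def
    proof (intro allI impI)
      fix I K \<phi> assume t: "test_fun \<Omega> \<phi>"
      show "(LINT x|lborel. g' I K x * \<phi> x) = (\<Sum>k\<in>UNIV. - (LINT x|lborel. dbar_field f' I K k x * dzbar k \<phi> x))"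
        using D t unfolding dbar_distr_def eq[OF t, symmetric] by blast
    qed
  next
    assume W: "\<forall>I K. weak_div \<Omega> (dbar_field f' I K) (g' I K)"
    show "dbar_distr \<Omega> f g"
      unfolding dbar_distr_def
    proof (intro allI impI)
      fix I K \<phi> assume t: "test_fun \<Omega> \<phi>"
      show "(LINT x|lebesgue_on \<Omega>. g I K x * \<phi> x) =
          (\<Sum>k\<in>K. dbar_sign I k K * - (LINT x|lebesgue_on \<Omega>. f I (K - {k}) x * dzbar k \<phi> x))"
        using W t unfolding weak_div_def eq[OF t] by blast
    qed
  qed
qed

text \<open>On any domain integration by parts passes to graph norm limits.\<close>

lemma dbar_strong_subset_dbar_weak:
  fixes \<Omega> :: "(complex ^ 2) set"
  assumes \<Omega>: "\<Omega> \<in> sets borel"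
  shows "dbar_strong p q \<Omega> \<subseteq> dbar_weak p q \<Omega>"
proof (rule subrelI)
  fix f g assume "(f, g) \<in> dbar_strong p q \<Omega>"
  then obtain F :: "nat \<Rightarrow> 2 cform" where f: "f \<in> L2_forms p (q - 1) \<Omega>" and g: "g \<in> L2_forms p q \<Omega>"
    and F: "\<And>n. F n \<in> smooth_forms p (q - 1)"
    and lim: "(\<lambda>n. L2_norm_sq \<Omega> (F n - f)) \<longlonglongrightarrow> 0" "(\<lambda>n. L2_norm_sq \<Omega> (dbar_smooth (F n) - g)) \<longlonglongrightarrow> 0"
    by (auto simp: dbar_strong_def)
  obtain f' where f': "\<And>I J. L2on \<Omega> (f' I J)" "\<And>I J. AE x in lborel. x \<in> \<Omega> \<longrightarrow> f I J x = f' I J x"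
    by (rule borel_form[OF f \<Omega>]) (rule that)
  obtain g' where g': "\<And>I J. L2on \<Omega> (g' I J)" "\<And>I J. AE x in lborel. x \<in> \<Omega> \<longrightarrow> g I J x = g' I J x"
    by (rule borel_form[OF g \<Omega>]) (rule that)
  have sm: "smooth (F n I J)" for n I J using F[of n] by (simp add: smooth_forms_def)
  have component: "(\<lambda>n. l2 \<Omega> (\<lambda>x. G n I J x - h' I J x)) \<longlonglongrightarrow> 0"
    if "(\<lambda>n. L2_norm_sq \<Omega> (G n - h)) \<longlonglongrightarrow> 0" "\<And>I J. AE x in lborel. x \<in> \<Omega> \<longrightarrow> h I J x = h' I J x"
    for G :: "nat \<Rightarrow> 2 cform" and h h' I J
  proof (rule tendsto_sandwich[OF always_eventually always_eventually tendsto_const that(1)]; intro allI)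
    fix n
    show "0 \<le> l2 \<Omega> (\<lambda>x. G n I J x - h' I J x)" by simp
    have "l2 \<Omega> (\<lambda>x. G n I J x - h' I J x) \<le> (\<Sum>J\<in>UNIV. l2 \<Omega> (\<lambda>x. G n I J x - h' I J x))"
      by (rule member_le_sum) auto
    also have "\<dots> \<le> (\<Sum>I\<in>UNIV. \<Sum>J\<in>UNIV. l2 \<Omega> (\<lambda>x. G n I J x - h' I J x))"
      by (rule member_le_sum) auto
    finally show "l2 \<Omega> (\<lambda>x. G n I J x - h' I J x) \<le> L2_norm_sq \<Omega> (G n - h)"
      by (simp only: L2_norm_sq_diff_eq[OF \<Omega> that(2)])
  qed
  have "weak_div \<Omega> (dbar_field f' I K) (g' I K)" for I K
  proof (rule weak_div_limit[OF \<Omega> L2on_dbar_field[OF f'(1)] g'(1)])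
    show "smooth (dbar_field (F n) I K k)" for n k by (rule dbar_field_smooth(1)[OF sm])
    show "(\<lambda>n. l2 \<Omega> (\<lambda>x. dbar_field (F n) I K k x - dbar_field f' I K k x)) \<longlonglongrightarrow> 0" for k
    proof (rule tendsto_sandwich[OF always_eventually always_eventually tendsto_const
          component[OF lim(1) f'(2), of I "K - {k}"]]; intro allI)
      fix n
      show "0 \<le> l2 \<Omega> (\<lambda>x. dbar_field (F n) I K k x - dbar_field f' I K k x)" by simp
      show "l2 \<Omega> (\<lambda>x. dbar_field (F n) I K k x - dbar_field f' I K k x) \<le> l2 \<Omega> (\<lambda>x. F n I (K - {k}) x - f' I (K - {k}) x)"
        by (rule l2_mono) (simp_all add: dbar_field_def norm_mult cmod_dbar_sign flip: right_diff_distrib)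
    qed
    show "(\<lambda>n. l2 \<Omega> (\<lambda>x. (\<Sum>k\<in>UNIV. dzbar k (dbar_field (F n) I K k) x) - g' I K x)) \<longlonglongrightarrow> 0"
      using component[OF lim(2) g'(2), of I K] by (simp only: dbar_field_smooth(2)[OF sm])
  qed
  then show "(f, g) \<in> dbar_weak p q \<Omega>"
    using f g dbar_distr_iff_weak_div[OF \<Omega> f f' g g'] by (simp add: dbar_weak_def)
qed

lemma weak_div_cmult: "weak_div \<Omega> f g \<Longrightarrow> weak_div \<Omega> (\<lambda>k x. c * f k x) (\<lambda>x. c * g x)"
  by (simp add: weak_div_def mult.assoc sum_distrib_left)

lemma subset_2_cases:
  fixes K :: "2 set"
  obtains "K = {}" | "K = {0}" | "K = {1}" | "K = UNIV"
proof -
  have "K \<in> Pow {0, 1}" using UNIV_2' by auto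
  then have "K = {} \<or> K = {0} \<or> K = {1} \<or> K = UNIV" by (auto simp: Pow_insert UNIV_2')
  then show ?thesis using that by blast
qed

text \<open>
  On functions the operator has one component for each \<open>dzbar\<^sub>k\<close>, so that for each \<open>I\<close> both derivatives
  of a single function are prescribed.
\<close>

lemma approx_form_1:
  fixes f g :: "2 cform"
  assumes f: "\<And>I J. L2on T (f I J)" "\<And>I J. \<not> (card I = p \<and> card J = 0) \<Longrightarrow> f I J = (\<lambda>x. 0)"
    and g: "\<And>I J. L2on T (g I J)" "\<And>I J. \<not> (card I = p \<and> card J = 1) \<Longrightarrow> g I J = (\<lambda>x. 0)"
    and w: "\<And>I K. weak_div T (dbar_field f I K) (g I K)" and e: "(e :: real) > 0"
  shows "\<exists>F. F \<in> smooth_forms p 0 \<and> (\<forall>I J. l2 T (\<lambda>x. F I J x - f I J x) \<le> ennreal e) \<and>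
    (\<forall>I K. l2 T (\<lambda>x. dbar_smooth F I K x - g I K x) \<le> ennreal e)"
proof -
  define \<sigma> where "\<sigma> I = (-1 :: complex) ^ card I" for I :: "2 set"
  have \<sigma>: "\<sigma> I * \<sigma> I = 1" "cmod (\<sigma> I) = 1" for I
    by (simp_all add: \<sigma>_def minus_one_power_iff)
  have sg: "dbar_sign I k {k} = \<sigma> I" for I and k :: 2
  proof -
    have "{j \<in> {k}. j < k} = {}" by auto
    then show ?thesis by (simp only: dbar_sign_def \<sigma>_def card.empty power_0 mult_1_right)
  qed
  have "\<forall>I. \<exists>F. smooth F \<and> l2 T (\<lambda>x. F x - f I {} x) \<le> ennreal e \<and> (\<forall>k. l2 T (\<lambda>x. dzbar k F x - \<sigma> I * g I {k} x) \<le> ennreal e)"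
  proof (intro allI approx_function[OF f(1) L2on_cmult[OF g(1)] _ e])
    fix I and k :: 2
    have "(\<lambda>j x. \<sigma> I * dbar_field f I {k} j x) = (\<lambda>j. if j = k then f I {} else (\<lambda>x. 0))"
      by (auto simp: fun_eq_iff dbar_field_def sg \<sigma> mult.assoc[symmetric])
    then show "weak_div T (\<lambda>j. if j = k then f I {} else (\<lambda>x. 0)) (\<lambda>x. \<sigma> I * g I {k} x)"
      using weak_div_cmult[OF w, of "\<sigma> I" I "{k}"] by simp
  qed
  from choice[OF this] obtain H where "\<forall>I. smooth (H I) \<and> l2 T (\<lambda>x. H I x - f I {} x) \<le> ennreal e \<and>
      (\<forall>k. l2 T (\<lambda>x. dzbar k (H I) x - \<sigma> I * g I {k} x) \<le> ennreal e)" ..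
  then have H: "\<And>I. smooth (H I)" "\<And>I. l2 T (\<lambda>x. H I x - f I {} x) \<le> ennreal e"
    "\<And>I k. l2 T (\<lambda>x. dzbar k (H I) x - \<sigma> I * g I {k} x) \<le> ennreal e" by simp_all
  define F where "F I J = (if card I = p \<and> J = {} then H I else (\<lambda>x. 0))" for I and J :: "2 set"
  have sm: "smooth (F I J)" for I J by (simp add: F_def H(1) smooth_const)
  show ?thesis
  proof (intro exI[of _ F] conjI allI)
    show "F \<in> smooth_forms p 0"
      using sm by (auto simp: smooth_forms_def is_form_def F_def split: if_splits)
    show "l2 T (\<lambda>x. F I J x - f I J x) \<le> ennreal e" for I J
    proof (cases "card I = p \<and> J = {}")
      case True
      then show ?thesis using H(2)[of I] by (simp add: F_def)
    next
      case False
      then have "F I J = (\<lambda>x. 0)" "f I J = (\<lambda>x. 0)" using f(2)[of I J] by (auto simp: F_def)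
      then show ?thesis by simp
    qed
    show "l2 T (\<lambda>x. dbar_smooth F I K x - g I K x) \<le> ennreal e" for I K
    proof (cases "card I = p \<and> card K = 1")
      case True
      then obtain k where k: "K = {k}" "card I = p" by (auto simp: card_1_singleton_iff)
      have "dbar_smooth F I K x - g I K x = \<sigma> I * (dzbar k (H I) x - \<sigma> I * g I {k} x)" for x
        by (simp add: k dbar_smooth_def sg F_def right_diff_distrib \<sigma> mult.assoc[symmetric])
      then have "l2 T (\<lambda>x. dbar_smooth F I K x - g I K x) \<le> l2 T (\<lambda>x. dzbar k (H I) x - \<sigma> I * g I {k} x)"
        by (intro l2_mono) (simp_all add: norm_mult \<sigma>)
      then show ?thesis using H(3) by (rule order_trans)
    next
      case False
      have "F I (K - {k}) = (\<lambda>x. 0)" if "k \<in> K" for k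
      proof -
        have card: "card K = Suc (card (K - {k}))" by (rule card.remove[OF finite that])
        have "\<not> (card I = p \<and> K - {k} = {})"
        proof
          assume *: "card I = p \<and> K - {k} = {}"
          then have "card K = 1" unfolding card by (simp only: card.empty One_nat_def)
          with * False show False by simp
        qed
        then show ?thesis unfolding F_def by (rule if_not_P)
      qed
      then have "dbar_smooth F I K x = 0" for x by (simp add: dbar_smooth_def)
      then show ?thesis using g(2)[OF False] by simp
    qed
  qed
qed

text \<open>
  In the top degree there is only one component for each \<open>I\<close>, the divergence of the field of the
  two coefficients.
\<close>

lemma approx_form_2:
  fixes f g :: "2 cform"
  assumes f: "\<And>I J. L2on T (f I J)" "\<And>I J. \<not> (card I = p \<and> card J = 1) \<Longrightarrow> f I J = (\<lambda>x. 0)"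
    and g: "\<And>I J. L2on T (g I J)" "\<And>I J. \<not> (card I = p \<and> card J = 2) \<Longrightarrow> g I J = (\<lambda>x. 0)"
    and w: "\<And>I K. weak_div T (dbar_field f I K) (g I K)" and e: "(e :: real) > 0"
  shows "\<exists>F. F \<in> smooth_forms p 1 \<and> (\<forall>I J. l2 T (\<lambda>x. F I J x - f I J x) \<le> ennreal e) \<and>
    (\<forall>I K. l2 T (\<lambda>x. dbar_smooth F I K x - g I K x) \<le> ennreal e)"
proof -
  have "\<forall>I. \<exists>H. (\<forall>k. smooth (H k)) \<and> (\<forall>k. l2 T (\<lambda>x. H k x - dbar_field f I UNIV k x) \<le> ennreal e) \<and>
      l2 T (\<lambda>x. (\<Sum>k\<in>UNIV. dzbar k (H k) x) - g I UNIV x) \<le> ennreal e"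
    by (intro allI approx_field[OF L2on_dbar_field[OF f(1)] g(1) w e])
  from choice[OF this] obtain H where "\<forall>I. (\<forall>k. smooth (H I k)) \<and>
      (\<forall>k. l2 T (\<lambda>x. H I k x - dbar_field f I UNIV k x) \<le> ennreal e) \<and>
      l2 T (\<lambda>x. (\<Sum>k\<in>UNIV. dzbar k (H I k) x) - g I UNIV x) \<le> ennreal e" ..
  then have H: "\<And>I k. smooth (H I k)" "\<And>I k. l2 T (\<lambda>x. H I k x - dbar_field f I UNIV k x) \<le> ennreal e"
    "\<And>I. l2 T (\<lambda>x. (\<Sum>k\<in>UNIV. dzbar k (H I k) x) - g I UNIV x) \<le> ennreal e" by simp_all
  define \<sigma> where "\<sigma> I k = dbar_sign I k (UNIV :: 2 set)" for I and k :: 2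
  have \<sigma>: "\<sigma> I k * \<sigma> I k = 1" "cmod (\<sigma> I k) = 1" for I k
    by (simp_all add: \<sigma>_def dbar_sign_square cmod_dbar_sign)
  define F where "F I J = (if card I = p \<and> J = {1} then (\<lambda>x. \<sigma> I 0 * H I 0 x)
      else if card I = p \<and> J = {0} then (\<lambda>x. \<sigma> I 1 * H I 1 x) else (\<lambda>x. 0))" for I and J :: "2 set"
  have U: "UNIV - {0} = {1 :: 2}" "UNIV - {1} = {0 :: 2}" by (auto simp: UNIV_2')
  have FU: "F I (UNIV - {k}) = (\<lambda>x. \<sigma> I k * H I k x)" if "card I = p" for I k
  proof -
    have "k = 0 \<or> k = 1" using UNIV_2' by auto
    then show ?thesis using that U by (auto simp: F_def)
  qed
  have sm: "smooth (F I J)" for I J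
    by (simp add: F_def smooth_mult[OF smooth_const H(1)] smooth_const)
  have zero: "F I J = (\<lambda>x. 0)" if "\<not> (card I = p \<and> card J = 1)" for I J
    using that by (auto simp: F_def)
  show ?thesis
  proof (intro exI[of _ F] conjI allI)
    show "F \<in> smooth_forms p 1"
    proof -
      have "card I = p \<and> card J = 1" if "F I J x \<noteq> 0" for I J x
        by (rule ccontr) (use that zero[of I J] in simp)
      then show ?thesis unfolding smooth_forms_def is_form_def using sm by blast
    qed
    show "l2 T (\<lambda>x. F I J x - f I J x) \<le> ennreal e" for I J
    proof (cases "card I = p \<and> card J = 1")
      case True
      then have "J = {0} \<or> J = {1}" by (cases J rule: subset_2_cases) simp_all
      then have "J = UNIV - {1} \<or> J = UNIV - {0}" unfolding U .
      then obtain k where k: "J = UNIV - {k}" by blast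
      have "F I J x - f I J x = \<sigma> I k * (H I k x - dbar_field f I UNIV k x)" for x
        using True by (simp add: k FU dbar_field_def \<sigma>_def[symmetric] right_diff_distrib mult.assoc[symmetric] \<sigma>)
      then have "l2 T (\<lambda>x. F I J x - f I J x) \<le> l2 T (\<lambda>x. H I k x - dbar_field f I UNIV k x)"
        by (intro l2_mono) (simp_all add: norm_mult \<sigma>)
      then show ?thesis using H(2) by (rule order_trans)
    next
      case False
      then show ?thesis by (simp add: f(2)[OF False] zero[OF False])
    qed
    show "l2 T (\<lambda>x. dbar_smooth F I K x - g I K x) \<le> ennreal e" for I K
    proof (cases "card I = p \<and> card K = 2")
      case True
      then have K: "K = UNIV" by (cases K rule: subset_2_cases) auto
      have "dbar_field F I UNIV k = H I k" for k
        using True by (auto simp: fun_eq_iff dbar_field_def FU \<sigma>_def[symmetric] mult.assoc[symmetric] \<sigma>)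
      then have "dbar_smooth F I K x = (\<Sum>k\<in>UNIV. dzbar k (H I k) x)" for x
        by (simp add: K dbar_field_smooth(2)[OF sm])
      then show ?thesis using H(3)[of I] by (simp add: K)
    next
      case False
      have "F I (K - {k}) = (\<lambda>x. 0)" if "k \<in> K" for k
      proof (rule zero)
        have "card K = Suc (card (K - {k}))" by (rule card.remove[OF finite that])
        then show "\<not> (card I = p \<and> card (K - {k}) = 1)" using False by linarith
      qed
      then have "dbar_smooth F I K x = 0" for x by (simp add: dbar_smooth_def)
      then show ?thesis using g(2)[OF False] by simp
    qed
  qed
qed

lemma dbar_weak_subset_dbar_strong:
  assumes "1 \<le> q" "q \<le> 2"
  shows "dbar_weak p q T \<subseteq> dbar_strong p q T"
proof (rule subrelI)
  fix f g assume fg: "(f, g) \<in> dbar_weak p q T"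
  then have f: "f \<in> L2_forms p (q - 1) T" and g: "g \<in> L2_forms p q T" and D: "dbar_distr T f g"
    by (auto simp: dbar_weak_def)
  obtain f' where f': "\<And>I J. L2on T (f' I J)" "\<And>I J. AE x in lborel. x \<in> T \<longrightarrow> f I J x = f' I J x"
    "\<And>I J. \<not> (card I = p \<and> card J = q - 1) \<Longrightarrow> f' I J = (\<lambda>x. 0)"
    by (rule borel_form[OF f T_borel]) (rule that)
  obtain g' where g': "\<And>I J. L2on T (g' I J)" "\<And>I J. AE x in lborel. x \<in> T \<longrightarrow> g I J x = g' I J x"
    "\<And>I J. \<not> (card I = p \<and> card J = q) \<Longrightarrow> g' I J = (\<lambda>x. 0)"
    by (rule borel_form[OF g T_borel]) (rule that)
  have w: "weak_div T (dbar_field f' I K) (g' I K)" for I K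
    using D dbar_distr_iff_weak_div[OF T_borel f f'(1,2) g g'(1,2)] by blast
  have ex: "\<exists>F. F \<in> smooth_forms p (q - 1) \<and> (\<forall>I J. l2 T (\<lambda>x. F I J x - f' I J x) \<le> ennreal e) \<and>
      (\<forall>I K. l2 T (\<lambda>x. dbar_smooth F I K x - g' I K x) \<le> ennreal e)" if e: "e > 0" for e :: real
  proof -
    have "q = 1 \<or> q = 2" using assms by auto
    then show ?thesis
    proof
      assume q: "q = 1"
      show ?thesis using approx_form_1[OF f'(1) f'(3) g'(1) g'(3) w e] by (simp add: q)
    next
      assume q: "q = 2"
      show ?thesis using approx_form_2[OF f'(1) f'(3) g'(1) g'(3) w e] by (simp add: q)
    qed
  qed
  define d where "d n = 1 / (real n + 1)" for n
  have d: "d n > 0" for n by (simp add: d_def)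
  have "\<forall>n. \<exists>F. F \<in> smooth_forms p (q - 1) \<and> (\<forall>I J. l2 T (\<lambda>x. F I J x - f' I J x) \<le> ennreal (d n)) \<and>
      (\<forall>I K. l2 T (\<lambda>x. dbar_smooth F I K x - g' I K x) \<le> ennreal (d n))"
    by (intro allI ex d)
  from choice[OF this] obtain F where "\<forall>n. F n \<in> smooth_forms p (q - 1) \<and>
      (\<forall>I J. l2 T (\<lambda>x. F n I J x - f' I J x) \<le> ennreal (d n)) \<and>
      (\<forall>I K. l2 T (\<lambda>x. dbar_smooth (F n) I K x - g' I K x) \<le> ennreal (d n))" ..
  then have F: "\<And>n. F n \<in> smooth_forms p (q - 1)" "\<And>n I J. l2 T (\<lambda>x. F n I J x - f' I J x) \<le> ennreal (d n)"
    "\<And>n I K. l2 T (\<lambda>x. dbar_smooth (F n) I K x - g' I K x) \<le> ennreal (d n)" by simp_all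
  have "d \<longlonglongrightarrow> 0"
    unfolding d_def using LIMSEQ_inverse_real_of_nat by (simp add: inverse_eq_divide add.commute)
  then have dlim: "(\<lambda>n. ennreal (d n)) \<longlonglongrightarrow> 0"
    using tendsto_ennrealI[of d 0] by simp
  have lim: "(\<lambda>n. L2_norm_sq T (G n - h)) \<longlonglongrightarrow> 0"
    if le: "\<And>n I J. l2 T (\<lambda>x. G n I J x - h' I J x) \<le> ennreal (d n)"
      and ae: "\<And>I J. AE x in lborel. x \<in> T \<longrightarrow> h I J x = h' I J x" for G :: "nat \<Rightarrow> 2 cform" and h h'
  proof -
    have "(\<lambda>n. l2 T (\<lambda>x. G n I J x - h' I J x)) \<longlonglongrightarrow> 0" for I J
      by (rule tendsto_sandwich[OF always_eventually always_eventually tendsto_const dlim]) (auto intro: le)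
    then have "(\<lambda>n. \<Sum>I\<in>UNIV. \<Sum>J\<in>UNIV. l2 T (\<lambda>x. G n I J x - h' I J x)) \<longlonglongrightarrow> (\<Sum>I\<in>(UNIV :: 2 set set). \<Sum>J\<in>(UNIV :: 2 set set). 0)"
      by (intro tendsto_sum)
    then show ?thesis by (simp add: L2_norm_sq_diff_eq[OF T_borel ae])
  qed
  show "(f, g) \<in> dbar_strong p q T"
    unfolding dbar_strong_def mem_Collect_eq case_prod_conv
    by (intro conjI exI[of _ F] allI f g F(1) lim[OF F(2) f'(2)] lim[OF F(3) g'(2)])
qed

theorem theorem3p13:
  fixes p q :: nat
  assumes "p \<le> 2" and "1 \<le> q" and "q \<le> 2"
  shows "dbar_strong p q hartogs_triangle = dbar_weak p q hartogs_triangle"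
  by (intro equalityI dbar_strong_subset_dbar_weak[OF T_borel] dbar_weak_subset_dbar_strong[OF assms(2,3)])

end
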